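(* Let $k$ be a field and let $G$ be a finite abelian group which splits over $k$. Let $\mathcal{T}$ be a skeletally small $k$-linear pre-triangulated category which is idempotent complete, with a $k$-linear triangle $G$-action $\{(F_g,\omega_g),\varepsilon_{g,h}\mid g,h\in G\}$, and consider the dual $\widehat{G}$-action on $\mathcal{T}^G$. Then the equivariantization homomorphism $$(-)^G\colon {\rm Aut}_\vartriangle(\mathcal{T};G)\longrightarrow {\rm Aut}_\vartriangle(\mathcal{T}^G;\widehat{G}),\quad [(F,\omega),\delta]\mapsto[((F,\omega),\delta)^G],$$ is an isomorphism of groups. Moreover, if $Z_\vartriangle(\mathcal{T})=k=Z_\vartriangle(\mathcal{T}^G)$, then it restricts to an isomorphism $$(-)^G\colon {\rm Act}_\vartriangle(\mathcal{T};G)\longrightarrow {\rm Act}_\vartriangle(\mathcal{T}^G;\widehat{G}).$$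
   Context: All functors are $k$-linear. A pre-triangulated category is a triangulated category except that the octahedral axiom need not hold; $\Sigma$ is the translation functor. $G$ splits over $k$ if $kG$ is a product of copies of $k$. $\widehat{G}={\rm Hom}(G,k^* )$. A triangle functor $(F,\omega)$ is an additive functor $F$ with a natural isomorphism $\omega\colon F\Sigma\to\Sigma F$ such that exact triangles are sent to exact triangles; natural transformations of triangle functors must respect the connecting isomorphisms $\omega$. A triangle $G$-action consists of triangle autoequivalences $(F_g,\omega_g)$ and isomorphisms of triangle functors $\varepsilon_{g,h}\colon(F_g,\omega_g)(F_h,\omega_h)\to(F_{gh},\omega_{gh})$ with $\varepsilon_{gh,l}\circ\varepsilon_{g,h}F_l=\varepsilon_{g,hl}\circ F_g\varepsilon_{h,l}$. $\mathcal{T}^G$ is the category of pairs $(X,\alpha)$ with isomorphisms $\alpha_g\colon X\to F_g(X)$ satisfying $\alpha_{gh}=(\varepsilon_{g,h})_X\circ F_g(\alpha_h)\circ\alpha_g$, with morphisms $f\colon (X,\alpha)\to(Y,\beta)$ satisfying $\beta_g f=F_g(f)\alpha_g$. It is pre-triangulated, with translation functor $\Sigma^G(X,\alpha)=(\Sigma X,((\omega_g)_X^{-1}\circ\Sigma(\alpha_g))_g)$, a triangle being exact iff the underlying triangle in $\mathcal{T}$ is. The dual action is the strict triangle $\widehat{G}$-action given by $F_\chi(X,\alpha)=(X,(\chi(g^{-1})\alpha_g)_g)$, identity on morphisms, with trivial connecting isomorphisms. ${\rm Aut}_\vartriangle(\mathcal{T};G)$ is the group of isoclasses $[(F,\omega),\delta]$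 of $G$-equivariant triangle autoequivalences: $(F,\omega)$ is a triangle autoequivalence and $\delta_g\colon(F,\omega)(F_g,\omega_g)\to(F_g,\omega_g)(F,\omega)$ are isomorphisms of triangle functors with $\delta_{gh}\circ F\varepsilon_{g,h}=\varepsilon_{g,h}F\circ F_g\delta_h\circ\delta_gF_h$; isomorphisms are isomorphisms $\phi\colon F\to F'$ of triangle functors with $F_g\phi\circ\delta_g=\delta'_g\circ\phi F_g$; the product is $(F,\delta)(F',\delta')=(FF',(\delta_gF'\circ F\delta'_g)_g)$. ${\rm Act}_\vartriangle(\mathcal{T};G)$ is the normal subgroup of those $[(F,\omega),\delta]$ such that $(F,\omega)$ is isomorphic to $(F_a,\omega_a)$ as a triangle functor for some $a\in G$. The groups for $\mathcal{T}^G$ are defined with respect to the dual $\widehat{G}$-action. The triangle functor $((F,\omega),\delta)^G$ on $\mathcal{T}^G$ sends $(X,\alpha)$ to $(F(X),((\delta_g)_X\circ F(\alpha_g))_g)$, acts on morphisms by $F$, and has connecting isomorphism $(\omega^G)_{(X,\alpha)}=\omega_X$; it commutes strictly with each $F_\chi$ and is regarded as $\widehat{G}$-equivariant with identity structure isomorphisms. The triangle center is $Z_\vartriangle(\mathcal{T})=\{\lambda\colon{\rm Id}_\mathcal{T}\to{\rm Id}_\mathcal{T}\text{ natural}\mid \Sigma\lambda=\lambda\Sigma\}$, a commutative $k$-algebra. *)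

theory Defs
  imports "HOL-Algebra.Module" "HOL-Algebra.QuotRing" "HOL-Algebra.Product_Groups"
begin

section \<open>Finite abelian groups that split over a field\<close>

definition group_algebra ::
    "('k, 'e) ring_scheme \<Rightarrow> ('g, 'h) monoid_scheme \<Rightarrow> ('k, 'g \<Rightarrow> 'k) module" where
  "group_algebra K G = \<lparr>
     carrier = carrier G \<rightarrow>\<^sub>E carrier K,
     monoid.mult = (\<lambda>x y. \<lambda>g\<in>carrier G. \<Oplus>\<^bsub>K\<^esub>h\<in>carrier G. x h \<otimes>\<^bsub>K\<^esub> y (inv\<^bsub>G\<^esub> h \<otimes>\<^bsub>G\<^esub> g)),
     monoid.one = (\<lambda>g\<in>carrier G. if g = \<one>\<^bsub>G\<^esub> then \<one>\<^bsub>K\<^esub> else \<zero>\<^bsub>K\<^esub>),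
     ring.zero = (\<lambda>g\<in>carrier G. \<zero>\<^bsub>K\<^esub>),
     ring.add = (\<lambda>x y. \<lambda>g\<in>carrier G. x g \<oplus>\<^bsub>K\<^esub> y g),
     smult = (\<lambda>c x. \<lambda>g\<in>carrier G. c \<otimes>\<^bsub>K\<^esub> x g)\<rparr>"

definition power_algebra :: "('k, 'e) ring_scheme \<Rightarrow> nat \<Rightarrow> ('k, nat \<Rightarrow> 'k) module" where
  "power_algebra K n = \<lparr>
     carrier = {..<n} \<rightarrow>\<^sub>E carrier K,
     monoid.mult = (\<lambda>x y. \<lambda>i\<in>{..<n}. x i \<otimes>\<^bsub>K\<^esub> y i),
     monoid.one = (\<lambda>i\<in>{..<n}. \<one>\<^bsub>K\<^esub>),
     ring.zero = (\<lambda>i\<in>{..<n}. \<zero>\<^bsub>K\<^esub>),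
     ring.add = (\<lambda>x y. \<lambda>i\<in>{..<n}. x i \<oplus>\<^bsub>K\<^esub> y i),
     smult = (\<lambda>c x. \<lambda>i\<in>{..<n}. c \<otimes>\<^bsub>K\<^esub> x i)\<rparr>"

definition splits_over :: "('g, 'h) monoid_scheme \<Rightarrow> ('k, 'e) ring_scheme \<Rightarrow> bool" where
  "splits_over G K \<longleftrightarrow>
     (\<exists>n \<phi>. \<phi> \<in> ring_iso (group_algebra K G) (power_algebra K n) \<and>
        (\<forall>c\<in>carrier K. \<forall>x\<in>carrier (group_algebra K G).
           \<phi> (c \<odot>\<^bsub>group_algebra K G\<^esub> x) = c \<odot>\<^bsub>power_algebra K n\<^esub> \<phi> x))"

text \<open>Characters are made extensional so that equality of characters is equality of functions.\<close>

definition dual_group ::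
    "('k, 'e) ring_scheme \<Rightarrow> ('g, 'h) monoid_scheme \<Rightarrow> ('g \<Rightarrow> 'k) monoid" where
  "dual_group K G = (product_group (carrier G) (\<lambda>_. units_of K))
     \<lparr>carrier := hom G (units_of K) \<inter> extensional (carrier G)\<rparr>"


section \<open>Linear categories and functors\<close>

text \<open>
  The objects form a set in the sense of HOL, hence every category below is small.
  Distinct Hom-modules are disjoint, so a morphism determines its domain and codomain, and
  composition and functors take morphisms alone as arguments. The ring multiplication and unit
  present in the library's record type of modules are not used for Hom-modules.
\<close>

record ('k, 'o, 'm) lincat =
  Ob :: "'o set"
  Hom :: "'o \<Rightarrow> 'o \<Rightarrow> ('k, 'm) module"
  Comp :: "'m \<Rightarrow> 'm \<Rightarrow> 'm"  (infixr \<open>\<cdot>\<index>\<close> 75)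
  Idt :: "'o \<Rightarrow> 'm"

locale linear_category = field K
  for K :: "('k, 'e) ring_scheme" (structure) +
  fixes C :: "('k, 'o, 'm, 'z) lincat_scheme"
  assumes hom_module: "\<lbrakk>X \<in> Ob C; Y \<in> Ob C\<rbrakk> \<Longrightarrow> module K (Hom C X Y)"
    and hom_disjoint: "\<lbrakk>X \<in> Ob C; Y \<in> Ob C; X' \<in> Ob C; Y' \<in> Ob C;
        f \<in> carrier (Hom C X Y); f \<in> carrier (Hom C X' Y')\<rbrakk> \<Longrightarrow> X = X' \<and> Y = Y'"
    and comp_closed: "\<lbrakk>X \<in> Ob C; Y \<in> Ob C; Z \<in> Ob C;
        f \<in> carrier (Hom C X Y); g \<in> carrier (Hom C Y Z)\<rbrakk> \<Longrightarrow> g \<cdot>\<^bsub>C\<^esub> f \<in> carrier (Hom C X Z)"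
    and comp_assoc: "\<lbrakk>W \<in> Ob C; X \<in> Ob C; Y \<in> Ob C; Z \<in> Ob C;
        f \<in> carrier (Hom C W X); g \<in> carrier (Hom C X Y); h \<in> carrier (Hom C Y Z)\<rbrakk>
        \<Longrightarrow> (h \<cdot>\<^bsub>C\<^esub> g) \<cdot>\<^bsub>C\<^esub> f = h \<cdot>\<^bsub>C\<^esub> (g \<cdot>\<^bsub>C\<^esub> f)"
    and idt_closed: "X \<in> Ob C \<Longrightarrow> Idt C X \<in> carrier (Hom C X X)"
    and idt_left: "\<lbrakk>X \<in> Ob C; Y \<in> Ob C; f \<in> carrier (Hom C X Y)\<rbrakk> \<Longrightarrow> Idt C Y \<cdot>\<^bsub>C\<^esub> f = f"
    and idt_right: "\<lbrakk>X \<in> Ob C; Y \<in> Ob C; f \<in> carrier (Hom C X Y)\<rbrakk> \<Longrightarrow> f \<cdot>\<^bsub>C\<^esub> Idt C X = f"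
    and comp_add_left: "\<lbrakk>X \<in> Ob C; Y \<in> Ob C; Z \<in> Ob C; f \<in> carrier (Hom C X Y);
        g \<in> carrier (Hom C Y Z); g' \<in> carrier (Hom C Y Z)\<rbrakk>
        \<Longrightarrow> (g \<oplus>\<^bsub>Hom C Y Z\<^esub> g') \<cdot>\<^bsub>C\<^esub> f = (g \<cdot>\<^bsub>C\<^esub> f) \<oplus>\<^bsub>Hom C X Z\<^esub> (g' \<cdot>\<^bsub>C\<^esub> f)"
    and comp_add_right: "\<lbrakk>X \<in> Ob C; Y \<in> Ob C; Z \<in> Ob C; f \<in> carrier (Hom C X Y);
        f' \<in> carrier (Hom C X Y); g \<in> carrier (Hom C Y Z)\<rbrakk>
        \<Longrightarrow> g \<cdot>\<^bsub>C\<^esub> (f \<oplus>\<^bsub>Hom C X Y\<^esub> f') = (g \<cdot>\<^bsub>C\<^esub> f) \<oplus>\<^bsub>Hom C X Z\<^esub> (g \<cdot>\<^bsub>C\<^esub> f')"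
    and comp_smult_left: "\<lbrakk>X \<in> Ob C; Y \<in> Ob C; Z \<in> Ob C; c \<in> carrier K;
        f \<in> carrier (Hom C X Y); g \<in> carrier (Hom C Y Z)\<rbrakk>
        \<Longrightarrow> (c \<odot>\<^bsub>Hom C Y Z\<^esub> g) \<cdot>\<^bsub>C\<^esub> f = c \<odot>\<^bsub>Hom C X Z\<^esub> (g \<cdot>\<^bsub>C\<^esub> f)"
    and comp_smult_right: "\<lbrakk>X \<in> Ob C; Y \<in> Ob C; Z \<in> Ob C; c \<in> carrier K;
        f \<in> carrier (Hom C X Y); g \<in> carrier (Hom C Y Z)\<rbrakk>
        \<Longrightarrow> g \<cdot>\<^bsub>C\<^esub> (c \<odot>\<^bsub>Hom C X Y\<^esub> f) = c \<odot>\<^bsub>Hom C X Z\<^esub> (g \<cdot>\<^bsub>C\<^esub> f)"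

definition inverse_in :: "('k, 'o, 'm, 'z) lincat_scheme \<Rightarrow> 'o \<Rightarrow> 'o \<Rightarrow> 'm \<Rightarrow> 'm \<Rightarrow> bool" where
  "inverse_in C X Y f h \<longleftrightarrow> f \<in> carrier (Hom C X Y) \<and> h \<in> carrier (Hom C Y X) \<and>
     h \<cdot>\<^bsub>C\<^esub> f = Idt C X \<and> f \<cdot>\<^bsub>C\<^esub> h = Idt C Y"

definition iso_in :: "('k, 'o, 'm, 'z) lincat_scheme \<Rightarrow> 'o \<Rightarrow> 'o \<Rightarrow> 'm \<Rightarrow> bool" where
  "iso_in C X Y f \<longleftrightarrow> (\<exists>h. inverse_in C X Y f h)"

definition inv_in :: "('k, 'o, 'm, 'z) lincat_scheme \<Rightarrow> 'o \<Rightarrow> 'o \<Rightarrow> 'm \<Rightarrow> 'm" where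
  "inv_in C X Y f = (THE h. inverse_in C X Y f h)"

definition zero_object :: "('k, 'o, 'm, 'z) lincat_scheme \<Rightarrow> 'o \<Rightarrow> bool" where
  "zero_object C Z \<longleftrightarrow> Z \<in> Ob C \<and> Idt C Z = \<zero>\<^bsub>Hom C Z Z\<^esub>"

definition biproduct_of ::
    "('k, 'o, 'm, 'z) lincat_scheme \<Rightarrow> 'o \<Rightarrow> 'o \<Rightarrow> 'o \<Rightarrow> 'm \<Rightarrow> 'm \<Rightarrow> 'm \<Rightarrow> 'm \<Rightarrow> bool" where
  "biproduct_of C X Y P i j p q \<longleftrightarrow> P \<in> Ob C \<and>
     i \<in> carrier (Hom C X P) \<and> j \<in> carrier (Hom C Y P) \<and>
     p \<in> carrier (Hom C P X) \<and> q \<in> carrier (Hom C P Y) \<and>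
     p \<cdot>\<^bsub>C\<^esub> i = Idt C X \<and> q \<cdot>\<^bsub>C\<^esub> j = Idt C Y \<and>
     p \<cdot>\<^bsub>C\<^esub> j = \<zero>\<^bsub>Hom C Y X\<^esub> \<and> q \<cdot>\<^bsub>C\<^esub> i = \<zero>\<^bsub>Hom C X Y\<^esub> \<and>
     (i \<cdot>\<^bsub>C\<^esub> p) \<oplus>\<^bsub>Hom C P P\<^esub> (j \<cdot>\<^bsub>C\<^esub> q) = Idt C P"

definition idempotent_complete :: "('k, 'o, 'm, 'z) lincat_scheme \<Rightarrow> bool" where
  "idempotent_complete C \<longleftrightarrow>
     (\<forall>X\<in>Ob C. \<forall>e\<in>carrier (Hom C X X). e \<cdot>\<^bsub>C\<^esub> e = e \<longrightarrow>
        (\<exists>Y\<in>Ob C. \<exists>r\<in>carrier (Hom C X Y). \<exists>s\<in>carrier (Hom C Y X).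
           s \<cdot>\<^bsub>C\<^esub> r = e \<and> r \<cdot>\<^bsub>C\<^esub> s = Idt C Y))"

record ('o1, 'm1, 'o2, 'm2) lfunctor =
  Fob :: "'o1 \<Rightarrow> 'o2"
  Fmor :: "'m1 \<Rightarrow> 'm2"

locale linear_functor =
  fixes K :: "('k, 'e) ring_scheme"
    and C :: "('k, 'o1, 'm1, 'y) lincat_scheme"
    and D :: "('k, 'o2, 'm2, 'z) lincat_scheme"
    and F :: "('o1, 'm1, 'o2, 'm2, 'w) lfunctor_scheme"
  assumes Fob_closed: "X \<in> Ob C \<Longrightarrow> Fob F X \<in> Ob D"
    and Fmor_closed: "\<lbrakk>X \<in> Ob C; Y \<in> Ob C; f \<in> carrier (Hom C X Y)\<rbrakk>
        \<Longrightarrow> Fmor F f \<in> carrier (Hom D (Fob F X) (Fob F Y))"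
    and Fmor_idt: "X \<in> Ob C \<Longrightarrow> Fmor F (Idt C X) = Idt D (Fob F X)"
    and Fmor_comp: "\<lbrakk>X \<in> Ob C; Y \<in> Ob C; Z \<in> Ob C;
        f \<in> carrier (Hom C X Y); g \<in> carrier (Hom C Y Z)\<rbrakk>
        \<Longrightarrow> Fmor F (g \<cdot>\<^bsub>C\<^esub> f) = Fmor F g \<cdot>\<^bsub>D\<^esub> Fmor F f"
    and Fmor_add: "\<lbrakk>X \<in> Ob C; Y \<in> Ob C; f \<in> carrier (Hom C X Y); f' \<in> carrier (Hom C X Y)\<rbrakk>
        \<Longrightarrow> Fmor F (f \<oplus>\<^bsub>Hom C X Y\<^esub> f') = Fmor F f \<oplus>\<^bsub>Hom D (Fob F X) (Fob F Y)\<^esub> Fmor F f'"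
    and Fmor_smult: "\<lbrakk>X \<in> Ob C; Y \<in> Ob C; c \<in> carrier K; f \<in> carrier (Hom C X Y)\<rbrakk>
        \<Longrightarrow> Fmor F (c \<odot>\<^bsub>Hom C X Y\<^esub> f) = c \<odot>\<^bsub>Hom D (Fob F X) (Fob F Y)\<^esub> Fmor F f"

definition fid :: "('o, 'm, 'o, 'm) lfunctor" where
  "fid = \<lparr>Fob = (\<lambda>X. X), Fmor = (\<lambda>f. f)\<rparr>"

definition fcomp :: "('o2, 'm2, 'o3, 'm3, 'w) lfunctor_scheme \<Rightarrow>
    ('o1, 'm1, 'o2, 'm2, 'v) lfunctor_scheme \<Rightarrow> ('o1, 'm1, 'o3, 'm3) lfunctor" where
  "fcomp F H = \<lparr>Fob = (\<lambda>X. Fob F (Fob H X)), Fmor = (\<lambda>f. Fmor F (Fmor H f))\<rparr>"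

definition nat_trans :: "('k, 'o1, 'm1, 'y) lincat_scheme \<Rightarrow> ('k, 'o2, 'm2, 'z) lincat_scheme \<Rightarrow>
    ('o1, 'm1, 'o2, 'm2, 'v) lfunctor_scheme \<Rightarrow> ('o1, 'm1, 'o2, 'm2, 'w) lfunctor_scheme \<Rightarrow>
    ('o1 \<Rightarrow> 'm2) \<Rightarrow> bool" where
  "nat_trans C D F H \<eta> \<longleftrightarrow>
     (\<forall>X\<in>Ob C. \<eta> X \<in> carrier (Hom D (Fob F X) (Fob H X))) \<and>
     (\<forall>X\<in>Ob C. \<forall>Y\<in>Ob C. \<forall>f\<in>carrier (Hom C X Y). Fmor H f \<cdot>\<^bsub>D\<^esub> \<eta> X = \<eta> Y \<cdot>\<^bsub>D\<^esub> Fmor F f)"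

definition nat_iso :: "('k, 'o1, 'm1, 'y) lincat_scheme \<Rightarrow> ('k, 'o2, 'm2, 'z) lincat_scheme \<Rightarrow>
    ('o1, 'm1, 'o2, 'm2, 'v) lfunctor_scheme \<Rightarrow> ('o1, 'm1, 'o2, 'm2, 'w) lfunctor_scheme \<Rightarrow>
    ('o1 \<Rightarrow> 'm2) \<Rightarrow> bool" where
  "nat_iso C D F H \<eta> \<longleftrightarrow> nat_trans C D F H \<eta> \<and> (\<forall>X\<in>Ob C. iso_in D (Fob F X) (Fob H X) (\<eta> X))"

definition equivalence_functor :: "('k, 'e) ring_scheme \<Rightarrow> ('k, 'o1, 'm1, 'y) lincat_scheme \<Rightarrow>
    ('k, 'o2, 'm2, 'z) lincat_scheme \<Rightarrow> ('o1, 'm1, 'o2, 'm2, 'w) lfunctor_scheme \<Rightarrow> bool" where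
  "equivalence_functor K C D F \<longleftrightarrow> linear_functor K C D F \<and>
     (\<exists>(H :: ('o2, 'm2, 'o1, 'm1) lfunctor) \<eta> \<theta>. linear_functor K D C H \<and>
        nat_iso C C (fcomp H F) fid \<eta> \<and> nat_iso D D (fcomp F H) fid \<theta>)"


section \<open>Pre-triangulated categories and triangle functors\<close>

text \<open>
  A triangle \<open>X \<rightarrow> Y \<rightarrow> Z \<rightarrow> \<Sigma>X\<close> is stored as the triple of its three morphisms. The translation
  functor is only required to be an autoequivalence.
\<close>

record ('k, 'o, 'm) pretricat = "('k, 'o, 'm) lincat" +
  Susp :: "('o, 'm, 'o, 'm) lfunctor"
  Exact :: "('m \<times> 'm \<times> 'm) set"

definition triangle_in ::
    "('k, 'o, 'm, 'z) pretricat_scheme \<Rightarrow> 'o \<Rightarrow> 'o \<Rightarrow> 'o \<Rightarrow> 'm \<Rightarrow> 'm \<Rightarrow> 'm \<Rightarrow> bool" where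
  "triangle_in T X Y Z u v w \<longleftrightarrow> X \<in> Ob T \<and> Y \<in> Ob T \<and> Z \<in> Ob T \<and>
     u \<in> carrier (Hom T X Y) \<and> v \<in> carrier (Hom T Y Z) \<and> w \<in> carrier (Hom T Z (Fob (Susp T) X))"

locale pretriangulated_category = linear_category K T
  for K :: "('k, 'e) ring_scheme" (structure) and T :: "('k, 'o, 'm, 'z) pretricat_scheme" +
  assumes zero_object_exists: "\<exists>Z. zero_object T Z"
    and biproduct_exists: "\<lbrakk>X \<in> Ob T; Y \<in> Ob T\<rbrakk> \<Longrightarrow> \<exists>P i j p q. biproduct_of T X Y P i j p q"
    and susp_equivalence: "equivalence_functor K T T (Susp T)"
    and exact_triangle: "(u, v, w) \<in> Exact T \<Longrightarrow> \<exists>X Y Z. triangle_in T X Y Z u v w"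
    and exact_iso: "\<lbrakk>(u, v, w) \<in> Exact T; triangle_in T X Y Z u v w; triangle_in T X' Y' Z' u' v' w';
        iso_in T X X' a; iso_in T Y Y' b; iso_in T Z Z' c;
        b \<cdot>\<^bsub>T\<^esub> u = u' \<cdot>\<^bsub>T\<^esub> a; c \<cdot>\<^bsub>T\<^esub> v = v' \<cdot>\<^bsub>T\<^esub> b; Fmor (Susp T) a \<cdot>\<^bsub>T\<^esub> w = w' \<cdot>\<^bsub>T\<^esub> c\<rbrakk>
        \<Longrightarrow> (u', v', w') \<in> Exact T"
    and exact_idt: "\<lbrakk>X \<in> Ob T; zero_object T Z\<rbrakk>
        \<Longrightarrow> (Idt T X, \<zero>\<^bsub>Hom T X Z\<^esub>, \<zero>\<^bsub>Hom T Z (Fob (Susp T) X)\<^esub>) \<in> Exact T"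
    and exact_cone: "\<lbrakk>X \<in> Ob T; Y \<in> Ob T; u \<in> carrier (Hom T X Y)\<rbrakk>
        \<Longrightarrow> \<exists>Z v w. triangle_in T X Y Z u v w \<and> (u, v, w) \<in> Exact T"
    and exact_rotate: "triangle_in T X Y Z u v w \<Longrightarrow> (u, v, w) \<in> Exact T \<longleftrightarrow>
        (v, w, \<ominus>\<^bsub>Hom T (Fob (Susp T) X) (Fob (Susp T) Y)\<^esub> Fmor (Susp T) u) \<in> Exact T"
    and exact_fill: "\<lbrakk>(u, v, w) \<in> Exact T; triangle_in T X Y Z u v w;
        (u', v', w') \<in> Exact T; triangle_in T X' Y' Z' u' v' w';
        a \<in> carrier (Hom T X X'); b \<in> carrier (Hom T Y Y'); b \<cdot>\<^bsub>T\<^esub> u = u' \<cdot>\<^bsub>T\<^esub> a\<rbrakk>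
        \<Longrightarrow> \<exists>c\<in>carrier (Hom T Z Z'). c \<cdot>\<^bsub>T\<^esub> v = v' \<cdot>\<^bsub>T\<^esub> b \<and>
              Fmor (Susp T) a \<cdot>\<^bsub>T\<^esub> w = w' \<cdot>\<^bsub>T\<^esub> c"

record ('o1, 'm1, 'o2, 'm2) tfunctor = "('o1, 'm1, 'o2, 'm2) lfunctor" +
  conn :: "'o1 \<Rightarrow> 'm2"

locale triangle_functor = linear_functor K S T F
  for K :: "('k, 'e) ring_scheme"
    and S :: "('k, 'o1, 'm1, 'y) pretricat_scheme"
    and T :: "('k, 'o2, 'm2, 'z) pretricat_scheme"
    and F :: "('o1, 'm1, 'o2, 'm2) tfunctor" +
  assumes conn_iso: "nat_iso S T (fcomp F (Susp S)) (fcomp (Susp T) F) (conn F)"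
    and exact_pres: "\<lbrakk>(u, v, w) \<in> Exact S; triangle_in S X Y Z u v w\<rbrakk>
        \<Longrightarrow> (Fmor F u, Fmor F v, conn F X \<cdot>\<^bsub>T\<^esub> Fmor F w) \<in> Exact T"

definition triangle_autoequivalence :: "('k, 'e) ring_scheme \<Rightarrow> ('k, 'o, 'm, 'z) pretricat_scheme \<Rightarrow>
    ('o, 'm, 'o, 'm) tfunctor \<Rightarrow> bool" where
  "triangle_autoequivalence K T F \<longleftrightarrow> triangle_functor K T T F \<and> equivalence_functor K T T F"

definition tid :: "('k, 'o, 'm, 'z) pretricat_scheme \<Rightarrow> ('o, 'm, 'o, 'm) tfunctor" where
  "tid T = \<lparr>Fob = (\<lambda>X. X), Fmor = (\<lambda>f. f), conn = (\<lambda>X. Idt T (Fob (Susp T) X))\<rparr>"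

text \<open>In \<open>tcomp T F H\<close> the category \<open>T\<close> is the target of \<open>F\<close>; the composite of \<open>(F, \<omega>)\<close> and
  \<open>(H, \<omega>')\<close> has connecting isomorphism \<open>\<omega>H \<circ> F\<omega>'\<close>.\<close>

definition tcomp :: "('k, 'o3, 'm3, 'z) pretricat_scheme \<Rightarrow> ('o2, 'm2, 'o3, 'm3) tfunctor \<Rightarrow>
    ('o1, 'm1, 'o2, 'm2) tfunctor \<Rightarrow> ('o1, 'm1, 'o3, 'm3) tfunctor" where
  "tcomp T F H = \<lparr>Fob = (\<lambda>X. Fob F (Fob H X)), Fmor = (\<lambda>f. Fmor F (Fmor H f)),
     conn = (\<lambda>X. conn F (Fob H X) \<cdot>\<^bsub>T\<^esub> Fmor F (conn H X))\<rparr>"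

definition tri_nat_iso :: "('k, 'o1, 'm1, 'y) pretricat_scheme \<Rightarrow> ('k, 'o2, 'm2, 'z) pretricat_scheme \<Rightarrow>
    ('o1, 'm1, 'o2, 'm2) tfunctor \<Rightarrow> ('o1, 'm1, 'o2, 'm2) tfunctor \<Rightarrow> ('o1 \<Rightarrow> 'm2) \<Rightarrow> bool" where
  "tri_nat_iso S T F H \<eta> \<longleftrightarrow> nat_iso S T F H \<eta> \<and>
     (\<forall>X\<in>Ob S. Fmor (Susp T) (\<eta> X) \<cdot>\<^bsub>T\<^esub> conn F X = conn H X \<cdot>\<^bsub>T\<^esub> \<eta> (Fob (Susp S) X))"

definition tri_center :: "('k, 'o, 'm, 'z) pretricat_scheme \<Rightarrow> ('k, 'o \<Rightarrow> 'm) module" where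
  "tri_center T = \<lparr>
     carrier = {\<zeta>. \<zeta> \<in> extensional (Ob T) \<and> nat_trans T T fid fid \<zeta> \<and>
                  (\<forall>X\<in>Ob T. Fmor (Susp T) (\<zeta> X) = \<zeta> (Fob (Susp T) X))},
     monoid.mult = (\<lambda>\<zeta> \<mu>. \<lambda>X\<in>Ob T. \<zeta> X \<cdot>\<^bsub>T\<^esub> \<mu> X),
     monoid.one = (\<lambda>X\<in>Ob T. Idt T X),
     ring.zero = (\<lambda>X\<in>Ob T. \<zero>\<^bsub>Hom T X X\<^esub>),
     ring.add = (\<lambda>\<zeta> \<mu>. \<lambda>X\<in>Ob T. \<zeta> X \<oplus>\<^bsub>Hom T X X\<^esub> \<mu> X),
     smult = (\<lambda>c \<zeta>. \<lambda>X\<in>Ob T. c \<odot>\<^bsub>Hom T X X\<^esub> \<zeta> X)\<rparr>"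

text \<open>\<open>Z(T) = k\<close> means that the structure map \<open>k \<rightarrow> Z(T)\<close> of the \<open>k\<close>-algebra \<open>Z(T)\<close> is bijective.\<close>

definition tri_center_trivial :: "('k, 'e) ring_scheme \<Rightarrow> ('k, 'o, 'm, 'z) pretricat_scheme \<Rightarrow> bool" where
  "tri_center_trivial K T \<longleftrightarrow>
     (\<lambda>c. c \<odot>\<^bsub>tri_center T\<^esub> \<one>\<^bsub>tri_center T\<^esub>) \<in> ring_iso K (tri_center T)"


section \<open>Triangle actions and equivariant objects\<close>

record ('g, 'o, 'm) taction =
  act :: "'g \<Rightarrow> ('o, 'm, 'o, 'm) tfunctor"
  coh :: "'g \<Rightarrow> 'g \<Rightarrow> 'o \<Rightarrow> 'm"

locale triangle_action =
  fixes K :: "('k, 'e) ring_scheme" and G :: "('g, 'h) monoid_scheme"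
    and T :: "('k, 'o, 'm, 'z) pretricat_scheme" and A :: "('g, 'o, 'm) taction"
  assumes act_autoequivalence: "g \<in> carrier G \<Longrightarrow> triangle_autoequivalence K T (act A g)"
    and coh_iso: "\<lbrakk>g \<in> carrier G; h \<in> carrier G\<rbrakk> \<Longrightarrow>
        tri_nat_iso T T (tcomp T (act A g) (act A h)) (act A (g \<otimes>\<^bsub>G\<^esub> h)) (coh A g h)"
    and coh_cocycle: "\<lbrakk>g \<in> carrier G; h \<in> carrier G; l \<in> carrier G; X \<in> Ob T\<rbrakk> \<Longrightarrow>
        coh A (g \<otimes>\<^bsub>G\<^esub> h) l X \<cdot>\<^bsub>T\<^esub> coh A g h (Fob (act A l) X) =
        coh A g (h \<otimes>\<^bsub>G\<^esub> l) X \<cdot>\<^bsub>T\<^esub> Fmor (act A g) (coh A h l X)"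

text \<open>Families indexed by the group are extensional, so that equal families give the same object.\<close>

type_synonym ('g, 'o, 'm) eqv_ob = "'o \<times> ('g \<Rightarrow> 'm)"

definition eqv_objects :: "('g, 'h) monoid_scheme \<Rightarrow> ('k, 'o, 'm, 'z) pretricat_scheme \<Rightarrow>
    ('g, 'o, 'm) taction \<Rightarrow> ('g, 'o, 'm) eqv_ob set" where
  "eqv_objects G T A = {(X, \<alpha>). X \<in> Ob T \<and> \<alpha> \<in> extensional (carrier G) \<and>
     (\<forall>g\<in>carrier G. iso_in T X (Fob (act A g) X) (\<alpha> g)) \<and>
     (\<forall>g\<in>carrier G. \<forall>h\<in>carrier G.
        \<alpha> (g \<otimes>\<^bsub>G\<^esub> h) = coh A g h X \<cdot>\<^bsub>T\<^esub> Fmor (act A g) (\<alpha> h) \<cdot>\<^bsub>T\<^esub> \<alpha> g)}"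

text \<open>
  A morphism of equivariant objects is tagged with its domain and codomain, as the same morphism
  of \<open>T\<close> may underlie morphisms between different equivariant objects.
\<close>

type_synonym ('g, 'o, 'm) eqv_mor = "('g, 'o, 'm) eqv_ob \<times> 'm \<times> ('g, 'o, 'm) eqv_ob"

abbreviation underlying :: "('g, 'o, 'm) eqv_mor \<Rightarrow> 'm" where
  "underlying f \<equiv> fst (snd f)"

definition eqv_hom :: "('g, 'h) monoid_scheme \<Rightarrow> ('k, 'o, 'm, 'z) pretricat_scheme \<Rightarrow>
    ('g, 'o, 'm) taction \<Rightarrow> ('g, 'o, 'm) eqv_ob \<Rightarrow> ('g, 'o, 'm) eqv_ob \<Rightarrow>
    ('k, ('g, 'o, 'm) eqv_mor) module" where
  "eqv_hom G T A P Q = \<lparr>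
     carrier = {(P, f, Q) | f. f \<in> carrier (Hom T (fst P) (fst Q)) \<and>
                  (\<forall>g\<in>carrier G. snd Q g \<cdot>\<^bsub>T\<^esub> f = Fmor (act A g) f \<cdot>\<^bsub>T\<^esub> snd P g)},
     monoid.mult = undefined,
     monoid.one = undefined,
     ring.zero = (P, \<zero>\<^bsub>Hom T (fst P) (fst Q)\<^esub>, Q),
     ring.add = (\<lambda>f f'. (P, underlying f \<oplus>\<^bsub>Hom T (fst P) (fst Q)\<^esub> underlying f', Q)),
     smult = (\<lambda>c f. (P, c \<odot>\<^bsub>Hom T (fst P) (fst Q)\<^esub> underlying f, Q))\<rparr>"

definition eqv_susp_ob :: "('g, 'h) monoid_scheme \<Rightarrow> ('k, 'o, 'm, 'z) pretricat_scheme \<Rightarrow>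
    ('g, 'o, 'm) taction \<Rightarrow> ('g, 'o, 'm) eqv_ob \<Rightarrow> ('g, 'o, 'm) eqv_ob" where
  "eqv_susp_ob G T A = (\<lambda>(X, \<alpha>). (Fob (Susp T) X,
     \<lambda>g\<in>carrier G. inv_in T (Fob (act A g) (Fob (Susp T) X)) (Fob (Susp T) (Fob (act A g) X))
                     (conn (act A g) X) \<cdot>\<^bsub>T\<^esub> Fmor (Susp T) (\<alpha> g)))"

definition eqv_cat :: "('g, 'h) monoid_scheme \<Rightarrow> ('k, 'o, 'm, 'z) pretricat_scheme \<Rightarrow>
    ('g, 'o, 'm) taction \<Rightarrow> ('k, ('g, 'o, 'm) eqv_ob, ('g, 'o, 'm) eqv_mor) pretricat" where
  "eqv_cat G T A = \<lparr>
     Ob = eqv_objects G T A,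
     Hom = eqv_hom G T A,
     Comp = (\<lambda>g f. (fst f, underlying g \<cdot>\<^bsub>T\<^esub> underlying f, snd (snd g))),
     Idt = (\<lambda>P. (P, Idt T (fst P), P)),
     Susp = \<lparr>Fob = eqv_susp_ob G T A,
             Fmor = (\<lambda>(P, f, Q). (eqv_susp_ob G T A P, Fmor (Susp T) f, eqv_susp_ob G T A Q))\<rparr>,
     Exact = {(u, v, w). \<exists>P\<in>eqv_objects G T A. \<exists>Q\<in>eqv_objects G T A. \<exists>R\<in>eqv_objects G T A.
                u \<in> carrier (eqv_hom G T A P Q) \<and> v \<in> carrier (eqv_hom G T A Q R) \<and>
                w \<in> carrier (eqv_hom G T A R (eqv_susp_ob G T A P)) \<and>
                (underlying u, underlying v, underlying w) \<in> Exact T}\<rparr>"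

definition twist_ob :: "('g, 'h) monoid_scheme \<Rightarrow> ('k, 'o, 'm, 'z) pretricat_scheme \<Rightarrow>
    ('g, 'o, 'm) taction \<Rightarrow> ('g \<Rightarrow> 'k) \<Rightarrow> ('g, 'o, 'm) eqv_ob \<Rightarrow> ('g, 'o, 'm) eqv_ob" where
  "twist_ob G T A \<chi> = (\<lambda>(X, \<alpha>). (X,
     \<lambda>g\<in>carrier G. \<chi> (inv\<^bsub>G\<^esub> g) \<odot>\<^bsub>Hom T X (Fob (act A g) X)\<^esub> \<alpha> g))"

text \<open>
  The connecting and coherence isomorphisms below are the identities, since
  \<open>F\<^sub>\<chi>\<Sigma> = \<Sigma>F\<^sub>\<chi>\<close> and \<open>F\<^sub>\<chi>F\<^sub>\<psi> = F\<^sub>\<chi>\<^sub>\<psi>\<close> hold on the nose.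
\<close>

definition dual_action :: "('k, 'e) ring_scheme \<Rightarrow> ('g, 'h) monoid_scheme \<Rightarrow>
    ('k, 'o, 'm, 'z) pretricat_scheme \<Rightarrow> ('g, 'o, 'm) taction \<Rightarrow>
    ('g \<Rightarrow> 'k, ('g, 'o, 'm) eqv_ob, ('g, 'o, 'm) eqv_mor) taction" where
  "dual_action K G T A = \<lparr>
     act = (\<lambda>\<chi>. \<lparr>
       Fob = twist_ob G T A \<chi>,
       Fmor = (\<lambda>(P, f, Q). (twist_ob G T A \<chi> P, f, twist_ob G T A \<chi> Q)),
       conn = (\<lambda>P. Idt (eqv_cat G T A) (twist_ob G T A \<chi> (eqv_susp_ob G T A P)))\<rparr>),
     coh = (\<lambda>\<chi> \<psi> P. Idt (eqv_cat G T A) (twist_ob G T A (\<chi> \<otimes>\<^bsub>dual_group K G\<^esub> \<psi>) P))\<rparr>"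


section \<open>Groups of equivariant triangle autoequivalences\<close>

type_synonym ('g, 'o, 'm) eqv_functor = "('o, 'm, 'o, 'm) tfunctor \<times> ('g \<Rightarrow> 'o \<Rightarrow> 'm)"

definition eqv_autoequivalence :: "('k, 'e) ring_scheme \<Rightarrow> ('g, 'h) monoid_scheme \<Rightarrow>
    ('k, 'o, 'm, 'z) pretricat_scheme \<Rightarrow> ('g, 'o, 'm) taction \<Rightarrow> ('g, 'o, 'm) eqv_functor \<Rightarrow> bool" where
  "eqv_autoequivalence K G T A = (\<lambda>(F, \<delta>). triangle_autoequivalence K T F \<and>
     (\<forall>g\<in>carrier G. tri_nat_iso T T (tcomp T F (act A g)) (tcomp T (act A g) F) (\<delta> g)) \<and>
     (\<forall>g\<in>carrier G. \<forall>h\<in>carrier G. \<forall>X\<in>Ob T.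
        \<delta> (g \<otimes>\<^bsub>G\<^esub> h) X \<cdot>\<^bsub>T\<^esub> Fmor F (coh A g h X) =
        coh A g h (Fob F X) \<cdot>\<^bsub>T\<^esub> Fmor (act A g) (\<delta> h X) \<cdot>\<^bsub>T\<^esub> \<delta> g (Fob (act A h) X)))"

definition eqv_isomorphic :: "('g, 'h) monoid_scheme \<Rightarrow> ('k, 'o, 'm, 'z) pretricat_scheme \<Rightarrow>
    ('g, 'o, 'm) taction \<Rightarrow> ('g, 'o, 'm) eqv_functor \<Rightarrow> ('g, 'o, 'm) eqv_functor \<Rightarrow> bool" where
  "eqv_isomorphic G T A = (\<lambda>(F, \<delta>) (F', \<delta>'). \<exists>\<phi>. tri_nat_iso T T F F' \<phi> \<and>
     (\<forall>g\<in>carrier G. \<forall>X\<in>Ob T.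
        Fmor (act A g) (\<phi> X) \<cdot>\<^bsub>T\<^esub> \<delta> g X = \<delta>' g X \<cdot>\<^bsub>T\<^esub> \<phi> (Fob (act A g) X)))"

definition eqv_class :: "('k, 'e) ring_scheme \<Rightarrow> ('g, 'h) monoid_scheme \<Rightarrow>
    ('k, 'o, 'm, 'z) pretricat_scheme \<Rightarrow> ('g, 'o, 'm) taction \<Rightarrow> ('g, 'o, 'm) eqv_functor \<Rightarrow>
    ('g, 'o, 'm) eqv_functor set" where
  "eqv_class K G T A x = {y. eqv_autoequivalence K G T A y \<and> eqv_isomorphic G T A x y}"

definition eqv_mult :: "('k, 'o, 'm, 'z) pretricat_scheme \<Rightarrow> ('g, 'o, 'm) eqv_functor \<Rightarrow>
    ('g, 'o, 'm) eqv_functor \<Rightarrow> ('g, 'o, 'm) eqv_functor" where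
  "eqv_mult T = (\<lambda>(F, \<delta>) (F', \<delta>'). (tcomp T F F',
     \<lambda>g X. \<delta> g (Fob F' X) \<cdot>\<^bsub>T\<^esub> Fmor F (\<delta>' g X)))"

definition eqv_one :: "('k, 'o, 'm, 'z) pretricat_scheme \<Rightarrow> ('g, 'o, 'm) taction \<Rightarrow>
    ('g, 'o, 'm) eqv_functor" where
  "eqv_one T A = (tid T, \<lambda>g X. Idt T (Fob (act A g) X))"

text \<open>Isoclasses are sets of functors, and operations on classes are defined by taking the union over
  all representatives.\<close>

definition Aut_tri :: "('k, 'e) ring_scheme \<Rightarrow> ('g, 'h) monoid_scheme \<Rightarrow>
    ('k, 'o, 'm, 'z) pretricat_scheme \<Rightarrow> ('g, 'o, 'm) taction \<Rightarrow>
    ('g, 'o, 'm) eqv_functor set monoid" where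
  "Aut_tri K G T A = \<lparr>
     carrier = {eqv_class K G T A x | x. eqv_autoequivalence K G T A x},
     monoid.mult = (\<lambda>c d. \<Union>x\<in>c. \<Union>y\<in>d. eqv_class K G T A (eqv_mult T x y)),
     monoid.one = eqv_class K G T A (eqv_one T A)\<rparr>"

definition Act_tri :: "('k, 'e) ring_scheme \<Rightarrow> ('g, 'h) monoid_scheme \<Rightarrow>
    ('k, 'o, 'm, 'z) pretricat_scheme \<Rightarrow> ('g, 'o, 'm) taction \<Rightarrow>
    ('g, 'o, 'm) eqv_functor set monoid" where
  "Act_tri K G T A = (Aut_tri K G T A)
     \<lparr>carrier := {eqv_class K G T A (F, \<delta>) | F \<delta>. eqv_autoequivalence K G T A (F, \<delta>) \<and>
                    (\<exists>a\<in>carrier G. \<exists>\<phi>. tri_nat_iso T T F (act A a) \<phi>)}\<rparr>"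


section \<open>Equivariantization of equivariant functors\<close>

definition eqvz_ob :: "('g, 'h) monoid_scheme \<Rightarrow> ('k, 'o, 'm, 'z) pretricat_scheme \<Rightarrow>
    ('g, 'o, 'm) eqv_functor \<Rightarrow> ('g, 'o, 'm) eqv_ob \<Rightarrow> ('g, 'o, 'm) eqv_ob" where
  "eqvz_ob G T = (\<lambda>(F, \<delta>) (X, \<alpha>). (Fob F X, \<lambda>g\<in>carrier G. \<delta> g X \<cdot>\<^bsub>T\<^esub> Fmor F (\<alpha> g)))"

definition eqvz_functor :: "('g, 'h) monoid_scheme \<Rightarrow> ('k, 'o, 'm, 'z) pretricat_scheme \<Rightarrow>
    ('g, 'o, 'm) taction \<Rightarrow> ('g, 'o, 'm) eqv_functor \<Rightarrow>
    ('g \<Rightarrow> 'k, ('g, 'o, 'm) eqv_ob, ('g, 'o, 'm) eqv_mor) eqv_functor" where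
  "eqvz_functor G T A x =
     (\<lparr>Fob = eqvz_ob G T x,
       Fmor = (\<lambda>(P, f, Q). (eqvz_ob G T x P, Fmor (fst x) f, eqvz_ob G T x Q)),
       conn = (\<lambda>P. (eqvz_ob G T x (eqv_susp_ob G T A P), conn (fst x) (fst P),
                    eqv_susp_ob G T A (eqvz_ob G T x P)))\<rparr>,
      \<lambda>\<chi> P. Idt (eqv_cat G T A) (eqvz_ob G T x (twist_ob G T A \<chi> P)))"

definition eqvz_map :: "('k, 'e) ring_scheme \<Rightarrow> ('g, 'h) monoid_scheme \<Rightarrow>
    ('k, 'o, 'm, 'z) pretricat_scheme \<Rightarrow> ('g, 'o, 'm) taction \<Rightarrow> ('g, 'o, 'm) eqv_functor set \<Rightarrow>
    ('g \<Rightarrow> 'k, ('g, 'o, 'm) eqv_ob, ('g, 'o, 'm) eqv_mor) eqv_functor set" where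
  "eqvz_map K G T A c =
     (\<Union>x\<in>c. eqv_class K (dual_group K G) (eqv_cat G T A) (dual_action K G T A) (eqvz_functor G T A x))"

end

theory Submission
  imports Defs
begin

text \<open>
  Write \<open>U\<close> for the forgetful functor from the category \<open>T\<^sup>G\<close> of equivariant objects to \<open>T\<close>. The proof shows
  that \<open>T\<close> can be recovered from \<open>T\<^sup>G\<close> and the dual action, together with everything that is compatible
  with that action.

  Since the group algebra splits, the order of \<open>G\<close> is invertible in \<open>K\<close> and the characters satisfy both
  orthogonality relations. Conjugation by the structure maps makes the morphisms \<open>UP \<rightarrow> UQ\<close> a
  representation of \<open>G\<close>, so every such morphism is the sum of its homogeneous components, and the
  components of degree \<open>\<chi>\<close> are the morphisms \<open>P \<rightarrow> F\<^sub>\<chi> Q\<close> of \<open>T\<^sup>G\<close> (\<open>component_eqm\<close>, \<open>sum_component\<close>,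
  \<open>component_homog\<close>). On the other hand every object of \<open>T\<close> is a retract of the underlying object of its
  induced object, and every exact triangle is a retract of an exact triangle of \<open>T\<^sup>G\<close> (\<open>ind_exact\<close>,
  \<open>exact_pres_dense\<close>); retracts of direct sums of exact triangles are exact by a form of the five lemma
  (\<open>exact_of_family\<close>). Together this gives a density principle: a family of
  isomorphisms on the objects \<open>UP\<close> that is natural for homogeneous morphisms extends uniquely to a natural
  family on \<open>T\<close> (\<open>dense_ext_mor\<close>, \<open>dense_ext_nat\<close>, \<open>dense_eq\<close>).

  Injectivity (\<open>fz_injective\<close>) is density applied to an isomorphism between two equivariantizations. For
  surjectivity (\<open>fz_surjective\<close>) let \<open>\<Phi>\<close> be an equivariant triangle autoequivalence of \<open>T\<^sup>G\<close>. Applying it to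
  homogeneous components extends it to all morphisms \<open>UP \<rightarrow> UQ\<close> (\<open>extend_comp\<close>, \<open>extend_full\<close>,
  \<open>extend_faithful\<close>). An object \<open>X\<close> of \<open>T\<close> is the image of an idempotent on its induced object, and the
  functor on \<open>T\<close> sends \<open>X\<close> to an image of the extended idempotent; the connecting and equivariance
  isomorphisms come from density (\<open>F0_equi\<close>, \<open>FF_tfun\<close>, \<open>FF_ea\<close>, \<open>FF_iso\<close>). The equivalence classes over
  \<open>T\<close> form a group because the quasi-inverse of a triangle autoequivalence is one (\<open>Aut_group\<close>), and the
  group structure over \<open>T\<^sup>G\<close> is transported along the bijection.

  If the triangle centers are \<open>K\<close>, then two isomorphisms between triangle autoequivalences differ by a
  scalar (\<open>tni_scalar\<close>). An isomorphism \<open>F \<simeq> F\<^sub>a\<close> is compatible with the equivariance isomorphisms of \<open>F\<close>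
  up to scalars depending on the group element; they form a character \<open>\<chi>\<close>, and the equivariantization of
  \<open>F\<close> is isomorphic to \<open>F\<^sub>\<chi>\<close> (\<open>iso_to_action_char\<close>). Conversely, an isomorphism from the equivariantization
  to \<open>F\<^sub>\<chi>\<close> gives scalars that form a character of the dual group. By duality (\<open>evaluation_duality\<close>) this
  character is evaluation at some \<open>a\<close>, and density gives \<open>F \<simeq> F\<^sub>a\<close> (\<open>char_iso_to_action\<close>).
\<close>

section \<open>Morphisms of a linear category\<close>

text \<open>Distinct Hom sets are disjoint, so a morphism determines its domain and codomain. With these as
  total functions \<open>dm\<close> and \<open>cd\<close>, the axioms of a category become conditional rewrite rules whose
  side conditions the simplifier discharges by itself; composites are normalised to the right.\<close>

definition mor :: "('k, 'o, 'm, 'z) lincat_scheme \<Rightarrow> 'o \<Rightarrow> 'o \<Rightarrow> 'm \<Rightarrow> bool" where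
  "mor C X Y f \<longleftrightarrow> X \<in> Ob C \<and> Y \<in> Ob C \<and> f \<in> carrier (Hom C X Y)"

definition arr :: "('k, 'o, 'm, 'z) lincat_scheme \<Rightarrow> 'm \<Rightarrow> bool" where
  "arr C f \<longleftrightarrow> (\<exists>X Y. mor C X Y f)"

definition dm :: "('k, 'o, 'm, 'z) lincat_scheme \<Rightarrow> 'm \<Rightarrow> 'o" where
  "dm C f = (THE X. \<exists>Y. mor C X Y f)"

definition cd :: "('k, 'o, 'm, 'z) lincat_scheme \<Rightarrow> 'm \<Rightarrow> 'o" where
  "cd C f = (THE Y. \<exists>X. mor C X Y f)"

definition isom :: "('k, 'o, 'm, 'z) lincat_scheme \<Rightarrow> 'm \<Rightarrow> bool" where
  "isom C f \<longleftrightarrow> arr C f \<and> iso_in C (dm C f) (cd C f) f"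

definition iv :: "('k, 'o, 'm, 'z) lincat_scheme \<Rightarrow> 'm \<Rightarrow> 'm" where
  "iv C f = inv_in C (dm C f) (cd C f) f"

text \<open>Scalar multiple and sum, with the Hom space read off from the first argument: linear identities
  can then be written without naming the space they live in.\<close>

definition sc :: "('k, 'o, 'm, 'z) lincat_scheme \<Rightarrow> 'k \<Rightarrow> 'm \<Rightarrow> 'm" where
  "sc C c f = c \<odot>\<^bsub>Hom C (dm C f) (cd C f)\<^esub> f"

definition pl :: "('k, 'o, 'm, 'z) lincat_scheme \<Rightarrow> 'm \<Rightarrow> 'm \<Rightarrow> 'm" where
  "pl C f g = f \<oplus>\<^bsub>Hom C (dm C f) (cd C f)\<^esub> g"

lemma foldSetD_cong:
  assumes "(B, x) \<in> foldSetD D f e" "\<forall>a\<in>B. f a = g a"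
  shows "(B, x) \<in> foldSetD D g e"
  using assms by (induction rule: foldSetD.induct) (auto intro!: foldSetD.intros)

text \<open>The value of a finite sum only depends on the summands over the index set, also when they are
  not known to lie in the carrier. As a congruence rule this permits rewriting below the sum.\<close>

lemma finsum_cong_all [cong]:
  assumes "M = N" "A = B" "\<And>a. a \<in> B \<Longrightarrow> f a = g a"
  shows "finsum M f A = finsum N g B"
proof -
  have "(B, x) \<in> foldSetD (carrier N) ((\<oplus>\<^bsub>N\<^esub>) \<circ> f) \<zero>\<^bsub>N\<^esub> \<longleftrightarrow> (B, x) \<in> foldSetD (carrier N) ((\<oplus>\<^bsub>N\<^esub>) \<circ> g) \<zero>\<^bsub>N\<^esub>" for x
    using assms(3) by (auto elim!: foldSetD_cong)
  then show ?thesis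
    using assms(1,2) by (simp add: finsum_def finprod_def foldD_def)
qed

context linear_category
begin

lemma hom_abelian: "\<lbrakk>X \<in> Ob C; Y \<in> Ob C\<rbrakk> \<Longrightarrow> abelian_group (Hom C X Y)"
  using hom_module module.axioms by blast

lemma mor_dm_cd:
  assumes "mor C X Y f" shows "dm C f = X" "cd C f = Y"
  using assms hom_disjoint unfolding dm_def cd_def mor_def by (blast intro!: the_equality)+

lemma mor_iff: "mor C X Y f \<longleftrightarrow> arr C f \<and> dm C f = X \<and> cd C f = Y"
  using mor_dm_cd arr_def by metis

declare mor_iff [simp]

lemma mor_carrier: "\<lbrakk>X \<in> Ob C; Y \<in> Ob C\<rbrakk> \<Longrightarrow> f \<in> carrier (Hom C X Y) \<longleftrightarrow> mor C X Y f"
  by (simp add: mor_def del: mor_iff)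

lemma arr_carrier: "arr C f \<Longrightarrow> f \<in> carrier (Hom C (dm C f) (cd C f))"
  using mor_iff[of "dm C f" "cd C f" f] unfolding mor_def by simp

lemma dm_Ob [simp]: "arr C f \<Longrightarrow> dm C f \<in> Ob C"
  using mor_iff[of "dm C f" "cd C f" f] unfolding mor_def by simp

lemma cd_Ob [simp]: "arr C f \<Longrightarrow> cd C f \<in> Ob C"
  using mor_iff[of "dm C f" "cd C f" f] unfolding mor_def by simp

lemma morI: "\<lbrakk>X \<in> Ob C; Y \<in> Ob C; f \<in> carrier (Hom C X Y)\<rbrakk> \<Longrightarrow> mor C X Y f"
  by (simp add: mor_def del: mor_iff)

lemma in_hom: "\<lbrakk>arr C f; dm C f = X; cd C f = Y\<rbrakk> \<Longrightarrow> f \<in> carrier (Hom C X Y)"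
  using arr_carrier by blast

lemma comp_mor: "\<lbrakk>arr C g; arr C f; dm C g = cd C f\<rbrakk> \<Longrightarrow> mor C (dm C f) (cd C g) (g \<cdot>\<^bsub>C\<^esub> f)"
  by (metis comp_closed in_hom dm_Ob cd_Ob morI)

lemma comp_arr [simp]:
  assumes "arr C g" "arr C f" "dm C g = cd C f"
  shows "arr C (g \<cdot>\<^bsub>C\<^esub> f)" "dm C (g \<cdot>\<^bsub>C\<^esub> f) = dm C f" "cd C (g \<cdot>\<^bsub>C\<^esub> f) = cd C g"
  using comp_mor[OF assms] by auto

lemma assoc [simp]:
  assumes "arr C h" "arr C g" "arr C f" "dm C h = cd C g" "dm C g = cd C f"
  shows "(h \<cdot>\<^bsub>C\<^esub> g) \<cdot>\<^bsub>C\<^esub> f = h \<cdot>\<^bsub>C\<^esub> (g \<cdot>\<^bsub>C\<^esub> f)"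
  using comp_assoc[of "dm C f" "cd C f" "cd C g" "cd C h" f g h] assms by (auto simp: in_hom)

lemma idt_mor [simp]:
  assumes "X \<in> Ob C" shows "arr C (Idt C X)" "dm C (Idt C X) = X" "cd C (Idt C X) = X"
  using morI[OF assms assms idt_closed[OF assms]] by auto

lemma idt_comp [simp]: "\<lbrakk>arr C f; cd C f = Y\<rbrakk> \<Longrightarrow> Idt C Y \<cdot>\<^bsub>C\<^esub> f = f"
  using idt_left[of "dm C f" Y f] in_hom by auto

lemma comp_idt [simp]: "\<lbrakk>arr C f; dm C f = X\<rbrakk> \<Longrightarrow> f \<cdot>\<^bsub>C\<^esub> Idt C X = f"
  using idt_right[of X "cd C f" f] in_hom by auto

text \<open>Applies an equation between composites of two morphisms in front of a third one, where the
  normalisation to the right has hidden its left-hand side.\<close>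

lemma comp_reassoc:
  assumes "g \<cdot>\<^bsub>C\<^esub> f = g' \<cdot>\<^bsub>C\<^esub> f'" "arr C k" "cd C k = dm C f"
    "arr C g" "arr C f" "dm C g = cd C f" "arr C g'" "arr C f'" "dm C g' = cd C f'"
  shows "g \<cdot>\<^bsub>C\<^esub> (f \<cdot>\<^bsub>C\<^esub> k) = g' \<cdot>\<^bsub>C\<^esub> (f' \<cdot>\<^bsub>C\<^esub> k)"
proof -
  have "dm C f = dm C f'"
    using assms by (metis comp_arr(2))
  then have "g \<cdot>\<^bsub>C\<^esub> (f \<cdot>\<^bsub>C\<^esub> k) = (g \<cdot>\<^bsub>C\<^esub> f) \<cdot>\<^bsub>C\<^esub> k" "g' \<cdot>\<^bsub>C\<^esub> (f' \<cdot>\<^bsub>C\<^esub> k) = (g' \<cdot>\<^bsub>C\<^esub> f') \<cdot>\<^bsub>C\<^esub> k"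
    using assms(2-) by simp_all
  then show ?thesis using assms(1) by simp
qed

lemma comp_reassoc1:
  assumes "g \<cdot>\<^bsub>C\<^esub> f = h" "arr C k" "cd C k = dm C f" "arr C g" "arr C f" "dm C g = cd C f"
  shows "g \<cdot>\<^bsub>C\<^esub> (f \<cdot>\<^bsub>C\<^esub> k) = h \<cdot>\<^bsub>C\<^esub> k"
  using assms by (metis assoc)

section \<open>Isomorphisms\<close>

lemma inverse_unique:
  assumes "inverse_in C X Y f h" "inverse_in C X Y f h'" "X \<in> Ob C" "Y \<in> Ob C"
  shows "h = h'"
  using assms unfolding inverse_in_def by (metis comp_assoc idt_left idt_right)

lemma isomI:
  assumes "arr C f" "arr C h" "dm C h = cd C f" "cd C h = dm C f"
    "h \<cdot>\<^bsub>C\<^esub> f = Idt C (dm C f)" "f \<cdot>\<^bsub>C\<^esub> h = Idt C (cd C f)"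
  shows "isom C f" "iv C f = h"
proof -
  have *: "inverse_in C (dm C f) (cd C f) f h"
    using assms by (simp add: inverse_in_def in_hom)
  then show "isom C f"
    using assms(1) by (auto simp: isom_def iso_in_def)
  show "iv C f = h"
    using * inverse_unique assms(1) unfolding iv_def inv_in_def by (blast intro: the_equality dm_Ob cd_Ob)
qed

lemma isom_inverse_in: "isom C f \<Longrightarrow> inverse_in C (dm C f) (cd C f) f (iv C f)"
  unfolding isom_def iso_in_def iv_def inv_in_def using inverse_unique dm_Ob cd_Ob
  by (metis (no_types, lifting) theI)

lemma isom_arr [simp]: "isom C f \<Longrightarrow> arr C f"
  by (simp add: isom_def)

lemma iv_mor [simp]:
  assumes "isom C f"
  shows "arr C (iv C f)" "dm C (iv C f) = cd C f" "cd C (iv C f) = dm C f"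
    "iv C f \<cdot>\<^bsub>C\<^esub> f = Idt C (dm C f)" "f \<cdot>\<^bsub>C\<^esub> iv C f = Idt C (cd C f)"
proof -
  have "mor C (cd C f) (dm C f) (iv C f)"
    using isom_inverse_in[OF assms] assms by (intro morI) (auto simp: inverse_in_def)
  then show "arr C (iv C f)" "dm C (iv C f) = cd C f" "cd C (iv C f) = dm C f"
    by auto
  show "iv C f \<cdot>\<^bsub>C\<^esub> f = Idt C (dm C f)" "f \<cdot>\<^bsub>C\<^esub> iv C f = Idt C (cd C f)"
    using isom_inverse_in[OF assms] by (auto simp: inverse_in_def)
qed

lemma iv_cancel [simp]:
  assumes "isom C f" "arr C k"
  shows "cd C k = dm C f \<Longrightarrow> iv C f \<cdot>\<^bsub>C\<^esub> (f \<cdot>\<^bsub>C\<^esub> k) = k" "cd C k = cd C f \<Longrightarrow> f \<cdot>\<^bsub>C\<^esub> (iv C f \<cdot>\<^bsub>C\<^esub> k) = k"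
  using assms assoc[of "iv C f" f k] assoc[of f "iv C f" k] by auto

lemma isom_iv [simp]: "isom C f \<Longrightarrow> isom C (iv C f)" "isom C f \<Longrightarrow> iv C (iv C f) = f"
  using isomI[of "iv C f" f] by auto

lemma isom_comp [simp]:
  assumes "isom C g" "isom C f" "dm C g = cd C f"
  shows "isom C (g \<cdot>\<^bsub>C\<^esub> f)" "iv C (g \<cdot>\<^bsub>C\<^esub> f) = iv C f \<cdot>\<^bsub>C\<^esub> iv C g"
  using isomI[of "g \<cdot>\<^bsub>C\<^esub> f" "iv C f \<cdot>\<^bsub>C\<^esub> iv C g"] assms by auto

lemma isom_idt [simp]: "X \<in> Ob C \<Longrightarrow> isom C (Idt C X)" "X \<in> Ob C \<Longrightarrow> iv C (Idt C X) = Idt C X"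
  using isomI[of "Idt C X" "Idt C X"] by auto

lemma iso_in_iff: "\<lbrakk>X \<in> Ob C; Y \<in> Ob C\<rbrakk> \<Longrightarrow> iso_in C X Y f \<longleftrightarrow> isom C f \<and> dm C f = X \<and> cd C f = Y"
  using morI[of X Y f] by (auto simp: isom_def iso_in_def inverse_in_def)

lemma inv_in_iv: "\<lbrakk>isom C f; dm C f = X; cd C f = Y\<rbrakk> \<Longrightarrow> inv_in C X Y f = iv C f"
  by (auto simp: iv_def)

lemma iso_cancel_left:
  assumes "isom C f" "arr C g" "arr C h" "cd C g = dm C f" "cd C h = dm C f"
  shows "f \<cdot>\<^bsub>C\<^esub> g = f \<cdot>\<^bsub>C\<^esub> h \<longleftrightarrow> g = h"
  using assms iv_cancel(1) by metis

lemma iso_cancel_right: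
  assumes "isom C f" "arr C g" "arr C h" "dm C g = cd C f" "dm C h = cd C f"
  shows "g \<cdot>\<^bsub>C\<^esub> f = h \<cdot>\<^bsub>C\<^esub> f \<longleftrightarrow> g = h"
proof
  assume *: "g \<cdot>\<^bsub>C\<^esub> f = h \<cdot>\<^bsub>C\<^esub> f"
  have "g = (g \<cdot>\<^bsub>C\<^esub> f) \<cdot>\<^bsub>C\<^esub> iv C f" "h = (h \<cdot>\<^bsub>C\<^esub> f) \<cdot>\<^bsub>C\<^esub> iv C f"
    using assms by simp_all
  then show "g = h" using * by simp
qed simp

lemma iso_move_left:
  assumes "isom C f" "arr C g" "arr C h" "cd C g = dm C f" "cd C h = cd C f"
  shows "f \<cdot>\<^bsub>C\<^esub> g = h \<longleftrightarrow> g = iv C f \<cdot>\<^bsub>C\<^esub> h"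
  using assms by (metis iv_cancel)

section \<open>Linear structure on morphisms\<close>

lemma sc_eq: "\<lbrakk>arr C f; dm C f = X; cd C f = Y\<rbrakk> \<Longrightarrow> c \<odot>\<^bsub>Hom C X Y\<^esub> f = sc C c f"
  by (simp add: sc_def)

lemma pl_eq: "\<lbrakk>arr C f; dm C f = X; cd C f = Y\<rbrakk> \<Longrightarrow> f \<oplus>\<^bsub>Hom C X Y\<^esub> g = pl C f g"
  by (simp add: pl_def)

lemma sc_mor [simp]:
  assumes "arr C f" "c \<in> carrier K"
  shows "arr C (sc C c f)" "dm C (sc C c f) = dm C f" "cd C (sc C c f) = cd C f"
proof -
  have "mor C (dm C f) (cd C f) (sc C c f)"
    unfolding sc_def using assms
    by (intro morI) (auto intro!: module.smult_closed[OF hom_module] arr_carrier)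
  then show "arr C (sc C c f)" "dm C (sc C c f) = dm C f" "cd C (sc C c f) = cd C f"
    by auto
qed

lemma pl_mor [simp]:
  assumes "arr C f" "arr C g" "dm C f = dm C g" "cd C f = cd C g"
  shows "arr C (pl C f g)" "dm C (pl C f g) = dm C g" "cd C (pl C f g) = cd C g"
proof -
  interpret H: abelian_group "Hom C (dm C f) (cd C f)" using assms by (simp add: hom_abelian)
  have "mor C (dm C f) (cd C f) (pl C f g)"
    unfolding pl_def using assms arr_carrier[of f] arr_carrier[of g]
    by (intro morI H.a_closed dm_Ob cd_Ob) simp_all
  then show "arr C (pl C f g)" "dm C (pl C f g) = dm C g" "cd C (pl C f g) = cd C g"
    using assms by auto
qed

lemma comp_sc [simp]:
  assumes "arr C g" "arr C f" "dm C g = cd C f" "c \<in> carrier K"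
  shows "g \<cdot>\<^bsub>C\<^esub> sc C c f = sc C c (g \<cdot>\<^bsub>C\<^esub> f)" "sc C c g \<cdot>\<^bsub>C\<^esub> f = sc C c (g \<cdot>\<^bsub>C\<^esub> f)"
  using assms comp_smult_left[of "dm C f" "cd C f" "cd C g" c f g]
    comp_smult_right[of "dm C f" "cd C f" "cd C g" c f g]
  by (auto simp: in_hom sc_def)

lemma comp_pl:
  assumes "arr C g" "arr C f" "dm C g = cd C f"
  shows "arr C f' \<Longrightarrow> dm C f' = dm C f \<Longrightarrow> cd C f' = cd C f \<Longrightarrow> g \<cdot>\<^bsub>C\<^esub> pl C f f' = pl C (g \<cdot>\<^bsub>C\<^esub> f) (g \<cdot>\<^bsub>C\<^esub> f')"
    "arr C g' \<Longrightarrow> dm C g' = dm C g \<Longrightarrow> cd C g' = cd C g \<Longrightarrow> pl C g g' \<cdot>\<^bsub>C\<^esub> f = pl C (g \<cdot>\<^bsub>C\<^esub> f) (g' \<cdot>\<^bsub>C\<^esub> f)"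
  using assms comp_add_left[of "dm C f" "cd C f" "cd C g" f g g']
    comp_add_right[of "dm C f" "cd C f" "cd C g" f f' g]
  by (auto simp: in_hom pl_def)

lemma sc_sc [simp]: "\<lbrakk>arr C f; c \<in> carrier K; d \<in> carrier K\<rbrakk> \<Longrightarrow> sc C c (sc C d f) = sc C (c \<otimes> d) f"
  unfolding sc_def[of C c "sc C d f"] using module.smult_assoc1[OF hom_module, of "dm C f" "cd C f" c d f]
  by (simp add: sc_def[of C _ f] sc_mor[unfolded sc_def] arr_carrier)

lemma sc_one [simp]: "arr C f \<Longrightarrow> sc C \<one> f = f"
  unfolding sc_def by (intro module.smult_one[OF hom_module]) (auto simp: arr_carrier)

lemma sc_isom [simp]:
  assumes "isom C f" "c \<in> carrier K" "c \<noteq> \<zero>"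
  shows "isom C (sc C c f)" "iv C (sc C c f) = sc C (inv c) (iv C f)"
  using isomI[of "sc C c f" "sc C (inv c) (iv C f)"] assms
  by (auto simp: field_Units)

lemma zero_mor [simp]:
  assumes "X \<in> Ob C" "Y \<in> Ob C"
  shows "arr C \<zero>\<^bsub>Hom C X Y\<^esub>" "dm C \<zero>\<^bsub>Hom C X Y\<^esub> = X" "cd C \<zero>\<^bsub>Hom C X Y\<^esub> = Y"
  using morI[OF assms, of "\<zero>\<^bsub>Hom C X Y\<^esub>"] assms
  by (auto intro!: abelian_monoid.zero_closed abelian_group.axioms hom_abelian)

lemma sc_zero: "arr C f \<Longrightarrow> sc C \<zero> f = \<zero>\<^bsub>Hom C (dm C f) (cd C f)\<^esub>"
  unfolding sc_def by (intro module.smult_l_null[OF hom_module]) (auto simp: arr_carrier)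

lemma comp_zero [simp]:
  assumes "arr C g" "X \<in> Ob C" "dm C g = Y"
  shows "g \<cdot>\<^bsub>C\<^esub> \<zero>\<^bsub>Hom C X Y\<^esub> = \<zero>\<^bsub>Hom C X (cd C g)\<^esub>"
  using sc_zero[of "\<zero>\<^bsub>Hom C X Y\<^esub>"] sc_zero[of "g \<cdot>\<^bsub>C\<^esub> \<zero>\<^bsub>Hom C X Y\<^esub>"] assms comp_sc(1)[of g "\<zero>\<^bsub>Hom C X Y\<^esub>" \<zero>]
  by force

lemma zero_comp [simp]:
  assumes "arr C g" "X \<in> Ob C" "cd C g = Y"
  shows "\<zero>\<^bsub>Hom C Y X\<^esub> \<cdot>\<^bsub>C\<^esub> g = \<zero>\<^bsub>Hom C (dm C g) X\<^esub>"
  using sc_zero[of "\<zero>\<^bsub>Hom C Y X\<^esub>"] sc_zero[of "\<zero>\<^bsub>Hom C Y X\<^esub> \<cdot>\<^bsub>C\<^esub> g"] assms comp_sc(2)[of "\<zero>\<^bsub>Hom C Y X\<^esub>" g \<zero>]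
  by force

lemma sum_mor [simp]:
  assumes "X \<in> Ob C" "Y \<in> Ob C" "\<And>h. h \<in> S \<Longrightarrow> mor C X Y (f h)"
  shows "arr C (finsum (Hom C X Y) f S)" "dm C (finsum (Hom C X Y) f S) = X"
    "cd C (finsum (Hom C X Y) f S) = Y"
proof -
  have "mor C X Y (finsum (Hom C X Y) f S)"
    using assms
    by (intro morI abelian_monoid.finsum_closed abelian_group.axioms hom_abelian) (auto intro!: in_hom)
  then show "arr C (finsum (Hom C X Y) f S)" "dm C (finsum (Hom C X Y) f S) = X"
    "cd C (finsum (Hom C X Y) f S) = Y" by auto
qed

lemma sum_empty [simp]: "\<lbrakk>X \<in> Ob C; Y \<in> Ob C\<rbrakk> \<Longrightarrow> finsum (Hom C X Y) f {} = \<zero>\<^bsub>Hom C X Y\<^esub>"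
  by (intro abelian_monoid.finsum_empty abelian_group.axioms hom_abelian)

lemma sum_insert:
  assumes "X \<in> Ob C" "Y \<in> Ob C" "finite S" "a \<notin> S" "mor C X Y (f a)" "\<And>h. h \<in> S \<Longrightarrow> mor C X Y (f h)"
  shows "finsum (Hom C X Y) f (insert a S) = pl C (f a) (finsum (Hom C X Y) f S)"
proof -
  have "finsum (Hom C X Y) f (insert a S) = f a \<oplus>\<^bsub>Hom C X Y\<^esub> finsum (Hom C X Y) f S"
    using assms by (intro abelian_monoid.finsum_insert abelian_group.axioms hom_abelian) (auto intro!: in_hom)
  then show ?thesis using assms by (simp add: pl_eq)
qed

lemma pl_zero [simp]:
  assumes "arr C f" "dm C f = X" "cd C f = Y"
  shows "pl C f \<zero>\<^bsub>Hom C X Y\<^esub> = f" "pl C \<zero>\<^bsub>Hom C X Y\<^esub> f = f"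
proof -
  have [simp]: "X \<in> Ob C" "Y \<in> Ob C" using assms by auto
  interpret H: abelian_group "Hom C X Y" by (simp add: hom_abelian)
  show "pl C f \<zero>\<^bsub>Hom C X Y\<^esub> = f" "pl C \<zero>\<^bsub>Hom C X Y\<^esub> f = f"
    using assms H.r_zero H.l_zero in_hom[OF assms] by (auto simp: pl_def)
qed

lemma comp_sum [simp]:
  assumes "finite S" "X \<in> Ob C" "arr C g" "dm C g = Y" "\<And>h. h \<in> S \<Longrightarrow> mor C X Y (f h)"
  shows "g \<cdot>\<^bsub>C\<^esub> finsum (Hom C X Y) f S = finsum (Hom C X (cd C g)) (\<lambda>h. g \<cdot>\<^bsub>C\<^esub> f h) S"
  using assms(1) assms(2-)
  by (induction S) (auto simp: sum_insert comp_pl)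

lemma sum_comp [simp]:
  assumes "finite S" "Y \<in> Ob C" "arr C g" "cd C g = X" "\<And>h. h \<in> S \<Longrightarrow> mor C X Y (f h)"
  shows "finsum (Hom C X Y) f S \<cdot>\<^bsub>C\<^esub> g = finsum (Hom C (dm C g) Y) (\<lambda>h. f h \<cdot>\<^bsub>C\<^esub> g) S"
  using assms(1) assms(2-)
  by (induction S) (auto simp: sum_insert comp_pl)

lemma sum_single:
  assumes "X \<in> Ob C" "Y \<in> Ob C" "finite S" "a \<in> S" "mor C X Y (f a)"
    "\<And>h. h \<in> S \<Longrightarrow> h \<noteq> a \<Longrightarrow> f h = \<zero>\<^bsub>Hom C X Y\<^esub>"
  shows "finsum (Hom C X Y) f S = f a"
proof -
  have "finsum (Hom C X Y) f S = finsum (Hom C X Y) f (insert a (S - {a}))"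
    using assms(4) by (simp add: insert_absorb)
  also have "\<dots> = pl C (f a) (finsum (Hom C X Y) f (S - {a}))"
    using assms by (intro sum_insert) auto
  also have "finsum (Hom C X Y) f (S - {a}) = \<zero>\<^bsub>Hom C X Y\<^esub>"
  proof -
    have "finsum (Hom C X Y) f (S - {a}) = finsum (Hom C X Y) (\<lambda>h. \<zero>\<^bsub>Hom C X Y\<^esub>) (S - {a})"
      using assms(6) by (intro finsum_cong_all) auto
    then show ?thesis
      using assms(1,2) by (simp only: abelian_monoid.finsum_zero[OF abelian_group.axioms(1)[OF hom_abelian]])
  qed
  finally show ?thesis using assms by simp
qed

lemma sum_zero [simp]: "\<lbrakk>X \<in> Ob C; Y \<in> Ob C\<rbrakk> \<Longrightarrow> finsum (Hom C X Y) (\<lambda>h. \<zero>\<^bsub>Hom C X Y\<^esub>) S = \<zero>\<^bsub>Hom C X Y\<^esub>"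
  by (rule abelian_monoid.finsum_zero[OF abelian_group.axioms(1)[OF hom_abelian]])

lemma sc_pl:
  assumes "arr C f" "arr C g" "dm C f = dm C g" "cd C f = cd C g" "c \<in> carrier K"
  shows "sc C c (pl C f g) = pl C (sc C c f) (sc C c g)"
proof -
  interpret H: module K "Hom C (dm C g) (cd C g)" using assms by (simp add: hom_module)
  show ?thesis using H.smult_r_distr[of c f g] assms unfolding sc_def[of C c "pl C f g"] pl_def[of C "sc C c f"]
    by (simp add: in_hom) (simp add: pl_def sc_def)
qed

lemma sc_zero_mor [simp]: "\<lbrakk>X \<in> Ob C; Y \<in> Ob C; c \<in> carrier K\<rbrakk> \<Longrightarrow> sc C c \<zero>\<^bsub>Hom C X Y\<^esub> = \<zero>\<^bsub>Hom C X Y\<^esub>"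
  unfolding sc_def using module.smult_r_null[OF hom_module] by auto

lemma sc_sum [simp]:
  assumes "finite S" "X \<in> Ob C" "Y \<in> Ob C" "c \<in> carrier K" "\<And>h. h \<in> S \<Longrightarrow> mor C X Y (f h)"
  shows "sc C c (finsum (Hom C X Y) f S) = finsum (Hom C X Y) (\<lambda>h. sc C c (f h)) S"
  using assms(1) assms(2-) by (induction S) (auto simp: sum_insert sc_pl)

lemma sum_sc_left:
  assumes "finite S" "arr C f" "dm C f = X" "cd C f = Y" "\<And>h. h \<in> S \<Longrightarrow> c h \<in> carrier K"
  shows "finsum (Hom C X Y) (\<lambda>h. sc C (c h) f) S = sc C (finsum K c S) f"
  using assms(1) assms(2-)
proof (induction S)
  case empty then show ?case by (auto simp: sc_zero)
next
  case (insert a S)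
  interpret H: module K "Hom C X Y" using insert.prems by (auto intro: hom_module)
  have "c a \<in> carrier K" "finsum K c S \<in> carrier K" using insert by (auto intro!: finsum_closed)
  moreover have "finsum K c (insert a S) = c a \<oplus> finsum K c S"
    using insert by (intro finsum_insert) auto
  ultimately show ?case using insert H.smult_l_distr[of "c a" "finsum K c S" f]
    by (auto simp: sum_insert in_hom sc_eq pl_eq)
qed

lemma sum_swap:
  assumes "finite S" "finite R" "X \<in> Ob C" "Y \<in> Ob C" "\<And>a b. a \<in> S \<Longrightarrow> b \<in> R \<Longrightarrow> mor C X Y (f a b)"
  shows "finsum (Hom C X Y) (\<lambda>a. finsum (Hom C X Y) (f a) R) S
       = finsum (Hom C X Y) (\<lambda>b. finsum (Hom C X Y) (\<lambda>a. f a b) S) R"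
  using assms(1) assms(2-)
proof (induction S)
  case (insert a S)
  interpret H: abelian_group "Hom C X Y" using insert.prems by (auto intro: hom_abelian)
  have "finsum (Hom C X Y) (\<lambda>b. finsum (Hom C X Y) (\<lambda>a. f a b) (insert a S)) R
      = finsum (Hom C X Y) (\<lambda>b. f a b \<oplus>\<^bsub>Hom C X Y\<^esub> finsum (Hom C X Y) (\<lambda>a. f a b) S) R"
    using insert by (intro finsum_cong_all refl) (auto simp: sum_insert pl_eq)
  also have "\<dots> = finsum (Hom C X Y) (f a) R \<oplus>\<^bsub>Hom C X Y\<^esub> finsum (Hom C X Y) (\<lambda>b. finsum (Hom C X Y) (\<lambda>a. f a b) S) R"
    using insert by (intro H.finsum_addf) (auto intro!: in_hom)
  finally show ?case using insert by (simp add: sum_insert pl_eq)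
qed simp

text \<open>The morphism \<open>d\<close> plays the part of \<open>f - g\<close> in diagram chases.\<close>

lemma diff_exists:
  assumes "arr C f" "arr C g" "dm C f = dm C g" "cd C f = cd C g"
  obtains d where "mor C (dm C g) (cd C g) d" "pl C d g = f"
    "d = \<zero>\<^bsub>Hom C (dm C g) (cd C g)\<^esub> \<Longrightarrow> f = g"
proof -
  interpret H: abelian_group "Hom C (dm C g) (cd C g)" using assms by (simp add: hom_abelian)
  define d where "d = f \<ominus>\<^bsub>Hom C (dm C g) (cd C g)\<^esub> g"
  have c: "f \<in> carrier (Hom C (dm C g) (cd C g))" "g \<in> carrier (Hom C (dm C g) (cd C g))"
    using assms by (auto intro: in_hom)
  have m: "mor C (dm C g) (cd C g) d" unfolding d_def using assms c by (intro morI) auto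
  have "pl C d g = f"
    using m c by (simp add: pl_def) (simp add: d_def H.minus_eq H.a_assoc H.l_neg)
  moreover have "d = \<zero>\<^bsub>Hom C (dm C g) (cd C g)\<^esub> \<Longrightarrow> f = g"
    using calculation assms by simp
  ultimately show ?thesis using that m by blast
qed

lemma pl_cancel:
  assumes "pl C d g = pl C e g" "mor C (dm C g) (cd C g) d" "mor C (dm C g) (cd C g) e" "arr C g"
  shows "d = e"
proof -
  interpret H: abelian_group "Hom C (dm C g) (cd C g)" using assms by (simp add: hom_abelian)
  show ?thesis using assms H.add.right_cancel[of g d e] by (simp add: pl_def in_hom)
qed

end

section \<open>Linear functors and equivalences\<close>

lemma fid_simps [simp]: "Fob fid X = X" "Fmor fid f = f"
  by (simp_all add: fid_def)

lemma fcomp_simps [simp]: "Fob (fcomp F H) X = Fob F (Fob H X)" "Fmor (fcomp F H) f = Fmor F (Fmor H f)"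
  by (simp_all add: fcomp_def)

lemma tid_simps [simp]: "Fob (tid T) X = X" "Fmor (tid T) f = f" "conn (tid T) X = Idt T (Fob (Susp T) X)"
  by (simp_all add: tid_def)

lemma tcomp_simps [simp]: "Fob (tcomp T F H) X = Fob F (Fob H X)"
  "Fmor (tcomp T F H) f = Fmor F (Fmor H f)"
  "conn (tcomp T F H) X = conn F (Fob H X) \<cdot>\<^bsub>T\<^esub> Fmor F (conn H X)"
  by (simp_all add: tcomp_def)

context linear_category
begin

abbreviation endo :: "('o, 'm, 'o, 'm, 'w) lfunctor_scheme \<Rightarrow> bool" where
  "endo F \<equiv> linear_functor K C C F"

lemma fun_ob [simp]: "\<lbrakk>endo F; X \<in> Ob C\<rbrakk> \<Longrightarrow> Fob F X \<in> Ob C"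
  by (rule linear_functor.Fob_closed)

lemma fun_arr [simp]:
  assumes "endo F" "arr C f"
  shows "arr C (Fmor F f)" "dm C (Fmor F f) = Fob F (dm C f)" "cd C (Fmor F f) = Fob F (cd C f)"
proof -
  have "mor C (Fob F (dm C f)) (Fob F (cd C f)) (Fmor F f)"
    using assms by (intro morI linear_functor.Fmor_closed[OF assms(1)] arr_carrier) simp_all
  then show "arr C (Fmor F f)" "dm C (Fmor F f) = Fob F (dm C f)" "cd C (Fmor F f) = Fob F (cd C f)"
    by auto
qed

lemma fun_idt [simp]: "\<lbrakk>endo F; X \<in> Ob C\<rbrakk> \<Longrightarrow> Fmor F (Idt C X) = Idt C (Fob F X)"
  by (rule linear_functor.Fmor_idt)

lemma fun_comp [simp]:
  "\<lbrakk>endo F; arr C g; arr C f; dm C g = cd C f\<rbrakk> \<Longrightarrow> Fmor F (g \<cdot>\<^bsub>C\<^esub> f) = Fmor F g \<cdot>\<^bsub>C\<^esub> Fmor F f"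
  using linear_functor.Fmor_comp[of K C C F "dm C f" "cd C f" "cd C g" f g] by (simp add: in_hom)

lemma fun_sc [simp]: "\<lbrakk>endo F; arr C f; c \<in> carrier K\<rbrakk> \<Longrightarrow> Fmor F (sc C c f) = sc C c (Fmor F f)"
  using linear_functor.Fmor_smult[of K C C F "dm C f" "cd C f" c f] by (simp add: in_hom sc_def)

lemma fun_pl:
  "\<lbrakk>endo F; arr C f; arr C g; dm C f = dm C g; cd C f = cd C g\<rbrakk> \<Longrightarrow> Fmor F (pl C f g) = pl C (Fmor F f) (Fmor F g)"
  using linear_functor.Fmor_add[of K C C F "dm C f" "cd C f" f g] by (simp add: in_hom pl_eq)

lemma fun_zero [simp]: "\<lbrakk>endo F; X \<in> Ob C; Y \<in> Ob C\<rbrakk> \<Longrightarrow> Fmor F \<zero>\<^bsub>Hom C X Y\<^esub> = \<zero>\<^bsub>Hom C (Fob F X) (Fob F Y)\<^esub>"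
  using fun_sc[of F "\<zero>\<^bsub>Hom C X Y\<^esub>" \<zero>] sc_zero[of "\<zero>\<^bsub>Hom C X Y\<^esub>"] sc_zero[of "Fmor F \<zero>\<^bsub>Hom C X Y\<^esub>"]
  by (simp del: fun_sc sc_zero_mor)

lemma fun_sum [simp]:
  assumes "endo F" "finite S" "X \<in> Ob C" "Y \<in> Ob C" "\<And>h. h \<in> S \<Longrightarrow> mor C X Y (f h)"
  shows "Fmor F (finsum (Hom C X Y) f S) = finsum (Hom C (Fob F X) (Fob F Y)) (\<lambda>h. Fmor F (f h)) S"
  using assms(2) assms(1,3-) by (induction S) (auto simp: sum_insert fun_pl)

lemma fun_isom [simp]:
  assumes "endo F" "isom C f"
  shows "isom C (Fmor F f)" "Fmor F (iv C f) = iv C (Fmor F f)"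
proof -
  have "Fmor F (iv C f) \<cdot>\<^bsub>C\<^esub> Fmor F f = Fmor F (Idt C (dm C f))" "Fmor F f \<cdot>\<^bsub>C\<^esub> Fmor F (iv C f) = Fmor F (Idt C (cd C f))"
    using assms by (simp_all flip: fun_comp)
  then show "isom C (Fmor F f)" "Fmor F (iv C f) = iv C (Fmor F f)"
    using isomI[of "Fmor F f" "Fmor F (iv C f)"] assms by simp_all
qed

lemma endoI:
  assumes "\<And>X. X \<in> Ob C \<Longrightarrow> Fob F X \<in> Ob C"
    and "\<And>f. arr C f \<Longrightarrow> mor C (Fob F (dm C f)) (Fob F (cd C f)) (Fmor F f)"
    and "\<And>X. X \<in> Ob C \<Longrightarrow> Fmor F (Idt C X) = Idt C (Fob F X)"
    and "\<And>f g. \<lbrakk>arr C f; arr C g; dm C g = cd C f\<rbrakk> \<Longrightarrow> Fmor F (g \<cdot>\<^bsub>C\<^esub> f) = Fmor F g \<cdot>\<^bsub>C\<^esub> Fmor F f"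
    and "\<And>f g. \<lbrakk>arr C f; arr C g; dm C g = dm C f; cd C g = cd C f\<rbrakk> \<Longrightarrow> Fmor F (pl C f g) = pl C (Fmor F f) (Fmor F g)"
    and "\<And>f c. \<lbrakk>arr C f; c \<in> carrier K\<rbrakk> \<Longrightarrow> Fmor F (sc C c f) = sc C c (Fmor F f)"
  shows "endo F"
proof
  show "Fob F X \<in> Ob C" if "X \<in> Ob C" for X using assms(1) that .
  fix X Y f assume "X \<in> Ob C" "Y \<in> Ob C" "f \<in> carrier (Hom C X Y)"
  then have f: "arr C f" "dm C f = X" "cd C f = Y" using morI[of X Y f] by auto
  then show "Fmor F f \<in> carrier (Hom C (Fob F X) (Fob F Y))"
    using assms(2)[OF f(1)] by (auto intro: in_hom)
  show "Fmor F (f \<oplus>\<^bsub>Hom C X Y\<^esub> f') = Fmor F f \<oplus>\<^bsub>Hom C (Fob F X) (Fob F Y)\<^esub> Fmor F f'"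
    if "f' \<in> carrier (Hom C X Y)" for f'
  proof -
    have "arr C f'" "dm C f' = X" "cd C f' = Y"
      using morI[of X Y f'] that \<open>X \<in> Ob C\<close> \<open>Y \<in> Ob C\<close> by auto
    then show ?thesis using f assms(5)[of f f'] assms(2)[of f] assms(2)[of f'] by (simp add: pl_eq)
  qed
  show "Fmor F (c \<odot>\<^bsub>Hom C X Y\<^esub> f) = c \<odot>\<^bsub>Hom C (Fob F X) (Fob F Y)\<^esub> Fmor F f" if "c \<in> carrier K" for c
    using f assms(6)[of f c] assms(2)[of f] that by (simp add: sc_eq)
  fix Z g assume "Z \<in> Ob C" "g \<in> carrier (Hom C Y Z)"
  then have g: "arr C g" "dm C g = Y" "cd C g = Z" using morI[of Y Z g] \<open>Y \<in> Ob C\<close> by auto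
  then show "Fmor F (g \<cdot>\<^bsub>C\<^esub> f) = Fmor F g \<cdot>\<^bsub>C\<^esub> Fmor F f" using f assms(4) by simp
next
  show "Fmor F (Idt C X) = Idt C (Fob F X)" if "X \<in> Ob C" for X using assms(3) that .
qed

lemma endo_fid [simp]: "endo fid"
  by (rule endoI) auto

lemma endo_fcomp [simp]: "\<lbrakk>endo F; endo H\<rbrakk> \<Longrightarrow> endo (fcomp F H)"
  by (rule endoI) (auto simp: fun_pl)

lemma nat_trans_iff:
  assumes "endo F" "endo H"
  shows "nat_trans C C F H \<eta> \<longleftrightarrow>
    (\<forall>X\<in>Ob C. mor C (Fob F X) (Fob H X) (\<eta> X)) \<and>
    (\<forall>f. arr C f \<longrightarrow> Fmor H f \<cdot>\<^bsub>C\<^esub> \<eta> (dm C f) = \<eta> (cd C f) \<cdot>\<^bsub>C\<^esub> Fmor F f)"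
    (is "?L \<longleftrightarrow> ?R")
proof
  assume ?L
  then show ?R using assms unfolding nat_trans_def
    by (metis arr_carrier dm_Ob cd_Ob fun_ob morI)
next
  assume R: ?R
  show ?L unfolding nat_trans_def
  proof (intro conjI ballI)
    show "\<eta> X \<in> carrier (Hom C (Fob F X) (Fob H X))" if "X \<in> Ob C" for X
      using R that by (intro in_hom) auto
    fix X Y f assume "X \<in> Ob C" "Y \<in> Ob C" "f \<in> carrier (Hom C X Y)"
    then have f: "arr C f" "dm C f = X" "cd C f = Y" using morI[of X Y f] by auto
    then show "Fmor H f \<cdot>\<^bsub>C\<^esub> \<eta> X = \<eta> Y \<cdot>\<^bsub>C\<^esub> Fmor F f" using R by blast
  qed
qed

lemma nat_iso_iff:
  assumes "endo F" "endo H"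
  shows "nat_iso C C F H \<eta> \<longleftrightarrow>
    (\<forall>X\<in>Ob C. isom C (\<eta> X) \<and> dm C (\<eta> X) = Fob F X \<and> cd C (\<eta> X) = Fob H X) \<and>
    (\<forall>f. arr C f \<longrightarrow> Fmor H f \<cdot>\<^bsub>C\<^esub> \<eta> (dm C f) = \<eta> (cd C f) \<cdot>\<^bsub>C\<^esub> Fmor F f)"
  unfolding nat_iso_def nat_trans_iff[OF assms] using assms by (auto simp: iso_in_iff)

text \<open>Fully faithful and essentially surjective. In contrast to the existence of a quasi-inverse this
  can be verified and used one morphism at a time.\<close>

definition equi :: "('o, 'm, 'o, 'm, 'w) lfunctor_scheme \<Rightarrow> bool" where
  "equi F \<longleftrightarrow>
    (\<forall>f g. arr C f \<longrightarrow> arr C g \<longrightarrow> dm C f = dm C g \<longrightarrow> cd C f = cd C g \<longrightarrow> Fmor F f = Fmor F g \<longrightarrow> f = g) \<and>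
    (\<forall>X\<in>Ob C. \<forall>Y\<in>Ob C. \<forall>h. mor C (Fob F X) (Fob F Y) h \<longrightarrow> (\<exists>f. mor C X Y f \<and> Fmor F f = h)) \<and>
    (\<forall>X\<in>Ob C. \<exists>Y\<in>Ob C. \<exists>\<theta>. isom C \<theta> \<and> dm C \<theta> = Fob F Y \<and> cd C \<theta> = X)"

lemma equi_faithful: "\<lbrakk>equi F; Fmor F f = Fmor F g; arr C f; arr C g; dm C f = dm C g; cd C f = cd C g\<rbrakk> \<Longrightarrow> f = g"
  unfolding equi_def by blast

lemma equi_full:
  assumes "equi F" "X \<in> Ob C" "Y \<in> Ob C" "arr C h" "dm C h = Fob F X" "cd C h = Fob F Y"
  obtains f where "arr C f" "dm C f = X" "cd C f = Y" "Fmor F f = h"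
proof -
  have "mor C (Fob F X) (Fob F Y) h" using assms by simp
  then have "\<exists>f. mor C X Y f \<and> Fmor F f = h" using assms(1-3) unfolding equi_def by blast
  then show ?thesis using that by auto
qed

text \<open>The preimage of a morphism under a fully faithful functor.\<close>

definition rfl :: "('o, 'm, 'o, 'm, 'w) lfunctor_scheme \<Rightarrow> 'o \<Rightarrow> 'o \<Rightarrow> 'm \<Rightarrow> 'm" where
  "rfl F X Y h = (SOME f. mor C X Y f \<and> Fmor F f = h)"

lemma rfl_mor [simp]:
  assumes "equi F" "X \<in> Ob C" "Y \<in> Ob C" "arr C h" "dm C h = Fob F X" "cd C h = Fob F Y"
  shows "arr C (rfl F X Y h)" "dm C (rfl F X Y h) = X" "cd C (rfl F X Y h) = Y" "Fmor F (rfl F X Y h) = h"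
proof -
  obtain f where "arr C f" "dm C f = X" "cd C f = Y" "Fmor F f = h"
    using equi_full[OF assms] .
  then have "mor C X Y f \<and> Fmor F f = h" by simp
  then have "mor C X Y (rfl F X Y h) \<and> Fmor F (rfl F X Y h) = h"
    unfolding rfl_def by (rule someI)
  then show "arr C (rfl F X Y h)" "dm C (rfl F X Y h) = X" "cd C (rfl F X Y h) = Y" "Fmor F (rfl F X Y h) = h"
    by auto
qed

lemma equi_isom:
  assumes "endo F" "equi F" "arr C f" "isom C (Fmor F f)"
  shows "isom C f"
proof -
  define h where "h = rfl F (cd C f) (dm C f) (iv C (Fmor F f))"
  have h [simp]: "arr C h" "dm C h = cd C f" "cd C h = dm C f" "Fmor F h = iv C (Fmor F f)"
    unfolding h_def using assms by simp_all
  have "h \<cdot>\<^bsub>C\<^esub> f = Idt C (dm C f)" "f \<cdot>\<^bsub>C\<^esub> h = Idt C (cd C f)"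
    by (rule equi_faithful[OF assms(2)]; use assms h in simp)+
  then show ?thesis using isomI(1)[of f h] assms h by simp
qed

text \<open>The quasi-inverse of an essentially surjective and fully faithful functor: chosen preimages of
  objects, the isomorphisms \<open>qth F X : F (qob F X) \<rightarrow> X\<close> that come with them, and the action on
  morphisms which makes these isomorphisms natural.\<close>

definition qob :: "('o, 'm, 'o, 'm, 'w) lfunctor_scheme \<Rightarrow> 'o \<Rightarrow> 'o" where
  "qob F X = (SOME Y. Y \<in> Ob C \<and> (\<exists>\<theta>. isom C \<theta> \<and> dm C \<theta> = Fob F Y \<and> cd C \<theta> = X))"

definition qth :: "('o, 'm, 'o, 'm, 'w) lfunctor_scheme \<Rightarrow> 'o \<Rightarrow> 'm" where
  "qth F X = (SOME \<theta>. isom C \<theta> \<and> dm C \<theta> = Fob F (qob F X) \<and> cd C \<theta> = X)"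

definition qmor :: "('o, 'm, 'o, 'm, 'w) lfunctor_scheme \<Rightarrow> 'm \<Rightarrow> 'm" where
  "qmor F f = rfl F (qob F (dm C f)) (qob F (cd C f)) (iv C (qth F (cd C f)) \<cdot>\<^bsub>C\<^esub> f \<cdot>\<^bsub>C\<^esub> qth F (dm C f))"

lemma qth [simp]:
  assumes "equi F" "X \<in> Ob C"
  shows "qob F X \<in> Ob C" "isom C (qth F X)" "dm C (qth F X) = Fob F (qob F X)" "cd C (qth F X) = X"
proof -
  have 1: "qob F X \<in> Ob C \<and> (\<exists>\<theta>. isom C \<theta> \<and> dm C \<theta> = Fob F (qob F X) \<and> cd C \<theta> = X)"
    unfolding qob_def by (rule someI_ex) (use assms in \<open>unfold equi_def, blast\<close>)
  have "isom C (qth F X) \<and> dm C (qth F X) = Fob F (qob F X) \<and> cd C (qth F X) = X"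
    unfolding qth_def by (rule someI_ex) (use 1 in blast)
  with 1 show "qob F X \<in> Ob C" "isom C (qth F X)" "dm C (qth F X) = Fob F (qob F X)" "cd C (qth F X) = X" by auto
qed

lemma qmor [simp]:
  assumes "endo F" "equi F" "arr C f"
  shows "arr C (qmor F f)" "dm C (qmor F f) = qob F (dm C f)" "cd C (qmor F f) = qob F (cd C f)"
    "Fmor F (qmor F f) = iv C (qth F (cd C f)) \<cdot>\<^bsub>C\<^esub> f \<cdot>\<^bsub>C\<^esub> qth F (dm C f)"
  unfolding qmor_def using assms by simp_all

lemma q_endo:
  assumes "endo F" "equi F" "Fob H = qob F" "Fmor H = qmor F"
  shows "endo H"
  by (rule endoI; (rule equi_faithful[OF assms(2)])?) (use assms in \<open>auto simp: fun_pl comp_pl\<close>)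

lemma q_theta:
  assumes "endo F" "equi F" "Fob H = qob F" "Fmor H = qmor F"
  shows "nat_iso C C (fcomp F H) fid (qth F)"
  using assms q_endo[OF assms] by (subst nat_iso_iff) simp_all

lemma q_eta:
  assumes "endo F" "equi F" "Fob H = qob F" "Fmor H = qmor F"
  shows "\<exists>\<eta>. nat_iso C C (fcomp H F) fid \<eta>"
proof -
  define \<eta> where "\<eta> X = rfl F (qob F (Fob F X)) X (qth F (Fob F X))" for X
  have e [simp]: "arr C (\<eta> X)" "dm C (\<eta> X) = qob F (Fob F X)" "cd C (\<eta> X) = X" "Fmor F (\<eta> X) = qth F (Fob F X)" if "X \<in> Ob C" for X
    unfolding \<eta>_def using assms that by simp_all
  have i [simp]: "isom C (\<eta> X)" if "X \<in> Ob C" for X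
    using equi_isom[OF assms(1,2), of "\<eta> X"] that assms by simp
  have "f \<cdot>\<^bsub>C\<^esub> \<eta> (dm C f) = \<eta> (cd C f) \<cdot>\<^bsub>C\<^esub> qmor F (Fmor F f)" if "arr C f" for f
    by (rule equi_faithful[OF assms(2)]) (use assms that in simp_all)
  then have "nat_iso C C (fcomp H F) fid \<eta>"
    using assms q_endo[OF assms] by (subst nat_iso_iff) simp_all
  then show ?thesis by blast
qed

lemma equivalence_equi:
  assumes "equivalence_functor K C C F"
  shows "endo F" "equi F"
proof -
  obtain H :: "('o, 'm, 'o, 'm) lfunctor" and \<eta> \<theta> where F: "endo F" and H: "endo H"
    and e: "nat_iso C C (fcomp H F) fid \<eta>" and t: "nat_iso C C (fcomp F H) fid \<theta>"
    using assms unfolding equivalence_functor_def by blast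
  show "endo F" by (rule F)
  note F [simp] H [simp]
  have e1 [simp]: "isom C (\<eta> X)" "dm C (\<eta> X) = Fob H (Fob F X)" "cd C (\<eta> X) = X" if "X \<in> Ob C" for X
    using e that by (simp_all add: nat_iso_iff)
  have e2: "f \<cdot>\<^bsub>C\<^esub> \<eta> (dm C f) = \<eta> (cd C f) \<cdot>\<^bsub>C\<^esub> Fmor H (Fmor F f)" if "arr C f" for f
    using e that by (simp add: nat_iso_iff)
  have t1 [simp]: "isom C (\<theta> X)" "dm C (\<theta> X) = Fob F (Fob H X)" "cd C (\<theta> X) = X" if "X \<in> Ob C" for X
    using t that by (simp_all add: nat_iso_iff)
  have t2: "f \<cdot>\<^bsub>C\<^esub> \<theta> (dm C f) = \<theta> (cd C f) \<cdot>\<^bsub>C\<^esub> Fmor F (Fmor H f)" if "arr C f" for f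
    using t that by (simp add: nat_iso_iff)
  show "equi F" unfolding equi_def
  proof (intro conjI allI impI ballI)
    fix f g assume a: "arr C f" "arr C g" "dm C f = dm C g" "cd C f = cd C g" "Fmor F f = Fmor F g"
    then have "f \<cdot>\<^bsub>C\<^esub> \<eta> (dm C g) = g \<cdot>\<^bsub>C\<^esub> \<eta> (dm C g)" using e2[of f] e2[of g] by simp
    then show "f = g" using a by (simp add: iso_cancel_right)
  next
    fix X assume "X \<in> Ob C"
    then show "\<exists>Y\<in>Ob C. \<exists>\<theta>. isom C \<theta> \<and> dm C \<theta> = Fob F Y \<and> cd C \<theta> = X"
      by (intro bexI[of _ "Fob H X"] exI[of _ "\<theta> X"]) simp_all
  next
    fix X Y h assume X: "X \<in> Ob C" "Y \<in> Ob C" and h: "mor C (Fob F X) (Fob F Y) h"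
    then have h': "arr C h" "dm C h = Fob F X" "cd C h = Fob F Y" by auto
    define f where "f = \<eta> Y \<cdot>\<^bsub>C\<^esub> Fmor H h \<cdot>\<^bsub>C\<^esub> iv C (\<eta> X)"
    have f: "arr C f" "dm C f = X" "cd C f = Y" unfolding f_def using h' X by simp_all
    have "f \<cdot>\<^bsub>C\<^esub> \<eta> X = \<eta> Y \<cdot>\<^bsub>C\<^esub> Fmor H h" unfolding f_def using h' X by simp
    then have "\<eta> Y \<cdot>\<^bsub>C\<^esub> Fmor H (Fmor F f) = \<eta> Y \<cdot>\<^bsub>C\<^esub> Fmor H h" using e2[of f] f by simp
    then have HH: "Fmor H (Fmor F f) = Fmor H h" using f h' X by (simp add: iso_cancel_left)
    have "Fmor F f \<cdot>\<^bsub>C\<^esub> \<theta> (Fob F X) = h \<cdot>\<^bsub>C\<^esub> \<theta> (Fob F X)"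
      using t2[of h] t2[of "Fmor F f"] f h' HH by simp
    then have "Fmor F f = h" using f h' X by (simp add: iso_cancel_right)
    then show "\<exists>f. mor C X Y f \<and> Fmor F f = h" using f by auto
  qed
qed

lemma equivalence_iff: "equivalence_functor K C C F \<longleftrightarrow> endo F \<and> equi F"
proof
  assume "equivalence_functor K C C F" then show "endo F \<and> equi F" using equivalence_equi by blast
next
  assume a: "endo F \<and> equi F"
  define H :: "('o, 'm, 'o, 'm) lfunctor" where "H = \<lparr>Fob = qob F, Fmor = qmor F\<rparr>"
  have H: "Fob H = qob F" "Fmor H = qmor F" by (simp_all add: H_def)
  have "endo H" "\<exists>\<eta>. nat_iso C C (fcomp H F) fid \<eta>" "nat_iso C C (fcomp F H) fid (qth F)"
    using q_endo[OF _ _ H] q_eta[OF _ _ H] q_theta[OF _ _ H] a by blast+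
  then show "equivalence_functor K C C F"
    using a unfolding equivalence_functor_def by blast
qed

text \<open>Both properties pass to a one-sided quasi-inverse \<open>H\<close>: as \<open>F H\<close> is isomorphic to the identity,
  \<open>H\<close> is faithful, and the faithfulness of \<open>F\<close> turns this into fullness.\<close>

lemma equi_quasi_inverse:
  assumes "endo F" "equi F" "endo H" "nat_iso C C (fcomp F H) fid \<theta>"
  shows "equi H"
proof -
  have t1 [simp]: "isom C (\<theta> X)" "dm C (\<theta> X) = Fob F (Fob H X)" "cd C (\<theta> X) = X" if "X \<in> Ob C" for X
    using assms that by (simp_all add: nat_iso_iff)
  have t2: "f \<cdot>\<^bsub>C\<^esub> \<theta> (dm C f) = \<theta> (cd C f) \<cdot>\<^bsub>C\<^esub> Fmor F (Fmor H f)" if "arr C f" for f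
    using assms that by (simp add: nat_iso_iff)
  note assms [simp]
  show ?thesis unfolding equi_def
  proof (intro conjI allI impI ballI)
    fix f g assume a: "arr C f" "arr C g" "dm C f = dm C g" "cd C f = cd C g" "Fmor H f = Fmor H g"
    then have "f \<cdot>\<^bsub>C\<^esub> \<theta> (dm C g) = g \<cdot>\<^bsub>C\<^esub> \<theta> (dm C g)" using t2[of f] t2[of g] by simp
    then show "f = g" using a by (simp add: iso_cancel_right)
  next
    fix X assume X: "X \<in> Ob C"
    define e where "e = rfl F (Fob H (Fob F X)) X (\<theta> (Fob F X))"
    have e: "arr C e" "dm C e = Fob H (Fob F X)" "cd C e = X" "Fmor F e = \<theta> (Fob F X)"
      unfolding e_def using X by simp_all
    then have "isom C e" using equi_isom[OF assms(1,2), of e] X by simp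
    with e X show "\<exists>Y\<in>Ob C. \<exists>\<theta>. isom C \<theta> \<and> dm C \<theta> = Fob H Y \<and> cd C \<theta> = X"
      by (intro bexI[of _ "Fob F X"] exI[of _ e]) simp_all
  next
    fix X Y h assume X: "X \<in> Ob C" "Y \<in> Ob C" and h: "mor C (Fob H X) (Fob H Y) h"
    then have h': "arr C h" "dm C h = Fob H X" "cd C h = Fob H Y" by auto
    define f where "f = \<theta> Y \<cdot>\<^bsub>C\<^esub> Fmor F h \<cdot>\<^bsub>C\<^esub> iv C (\<theta> X)"
    have f: "arr C f" "dm C f = X" "cd C f = Y" unfolding f_def using h' X by simp_all
    have "f \<cdot>\<^bsub>C\<^esub> \<theta> X = \<theta> Y \<cdot>\<^bsub>C\<^esub> Fmor F h" unfolding f_def using h' X by simp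
    then have "\<theta> Y \<cdot>\<^bsub>C\<^esub> Fmor F (Fmor H f) = \<theta> Y \<cdot>\<^bsub>C\<^esub> Fmor F h" using t2[of f] f by simp
    then have "Fmor F (Fmor H f) = Fmor F h" using f h' X by (simp add: iso_cancel_left)
    then have "Fmor H f = h" using f h' X equi_faithful[OF assms(2), of "Fmor H f" h] by simp
    then show "\<exists>f. mor C X Y f \<and> Fmor H f = h" using f by auto
  qed
qed

lemma equi_fcomp:
  assumes "endo F" "equi F" "endo H" "equi H"
  shows "equi (fcomp F H)"
  unfolding equi_def
proof (intro conjI allI impI ballI)
  note assms [simp]
  fix f g assume "arr C f" "arr C g" "dm C f = dm C g" "cd C f = cd C g" "Fmor (fcomp F H) f = Fmor (fcomp F H) g"
  then show "f = g" using equi_faithful[OF assms(4), of f g] equi_faithful[OF assms(2), of "Fmor H f" "Fmor H g"] by simp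
next
  note assms [simp]
  fix X assume X: "X \<in> Ob C"
  then show "\<exists>Y\<in>Ob C. \<exists>\<theta>. isom C \<theta> \<and> dm C \<theta> = Fob (fcomp F H) Y \<and> cd C \<theta> = X"
    by (intro bexI[of _ "qob H (qob F X)"] exI[of _ "qth F X \<cdot>\<^bsub>C\<^esub> Fmor F (qth H (qob F X))"]) simp_all
next
  note assms [simp]
  fix X Y h assume X: "X \<in> Ob C" "Y \<in> Ob C" and h: "mor C (Fob (fcomp F H) X) (Fob (fcomp F H) Y) h"
  then show "\<exists>f. mor C X Y f \<and> Fmor (fcomp F H) f = h"
    by (intro exI[of _ "rfl H X Y (rfl F (Fob H X) (Fob H Y) h)"]) simp_all
qed

end

section \<open>Suspended categories and triangle functors\<close>

text \<open>The shape of a triangle, with exactness left open.\<close>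

definition cand :: "('k, 'o, 'm, 'z) pretricat_scheme \<Rightarrow> 'm \<Rightarrow> 'm \<Rightarrow> 'm \<Rightarrow> bool" where
  "cand T u v w \<longleftrightarrow> arr T u \<and> arr T v \<and> arr T w \<and> dm T v = cd T u \<and> dm T w = cd T v \<and> cd T w = Fob (Susp T) (dm T u)"

text \<open>Triangle functors and their isomorphisms make sense for a translation functor and a set of
  triangles that are not subject to any further axiom. The category of equivariant objects is used
  in this form.\<close>

locale susp_category = linear_category K T
  for K :: "('k, 'e) ring_scheme" (structure) and T :: "('k, 'o, 'm, 'z) pretricat_scheme" +
  assumes susp_endo [simp]: "linear_functor K T T (Susp T)"
begin

abbreviation comp_base :: "'m \<Rightarrow> 'm \<Rightarrow> 'm" (infixr "\<bullet>" 75) where "g \<bullet> f \<equiv> g \<cdot>\<^bsub>T\<^esub> f"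
abbreviation Sg :: "'o \<Rightarrow> 'o" where "Sg X \<equiv> Fob (Susp T) X"
abbreviation Sm :: "'m \<Rightarrow> 'm" where "Sm f \<equiv> Fmor (Susp T) f"

lemma triangle_in_iff: "triangle_in T X Y Z u v w \<longleftrightarrow> cand T u v w \<and> dm T u = X \<and> cd T u = Y \<and> cd T v = Z"
proof -
  have "triangle_in T X Y Z u v w \<longleftrightarrow> mor T X Y u \<and> mor T Y Z v \<and> mor T Z (Sg X) w"
    unfolding triangle_in_def mor_def by auto
  then show ?thesis by (auto simp: cand_def)
qed

lemma triangle_functor_iff:
  "triangle_functor K T T F \<longleftrightarrow> endo F \<and>
     (\<forall>X\<in>Ob T. isom T (conn F X) \<and> dm T (conn F X) = Fob F (Sg X) \<and> cd T (conn F X) = Sg (Fob F X)) \<and>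
     (\<forall>f. arr T f \<longrightarrow> Sm (Fmor F f) \<bullet> conn F (dm T f) = conn F (cd T f) \<bullet> Fmor F (Sm f)) \<and>
     (\<forall>u v w. (u, v, w) \<in> Exact T \<longrightarrow> cand T u v w \<longrightarrow> (Fmor F u, Fmor F v, conn F (dm T u) \<bullet> Fmor F w) \<in> Exact T)"
  by (auto simp: triangle_functor_def triangle_functor_axioms_def nat_iso_iff triangle_in_iff)

lemma triangle_functorI:
  assumes "endo F" "\<And>X. X \<in> Ob T \<Longrightarrow> isom T (conn F X)" "\<And>X. X \<in> Ob T \<Longrightarrow> dm T (conn F X) = Fob F (Sg X)"
    "\<And>X. X \<in> Ob T \<Longrightarrow> cd T (conn F X) = Sg (Fob F X)"
    "\<And>f. arr T f \<Longrightarrow> Sm (Fmor F f) \<bullet> conn F (dm T f) = conn F (cd T f) \<bullet> Fmor F (Sm f)"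
    "\<And>u v w. (u, v, w) \<in> Exact T \<Longrightarrow> cand T u v w \<Longrightarrow> (Fmor F u, Fmor F v, conn F (dm T u) \<bullet> Fmor F w) \<in> Exact T"
  shows "triangle_functor K T T F"
  using assms by (simp add: triangle_functor_iff)

lemma tfun_exact:
  "\<lbrakk>triangle_functor K T T F; (u, v, w) \<in> Exact T; cand T u v w\<rbrakk> \<Longrightarrow> (Fmor F u, Fmor F v, conn F (dm T u) \<bullet> Fmor F w) \<in> Exact T"
  by (simp add: triangle_functor_iff)

lemma tfun_endo [simp]: "triangle_functor K T T F \<Longrightarrow> endo F"
  by (simp add: triangle_functor_iff)

lemma tfun_conn [simp]:
  assumes "triangle_functor K T T F" "X \<in> Ob T"
  shows "isom T (conn F X)" "dm T (conn F X) = Fob F (Sg X)" "cd T (conn F X) = Sg (Fob F X)"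
  using assms by (simp_all add: triangle_functor_iff)

lemma tfun_nat:
  assumes "triangle_functor K T T F" "arr T f" "dm T f = X"
  shows "Sm (Fmor F f) \<bullet> conn F X = conn F (cd T f) \<bullet> Fmor F (Sm f)"
    "arr T k \<Longrightarrow> cd T k = Fob F (Sg X) \<Longrightarrow> Sm (Fmor F f) \<bullet> conn F X \<bullet> k = conn F (cd T f) \<bullet> Fmor F (Sm f) \<bullet> k"
proof -
  show *: "Sm (Fmor F f) \<bullet> conn F X = conn F (cd T f) \<bullet> Fmor F (Sm f)"
    using assms(1,2) unfolding triangle_functor_iff assms(3)[symmetric] by blast
  show "arr T k \<Longrightarrow> cd T k = Fob F (Sg X) \<Longrightarrow> Sm (Fmor F f) \<bullet> conn F X \<bullet> k = conn F (cd T f) \<bullet> Fmor F (Sm f) \<bullet> k"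
    by (rule comp_reassoc[OF *]) (use assms(1,2) in \<open>simp_all add: assms(3)[symmetric]\<close>)
qed

lemma autoeq_iff: "triangle_autoequivalence K T F \<longleftrightarrow> triangle_functor K T T F \<and> equi F"
  by (auto simp: triangle_autoequivalence_def equivalence_iff)

lemma tni_iff:
  assumes "endo F" "endo H"
  shows "tri_nat_iso T T F H \<eta> \<longleftrightarrow>
     (\<forall>X\<in>Ob T. isom T (\<eta> X) \<and> dm T (\<eta> X) = Fob F X \<and> cd T (\<eta> X) = Fob H X) \<and>
     (\<forall>f. arr T f \<longrightarrow> Fmor H f \<bullet> \<eta> (dm T f) = \<eta> (cd T f) \<bullet> Fmor F f) \<and>
     (\<forall>X\<in>Ob T. Sm (\<eta> X) \<bullet> conn F X = conn H X \<bullet> \<eta> (Sg X))"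
  using assms by (auto simp: tri_nat_iso_def nat_iso_iff)

lemma tni_mor:
  assumes "tri_nat_iso T T F H \<eta>" "endo F" "endo H" "X \<in> Ob T"
  shows "isom T (\<eta> X)" "dm T (\<eta> X) = Fob F X" "cd T (\<eta> X) = Fob H X"
  using assms by (simp_all add: tni_iff)

lemma tni_nat:
  assumes "tri_nat_iso T T F H \<eta>" "endo F" "endo H" "arr T f" "dm T f = X"
  shows "Fmor H f \<bullet> \<eta> X = \<eta> (cd T f) \<bullet> Fmor F f"
    "arr T k \<Longrightarrow> cd T k = Fob F X \<Longrightarrow> Fmor H f \<bullet> \<eta> X \<bullet> k = \<eta> (cd T f) \<bullet> Fmor F f \<bullet> k"
proof -
  show *: "Fmor H f \<bullet> \<eta> X = \<eta> (cd T f) \<bullet> Fmor F f"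
    using assms(1,4) unfolding tni_iff[OF assms(2,3)] assms(5)[symmetric] by blast
  show "arr T k \<Longrightarrow> cd T k = Fob F X \<Longrightarrow> Fmor H f \<bullet> \<eta> X \<bullet> k = \<eta> (cd T f) \<bullet> Fmor F f \<bullet> k"
    by (rule comp_reassoc[OF *]) (use assms(1-4) tni_mor[OF assms(1-3)] in \<open>simp_all add: assms(5)[symmetric]\<close>)
qed

lemma tni_conn:
  assumes "tri_nat_iso T T F H \<eta>" "triangle_functor K T T F" "triangle_functor K T T H" "X \<in> Ob T"
  shows "Sm (\<eta> X) \<bullet> conn F X = conn H X \<bullet> \<eta> (Sg X)"
    "arr T k \<Longrightarrow> cd T k = Fob F (Sg X) \<Longrightarrow> Sm (\<eta> X) \<bullet> conn F X \<bullet> k = conn H X \<bullet> \<eta> (Sg X) \<bullet> k"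
proof -
  show *: "Sm (\<eta> X) \<bullet> conn F X = conn H X \<bullet> \<eta> (Sg X)"
    using assms by (simp add: tni_iff)
  show "arr T k \<Longrightarrow> cd T k = Fob F (Sg X) \<Longrightarrow> Sm (\<eta> X) \<bullet> conn F X \<bullet> k = conn H X \<bullet> \<eta> (Sg X) \<bullet> k"
    by (rule comp_reassoc[OF *]) (use assms tni_mor[OF assms(1)] in simp_all)
qed

lemma triangle_tid [simp]: "triangle_functor K T T (tid T)" "equi (tid T)"
proof -
  have e: "endo (tid T)" by (rule endoI) auto
  then show "triangle_functor K T T (tid T)"
    by (rule triangle_functorI) (simp_all add: cand_def)
  have "\<exists>Y\<in>Ob T. \<exists>\<theta>. isom T \<theta> \<and> dm T \<theta> = Y \<and> cd T \<theta> = X" if "X \<in> Ob T" for X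
    using that by (intro bexI[of _ X] exI[of _ "Idt T X"]) simp_all
  then show "equi (tid T)" unfolding equi_def by simp
qed

lemma cand_image:
  assumes "triangle_functor K T T F" "cand T u v w"
  shows "cand T (Fmor F u) (Fmor F v) (conn F (dm T u) \<bullet> Fmor F w)"
  using assms by (simp add: cand_def)

lemma triangle_tcomp [simp]:
  assumes "triangle_functor K T T F" "triangle_functor K T T H"
  shows "triangle_functor K T T (tcomp T F H)"
proof -
  note assms [simp]
  have e: "endo (tcomp T F H)" by (rule endoI) (simp_all add: fun_pl)
  have "(Fmor F (Fmor H u), Fmor F (Fmor H v), (conn F (Fob H (dm T u)) \<bullet> Fmor F (conn H (dm T u))) \<bullet> Fmor F (Fmor H w)) \<in> Exact T"
    if a: "(u, v, w) \<in> Exact T" and c: "cand T u v w" for u v w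
  proof -
    have "(Fmor H u, Fmor H v, conn H (dm T u) \<bullet> Fmor H w) \<in> Exact T"
      using tfun_exact[OF assms(2) a c] .
    then have "(Fmor F (Fmor H u), Fmor F (Fmor H v), conn F (dm T (Fmor H u)) \<bullet> Fmor F (conn H (dm T u) \<bullet> Fmor H w)) \<in> Exact T"
      using tfun_exact[OF assms(1) _ cand_image[OF assms(2) c]] by simp
    then show ?thesis using c by (simp add: cand_def)
  qed
  moreover have "Sm (Fmor F (Fmor H f)) \<bullet> conn F (Fob H (dm T f)) \<bullet> Fmor F (conn H (dm T f)) =
      (conn F (Fob H (cd T f)) \<bullet> Fmor F (conn H (cd T f))) \<bullet> Fmor F (Fmor H (Sm f))" if "arr T f" for f
  proof -
    have "Fmor F (Sm (Fmor H f)) \<bullet> Fmor F (conn H (dm T f)) = Fmor F (conn H (cd T f)) \<bullet> Fmor F (Fmor H (Sm f))"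
      using that tfun_nat(1)[OF assms(2), of f] by (simp flip: fun_comp)
    then show ?thesis using that by (simp add: tfun_nat)
  qed
  ultimately show ?thesis using e by (intro triangle_functorI) simp_all
qed

lemma equi_tcomp [simp]:
  assumes "endo F" "equi F" "endo H" "equi H"
  shows "equi (tcomp T F H)"
  using equi_fcomp[OF assms] by (simp add: equi_def)

text \<open>Functors that agree on objects, morphisms and connecting isomorphisms of \<open>T\<close> are isomorphic by
  identities. Such functors need not be equal as records, whose fields are total functions.\<close>

lemma tni_eq:
  assumes "triangle_functor K T T F" "endo H" "\<And>X. X \<in> Ob T \<Longrightarrow> Fob H X = Fob F X"
    "\<And>f. arr T f \<Longrightarrow> Fmor H f = Fmor F f" "\<And>X. X \<in> Ob T \<Longrightarrow> conn H X = conn F X"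
  shows "tri_nat_iso T T F H (\<lambda>X. Idt T (Fob F X))"
  using assms by (auto simp add: tni_iff)

lemma tni_sym:
  assumes "tri_nat_iso T T F H \<eta>" "triangle_functor K T T F" "triangle_functor K T T H"
  shows "tri_nat_iso T T H F (\<lambda>X. iv T (\<eta> X))"
proof -
  have e [simp]: "isom T (\<eta> X)" "dm T (\<eta> X) = Fob F X" "cd T (\<eta> X) = Fob H X" if "X \<in> Ob T" for X
    using tni_mor[OF assms(1)] that assms(2,3) by auto
  note assms(2,3) [simp]
  have 1: "Fmor F f \<bullet> iv T (\<eta> (dm T f)) = iv T (\<eta> (cd T f)) \<bullet> Fmor H f" if f: "arr T f" for f
  proof -
    have "\<eta> (cd T f) \<bullet> (Fmor F f \<bullet> iv T (\<eta> (dm T f))) = \<eta> (cd T f) \<bullet> (iv T (\<eta> (cd T f)) \<bullet> Fmor H f)"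
      using tni_nat(2)[OF assms(1), of f "dm T f" "iv T (\<eta> (dm T f))"] f by simp
    then show ?thesis using f by (subst (asm) iso_cancel_left) simp_all
  qed
  have 2: "Sm (iv T (\<eta> X)) \<bullet> conn H X = conn F X \<bullet> iv T (\<eta> (Sg X))" if X: "X \<in> Ob T" for X
  proof -
    have "Sm (\<eta> X) \<bullet> (Sm (iv T (\<eta> X)) \<bullet> conn H X) = Sm (\<eta> X) \<bullet> (conn F X \<bullet> iv T (\<eta> (Sg X)))"
      using tni_conn(2)[OF assms X, of "iv T (\<eta> (Sg X))"] X by simp
    then show ?thesis using X by (subst (asm) iso_cancel_left) simp_all
  qed
  from 1 2 show ?thesis by (simp add: tni_iff)
qed

lemma tni_trans:
  assumes "tri_nat_iso T T F H \<eta>" "tri_nat_iso T T H L \<mu>"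
    "triangle_functor K T T F" "triangle_functor K T T H" "triangle_functor K T T L"
  shows "tri_nat_iso T T F L (\<lambda>X. \<mu> X \<bullet> \<eta> X)"
proof -
  note assms(3,4,5) [simp]
  have e [simp]: "isom T (\<eta> X)" "dm T (\<eta> X) = Fob F X" "cd T (\<eta> X) = Fob H X" if "X \<in> Ob T" for X
    using tni_mor[OF assms(1)] that assms(3,4) by auto
  have m [simp]: "isom T (\<mu> X)" "dm T (\<mu> X) = Fob H X" "cd T (\<mu> X) = Fob L X" if "X \<in> Ob T" for X
    using tni_mor[OF assms(2)] that assms(4,5) by auto
  show ?thesis
    by (simp add: tni_iff tni_nat[OF assms(2)] tni_nat[OF assms(1)] tni_conn[OF assms(1)] tni_conn[OF assms(2)])
qed

lemma tni_whisker_left: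
  assumes "tri_nat_iso T T F H \<eta>" "triangle_functor K T T F" "triangle_functor K T T H" "triangle_functor K T T L"
  shows "tri_nat_iso T T (tcomp T L F) (tcomp T L H) (\<lambda>X. Fmor L (\<eta> X))"
proof -
  note assms(2-4) [simp]
  have e [simp]: "isom T (\<eta> X)" "dm T (\<eta> X) = Fob F X" "cd T (\<eta> X) = Fob H X" if "X \<in> Ob T" for X
    using tni_mor[OF assms(1)] that assms(2,3) by auto
  have "Fmor L (Fmor H f) \<bullet> Fmor L (\<eta> (dm T f)) = Fmor L (\<eta> (cd T f)) \<bullet> Fmor L (Fmor F f)" if "arr T f" for f
    using that tni_nat(1)[OF assms(1), of f] by (simp flip: fun_comp)
  moreover have "Fmor L (Sm (\<eta> X)) \<bullet> Fmor L (conn F X) = Fmor L (conn H X) \<bullet> Fmor L (\<eta> (Sg X))" if "X \<in> Ob T" for X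
    using that tni_conn(1)[OF assms(1), of X] by (simp flip: fun_comp)
  ultimately show ?thesis by (simp add: tni_iff tfun_nat)
qed

lemma tni_whisker_right:
  assumes "tri_nat_iso T T F H \<eta>" "triangle_functor K T T F" "triangle_functor K T T H" "triangle_functor K T T L"
  shows "tri_nat_iso T T (tcomp T F L) (tcomp T H L) (\<lambda>X. \<eta> (Fob L X))"
proof -
  note assms(2-4) [simp]
  have e [simp]: "isom T (\<eta> X)" "dm T (\<eta> X) = Fob F X" "cd T (\<eta> X) = Fob H X" if "X \<in> Ob T" for X
    using tni_mor[OF assms(1)] that assms(2,3) by auto
  show ?thesis
    by (simp add: tni_iff tni_nat[OF assms(1)] tni_conn[OF assms(1)])
qed

end

context pretriangulated_category
begin

lemma susp_category_pretriangulated: "susp_category K T"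
proof (intro susp_category.intro susp_category_axioms.intro)
  show "linear_category K T" by (rule linear_category_axioms)
  show "linear_functor K T T (Susp T)" by (rule equivalence_equi(1)[OF susp_equivalence])
qed

end

sublocale pretriangulated_category \<subseteq> susp_category K T
  by (rule susp_category_pretriangulated)

section \<open>Exact triangles\<close>

context linear_category
begin

text \<open>The sign of the rotation axiom is written as multiplication by the scalar \<open>-1\<close>, so that it
  commutes with composition and with linear functors by rules that hold for every scalar.\<close>

lemma neg_sc: "\<lbrakk>arr C f; dm C f = X; cd C f = Y\<rbrakk> \<Longrightarrow> \<ominus>\<^bsub>Hom C X Y\<^esub> f = sc C (\<ominus> \<one>) f"
proof -
  assume f: "arr C f" "dm C f = X" "cd C f = Y"
  interpret H: module K "Hom C X Y" using f by (auto intro: hom_module)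
  show ?thesis using H.smult_l_minus[of \<one> f] in_hom[OF f] f by (simp add: sc_eq)
qed

lemma neg_one: "\<ominus> \<one> \<otimes> \<ominus> \<one> = \<one>"
  by (simp add: l_minus)

lemma sc_neg_cancel: "\<lbrakk>sc C (\<ominus> \<one>) f = sc C (\<ominus> \<one>) g; arr C f; arr C g\<rbrakk> \<Longrightarrow> f = g"
proof -
  assume *: "sc C (\<ominus> \<one>) f = sc C (\<ominus> \<one>) g" "arr C f" "arr C g"
  then have "sc C (\<ominus> \<one>) (sc C (\<ominus> \<one>) f) = sc C (\<ominus> \<one>) (sc C (\<ominus> \<one>) g)" by simp
  then show ?thesis using *(2,3) by (simp add: neg_one)
qed

end

context pretriangulated_category
begin

lemma susp_equi [simp]: "equi (Susp T)"
  by (rule equivalence_equi(2)[OF susp_equivalence])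

lemma exact_cand: "(u, v, w) \<in> Exact T \<Longrightarrow> cand T u v w"
  using exact_triangle triangle_in_iff by blast

lemma exact_transport:
  assumes "(u, v, w) \<in> Exact T" "cand T u' v' w'" "isom T a" "isom T b" "isom T c"
    "dm T a = dm T u" "cd T a = dm T u'" "dm T b = cd T u" "cd T b = cd T u'" "dm T c = cd T v" "cd T c = cd T v'"
    "b \<bullet> u = u' \<bullet> a" "c \<bullet> v = v' \<bullet> b" "Sm a \<bullet> w = w' \<bullet> c"
  shows "(u', v', w') \<in> Exact T"
proof -
  have *: "cand T u v w" using assms(1) by (rule exact_cand)
  note c = * assms(2)
  show ?thesis
    by (rule exact_iso[of u v w "dm T u" "cd T u" "cd T v" "dm T u'" "cd T u'" "cd T v'" u' v' w' a b c])
      (use assms c in \<open>simp_all add: triangle_in_iff iso_in_iff cand_def\<close>)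
qed

lemma exact_fill_in:
  assumes "(u, v, w) \<in> Exact T" "(u', v', w') \<in> Exact T" "arr T a" "arr T b"
    "dm T a = dm T u" "cd T a = dm T u'" "dm T b = cd T u" "cd T b = cd T u'" "b \<bullet> u = u' \<bullet> a"
  obtains c where "arr T c" "dm T c = cd T v" "cd T c = cd T v'" "c \<bullet> v = v' \<bullet> b" "Sm a \<bullet> w = w' \<bullet> c"
proof -
  note c = exact_cand[OF assms(1)] exact_cand[OF assms(2)]
  have "a \<in> carrier (Hom T (dm T u) (dm T u'))" "b \<in> carrier (Hom T (cd T u) (cd T u'))"
    using assms by (simp_all add: in_hom)
  then obtain d where d: "d \<in> carrier (Hom T (cd T v) (cd T v'))" "d \<bullet> v = v' \<bullet> b" "Sm a \<bullet> w = w' \<bullet> d"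
    using exact_fill[of u v w "dm T u" "cd T u" "cd T v" u' v' w' "dm T u'" "cd T u'" "cd T v'" a b]
      assms c by (auto simp: triangle_in_iff)
  have "mor T (cd T v) (cd T v') d"
    by (rule morI[OF _ _ d(1)]) (use c in \<open>simp_all add: cand_def\<close>)
  then show ?thesis by (intro that[of d] d) simp_all
qed

lemma exact_rotate_left:
  assumes "(u, v, w) \<in> Exact T" shows "(v, w, sc T (\<ominus> \<one>) (Sm u)) \<in> Exact T"
proof -
  note c = exact_cand[OF assms]
  have "\<ominus>\<^bsub>Hom T (Sg (dm T u)) (Sg (cd T u))\<^esub> Sm u = sc T (\<ominus> \<one>) (Sm u)"
    using c by (intro neg_sc) (simp_all add: cand_def)
  moreover have "triangle_in T (dm T u) (cd T u) (cd T v) u v w" using c by (simp add: triangle_in_iff)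
  ultimately show ?thesis using exact_rotate assms by simp
qed

text \<open>In the morphism of triangles from \<open>X \<rightarrow> X \<rightarrow> 0 \<rightarrow> \<Sigma>X\<close> to the given one that starts with \<open>id\<close> and \<open>u\<close>,
  the composite \<open>v u\<close> factors through the zero object.\<close>

lemma exact_comp_zero:
  assumes "(u, v, w) \<in> Exact T" shows "v \<bullet> u = \<zero>\<^bsub>Hom T (dm T u) (cd T v)\<^esub>"
proof -
  note c = exact_cand[OF assms, unfolded cand_def]
  obtain O' where O: "zero_object T O'" using zero_object_exists by blast
  then have [simp]: "O' \<in> Ob T" by (simp add: zero_object_def)
  have e: "(Idt T (dm T u), \<zero>\<^bsub>Hom T (dm T u) O'\<^esub>, \<zero>\<^bsub>Hom T O' (Sg (dm T u))\<^esub>) \<in> Exact T"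
    using c O by (intro exact_idt) simp_all
  obtain d where "arr T d" "dm T d = O'" "cd T d = cd T v" "d \<bullet> \<zero>\<^bsub>Hom T (dm T u) O'\<^esub> = v \<bullet> u"
    using exact_fill_in[OF e assms, of "Idt T (dm T u)" u] c by auto
  then show ?thesis using c by (metis comp_zero dm_Ob)
qed

text \<open>Exactness of \<open>Hom(W, -)\<close>. The rotated triangle \<open>W \<rightarrow> 0 \<rightarrow> \<Sigma>W \<rightarrow> \<Sigma>W\<close> maps to the rotation of the
  given one, starting with \<open>x\<close> and \<open>0\<close>; the third component is the suspension of the lift.\<close>

lemma exact_lift1:
  assumes "(u, v, w) \<in> Exact T" "arr T x" "cd T x = cd T u" "v \<bullet> x = \<zero>\<^bsub>Hom T (dm T x) (cd T v)\<^esub>"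
  obtains y where "arr T y" "dm T y = dm T x" "cd T y = dm T u" "u \<bullet> y = x"
proof -
  note c = exact_cand[OF assms(1), unfolded cand_def]
  obtain O' where O: "zero_object T O'" using zero_object_exists by blast
  then have [simp]: "O' \<in> Ob T" by (simp add: zero_object_def)
  let ?W = "dm T x"
  have W [simp]: "?W \<in> Ob T" using assms by simp
  have "(Idt T ?W, \<zero>\<^bsub>Hom T ?W O'\<^esub>, \<zero>\<^bsub>Hom T O' (Sg ?W)\<^esub>) \<in> Exact T"
    using O by (intro exact_idt) simp_all
  then have e: "(\<zero>\<^bsub>Hom T ?W O'\<^esub>, \<zero>\<^bsub>Hom T O' (Sg ?W)\<^esub>, sc T (\<ominus> \<one>) (Sm (Idt T ?W))) \<in> Exact T"
    by (rule exact_rotate_left)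
  obtain d where d: "arr T d" "dm T d = Sg ?W" "cd T d = Sg (dm T u)"
      "Sm x \<bullet> sc T (\<ominus> \<one>) (Sm (Idt T ?W)) = sc T (\<ominus> \<one>) (Sm u) \<bullet> d"
    using exact_fill_in[OF e exact_rotate_left[OF assms(1)], of x "\<zero>\<^bsub>Hom T O' (cd T v)\<^esub>"] c assms by auto
  obtain y where y: "arr T y" "dm T y = ?W" "cd T y = dm T u" "Sm y = d"
    using equi_full[OF susp_equi, of ?W "dm T u" d] d c by auto
  have "sc T (\<ominus> \<one>) (Sm x) = sc T (\<ominus> \<one>) (Sm (u \<bullet> y))"
    using d y c assms by simp
  then have "Sm x = Sm (u \<bullet> y)" by (rule sc_neg_cancel) (use c y d assms in simp_all)
  then have "x = u \<bullet> y" by (rule equi_faithful[OF susp_equi]) (use c y assms in simp_all)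
  then show ?thesis using that y by simp
qed

lemma exact_lift2:
  assumes "(u, v, w) \<in> Exact T" "arr T x" "cd T x = cd T v" "w \<bullet> x = \<zero>\<^bsub>Hom T (dm T x) (Sg (dm T u))\<^esub>"
  obtains y where "arr T y" "dm T y = dm T x" "cd T y = cd T u" "v \<bullet> y = x"
  using exact_lift1[OF exact_rotate_left[OF assms(1)], of x] assms exact_cand[OF assms(1), unfolded cand_def]
  by auto

lemma exact_lift3:
  assumes "(u, v, w) \<in> Exact T" "arr T x" "cd T x = Sg (dm T u)" "Sm u \<bullet> x = \<zero>\<^bsub>Hom T (dm T x) (Sg (cd T u))\<^esub>"
  obtains y where "arr T y" "dm T y = dm T x" "cd T y = cd T v" "w \<bullet> y = x"
  using exact_lift2[OF exact_rotate_left[OF assms(1)], of x] assms exact_cand[OF assms(1), unfolded cand_def]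
  by auto

lemma exact_susp_comp_zero:
  assumes "(u, v, w) \<in> Exact T" shows "Sm u \<bullet> w = \<zero>\<^bsub>Hom T (cd T v) (Sg (cd T u))\<^esub>"
proof -
  note c = exact_cand[OF assms, unfolded cand_def]
  have "sc T (\<ominus> \<one>) (Sm u) \<bullet> w = \<zero>\<^bsub>Hom T (cd T v) (Sg (cd T u))\<^esub>"
    using exact_comp_zero[OF exact_rotate_left[OF exact_rotate_left[OF assms]]] c by simp
  then have "sc T (\<ominus> \<one>) (Sm u \<bullet> w) = sc T (\<ominus> \<one>) \<zero>\<^bsub>Hom T (cd T v) (Sg (cd T u))\<^esub>"
    using c by simp
  then show ?thesis by (rule sc_neg_cancel) (use c in simp_all)
qed

text \<open>A form of the five lemma on which all proofs of exactness rest. If a candidate \<open>(u, v, w)\<close> has the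
  lifting properties of an exact triangle, then a comparison \<open>d\<close> with a cone \<open>(u, v', w')\<close> is injective
  and surjective on generalised elements: it is invertible, and the candidate is isomorphic to an
  exact triangle.\<close>

lemma exact_by_comparison:
  assumes c: "cand T u v w" and e: "(u, v', w') \<in> Exact T"
    and d: "arr T d" "dm T d = cd T v" "cd T d = cd T v'" "d \<bullet> v = v'" "w' \<bullet> d = w"
    and l2: "\<And>x. \<lbrakk>arr T x; cd T x = cd T v; w \<bullet> x = \<zero>\<^bsub>Hom T (dm T x) (Sg (dm T u))\<^esub>\<rbrakk>
        \<Longrightarrow> \<exists>y. arr T y \<and> dm T y = dm T x \<and> cd T y = cd T u \<and> v \<bullet> y = x"
    and z: "v \<bullet> u = \<zero>\<^bsub>Hom T (dm T u) (cd T v)\<^esub>"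
    and l3: "\<And>x. \<lbrakk>arr T x; cd T x = Sg (dm T u); Sm u \<bullet> x = \<zero>\<^bsub>Hom T (dm T x) (Sg (cd T u))\<^esub>\<rbrakk>
        \<Longrightarrow> \<exists>y. arr T y \<and> dm T y = dm T x \<and> cd T y = cd T v \<and> w \<bullet> y = x"
  shows "(u, v, w) \<in> Exact T"
proof -
  note c1 = c[unfolded cand_def] and c2 = exact_cand[OF e, unfolded cand_def]
  have inj: "x = \<zero>\<^bsub>Hom T (dm T x) (cd T v)\<^esub>"
    if x: "arr T x" "cd T x = cd T v" "d \<bullet> x = \<zero>\<^bsub>Hom T (dm T x) (cd T v')\<^esub>" for x
  proof -
    have "w \<bullet> x = w' \<bullet> d \<bullet> x" using d x c1 c2 by (metis assoc)
    then have "w \<bullet> x = \<zero>\<^bsub>Hom T (dm T x) (Sg (dm T u))\<^esub>" using x c2 by simp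
    then obtain y where y: "arr T y" "dm T y = dm T x" "cd T y = cd T u" "v \<bullet> y = x"
      using l2 x by blast
    have "v' \<bullet> y = d \<bullet> v \<bullet> y" using d y c1 c2 by (metis assoc)
    then have "v' \<bullet> y = \<zero>\<^bsub>Hom T (dm T y) (cd T v')\<^esub>" using y x by simp
    then obtain t where t: "arr T t" "dm T t = dm T y" "cd T t = dm T u" "u \<bullet> t = y"
      using exact_lift1[OF e, of y] y by blast
    have "x = (v \<bullet> u) \<bullet> t" using t y c1 by simp
    then show ?thesis using z t y c1 by simp
  qed
  have surj: "\<exists>y. arr T y \<and> dm T y = dm T x \<and> cd T y = cd T v \<and> d \<bullet> y = x"
    if x: "arr T x" "cd T x = cd T v'" for x
  proof -
    have "Sm u \<bullet> w' \<bullet> x = (Sm u \<bullet> w') \<bullet> x" using x c2 by simp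
    then have "Sm u \<bullet> w' \<bullet> x = \<zero>\<^bsub>Hom T (dm T x) (Sg (cd T u))\<^esub>"
      using x c1 c2 exact_susp_comp_zero[OF e] by simp
    then obtain y where y: "arr T y" "dm T y = dm T x" "cd T y = cd T v" "w \<bullet> y = w' \<bullet> x"
      using l3[of "w' \<bullet> x"] x c2 by auto
    obtain t where t: "mor T (dm T x) (cd T v') t" "pl T t (d \<bullet> y) = x"
      using diff_exists[of x "d \<bullet> y"] d y x by auto
    have "pl T (w' \<bullet> t) (w' \<bullet> d \<bullet> y) = w' \<bullet> x"
      using t d y x c2 by (simp add: comp_pl(1)[symmetric])
    moreover have "w' \<bullet> d \<bullet> y = w' \<bullet> x" using y d x c1 c2 by (metis assoc)
    ultimately have "pl T (w' \<bullet> t) (w' \<bullet> x) = pl T \<zero>\<^bsub>Hom T (dm T x) (cd T w')\<^esub> (w' \<bullet> x)"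
      using c2 x by simp
    then have "w' \<bullet> t = \<zero>\<^bsub>Hom T (dm T x) (cd T w')\<^esub>"
      by (rule pl_cancel) (use c2 x t in simp_all)
    then obtain s where s: "arr T s" "dm T s = dm T x" "cd T s = cd T u" "v' \<bullet> s = t"
      using exact_lift2[OF e, of t] t c2 by auto
    have "t = d \<bullet> v \<bullet> s" using d s c1 by (metis assoc)
    then have "d \<bullet> pl T (v \<bullet> s) y = x" using t s y d c1 by (simp add: comp_pl)
    then show ?thesis using s y c1 by (intro exI[of _ "pl T (v \<bullet> s) y"]) simp
  qed
  obtain r where r: "arr T r" "dm T r = cd T v'" "cd T r = cd T v" "d \<bullet> r = Idt T (cd T v')"
    using surj[of "Idt T (cd T v')"] c2 by auto
  have "r \<bullet> d = Idt T (cd T v)"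
  proof -
    obtain s where s: "mor T (cd T v) (cd T v) s" "pl T s (Idt T (cd T v)) = r \<bullet> d"
      "s = \<zero>\<^bsub>Hom T (cd T v) (cd T v)\<^esub> \<Longrightarrow> r \<bullet> d = Idt T (cd T v)"
      using diff_exists[of "r \<bullet> d" "Idt T (cd T v)"] r d c1 by auto
    have "pl T (d \<bullet> s) d = d \<bullet> pl T s (Idt T (cd T v))" using s(1) d c1 by (simp add: comp_pl)
    also have "\<dots> = d \<bullet> r \<bullet> d" using s(2) by simp
    also have "\<dots> = (d \<bullet> r) \<bullet> d" using r(1-3) d(1-3) by simp
    also have "\<dots> = d" using r(4) d(1-3) by (simp del: assoc)
    also have "\<dots> = pl T \<zero>\<^bsub>Hom T (cd T v) (cd T v')\<^esub> d" using r d by simp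
    finally have "d \<bullet> s = \<zero>\<^bsub>Hom T (cd T v) (cd T v')\<^esub>"
      by (rule pl_cancel) (use s d c1 c2 in simp_all)
    then show ?thesis using inj[of s] s by simp
  qed
  then have i: "isom T d" "iv T d = r" using isomI[of d r] r d by simp_all
  show ?thesis
  proof (rule exact_transport[OF e c, of "Idt T (dm T u)" "Idt T (cd T u)" "iv T d"])
    have "iv T d \<bullet> d \<bullet> v = v" using i(1) d(1-3) c1 by simp
    then show "iv T d \<bullet> v' = v \<bullet> Idt T (cd T u)" unfolding d(4) using c1 by simp
    have "(w' \<bullet> d) \<bullet> iv T d = w'" using i(1) d(1-3) c2 by simp
    then show "Sm (Idt T (dm T u)) \<bullet> w' = w \<bullet> iv T d" unfolding d(5) using c1 c2 by simp
  qed (use i(1) d c1 c2 in simp_all)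
qed

text \<open>A retract of a finite direct sum of exact triangles is exact. The inclusions \<open>i\<close> and projections
  \<open>p\<close> are morphisms of triangles with \<open>\<Sum> i p = id\<close>; the fillers from the summands into a cone of \<open>u\<close>
  add up to a comparison map, and the lifting properties hold because they hold for each summand.
  A family with one member is the case of a retract.\<close>

lemma exact_of_family:
  assumes S: "finite S" and c: "cand T u v w"
    and e: "\<And>h. h \<in> S \<Longrightarrow> (U h, V h, W h) \<in> Exact T"
    and i1: "\<And>h. h \<in> S \<Longrightarrow> mor T (dm T (U h)) (dm T u) (i1 h)"
    and i2: "\<And>h. h \<in> S \<Longrightarrow> mor T (cd T (U h)) (cd T u) (i2 h)"
    and i3: "\<And>h. h \<in> S \<Longrightarrow> mor T (cd T (V h)) (cd T v) (i3 h)"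
    and p1: "\<And>h. h \<in> S \<Longrightarrow> mor T (dm T u) (dm T (U h)) (p1 h)"
    and p2: "\<And>h. h \<in> S \<Longrightarrow> mor T (cd T u) (cd T (U h)) (p2 h)"
    and p3: "\<And>h. h \<in> S \<Longrightarrow> mor T (cd T v) (cd T (V h)) (p3 h)"
    and ui: "\<And>h. h \<in> S \<Longrightarrow> u \<bullet> i1 h = i2 h \<bullet> U h"
    and vi: "\<And>h. h \<in> S \<Longrightarrow> v \<bullet> i2 h = i3 h \<bullet> V h"
    and wi: "\<And>h. h \<in> S \<Longrightarrow> w \<bullet> i3 h = Sm (i1 h) \<bullet> W h"
    and up: "\<And>h. h \<in> S \<Longrightarrow> U h \<bullet> p1 h = p2 h \<bullet> u"
    and vp: "\<And>h. h \<in> S \<Longrightarrow> V h \<bullet> p2 h = p3 h \<bullet> v"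
    and wp: "\<And>h. h \<in> S \<Longrightarrow> W h \<bullet> p3 h = Sm (p1 h) \<bullet> w"
    and s1: "finsum (Hom T (dm T u) (dm T u)) (\<lambda>h. i1 h \<bullet> p1 h) S = Idt T (dm T u)"
    and s2: "finsum (Hom T (cd T u) (cd T u)) (\<lambda>h. i2 h \<bullet> p2 h) S = Idt T (cd T u)"
    and s3: "finsum (Hom T (cd T v) (cd T v)) (\<lambda>h. i3 h \<bullet> p3 h) S = Idt T (cd T v)"
  shows "(u, v, w) \<in> Exact T"
proof -
  note c1 = c[unfolded cand_def]
  note ch = e[THEN exact_cand, unfolded cand_def]
  note m = i1[unfolded mor_iff] i2[unfolded mor_iff] i3[unfolded mor_iff] p1[unfolded mor_iff] p2[unfolded mor_iff] p3[unfolded mor_iff]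
  obtain Z v' w' where "triangle_in T (dm T u) (cd T u) Z u v' w'" and e': "(u, v', w') \<in> Exact T"
    using exact_cone[of "dm T u" "cd T u" u] c1 by (auto simp: in_hom)
  note c2 = exact_cand[OF e', unfolded cand_def]
  have "\<exists>d. mor T (cd T (V h)) (cd T v') d \<and> d \<bullet> V h = v' \<bullet> i2 h \<and> Sm (i1 h) \<bullet> W h = w' \<bullet> d" if "h \<in> S" for h
    using exact_fill_in[OF e[OF that] e', of "i1 h" "i2 h"] m[OF that] ui[OF that] by auto
  then obtain d where d: "\<And>h. h \<in> S \<Longrightarrow> mor T (cd T (V h)) (cd T v') (d h)"
    and dv: "\<And>h. h \<in> S \<Longrightarrow> d h \<bullet> V h = v' \<bullet> i2 h" and dw: "\<And>h. h \<in> S \<Longrightarrow> Sm (i1 h) \<bullet> W h = w' \<bullet> d h"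
    by metis
  note d1 = d[unfolded mor_iff]
  \<comment> \<open>the fillers \<open>d h\<close> assembled to a comparison map into the cone of \<open>u\<close>\<close>
  define D where "D = finsum (Hom T (cd T v) (cd T v')) (\<lambda>h. d h \<bullet> p3 h) S"
  have D: "arr T D" "dm T D = cd T v" "cd T D = cd T v'"
    unfolding D_def using c1 c2 m d1 by simp_all
  have Dv: "D \<bullet> v = v'"
  proof -
    have "D \<bullet> v = finsum (Hom T (cd T u) (cd T v')) (\<lambda>h. v' \<bullet> i2 h \<bullet> p2 h) S"
      unfolding D_def using S c1 c2 m d1
    proof (simp, intro finsum_cong_all refl)
      fix h assume h: "h \<in> S"
      have "d h \<bullet> p3 h \<bullet> v = d h \<bullet> V h \<bullet> p2 h" using vp[OF h] by simp
      also have "\<dots> = (d h \<bullet> V h) \<bullet> p2 h" using h ch m d1 by simp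
      finally show "d h \<bullet> p3 h \<bullet> v = v' \<bullet> i2 h \<bullet> p2 h" using dv h m c1 c2 by simp
    qed
    also have "\<dots> = v' \<bullet> finsum (Hom T (cd T u) (cd T u)) (\<lambda>h. i2 h \<bullet> p2 h) S"
      using S c1 c2 m by simp
    finally show ?thesis using s2 c2 by simp
  qed
  have Dw: "w' \<bullet> D = w"
  proof -
    have "w' \<bullet> D = finsum (Hom T (cd T v) (Sg (dm T u))) (\<lambda>h. w \<bullet> i3 h \<bullet> p3 h) S"
      unfolding D_def using S c1 c2 m d1
    proof (simp, intro finsum_cong_all refl)
      fix h assume h: "h \<in> S"
      have "w' \<bullet> d h \<bullet> p3 h = (w' \<bullet> d h) \<bullet> p3 h" using h m d1 c2 by simp
      also have "\<dots> = (w \<bullet> i3 h) \<bullet> p3 h" using dw wi h by simp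
      finally show "w' \<bullet> d h \<bullet> p3 h = w \<bullet> i3 h \<bullet> p3 h" using h m c1 by simp
    qed
    also have "\<dots> = w \<bullet> finsum (Hom T (cd T v) (cd T v)) (\<lambda>h. i3 h \<bullet> p3 h) S"
      using S c1 c2 m by simp
    finally show ?thesis using s3 c1 by simp
  qed
  show ?thesis
  proof (rule exact_by_comparison[OF c e' D Dv Dw])
    fix x assume x: "arr T x" "cd T x = cd T v" "w \<bullet> x = \<zero>\<^bsub>Hom T (dm T x) (Sg (dm T u))\<^esub>"
    have "\<exists>y. mor T (dm T x) (cd T (U h)) y \<and> V h \<bullet> y = p3 h \<bullet> x" if h: "h \<in> S" for h
    proof -
      have "W h \<bullet> p3 h \<bullet> x = (W h \<bullet> p3 h) \<bullet> x" using h x m ch by simp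
      also have "\<dots> = Sm (p1 h) \<bullet> w \<bullet> x" using wp[OF h] h x m c1 by simp
      finally have "W h \<bullet> p3 h \<bullet> x = \<zero>\<^bsub>Hom T (dm T (p3 h \<bullet> x)) (Sg (dm T (U h)))\<^esub>" using x h m by simp
      then show ?thesis
        using exact_lift2[OF e[OF h], of "p3 h \<bullet> x"] x m[OF h] by auto
    qed
    then obtain y where y: "\<And>h. h \<in> S \<Longrightarrow> mor T (dm T x) (cd T (U h)) (y h)" and
      Vy: "\<And>h. h \<in> S \<Longrightarrow> V h \<bullet> y h = p3 h \<bullet> x" by metis
    note y1 = y[unfolded mor_iff]
    have "v \<bullet> finsum (Hom T (dm T x) (cd T u)) (\<lambda>h. i2 h \<bullet> y h) S =
        finsum (Hom T (dm T x) (cd T v)) (\<lambda>h. i3 h \<bullet> p3 h \<bullet> x) S"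
      using S c1 x m y1
    proof (simp, intro finsum_cong_all refl)
      fix h assume h: "h \<in> S"
      have "v \<bullet> i2 h \<bullet> y h = (v \<bullet> i2 h) \<bullet> y h" using h m y1 c1 by simp
      also have "\<dots> = i3 h \<bullet> V h \<bullet> y h" using vi h m y1 ch by simp
      finally show "v \<bullet> i2 h \<bullet> y h = i3 h \<bullet> p3 h \<bullet> x" using Vy h by simp
    qed
    also have "\<dots> = finsum (Hom T (cd T v) (cd T v)) (\<lambda>h. i3 h \<bullet> p3 h) S \<bullet> x"
      using S c1 x m by simp
    finally have "v \<bullet> finsum (Hom T (dm T x) (cd T u)) (\<lambda>h. i2 h \<bullet> y h) S = x"
      using s3 x by simp
    then show "\<exists>y. arr T y \<and> dm T y = dm T x \<and> cd T y = cd T u \<and> v \<bullet> y = x"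
      using x c1 m y1 by (intro exI[of _ "finsum (Hom T (dm T x) (cd T u)) (\<lambda>h. i2 h \<bullet> y h) S"]) simp
  next
    have "p3 h \<bullet> v \<bullet> u = \<zero>\<^bsub>Hom T (dm T u) (cd T (V h))\<^esub>" if h: "h \<in> S" for h
    proof -
      have "p3 h \<bullet> v \<bullet> u = (V h \<bullet> p2 h) \<bullet> u" using h m c1 vp[OF h] by simp
      also have "\<dots> = V h \<bullet> U h \<bullet> p1 h" using h m c1 ch up[OF h] by simp
      also have "\<dots> = (V h \<bullet> U h) \<bullet> p1 h" using h m ch by simp
      finally show ?thesis using exact_comp_zero[OF e[OF h]] h m ch by simp
    qed
    then have "finsum (Hom T (cd T v) (cd T v)) (\<lambda>h. i3 h \<bullet> p3 h) S \<bullet> (v \<bullet> u) = \<zero>\<^bsub>Hom T (dm T u) (cd T v)\<^esub>"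
      using S c1 m by simp
    then show "v \<bullet> u = \<zero>\<^bsub>Hom T (dm T u) (cd T v)\<^esub>" using s3 c1 by simp
  next
    fix x assume x: "arr T x" "cd T x = Sg (dm T u)" "Sm u \<bullet> x = \<zero>\<^bsub>Hom T (dm T x) (Sg (cd T u))\<^esub>"
    have "\<exists>y. mor T (dm T x) (cd T (V h)) y \<and> W h \<bullet> y = Sm (p1 h) \<bullet> x" if h: "h \<in> S" for h
    proof -
      have "Sm (U h) \<bullet> Sm (p1 h) \<bullet> x = Sm (U h \<bullet> p1 h) \<bullet> x" using h x m ch by simp
      also have "\<dots> = Sm (p2 h) \<bullet> Sm u \<bullet> x" using up[OF h] h x m c1 by simp
      finally have "Sm (U h) \<bullet> Sm (p1 h) \<bullet> x = \<zero>\<^bsub>Hom T (dm T (Sm (p1 h) \<bullet> x)) (Sg (cd T (U h)))\<^esub>" using x h m by simp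
      then show ?thesis
        using exact_lift3[OF e[OF h], of "Sm (p1 h) \<bullet> x"] x m[OF h] by auto
    qed
    then obtain y where y: "\<And>h. h \<in> S \<Longrightarrow> mor T (dm T x) (cd T (V h)) (y h)" and
      Wy: "\<And>h. h \<in> S \<Longrightarrow> W h \<bullet> y h = Sm (p1 h) \<bullet> x" by metis
    note y1 = y[unfolded mor_iff]
    have "w \<bullet> finsum (Hom T (dm T x) (cd T v)) (\<lambda>h. i3 h \<bullet> y h) S =
        finsum (Hom T (dm T x) (Sg (dm T u))) (\<lambda>h. Sm (i1 h \<bullet> p1 h) \<bullet> x) S"
      using S c1 x m y1
    proof (simp, intro finsum_cong_all refl)
      fix h assume h: "h \<in> S"
      have "w \<bullet> i3 h \<bullet> y h = (w \<bullet> i3 h) \<bullet> y h" using h m y1 c1 by simp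
      also have "\<dots> = Sm (i1 h) \<bullet> W h \<bullet> y h" using wi h m y1 ch by simp
      finally show "w \<bullet> i3 h \<bullet> y h = Sm (i1 h) \<bullet> Sm (p1 h) \<bullet> x" using Wy h by simp
    qed
    also have "\<dots> = Sm (finsum (Hom T (dm T u) (dm T u)) (\<lambda>h. i1 h \<bullet> p1 h) S) \<bullet> x"
      using S c1 x m by simp
    finally have "w \<bullet> finsum (Hom T (dm T x) (cd T v)) (\<lambda>h. i3 h \<bullet> y h) S = x"
      using s1 x c1 by simp
    then show "\<exists>y. arr T y \<and> dm T y = dm T x \<and> cd T y = cd T v \<and> w \<bullet> y = x"
      using x c1 m y1 by (intro exI[of _ "finsum (Hom T (dm T x) (cd T v)) (\<lambda>h. i3 h \<bullet> y h) S"]) simp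
  qed
qed

text \<open>The comparison of \<open>F u\<close>, \<open>F v\<close>, \<open>F w\<close> with the image of a cone of \<open>u\<close> comes from a morphism in
  the source, as \<open>F\<close> is full, and so do the liftings.\<close>

lemma exact_reflect:
  assumes F: "triangle_functor K T T F" "equi F" and c: "cand T u v w"
    and e: "(Fmor F u, Fmor F v, conn F (dm T u) \<bullet> Fmor F w) \<in> Exact T"
  shows "(u, v, w) \<in> Exact T"
proof -
  note F [simp]
  note c1 = c[unfolded cand_def]
  obtain Z v' w' where "triangle_in T (dm T u) (cd T u) Z u v' w'" and e': "(u, v', w') \<in> Exact T"
    using exact_cone[of "dm T u" "cd T u" u] c1 by (auto simp: in_hom)
  note c2 = exact_cand[OF e', unfolded cand_def]
  have Fe': "(Fmor F u, Fmor F v', conn F (dm T u) \<bullet> Fmor F w') \<in> Exact T"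
    using tfun_exact[OF F(1) e' exact_cand[OF e']] .
  obtain d' where d': "arr T d'" "dm T d' = Fob F (cd T v)" "cd T d' = Fob F (cd T v')"
    "d' \<bullet> Fmor F v = Fmor F v'" "conn F (dm T u) \<bullet> Fmor F w = (conn F (dm T u) \<bullet> Fmor F w') \<bullet> d'"
    using exact_fill_in[OF e Fe', of "Idt T (Fob F (dm T u))" "Idt T (Fob F (cd T u))"] c1 c2 by auto
  obtain d where d: "arr T d" "dm T d = cd T v" "cd T d = cd T v'" "Fmor F d = d'"
    using equi_full[OF F(2), of "cd T v" "cd T v'" d'] d' c1 c2 by auto
  have dv: "d \<bullet> v = v'"
    by (rule equi_faithful[OF F(2)]) (use d d' c1 c2 in simp_all)
  have "conn F (dm T u) \<bullet> Fmor F w = conn F (dm T u) \<bullet> Fmor F (w' \<bullet> d)"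
    using d d' c1 c2 by simp
  then have "Fmor F w = Fmor F (w' \<bullet> d)" using d d' c1 c2 by (subst (asm) iso_cancel_left) simp_all
  then have dw: "w' \<bullet> d = w"
    by (rule equi_faithful[OF F(2), THEN sym]) (use d c1 c2 in simp_all)
  show ?thesis
  proof (rule exact_by_comparison[OF c e' d(1-3) dv dw])
    fix x assume x: "arr T x" "cd T x = cd T v" "w \<bullet> x = \<zero>\<^bsub>Hom T (dm T x) (Sg (dm T u))\<^esub>"
    have "(conn F (dm T u) \<bullet> Fmor F w) \<bullet> Fmor F x = conn F (dm T u) \<bullet> Fmor F (w \<bullet> x)" using x(1,2) c1 by simp
    then obtain y where "arr T y" "dm T y = Fob F (dm T x)" "cd T y = Fob F (cd T u)" "Fmor F v \<bullet> y = Fmor F x"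
      using exact_lift2[OF e, of "Fmor F x"] x c1 by auto
    moreover define t where "t = rfl F (dm T x) (cd T u) y"
    ultimately have t: "arr T t" "dm T t = dm T x" "cd T t = cd T u" "Fmor F (v \<bullet> t) = Fmor F x"
      using x c1 by simp_all
    then have "v \<bullet> t = x" using x c1 equi_faithful[OF F(2), of "v \<bullet> t" x] by simp
    then show "\<exists>y. arr T y \<and> dm T y = dm T x \<and> cd T y = cd T u \<and> v \<bullet> y = x" using t by blast
  next
    have "Fmor F (v \<bullet> u) = Fmor F \<zero>\<^bsub>Hom T (dm T u) (cd T v)\<^esub>"
      using exact_comp_zero[OF e] c1 by simp
    then show "v \<bullet> u = \<zero>\<^bsub>Hom T (dm T u) (cd T v)\<^esub>"
      by (rule equi_faithful[OF F(2)]) (use c1 in simp_all)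
  next
    fix x assume x: "arr T x" "cd T x = Sg (dm T u)" "Sm u \<bullet> x = \<zero>\<^bsub>Hom T (dm T x) (Sg (cd T u))\<^esub>"
    have "Sm (Fmor F u) \<bullet> conn F (dm T u) \<bullet> Fmor F x = conn F (cd T u) \<bullet> Fmor F (Sm u \<bullet> x)"
      using x(1,2) c1 by (simp add: tfun_nat)
    then obtain y where y: "arr T y" "dm T y = Fob F (dm T x)" "cd T y = Fob F (cd T v)"
        "(conn F (dm T u) \<bullet> Fmor F w) \<bullet> y = conn F (dm T u) \<bullet> Fmor F x"
      using exact_lift3[OF e, of "conn F (dm T u) \<bullet> Fmor F x"] x c1 by auto
    then have "conn F (dm T u) \<bullet> (Fmor F w \<bullet> y) = conn F (dm T u) \<bullet> Fmor F x" using c1 by simp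
    then have "Fmor F w \<bullet> y = Fmor F x" using x y c1 by (subst (asm) iso_cancel_left) simp_all
    moreover define t where "t = rfl F (dm T x) (cd T v) y"
    ultimately have t: "arr T t" "dm T t = dm T x" "cd T t = cd T v" "Fmor F (w \<bullet> t) = Fmor F x"
      using x y c1 by simp_all
    then have "w \<bullet> t = x" using x c1 equi_faithful[OF F(2), of "w \<bullet> t" x] by simp
    then show "\<exists>y. arr T y \<and> dm T y = dm T x \<and> cd T y = cd T v \<and> w \<bullet> y = x" using t by blast
  qed
qed

end

section \<open>The group of equivariant autoequivalences\<close>

context susp_category
begin

lemma tni_cong:
  assumes "tri_nat_iso T T F H \<eta>" "triangle_functor K T T F" "triangle_functor K T T H" "endo F'" "endo H'"
    "\<And>X. X \<in> Ob T \<Longrightarrow> Fob F' X = Fob F X" "\<And>f. arr T f \<Longrightarrow> Fmor F' f = Fmor F f" "\<And>X. X \<in> Ob T \<Longrightarrow> conn F' X = conn F X"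
    "\<And>X. X \<in> Ob T \<Longrightarrow> Fob H' X = Fob H X" "\<And>f. arr T f \<Longrightarrow> Fmor H' f = Fmor H f" "\<And>X. X \<in> Ob T \<Longrightarrow> conn H' X = conn H X"
    "\<And>X. X \<in> Ob T \<Longrightarrow> \<eta>' X = \<eta> X"
  shows "tri_nat_iso T T F' H' \<eta>'"
  using assms by (simp add: tni_iff)

text \<open>A quasi-inverse of \<open>F\<close> is known through its composite with \<open>F\<close> only. This lemma transfers
  statements about the composite to the quasi-inverse.\<close>

lemma tni_reflect:
  assumes "triangle_functor K T T F" "equi F" "triangle_functor K T T P" "triangle_functor K T T Q"
    "\<And>X. X \<in> Ob T \<Longrightarrow> mor T (Fob P X) (Fob Q X) (\<eta> X)"
    "tri_nat_iso T T (tcomp T F P) (tcomp T F Q) (\<lambda>X. Fmor F (\<eta> X))"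
  shows "tri_nat_iso T T P Q \<eta>"
proof -
  note [simp] = assms(1-4)
  note e [simp] = assms(5)[unfolded mor_iff]
  have i [simp]: "isom T (\<eta> X)" if X: "X \<in> Ob T" for X
    using equi_isom[OF _ assms(2), of "\<eta> X"] X tni_mor(1)[OF assms(6) _ _ X] by simp
  have "Fmor Q f \<bullet> \<eta> (dm T f) = \<eta> (cd T f) \<bullet> Fmor P f" if f: "arr T f" for f
    by (rule equi_faithful[OF assms(2)]) (use f tni_nat(1)[OF assms(6), of f] in simp_all)
  moreover have "Sm (\<eta> X) \<bullet> conn P X = conn Q X \<bullet> \<eta> (Sg X)" if X: "X \<in> Ob T" for X
  proof -
    have "conn F (Fob Q X) \<bullet> Fmor F (Sm (\<eta> X) \<bullet> conn P X) = conn F (Fob Q X) \<bullet> Fmor F (conn Q X \<bullet> \<eta> (Sg X))"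
      using tni_conn(1)[OF assms(6), of X] X by (simp add: tfun_nat)
    then have "Fmor F (Sm (\<eta> X) \<bullet> conn P X) = Fmor F (conn Q X \<bullet> \<eta> (Sg X))"
      using X by (subst (asm) iso_cancel_left) simp_all
    then show ?thesis by (rule equi_faithful[OF assms(2)]) (use X in simp_all)
  qed
  ultimately show ?thesis by (simp add: tni_iff)
qed

end

text \<open>A group acting on a suspended category. The locale is used twice, for \<open>G\<close> acting on \<open>T\<close> and for the
  dual group acting on the category of equivariant objects.\<close>

locale acted_category = susp_category K T + G: group G + triangle_action K G T A
  for K :: "('k, 'e) ring_scheme" and T :: "('k, 'o, 'm, 'z) pretricat_scheme"
    and G :: "('g, 'h) monoid_scheme" and A :: "('g, 'o, 'm) taction"
begin

lemma act_tfun [simp]: "g \<in> carrier G \<Longrightarrow> triangle_functor K T T (act A g)" "g \<in> carrier G \<Longrightarrow> equi (act A g)"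
  using act_autoequivalence autoeq_iff by auto

lemma coh_mor [simp]:
  assumes "g \<in> carrier G" "h \<in> carrier G" "X \<in> Ob T"
  shows "isom T (coh A g h X)" "dm T (coh A g h X) = Fob (act A g) (Fob (act A h) X)"
    "cd T (coh A g h X) = Fob (act A (g \<otimes>\<^bsub>G\<^esub> h)) X"
  using tni_mor[OF coh_iso[OF assms(1,2)] _ _ assms(3)] assms by simp_all

lemma coh_nat:
  assumes "g \<in> carrier G" "h \<in> carrier G" "arr T f" "dm T f = X"
  shows "Fmor (act A (g \<otimes>\<^bsub>G\<^esub> h)) f \<bullet> coh A g h X = coh A g h (cd T f) \<bullet> Fmor (act A g) (Fmor (act A h) f)"
    "arr T k \<Longrightarrow> cd T k = Fob (act A g) (Fob (act A h) X) \<Longrightarrow>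
     Fmor (act A (g \<otimes>\<^bsub>G\<^esub> h)) f \<bullet> coh A g h X \<bullet> k = coh A g h (cd T f) \<bullet> Fmor (act A g) (Fmor (act A h) f) \<bullet> k"
  using tni_nat[OF coh_iso[OF assms(1,2)] _ _ assms(3,4)] assms(1,2) by simp_all

lemma coh_conn:
  assumes "g \<in> carrier G" "h \<in> carrier G" "X \<in> Ob T"
  shows "Sm (coh A g h X) \<bullet> conn (act A g) (Fob (act A h) X) \<bullet> Fmor (act A g) (conn (act A h) X) =
      conn (act A (g \<otimes>\<^bsub>G\<^esub> h)) X \<bullet> coh A g h (Sg X)"
  using tni_conn(1)[OF coh_iso[OF assms(1,2)] _ _ assms(3)] assms by simp

abbreviation ea :: "('g, 'o, 'm) eqv_functor \<Rightarrow> bool" where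
  "ea \<equiv> eqv_autoequivalence K G T A"

abbreviation ei :: "('g, 'o, 'm) eqv_functor \<Rightarrow> ('g, 'o, 'm) eqv_functor \<Rightarrow> bool" where
  "ei \<equiv> eqv_isomorphic G T A"

lemma ea_tfun: "ea (F, \<delta>) \<Longrightarrow> triangle_functor K T T F" "ea (F, \<delta>) \<Longrightarrow> equi F"
  by (auto simp: eqv_autoequivalence_def autoeq_iff)

lemma ea_tni: "\<lbrakk>ea (F, \<delta>); g \<in> carrier G\<rbrakk> \<Longrightarrow> tri_nat_iso T T (tcomp T F (act A g)) (tcomp T (act A g) F) (\<delta> g)"
  by (auto simp: eqv_autoequivalence_def)

lemma ea_mor:
  assumes "ea (F, \<delta>)" "g \<in> carrier G" "X \<in> Ob T"
  shows "isom T (\<delta> g X)" "dm T (\<delta> g X) = Fob F (Fob (act A g) X)" "cd T (\<delta> g X) = Fob (act A g) (Fob F X)"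
  using tni_mor[OF ea_tni[OF assms(1,2)] _ _ assms(3)] assms(2,3) ea_tfun[OF assms(1)] by simp_all

lemmas ea_simps = ea_tfun ea_mor

lemma ea_nat:
  assumes "ea (F, \<delta>)" "g \<in> carrier G" "arr T f" "dm T f = X"
  shows "Fmor (act A g) (Fmor F f) \<bullet> \<delta> g X = \<delta> g (cd T f) \<bullet> Fmor F (Fmor (act A g) f)"
    "arr T k \<Longrightarrow> cd T k = Fob F (Fob (act A g) X) \<Longrightarrow>
     Fmor (act A g) (Fmor F f) \<bullet> \<delta> g X \<bullet> k = \<delta> g (cd T f) \<bullet> Fmor F (Fmor (act A g) f) \<bullet> k"
  using tni_nat[OF ea_tni[OF assms(1,2)] _ _ assms(3,4)] assms(2) ea_tfun[OF assms(1)] by simp_all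

lemma ea_coh:
  assumes "ea (F, \<delta>)" "g \<in> carrier G" "h \<in> carrier G" "X \<in> Ob T"
  shows "\<delta> (g \<otimes>\<^bsub>G\<^esub> h) X \<bullet> Fmor F (coh A g h X) =
        coh A g h (Fob F X) \<bullet> Fmor (act A g) (\<delta> h X) \<bullet> \<delta> g (Fob (act A h) X)"
    "arr T k \<Longrightarrow> cd T k = Fob F (Fob (act A g) (Fob (act A h) X)) \<Longrightarrow> \<delta> (g \<otimes>\<^bsub>G\<^esub> h) X \<bullet> Fmor F (coh A g h X) \<bullet> k =
        coh A g h (Fob F X) \<bullet> Fmor (act A g) (\<delta> h X) \<bullet> \<delta> g (Fob (act A h) X) \<bullet> k"
proof -
  show *: "\<delta> (g \<otimes>\<^bsub>G\<^esub> h) X \<bullet> Fmor F (coh A g h X) =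
        coh A g h (Fob F X) \<bullet> Fmor (act A g) (\<delta> h X) \<bullet> \<delta> g (Fob (act A h) X)"
    using assms by (auto simp: eqv_autoequivalence_def)
  show "arr T k \<Longrightarrow> cd T k = Fob F (Fob (act A g) (Fob (act A h) X)) \<Longrightarrow> \<delta> (g \<otimes>\<^bsub>G\<^esub> h) X \<bullet> Fmor F (coh A g h X) \<bullet> k =
        coh A g h (Fob F X) \<bullet> Fmor (act A g) (\<delta> h X) \<bullet> \<delta> g (Fob (act A h) X) \<bullet> k"
    using comp_reassoc[OF *, of k] assms(2-4) ea_simps[OF assms(1)] by simp
qed

lemma ea_conn:
  assumes "ea (F, \<delta>)" "g \<in> carrier G" "X \<in> Ob T"
  shows "Sm (\<delta> g X) \<bullet> conn F (Fob (act A g) X) \<bullet> Fmor F (conn (act A g) X) =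
     conn (act A g) (Fob F X) \<bullet> Fmor (act A g) (conn F X) \<bullet> \<delta> g (Sg X)"
  using tni_conn(1)[OF ea_tni[OF assms(1,2)] _ _ assms(3)] assms(2,3) ea_simps[OF assms(1)] by simp

lemma eaI:
  assumes "triangle_functor K T T F" "equi F"
    "\<And>g. g \<in> carrier G \<Longrightarrow> tri_nat_iso T T (tcomp T F (act A g)) (tcomp T (act A g) F) (\<delta> g)"
    "\<And>g h X. \<lbrakk>g \<in> carrier G; h \<in> carrier G; X \<in> Ob T\<rbrakk> \<Longrightarrow> \<delta> (g \<otimes>\<^bsub>G\<^esub> h) X \<bullet> Fmor F (coh A g h X) =
        coh A g h (Fob F X) \<bullet> Fmor (act A g) (\<delta> h X) \<bullet> \<delta> g (Fob (act A h) X)"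
  shows "ea (F, \<delta>)"
  using assms by (simp add: eqv_autoequivalence_def autoeq_iff)

lemma eiI:
  assumes "tri_nat_iso T T F F' \<phi>"
    "\<And>g X. \<lbrakk>g \<in> carrier G; X \<in> Ob T\<rbrakk> \<Longrightarrow> Fmor (act A g) (\<phi> X) \<bullet> \<delta> g X = \<delta>' g X \<bullet> \<phi> (Fob (act A g) X)"
  shows "ei (F, \<delta>) (F', \<delta>')"
  using assms by (auto simp: eqv_isomorphic_def)

lemma eiE:
  assumes "ei (F, \<delta>) (F', \<delta>')"
  obtains \<phi> where "tri_nat_iso T T F F' \<phi>"
    "\<And>g X. \<lbrakk>g \<in> carrier G; X \<in> Ob T\<rbrakk> \<Longrightarrow> Fmor (act A g) (\<phi> X) \<bullet> \<delta> g X = \<delta>' g X \<bullet> \<phi> (Fob (act A g) X)"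
  using assms by (auto simp: eqv_isomorphic_def)

lemma ei_eq:
  assumes xe: "ea (F, \<delta>)" "ea (F', \<delta>')" "\<And>X. X \<in> Ob T \<Longrightarrow> Fob F' X = Fob F X" "\<And>f. arr T f \<Longrightarrow> Fmor F' f = Fmor F f"
    "\<And>X. X \<in> Ob T \<Longrightarrow> conn F' X = conn F X" "\<And>g X. \<lbrakk>g \<in> carrier G; X \<in> Ob T\<rbrakk> \<Longrightarrow> \<delta>' g X = \<delta> g X"
  shows "ei (F, \<delta>) (F', \<delta>')"
proof (rule eiI)
  show "tri_nat_iso T T F F' (\<lambda>X. Idt T (Fob F X))"
    by (rule tni_eq) (use assms ea_tfun[OF xe(1)] ea_tfun[OF xe(2)] in simp_all)
qed (use assms ea_simps[OF xe(1)] ea_simps[OF xe(2)] in simp_all)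

lemma ei_refl: "ea x \<Longrightarrow> ei x x"
  by (cases x) (auto intro: ei_eq)

lemma ei_sym:
  assumes "ei x y" "ea x" "ea y" shows "ei y x"
proof -
  obtain F \<delta> F' \<delta>' where xy [simp]: "x = (F, \<delta>)" "y = (F', \<delta>')" by (metis surj_pair)
  note xe [simp] = assms(2,3)[unfolded xy]
  note [simp] = ea_simps[OF xe(1)] ea_simps[OF xe(2)]
  obtain \<phi> where \<phi>: "tri_nat_iso T T F F' \<phi>"
    "\<And>g X. \<lbrakk>g \<in> carrier G; X \<in> Ob T\<rbrakk> \<Longrightarrow> Fmor (act A g) (\<phi> X) \<bullet> \<delta> g X = \<delta>' g X \<bullet> \<phi> (Fob (act A g) X)"
    using assms(1) by (auto elim: eiE)
  have m [simp]: "isom T (\<phi> X)" "dm T (\<phi> X) = Fob F X" "cd T (\<phi> X) = Fob F' X" if "X \<in> Ob T" for X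
    using tni_mor[OF \<phi>(1) _ _ that] by simp_all
  have "ei (F', \<delta>') (F, \<delta>)"
  proof (rule eiI)
    show "tri_nat_iso T T F' F (\<lambda>X. iv T (\<phi> X))" by (rule tni_sym[OF \<phi>(1)]) simp_all
    fix g X assume g: "g \<in> carrier G" "X \<in> Ob T"
    have "Fmor (act A g) (\<phi> X) \<bullet> Fmor (act A g) (iv T (\<phi> X)) \<bullet> \<delta>' g X =
      Fmor (act A g) (\<phi> X) \<bullet> \<delta> g X \<bullet> iv T (\<phi> (Fob (act A g) X))"
      using g comp_reassoc[OF \<phi>(2)[OF g], of "iv T (\<phi> (Fob (act A g) X))"] by simp
    then show "Fmor (act A g) (iv T (\<phi> X)) \<bullet> \<delta>' g X = \<delta> g X \<bullet> iv T (\<phi> (Fob (act A g) X))"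
      using g by (subst (asm) iso_cancel_left) simp_all
  qed
  then show ?thesis by simp
qed

lemma ei_trans:
  assumes "ei x y" "ei y z" "ea x" "ea y" "ea z" shows "ei x z"
proof -
  obtain F \<delta> F' \<delta>' F'' \<delta>'' where xy [simp]: "x = (F, \<delta>)" "y = (F', \<delta>')" "z = (F'', \<delta>'')" by (metis surj_pair)
  note xe [simp] = assms(3-5)[unfolded xy]
  note [simp] = ea_simps[OF xe(1)] ea_simps[OF xe(2)] ea_simps[OF xe(3)]
  obtain \<phi> where \<phi>: "tri_nat_iso T T F F' \<phi>"
    "\<And>g X. \<lbrakk>g \<in> carrier G; X \<in> Ob T\<rbrakk> \<Longrightarrow> Fmor (act A g) (\<phi> X) \<bullet> \<delta> g X = \<delta>' g X \<bullet> \<phi> (Fob (act A g) X)"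
    using assms(1) by (auto elim: eiE)
  obtain \<psi> where \<psi>: "tri_nat_iso T T F' F'' \<psi>"
    "\<And>g X. \<lbrakk>g \<in> carrier G; X \<in> Ob T\<rbrakk> \<Longrightarrow> Fmor (act A g) (\<psi> X) \<bullet> \<delta>' g X = \<delta>'' g X \<bullet> \<psi> (Fob (act A g) X)"
    using assms(2) by (auto elim: eiE)
  have m [simp]: "isom T (\<phi> X)" "dm T (\<phi> X) = Fob F X" "cd T (\<phi> X) = Fob F' X"
    "isom T (\<psi> X)" "dm T (\<psi> X) = Fob F' X" "cd T (\<psi> X) = Fob F'' X" if "X \<in> Ob T" for X
    using tni_mor[OF \<phi>(1) _ _ that] tni_mor[OF \<psi>(1) _ _ that] by simp_all
  have "ei (F, \<delta>) (F'', \<delta>'')"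
  proof (rule eiI)
    show "tri_nat_iso T T F F'' (\<lambda>X. \<psi> X \<bullet> \<phi> X)" by (rule tni_trans[OF \<phi>(1) \<psi>(1)]) simp_all
    fix g X assume g: "g \<in> carrier G" "X \<in> Ob T"
    show "Fmor (act A g) (\<psi> X \<bullet> \<phi> X) \<bullet> \<delta> g X = \<delta>'' g X \<bullet> \<psi> (Fob (act A g) X) \<bullet> \<phi> (Fob (act A g) X)"
      using g comp_reassoc[OF \<psi>(2)[OF g], of "\<phi> (Fob (act A g) X)"] \<phi>(2)[OF g] by simp
  qed
  then show ?thesis by simp
qed

abbreviation ec :: "('g, 'o, 'm) eqv_functor \<Rightarrow> ('g, 'o, 'm) eqv_functor set" where
  "ec \<equiv> eqv_class K G T A"

lemma ec_self: "ea x \<Longrightarrow> x \<in> ec x"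
  by (simp add: eqv_class_def ei_refl)

lemma ec_D: "y \<in> ec x \<Longrightarrow> ea y" "y \<in> ec x \<Longrightarrow> ei x y"
  by (simp_all add: eqv_class_def)

lemma ec_eq_iff:
  assumes "ea x" "ea y" shows "ec x = ec y \<longleftrightarrow> ei x y"
proof
  assume "ec x = ec y"
  then have "y \<in> ec x" using ec_self assms by blast
  then show "ei x y" by (rule ec_D)
next
  assume *: "ei x y"
  then show "ec x = ec y"
    unfolding eqv_class_def using assms ei_trans ei_sym by blast
qed

lemma ea_one: "ea (eqv_one T A)"
  unfolding eqv_one_def
proof (rule eaI)
  fix g assume "g \<in> carrier G"
  then show "tri_nat_iso T T (tcomp T (tid T) (act A g)) (tcomp T (act A g) (tid T)) (\<lambda>X. Idt T (Fob (act A g) X))"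
    using tni_eq[of "tcomp T (tid T) (act A g)" "tcomp T (act A g) (tid T)"] by simp
qed simp_all

lemma ea_mult:
  assumes "ea x" "ea y" shows "ea (eqv_mult T x y)"
proof -
  obtain F \<delta> F' \<delta>' where xy [simp]: "x = (F, \<delta>)" "y = (F', \<delta>')" by (metis surj_pair)
  note xe [simp] = assms[unfolded xy]
  note [simp] = ea_simps[OF xe(1)] ea_simps[OF xe(2)]
  have "ea (tcomp T F F', \<lambda>g X. \<delta> g (Fob F' X) \<bullet> Fmor F (\<delta>' g X))"
  proof (rule eaI)
    fix g assume g [simp]: "g \<in> carrier G"
    have "tri_nat_iso T T (tcomp T F (tcomp T F' (act A g))) (tcomp T F (tcomp T (act A g) F')) (\<lambda>X. Fmor F (\<delta>' g X))"
      by (rule tni_whisker_left[OF ea_tni]) simp_all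
    moreover have "tri_nat_iso T T (tcomp T (tcomp T F (act A g)) F') (tcomp T (tcomp T (act A g) F) F') (\<lambda>X. \<delta> g (Fob F' X))"
      by (rule tni_whisker_right[OF ea_tni]) simp_all
    then have "tri_nat_iso T T (tcomp T F (tcomp T (act A g) F')) (tcomp T (act A g) (tcomp T F F')) (\<lambda>X. \<delta> g (Fob F' X))"
      by (rule tni_cong) simp_all
    ultimately have "tri_nat_iso T T (tcomp T F (tcomp T F' (act A g))) (tcomp T (act A g) (tcomp T F F'))
        (\<lambda>X. \<delta> g (Fob F' X) \<bullet> Fmor F (\<delta>' g X))"
      by (rule tni_trans) simp_all
    then show "tri_nat_iso T T (tcomp T (tcomp T F F') (act A g)) (tcomp T (act A g) (tcomp T F F'))
        (\<lambda>X. \<delta> g (Fob F' X) \<bullet> Fmor F (\<delta>' g X))"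
      by (rule tni_cong) simp_all
  next
    fix g h X assume g [simp]: "g \<in> carrier G" "h \<in> carrier G" "X \<in> Ob T"
    have "Fmor F (\<delta>' (g \<otimes>\<^bsub>G\<^esub> h) X) \<bullet> Fmor F (Fmor F' (coh A g h X)) =
      Fmor F (coh A g h (Fob F' X)) \<bullet> Fmor F (Fmor (act A g) (\<delta>' h X)) \<bullet> Fmor F (\<delta>' g (Fob (act A h) X))"
      using ea_coh(1)[OF xe(2) g] by (simp flip: fun_comp)
    then show "(\<delta> (g \<otimes>\<^bsub>G\<^esub> h) (Fob F' X) \<bullet> Fmor F (\<delta>' (g \<otimes>\<^bsub>G\<^esub> h) X)) \<bullet> Fmor (tcomp T F F') (coh A g h X) =
       coh A g h (Fob (tcomp T F F') X) \<bullet>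
       Fmor (act A g) (\<delta> h (Fob F' X) \<bullet> Fmor F (\<delta>' h X)) \<bullet> \<delta> g (Fob F' (Fob (act A h) X)) \<bullet> Fmor F (\<delta>' g (Fob (act A h) X))"
      by (simp add: ea_coh[OF xe(1)] ea_nat[OF xe(1)])
  qed simp_all
  then show ?thesis by (simp add: eqv_mult_def)
qed

lemma ei_mult:
  assumes "ei x x'" "ei y y'" "ea x" "ea y" "ea x'" "ea y'"
  shows "ei (eqv_mult T x y) (eqv_mult T x' y')"
proof -
  obtain F \<delta> F' \<delta>' where xy [simp]: "x = (F, \<delta>)" "x' = (F', \<delta>')" by (metis surj_pair)
  obtain H \<epsilon> H' \<epsilon>' where xy' [simp]: "y = (H, \<epsilon>)" "y' = (H', \<epsilon>')" by (metis surj_pair)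
  note xe [simp] = assms(3-6)[unfolded xy xy']
  note [simp] = ea_simps[OF xe(1)] ea_simps[OF xe(2)] ea_simps[OF xe(3)] ea_simps[OF xe(4)]
  obtain \<phi> where \<phi>: "tri_nat_iso T T F F' \<phi>"
    "\<And>g X. \<lbrakk>g \<in> carrier G; X \<in> Ob T\<rbrakk> \<Longrightarrow> Fmor (act A g) (\<phi> X) \<bullet> \<delta> g X = \<delta>' g X \<bullet> \<phi> (Fob (act A g) X)"
    using assms(1) by (auto elim: eiE)
  obtain \<psi> where \<psi>: "tri_nat_iso T T H H' \<psi>"
    "\<And>g X. \<lbrakk>g \<in> carrier G; X \<in> Ob T\<rbrakk> \<Longrightarrow> Fmor (act A g) (\<psi> X) \<bullet> \<epsilon> g X = \<epsilon>' g X \<bullet> \<psi> (Fob (act A g) X)"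
    using assms(2) by (auto elim: eiE)
  have m [simp]: "isom T (\<phi> X)" "dm T (\<phi> X) = Fob F X" "cd T (\<phi> X) = Fob F' X"
    "isom T (\<psi> X)" "dm T (\<psi> X) = Fob H X" "cd T (\<psi> X) = Fob H' X" if "X \<in> Ob T" for X
    using tni_mor[OF \<phi>(1) _ _ that] tni_mor[OF \<psi>(1) _ _ that] by simp_all
  have "ei (tcomp T F H, \<lambda>g X. \<delta> g (Fob H X) \<bullet> Fmor F (\<epsilon> g X)) (tcomp T F' H', \<lambda>g X. \<delta>' g (Fob H' X) \<bullet> Fmor F' (\<epsilon>' g X))"
  proof (rule eiI)
    show "tri_nat_iso T T (tcomp T F H) (tcomp T F' H') (\<lambda>X. \<phi> (Fob H' X) \<bullet> Fmor F (\<psi> X))"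
      by (rule tni_trans[OF tni_whisker_left[OF \<psi>(1)] tni_whisker_right[OF \<phi>(1)]]) simp_all
    fix g X assume g [simp]: "g \<in> carrier G" "X \<in> Ob T"
    have 1: "Fmor F (Fmor (act A g) (\<psi> X)) \<bullet> Fmor F (\<epsilon> g X) = Fmor F (\<epsilon>' g X) \<bullet> Fmor F (\<psi> (Fob (act A g) X))"
      using \<psi>(2)[OF g] by (simp flip: fun_comp)
    have 2: "Fmor (act A g) (\<phi> (Fob H' X)) \<bullet> \<delta> g (Fob H' X) \<bullet> k = \<delta>' g (Fob H' X) \<bullet> \<phi> (Fob (act A g) (Fob H' X)) \<bullet> k"
      if "arr T k" "cd T k = Fob F (Fob (act A g) (Fob H' X))" for k
      using comp_reassoc[OF \<phi>(2)[of g "Fob H' X"], of k] that by simp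
    show "Fmor (act A g) (\<phi> (Fob H' X) \<bullet> Fmor F (\<psi> X)) \<bullet> \<delta> g (Fob H X) \<bullet> Fmor F (\<epsilon> g X) =
           (\<delta>' g (Fob H' X) \<bullet> Fmor F' (\<epsilon>' g X)) \<bullet> \<phi> (Fob H' (Fob (act A g) X)) \<bullet> Fmor F (\<psi> (Fob (act A g) X))"
      by (simp add: ea_nat[OF xe(1)] 1 2 tni_nat[OF \<phi>(1)])
  qed
  then show ?thesis by (simp add: eqv_mult_def)
qed

text \<open>The product of two classes is a union over all representatives; it is the class of the product of
  any two, since isomorphism is a congruence.\<close>

lemma ec_mult:
  assumes "ea x" "ea y"
  shows "ec x \<otimes>\<^bsub>Aut_tri K G T A\<^esub> ec y = ec (eqv_mult T x y)"
proof -
  have "ec (eqv_mult T x' y') = ec (eqv_mult T x y)" if "x' \<in> ec x" "y' \<in> ec y" for x' y'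
    using ec_D[OF that(1)] ec_D[OF that(2)] assms by (metis ec_eq_iff ea_mult ei_mult)
  then have "(\<Union>x'\<in>ec x. \<Union>y'\<in>ec y. ec (eqv_mult T x' y')) = (\<Union>x'\<in>ec x. \<Union>y'\<in>ec y. ec (eqv_mult T x y))"
    by (intro SUP_cong refl)
  moreover have "ec x \<noteq> {}" "ec y \<noteq> {}" using ec_self assms by blast+
  ultimately show ?thesis by (simp add: Aut_tri_def)
qed

lemma Aut_tri_carrier: "c \<in> carrier (Aut_tri K G T A) \<longleftrightarrow> (\<exists>x. c = ec x \<and> ea x)"
  by (auto simp: Aut_tri_def)

lemma mult_assoc_ei:
  assumes "ea x" "ea y" "ea z"
  shows "ei (eqv_mult T (eqv_mult T x y) z) (eqv_mult T x (eqv_mult T y z))"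
proof -
  obtain F \<delta> F' \<delta>' F'' \<delta>'' where xy [simp]: "x = (F, \<delta>)" "y = (F', \<delta>')" "z = (F'', \<delta>'')" by (metis surj_pair)
  note xe [simp] = assms[unfolded xy]
  note [simp] = ea_simps[OF xe(1)] ea_simps[OF xe(2)] ea_simps[OF xe(3)]
  have e: "ea (eqv_mult T (eqv_mult T x y) z)" "ea (eqv_mult T x (eqv_mult T y z))"
    using assms ea_mult by simp_all
  show ?thesis using e unfolding eqv_mult_def xy case_prod_conv
    by (rule ei_eq) simp_all
qed

lemma mult_one_ei:
  assumes "ea x"
  shows "ei (eqv_mult T x (eqv_one T A)) x" "ei (eqv_mult T (eqv_one T A) x) x"
proof -
  obtain F \<delta> where xy [simp]: "x = (F, \<delta>)" by (metis surj_pair)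
  note xe [simp] = assms[unfolded xy]
  note [simp] = ea_simps[OF xe]
  have e: "ea (eqv_mult T x (eqv_one T A))" "ea (eqv_mult T (eqv_one T A) x)" "ea x"
    using assms ea_mult ea_one by simp_all
  show "ei (eqv_mult T x (eqv_one T A)) x" using e(1,3) unfolding eqv_mult_def eqv_one_def xy case_prod_conv
    by (rule ei_eq) simp_all
  show "ei (eqv_mult T (eqv_one T A) x) x" using e(2,3) unfolding eqv_mult_def eqv_one_def xy case_prod_conv
    by (rule ei_eq) simp_all
qed

lemma Aut_monoid: "monoid (Aut_tri K G T A)"
proof (rule monoidI)
  have one: "\<one>\<^bsub>Aut_tri K G T A\<^esub> = ec (eqv_one T A)" by (simp add: Aut_tri_def)
  show "\<one>\<^bsub>Aut_tri K G T A\<^esub> \<in> carrier (Aut_tri K G T A)"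
    unfolding one Aut_tri_carrier using ea_one by blast
  show "x \<otimes>\<^bsub>Aut_tri K G T A\<^esub> y \<in> carrier (Aut_tri K G T A)"
    if "x \<in> carrier (Aut_tri K G T A)" "y \<in> carrier (Aut_tri K G T A)" for x y
    using that unfolding Aut_tri_carrier by (metis ec_mult ea_mult)
  show "x \<otimes>\<^bsub>Aut_tri K G T A\<^esub> y \<otimes>\<^bsub>Aut_tri K G T A\<^esub> z = x \<otimes>\<^bsub>Aut_tri K G T A\<^esub> (y \<otimes>\<^bsub>Aut_tri K G T A\<^esub> z)"
    if "x \<in> carrier (Aut_tri K G T A)" "y \<in> carrier (Aut_tri K G T A)" "z \<in> carrier (Aut_tri K G T A)" for x y z
  proof -
    obtain a b c where "x = ec a" "y = ec b" "z = ec c" "ea a" "ea b" "ea c"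
      using \<open>x \<in> _\<close> \<open>y \<in> _\<close> \<open>z \<in> _\<close> unfolding Aut_tri_carrier by blast
    then show ?thesis using mult_assoc_ei[of a b c] by (simp add: ec_mult ea_mult ec_eq_iff)
  qed
  show "\<one>\<^bsub>Aut_tri K G T A\<^esub> \<otimes>\<^bsub>Aut_tri K G T A\<^esub> x = x" "x \<otimes>\<^bsub>Aut_tri K G T A\<^esub> \<one>\<^bsub>Aut_tri K G T A\<^esub> = x"
    if x: "x \<in> carrier (Aut_tri K G T A)" for x
  proof -
    obtain a where "x = ec a" "ea a" using x unfolding Aut_tri_carrier by blast
    then show "\<one>\<^bsub>Aut_tri K G T A\<^esub> \<otimes>\<^bsub>Aut_tri K G T A\<^esub> x = x" "x \<otimes>\<^bsub>Aut_tri K G T A\<^esub> \<one>\<^bsub>Aut_tri K G T A\<^esub> = x"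
      using mult_one_ei[of a] unfolding one by (simp_all add: ec_mult ea_mult ea_one ec_eq_iff)
  qed
qed

end

locale acted_pretriangulated = pretriangulated_category K T + acted_category K T G A
  for K :: "('k, 'e) ring_scheme" and T :: "('k, 'o, 'm, 'z) pretricat_scheme"
    and G :: "('g, 'h) monoid_scheme" and A :: "('g, 'o, 'm) taction"
begin

text \<open>The quasi-inverse of a triangle autoequivalence. Its connecting isomorphism is the only one for
  which \<open>qth : F (qtf F) \<rightarrow> Id\<close> is an isomorphism of triangle functors.\<close>

definition qtf :: "('o, 'm, 'o, 'm) tfunctor \<Rightarrow> ('o, 'm, 'o, 'm) tfunctor" where
  "qtf F = \<lparr>Fob = qob F, Fmor = qmor F,
    conn = (\<lambda>X. rfl F (qob F (Sg X)) (Sg (qob F X)) (iv T (conn F (qob F X)) \<bullet> Sm (iv T (qth F X)) \<bullet> qth F (Sg X)))\<rparr>"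

lemma qtf_simps [simp]: "Fob (qtf F) X = qob F X" "Fmor (qtf F) f = qmor F f"
  by (simp_all add: qtf_def)

context
  fixes F :: "('o, 'm, 'o, 'm) tfunctor"
  assumes F [simp]: "triangle_functor K T T F" "equi F"
begin

lemma qtf_endo [simp]: "endo (qtf F)"
  by (rule q_endo) (use F in \<open>simp_all add: qtf_def\<close>)

lemma qtf_theta: "nat_iso T T (fcomp F (qtf F)) fid (qth F)"
  by (rule q_theta) (use F in \<open>simp_all add: qtf_def\<close>)

lemma qtf_equi [simp]: "equi (qtf F)"
  by (rule equi_quasi_inverse[OF _ _ _ qtf_theta]) simp_all

lemma qtf_conn [simp]:
  assumes "X \<in> Ob T"
  shows "arr T (conn (qtf F) X)" "dm T (conn (qtf F) X) = qob F (Sg X)" "cd T (conn (qtf F) X) = Sg (qob F X)"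
    "Fmor F (conn (qtf F) X) = iv T (conn F (qob F X)) \<bullet> Sm (iv T (qth F X)) \<bullet> qth F (Sg X)"
    "isom T (conn (qtf F) X)"
proof -
  show *: "arr T (conn (qtf F) X)" "dm T (conn (qtf F) X) = qob F (Sg X)" "cd T (conn (qtf F) X) = Sg (qob F X)"
    "Fmor F (conn (qtf F) X) = iv T (conn F (qob F X)) \<bullet> Sm (iv T (qth F X)) \<bullet> qth F (Sg X)"
    unfolding qtf_def using assms by simp_all
  show "isom T (conn (qtf F) X)"
    by (rule equi_isom[OF _ F(2)]) (use * assms in simp_all)
qed

text \<open>After applying \<open>F\<close>, the image of an exact triangle becomes isomorphic to that triangle through
  \<open>qth\<close>, and \<open>F\<close> reflects exactness.\<close>

lemma qtf_tfun [simp]: "triangle_functor K T T (qtf F)"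
proof (rule triangle_functorI)
  fix f assume f: "arr T f"
  show "Sm (Fmor (qtf F) f) \<bullet> conn (qtf F) (dm T f) = conn (qtf F) (cd T f) \<bullet> Fmor (qtf F) (Sm f)"
  proof (rule equi_faithful[OF F(2)])
    have "conn F (qob F (cd T f)) \<bullet> Fmor F (Sm (qmor F f) \<bullet> conn (qtf F) (dm T f)) =
        Sm (Fmor F (qmor F f)) \<bullet> conn F (qob F (dm T f)) \<bullet> Fmor F (conn (qtf F) (dm T f))"
      using f by (subst tfun_nat(2)[OF F(1)]) simp_all
    also have "\<dots> = conn F (qob F (cd T f)) \<bullet> Fmor F (conn (qtf F) (cd T f) \<bullet> qmor F (Sm f))"
      using f by simp
    finally show "Fmor F (Sm (Fmor (qtf F) f) \<bullet> conn (qtf F) (dm T f)) = Fmor F (conn (qtf F) (cd T f) \<bullet> Fmor (qtf F) (Sm f))"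
      using f by (subst (asm) iso_cancel_left) simp_all
  qed (use f in simp_all)
next
  fix u v w assume e: "(u, v, w) \<in> Exact T" and "cand T u v w"
  then have c: "arr T u \<and> arr T v \<and> arr T w \<and> dm T v = cd T u \<and> dm T w = cd T v \<and> cd T w = Sg (dm T u)"
    by (simp add: cand_def)
  show "(Fmor (qtf F) u, Fmor (qtf F) v, conn (qtf F) (dm T u) \<bullet> Fmor (qtf F) w) \<in> Exact T"
  proof (rule exact_reflect[OF F])
    show "cand T (Fmor (qtf F) u) (Fmor (qtf F) v) (conn (qtf F) (dm T u) \<bullet> Fmor (qtf F) w)"
      using c by (simp add: cand_def)
    show "(Fmor F (Fmor (qtf F) u), Fmor F (Fmor (qtf F) v),
     conn F (dm T (Fmor (qtf F) u)) \<bullet> Fmor F (conn (qtf F) (dm T u) \<bullet> Fmor (qtf F) w)) \<in> Exact T"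
      by (rule exact_transport[OF e, of _ _ _ "iv T (qth F (dm T u))" "iv T (qth F (cd T u))" "iv T (qth F (cd T v))"])
        (use c in \<open>simp_all add: cand_def\<close>)
  qed
qed (use F in simp_all)

lemma qtf_tni: "tri_nat_iso T T (tcomp T F (qtf F)) (tid T) (qth F)"
  using qtf_theta by (simp add: tni_iff nat_iso_iff)

end

text \<open>Again the only choice that is compatible with \<open>qth\<close>.\<close>

definition qdel :: "('o, 'm, 'o, 'm) tfunctor \<Rightarrow> ('g \<Rightarrow> 'o \<Rightarrow> 'm) \<Rightarrow> 'g \<Rightarrow> 'o \<Rightarrow> 'm" where
  "qdel F \<delta> g X = rfl F (qob F (Fob (act A g) X)) (Fob (act A g) (qob F X))
     (iv T (\<delta> g (qob F X)) \<bullet> Fmor (act A g) (iv T (qth F X)) \<bullet> qth F (Fob (act A g) X))"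

lemma eqv_right_inverse:
  assumes "ea (F, \<delta>)"
  shows "ea (qtf F, qdel F \<delta>)" "ei (eqv_mult T (F, \<delta>) (qtf F, qdel F \<delta>)) (eqv_one T A)"
proof -
  note xe [simp] = assms
  note [simp] = ea_simps[OF xe]
  have q [simp]: "arr T (qdel F \<delta> g X)" "dm T (qdel F \<delta> g X) = qob F (Fob (act A g) X)"
    "cd T (qdel F \<delta> g X) = Fob (act A g) (qob F X)"
    "Fmor F (qdel F \<delta> g X) = iv T (\<delta> g (qob F X)) \<bullet> Fmor (act A g) (iv T (qth F X)) \<bullet> qth F (Fob (act A g) X)"
    if "g \<in> carrier G" "X \<in> Ob T" for g X
    unfolding qdel_def using that by simp_all
  show e: "ea (qtf F, qdel F \<delta>)"
  proof (rule eaI)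
    fix g assume g [simp]: "g \<in> carrier G"
    have t: "tri_nat_iso T T (tcomp T F (qtf F)) (tid T) (qth F)" by (rule qtf_tni) simp_all
    show "tri_nat_iso T T (tcomp T (qtf F) (act A g)) (tcomp T (act A g) (qtf F)) (qdel F \<delta> g)"
    proof (rule tni_reflect[of F])
      have 1: "tri_nat_iso T T (tcomp T F (tcomp T (qtf F) (act A g))) (act A g) (\<lambda>X. qth F (Fob (act A g) X))"
        by (rule tni_cong[OF tni_whisker_right[OF t, of "act A g"]]) simp_all
      have 2: "tri_nat_iso T T (act A g) (tcomp T (act A g) (tcomp T F (qtf F))) (\<lambda>X. Fmor (act A g) (iv T (qth F X)))"
        by (rule tni_cong[OF tni_whisker_left[OF tni_sym[OF t], of "act A g"]]) simp_all
      have 3: "tri_nat_iso T T (tcomp T (act A g) (tcomp T F (qtf F))) (tcomp T F (tcomp T (act A g) (qtf F))) (\<lambda>X. iv T (\<delta> g (qob F X)))"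
        by (rule tni_cong[OF tni_whisker_right[OF tni_sym[OF ea_tni[OF xe g]], of "qtf F"]]) simp_all
      have 4: "tri_nat_iso T T (tcomp T F (tcomp T (qtf F) (act A g))) (tcomp T F (tcomp T (act A g) (qtf F)))
         (\<lambda>X. iv T (\<delta> g (qob F X)) \<bullet> Fmor (act A g) (iv T (qth F X)) \<bullet> qth F (Fob (act A g) X))"
        by (rule tni_trans[OF tni_trans[OF 1 2] 3]) simp_all
      show "tri_nat_iso T T (tcomp T F (tcomp T (qtf F) (act A g))) (tcomp T F (tcomp T (act A g) (qtf F))) (\<lambda>X. Fmor F (qdel F \<delta> g X))"
        by (rule tni_cong[OF 4]) simp_all
    qed simp_all
  next
    fix g h X assume g [simp]: "g \<in> carrier G" "h \<in> carrier G" "X \<in> Ob T"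
    show "qdel F \<delta> (g \<otimes>\<^bsub>G\<^esub> h) X \<bullet> Fmor (qtf F) (coh A g h X) =
        coh A g h (Fob (qtf F) X) \<bullet> Fmor (act A g) (qdel F \<delta> h X) \<bullet> qdel F \<delta> g (Fob (act A h) X)"
    proof (rule equi_faithful[of F])
      let ?Q = "qob F X" and ?hX = "Fob (act A h) X"
      have "\<delta> (g \<otimes>\<^bsub>G\<^esub> h) ?Q \<bullet> Fmor F (coh A g h ?Q \<bullet> Fmor (act A g) (qdel F \<delta> h X) \<bullet> qdel F \<delta> g ?hX)
        = coh A g h (Fob F ?Q) \<bullet> Fmor (act A g) (\<delta> h ?Q) \<bullet> \<delta> g (Fob (act A h) ?Q) \<bullet> Fmor F (Fmor (act A g) (qdel F \<delta> h X)) \<bullet> Fmor F (qdel F \<delta> g ?hX)"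
        by (simp add: ea_coh[OF xe] del: q(4))
      also have "\<dots> = coh A g h (Fob F ?Q) \<bullet> Fmor (act A g) (\<delta> h ?Q) \<bullet> Fmor (act A g) (Fmor F (qdel F \<delta> h X)) \<bullet> \<delta> g (qob F ?hX) \<bullet> Fmor F (qdel F \<delta> g ?hX)"
        by (simp add: ea_nat[OF xe] del: q(4))
      also have "\<dots> = coh A g h (Fob F ?Q) \<bullet> Fmor (act A g) (Fmor (act A h) (iv T (qth F X))) \<bullet> qth F (Fob (act A g) ?hX)"
        by simp
      also have "\<dots> = Fmor (act A (g \<otimes>\<^bsub>G\<^esub> h)) (iv T (qth F X)) \<bullet> coh A g h X \<bullet> qth F (Fob (act A g) ?hX)"
        by (simp add: coh_nat del: fun_isom)
      also have "\<dots> = \<delta> (g \<otimes>\<^bsub>G\<^esub> h) ?Q \<bullet> Fmor F (qdel F \<delta> (g \<otimes>\<^bsub>G\<^esub> h) X \<bullet> qmor F (coh A g h X))"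
        by simp
      finally show "Fmor F (qdel F \<delta> (g \<otimes>\<^bsub>G\<^esub> h) X \<bullet> Fmor (qtf F) (coh A g h X)) =
        Fmor F (coh A g h (Fob (qtf F) X) \<bullet> Fmor (act A g) (qdel F \<delta> h X) \<bullet> qdel F \<delta> g (Fob (act A h) X))"
        by (subst (asm) iso_cancel_left) simp_all
    qed simp_all
  qed simp_all
  show "ei (eqv_mult T (F, \<delta>) (qtf F, qdel F \<delta>)) (eqv_one T A)"
    unfolding eqv_mult_def eqv_one_def case_prod_conv
    by (rule eiI[OF qtf_tni]) simp_all
qed

lemma Aut_group: "group (Aut_tri K G T A)"
proof -
  interpret M: monoid "Aut_tri K G T A" by (rule Aut_monoid)
  have one: "\<one>\<^bsub>Aut_tri K G T A\<^esub> = ec (eqv_one T A)" by (simp add: Aut_tri_def)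
  have r: "\<exists>d\<in>carrier (Aut_tri K G T A). c \<otimes>\<^bsub>Aut_tri K G T A\<^esub> d = \<one>\<^bsub>Aut_tri K G T A\<^esub>" if c: "c \<in> carrier (Aut_tri K G T A)" for c
  proof -
    obtain F \<delta> where c: "c = ec (F, \<delta>)" "ea (F, \<delta>)" using c unfolding Aut_tri_carrier by auto
    note i = eqv_right_inverse[OF c(2)]
    have "ec (qtf F, qdel F \<delta>) \<in> carrier (Aut_tri K G T A)" using i(1) unfolding Aut_tri_carrier by blast
    moreover have "c \<otimes>\<^bsub>Aut_tri K G T A\<^esub> ec (qtf F, qdel F \<delta>) = \<one>\<^bsub>Aut_tri K G T A\<^esub>"
      unfolding c one using c i by (simp add: ec_mult ec_eq_iff ea_mult ea_one)
    ultimately show ?thesis by blast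
  qed
  have "\<exists>d\<in>carrier (Aut_tri K G T A). d \<otimes>\<^bsub>Aut_tri K G T A\<^esub> c = \<one>\<^bsub>Aut_tri K G T A\<^esub>" if c: "c \<in> carrier (Aut_tri K G T A)" for c
  proof -
    obtain d where d: "d \<in> carrier (Aut_tri K G T A)" "c \<otimes>\<^bsub>Aut_tri K G T A\<^esub> d = \<one>\<^bsub>Aut_tri K G T A\<^esub>" using r c by blast
    obtain e where e: "e \<in> carrier (Aut_tri K G T A)" "d \<otimes>\<^bsub>Aut_tri K G T A\<^esub> e = \<one>\<^bsub>Aut_tri K G T A\<^esub>" using r d by blast
    have "c = e" using c d e by (metis M.m_assoc M.l_one M.r_one)
    then show ?thesis using d e by blast
  qed
  then show ?thesis by (intro groupI) (auto simp: M.m_assoc)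
qed

end

section \<open>Characters\<close>

lemma (in abelian_monoid) finsum_swap:
  assumes "finite S" "finite R" "\<And>a b. a \<in> S \<Longrightarrow> b \<in> R \<Longrightarrow> f a b \<in> carrier G"
  shows "finsum G (\<lambda>a. finsum G (f a) R) S = finsum G (\<lambda>b. finsum G (\<lambda>a. f a b) S) R"
  using assms(1) assms(2-)
proof (induction S)
  case (insert a S)
  have "finsum G (\<lambda>b. finsum G (\<lambda>a. f a b) (insert a S)) R = finsum G (\<lambda>b. f a b \<oplus> finsum G (\<lambda>a. f a b) S) R"
    using insert by (intro finsum_cong_all refl) (auto intro!: finsum_insert)
  also have "\<dots> = finsum G (f a) R \<oplus> finsum G (\<lambda>b. finsum G (\<lambda>a. f a b) S) R"
    using insert by (intro finsum_addf) auto
  finally show ?case using insert by simp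
qed simp

locale split_group = field K + G: comm_group G
  for K :: "('k, 'e) ring_scheme" (structure) and G :: "('g, 'h) monoid_scheme" +
  assumes finite_G [simp]: "finite (carrier G)" and splits: "splits_over G K"
begin

abbreviation D where "D \<equiv> dual_group K G"

lemma unit_iff: "c \<in> Units K \<longleftrightarrow> c \<in> carrier K \<and> c \<noteq> \<zero>"
  by (simp add: field_Units)

lemma D_carrier: "\<chi> \<in> carrier D \<longleftrightarrow> \<chi> \<in> extensional (carrier G) \<and> (\<forall>g\<in>carrier G. \<chi> g \<in> carrier K \<and> \<chi> g \<noteq> \<zero>) \<and>
    (\<forall>g\<in>carrier G. \<forall>h\<in>carrier G. \<chi> (g \<otimes>\<^bsub>G\<^esub> h) = \<chi> g \<otimes> \<chi> h)"
  by (auto simp: dual_group_def hom_def units_of_def unit_iff Pi_iff)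

lemma D_mult: "\<chi> \<otimes>\<^bsub>D\<^esub> \<psi> = (\<lambda>g\<in>carrier G. \<chi> g \<otimes> \<psi> g)"
  by (simp add: dual_group_def units_of_def)

lemma D_one: "\<one>\<^bsub>D\<^esub> = (\<lambda>g\<in>carrier G. \<one>)"
  by (simp add: dual_group_def units_of_def)

lemma char_closed [simp]: "\<lbrakk>\<chi> \<in> carrier D; g \<in> carrier G\<rbrakk> \<Longrightarrow> \<chi> g \<in> carrier K"
  "\<lbrakk>\<chi> \<in> carrier D; g \<in> carrier G\<rbrakk> \<Longrightarrow> \<chi> g \<noteq> \<zero>"
  unfolding D_carrier by blast+

lemma char_mult: "\<lbrakk>\<chi> \<in> carrier D; g \<in> carrier G; h \<in> carrier G\<rbrakk> \<Longrightarrow> \<chi> (g \<otimes>\<^bsub>G\<^esub> h) = \<chi> g \<otimes> \<chi> h"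
  unfolding D_carrier by blast

lemma char_one [simp]:
  assumes "\<chi> \<in> carrier D" shows "\<chi> \<one>\<^bsub>G\<^esub> = \<one>"
proof -
  have "\<chi> \<one>\<^bsub>G\<^esub> \<otimes> \<chi> \<one>\<^bsub>G\<^esub> = \<chi> \<one>\<^bsub>G\<^esub> \<otimes> \<one>"
    using char_mult[OF assms, of "\<one>\<^bsub>G\<^esub>" "\<one>\<^bsub>G\<^esub>"] assms by simp
  then show ?thesis using assms by (subst (asm) m_lcancel) auto
qed

lemma char_inv [simp]:
  assumes "\<chi> \<in> carrier D" "g \<in> carrier G"
  shows "\<chi> g \<otimes> \<chi> (inv\<^bsub>G\<^esub> g) = \<one>" "\<chi> (inv\<^bsub>G\<^esub> g) \<otimes> \<chi> g = \<one>"
  using char_mult[of \<chi> g "inv\<^bsub>G\<^esub> g"] char_mult[of \<chi> "inv\<^bsub>G\<^esub> g" g] assms by simp_all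

lemma char_eqI: "\<lbrakk>\<chi> \<in> carrier D; \<psi> \<in> carrier D; \<And>g. g \<in> carrier G \<Longrightarrow> \<chi> g = \<psi> g\<rbrakk> \<Longrightarrow> \<chi> = \<psi>"
  unfolding D_carrier by (blast intro: extensionalityI)

lemma charI:
  assumes "\<chi> \<in> extensional (carrier G)" "\<And>g. g \<in> carrier G \<Longrightarrow> \<chi> g \<in> carrier K" "\<And>g. g \<in> carrier G \<Longrightarrow> \<chi> g \<noteq> \<zero>"
    "\<And>g h. \<lbrakk>g \<in> carrier G; h \<in> carrier G\<rbrakk> \<Longrightarrow> \<chi> (g \<otimes>\<^bsub>G\<^esub> h) = \<chi> g \<otimes> \<chi> h"
  shows "\<chi> \<in> carrier D"
  unfolding D_carrier using assms by blast

lemma D_mult_closed [simp]: "\<lbrakk>\<chi> \<in> carrier D; \<psi> \<in> carrier D\<rbrakk> \<Longrightarrow> \<chi> \<otimes>\<^bsub>D\<^esub> \<psi> \<in> carrier D"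
  unfolding D_mult by (rule charI) (auto simp: integral_iff char_mult m_ac)

lemma D_one_closed [simp]: "\<one>\<^bsub>D\<^esub> \<in> carrier D"
  unfolding D_one by (rule charI) auto

definition cinv :: "('g \<Rightarrow> 'k) \<Rightarrow> 'g \<Rightarrow> 'k" where "cinv \<chi> = (\<lambda>g\<in>carrier G. \<chi> (inv\<^bsub>G\<^esub> g))"

lemma cinv_closed [simp]: "\<chi> \<in> carrier D \<Longrightarrow> cinv \<chi> \<in> carrier D"
  unfolding cinv_def by (rule charI) (auto simp: G.inv_mult char_mult)

lemma D_group: "comm_group D"
proof (rule comm_groupI)
  show "\<exists>y\<in>carrier D. y \<otimes>\<^bsub>D\<^esub> x = \<one>\<^bsub>D\<^esub>" if "x \<in> carrier D" for x
  proof (rule bexI[of _ "cinv x"])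
    show "cinv x \<otimes>\<^bsub>D\<^esub> x = \<one>\<^bsub>D\<^esub>" using that by (auto simp: D_mult D_one cinv_def fun_eq_iff)
    show "cinv x \<in> carrier D" using that by simp
  qed
  show "x \<otimes>\<^bsub>D\<^esub> y \<otimes>\<^bsub>D\<^esub> z = x \<otimes>\<^bsub>D\<^esub> (y \<otimes>\<^bsub>D\<^esub> z)" if "x \<in> carrier D" "y \<in> carrier D" "z \<in> carrier D" for x y z
    using that by (auto simp: D_mult fun_eq_iff m_assoc)
  show "x \<otimes>\<^bsub>D\<^esub> y = y \<otimes>\<^bsub>D\<^esub> x" if "x \<in> carrier D" "y \<in> carrier D" for x y
    using that by (auto simp: D_mult fun_eq_iff m_comm)
  show "\<one>\<^bsub>D\<^esub> \<otimes>\<^bsub>D\<^esub> x = x" if "x \<in> carrier D" for x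
    using that by (intro char_eqI) (simp_all, simp add: D_mult D_one)
qed simp_all

definition basis :: "'g \<Rightarrow> 'g \<Rightarrow> 'k" where
  "basis g = (\<lambda>h\<in>carrier G. if h = g then \<one> else \<zero>)"

abbreviation kG where "kG \<equiv> group_algebra K G"

lemma kG_carrier: "carrier kG = carrier G \<rightarrow>\<^sub>E carrier K" by (simp add: group_algebra_def)

lemma basis_closed [simp]: "basis g \<in> carrier kG"
  by (auto simp: kG_carrier basis_def)

lemma basis_mult:
  assumes g: "g \<in> carrier G" and x: "x \<in> carrier kG"
  shows "basis g \<otimes>\<^bsub>kG\<^esub> x = (\<lambda>h\<in>carrier G. x (inv\<^bsub>G\<^esub> g \<otimes>\<^bsub>G\<^esub> h))"
proof -
  have "(\<Oplus>a\<in>carrier G. basis g a \<otimes> x (inv\<^bsub>G\<^esub> a \<otimes>\<^bsub>G\<^esub> h)) = x (inv\<^bsub>G\<^esub> g \<otimes>\<^bsub>G\<^esub> h)" if h: "h \<in> carrier G" for h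
  proof -
    have xc: "x a \<in> carrier K" if "a \<in> carrier G" for a using x that by (auto simp: kG_carrier)
    have "(\<Oplus>a\<in>carrier G. basis g a \<otimes> x (inv\<^bsub>G\<^esub> a \<otimes>\<^bsub>G\<^esub> h)) = (\<Oplus>a\<in>carrier G. if g = a then x (inv\<^bsub>G\<^esub> a \<otimes>\<^bsub>G\<^esub> h) else \<zero>)"
      using h xc by (intro finsum_cong_all refl) (auto simp: basis_def)
    also have "\<dots> = x (inv\<^bsub>G\<^esub> g \<otimes>\<^bsub>G\<^esub> h)"
      using g h xc by (intro finsum_singleton) auto
    finally show ?thesis .
  qed
  then show ?thesis by (auto simp: group_algebra_def fun_eq_iff)
qed

lemma basis_basis:
  assumes "g \<in> carrier G" "h \<in> carrier G" shows "basis g \<otimes>\<^bsub>kG\<^esub> basis h = basis (g \<otimes>\<^bsub>G\<^esub> h)"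
proof -
  have "inv\<^bsub>G\<^esub> g \<otimes>\<^bsub>G\<^esub> a = h \<longleftrightarrow> a = g \<otimes>\<^bsub>G\<^esub> h" if "a \<in> carrier G" for a
    using assms that by (metis G.inv_closed G.inv_solve_left G.m_closed)
  then show ?thesis unfolding basis_mult[OF assms(1) basis_closed] using assms by (auto simp: basis_def fun_eq_iff)
qed

lemma one_kG: "\<one>\<^bsub>kG\<^esub> = basis \<one>\<^bsub>G\<^esub>"
  by (simp add: group_algebra_def basis_def)

definition lin_ext :: "('g \<Rightarrow> 'k) \<Rightarrow> ('g \<Rightarrow> 'k) \<Rightarrow> 'k" where
  "lin_ext \<psi> x = (\<Oplus>g\<in>carrier G. x g \<otimes> \<psi> g)"

lemma kG_val [simp]: "\<lbrakk>x \<in> carrier kG; g \<in> carrier G\<rbrakk> \<Longrightarrow> x g \<in> carrier K"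
  by (auto simp: kG_carrier)

lemma lin_ext_closed [simp]: "\<lbrakk>\<psi> \<in> carrier D; x \<in> carrier kG\<rbrakk> \<Longrightarrow> lin_ext \<psi> x \<in> carrier K"
  unfolding lin_ext_def by (rule finsum_closed) auto

lemma lin_ext_add: "\<lbrakk>\<psi> \<in> carrier D; x \<in> carrier kG; y \<in> carrier kG\<rbrakk> \<Longrightarrow> lin_ext \<psi> (x \<oplus>\<^bsub>kG\<^esub> y) = lin_ext \<psi> x \<oplus> lin_ext \<psi> y"
proof -
  assume a: "\<psi> \<in> carrier D" "x \<in> carrier kG" "y \<in> carrier kG"
  have "lin_ext \<psi> (x \<oplus>\<^bsub>kG\<^esub> y) = (\<Oplus>g\<in>carrier G. x g \<otimes> \<psi> g \<oplus> y g \<otimes> \<psi> g)"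
    unfolding lin_ext_def using a by (intro finsum_cong_all refl) (simp add: group_algebra_def[of K G] l_distr)
  then show ?thesis unfolding lin_ext_def using a by (simp add: finsum_addf Pi_iff)
qed

lemma lin_ext_smult: "\<lbrakk>\<psi> \<in> carrier D; x \<in> carrier kG; c \<in> carrier K\<rbrakk> \<Longrightarrow> lin_ext \<psi> (c \<odot>\<^bsub>kG\<^esub> x) = c \<otimes> lin_ext \<psi> x"
proof -
  assume a: "\<psi> \<in> carrier D" "x \<in> carrier kG" "c \<in> carrier K"
  have "lin_ext \<psi> (c \<odot>\<^bsub>kG\<^esub> x) = (\<Oplus>g\<in>carrier G. c \<otimes> (x g \<otimes> \<psi> g))"
    unfolding lin_ext_def using a by (intro finsum_cong_all refl) (simp add: group_algebra_def[of K G] m_assoc)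
  also have "\<dots> = c \<otimes> lin_ext \<psi> x"
    unfolding lin_ext_def using a by (intro finsum_rdistr[symmetric]) auto
  finally show ?thesis .
qed

lemma lin_ext_basis:
  assumes "\<psi> \<in> carrier D" "g \<in> carrier G" shows "lin_ext \<psi> (basis g) = \<psi> g"
proof -
  have "lin_ext \<psi> (basis g) = (\<Oplus>a\<in>carrier G. if g = a then \<psi> a else \<zero>)"
    unfolding lin_ext_def using assms by (intro finsum_cong_all refl) (auto simp: basis_def)
  also have "\<dots> = \<psi> g" using assms by (intro finsum_singleton) auto
  finally show ?thesis .
qed

lemma lin_ext_basis_mult:
  assumes "\<psi> \<in> carrier D" "g \<in> carrier G" "x \<in> carrier kG"
  shows "lin_ext \<psi> (basis g \<otimes>\<^bsub>kG\<^esub> x) = \<psi> g \<otimes> lin_ext \<psi> x"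
proof -
  have i: "inj_on (\<lambda>h. g \<otimes>\<^bsub>G\<^esub> h) (carrier G)" "(\<lambda>h. g \<otimes>\<^bsub>G\<^esub> h) ` carrier G = carrier G"
    using assms(2) by (simp_all add: G.inj_on_cmult G.surj_const_mult)
  have "lin_ext \<psi> (basis g \<otimes>\<^bsub>kG\<^esub> x) = (\<Oplus>h\<in>(\<lambda>h. g \<otimes>\<^bsub>G\<^esub> h) ` carrier G. x (inv\<^bsub>G\<^esub> g \<otimes>\<^bsub>G\<^esub> h) \<otimes> \<psi> h)"
    unfolding lin_ext_def i(2) using assms by (intro finsum_cong_all refl) (simp add: basis_mult)
  also have "\<dots> = (\<Oplus>h\<in>carrier G. x (inv\<^bsub>G\<^esub> g \<otimes>\<^bsub>G\<^esub> (g \<otimes>\<^bsub>G\<^esub> h)) \<otimes> \<psi> (g \<otimes>\<^bsub>G\<^esub> h))"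
    using i assms by (intro finsum_reindex) auto
  also have "\<dots> = (\<Oplus>h\<in>carrier G. \<psi> g \<otimes> (x h \<otimes> \<psi> h))"
    using assms by (intro finsum_cong_all refl) (simp add: char_mult m_ac flip: G.m_assoc)
  also have "\<dots> = \<psi> g \<otimes> lin_ext \<psi> x"
    unfolding lin_ext_def using assms by (intro finsum_rdistr[symmetric]) auto
  finally show ?thesis .
qed

text \<open>Let \<open>\<phi>\<close> be an isomorphism from the group algebra to a power of \<open>K\<close>. Its coordinates, restricted to
  the group elements, are characters \<open>\<chi> i\<close>. They exhaust all characters: the linear extension of a
  character \<open>\<psi>\<close> does not vanish on all the primitive idempotents \<open>e i\<close>, and \<open>\<psi> = \<chi> i\<close> if it does not
  vanish on \<open>e i\<close>. They separate group elements because \<open>\<phi>\<close> is injective. Finally let \<open>e i\<close> belong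
  to the trivial character. It is constant on the group, so its coefficient sum is a multiple of the
  group order; being nonzero, it forces the group order to be nonzero in \<open>K\<close>.\<close>

lemma split_facts:
  shows "finite (carrier D)"
    and "(\<Oplus>g\<in>carrier G. \<one>) \<noteq> \<zero>"
    and "\<And>g. \<lbrakk>g \<in> carrier G; g \<noteq> \<one>\<^bsub>G\<^esub>\<rbrakk> \<Longrightarrow> \<exists>\<chi>\<in>carrier D. \<chi> g \<noteq> \<one>"
proof -
  obtain n :: nat and \<phi> where 1: "\<phi> \<in> ring_iso kG (power_algebra K n)" and
    2: "\<forall>c\<in>carrier K. \<forall>x\<in>carrier kG. \<phi> (c \<odot>\<^bsub>kG\<^esub> x) = c \<odot>\<^bsub>power_algebra K n\<^esub> \<phi> x"
    using splits unfolding splits_over_def by blast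
  from 1 have 3: "\<phi> \<in> ring_hom kG (power_algebra K n)" and 4: "bij_betw \<phi> (carrier kG) (carrier (power_algebra K n))"
    by (auto simp: ring_iso_def)
  have f1: "\<phi> x \<in> {..<n} \<rightarrow>\<^sub>E carrier K" if "x \<in> carrier kG" for x
    using that 3 by (auto simp: ring_hom_def power_algebra_def)
  have f2: "\<phi> (x \<otimes>\<^bsub>kG\<^esub> y) i = \<phi> x i \<otimes> \<phi> y i" if "x \<in> carrier kG" "y \<in> carrier kG" "i < n" for x y i
    using that 3 by (auto simp: ring_hom_def power_algebra_def)
  have f3: "\<phi> (x \<oplus>\<^bsub>kG\<^esub> y) i = \<phi> x i \<oplus> \<phi> y i" if "x \<in> carrier kG" "y \<in> carrier kG" "i < n" for x y i
    using that 3 by (auto simp: ring_hom_def power_algebra_def)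
  have f4: "\<phi> (basis \<one>\<^bsub>G\<^esub>) i = \<one>" if "i < n" for i
    using that 3 by (auto simp: ring_hom_def power_algebra_def one_kG)
  have f5: "bij_betw \<phi> (carrier kG) ({..<n} \<rightarrow>\<^sub>E carrier K)"
    using 4 by (simp add: power_algebra_def)
  have f6: "\<phi> (c \<odot>\<^bsub>kG\<^esub> x) i = c \<otimes> \<phi> x i" if "x \<in> carrier kG" "c \<in> carrier K" "i < n" for x c i
    using that 2 by (auto simp: power_algebra_def)
  have fc: "\<phi> x i \<in> carrier K" if "x \<in> carrier kG" "i < n" for x i using f1[OF that(1)] that(2) by auto
  have inj: "x = y" if "x \<in> carrier kG" "y \<in> carrier kG" "\<And>i. i < n \<Longrightarrow> \<phi> x i = \<phi> y i" for x y
  proof -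
    have "\<phi> x = \<phi> y" using f1[OF that(1)] f1[OF that(2)] that(3) by (intro PiE_ext) auto
    then show ?thesis using f5 that by (auto simp: bij_betw_def inj_on_def)
  qed
  have kG_mult: "basis g \<otimes>\<^bsub>kG\<^esub> x \<in> carrier kG" if "g \<in> carrier G" "x \<in> carrier kG" for g x
    using that by (subst basis_mult) (auto simp: kG_carrier)
  have kG_add: "x \<oplus>\<^bsub>kG\<^esub> y \<in> carrier kG" if "x \<in> carrier kG" "y \<in> carrier kG" for x y
    using that by (auto simp: group_algebra_def)
  have kG_smult: "c \<odot>\<^bsub>kG\<^esub> x \<in> carrier kG" if "c \<in> carrier K" "x \<in> carrier kG" for c x
    using that by (auto simp: group_algebra_def)
  define \<chi> where "\<chi> i = (\<lambda>g\<in>carrier G. \<phi> (basis g) i)" for i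
  have \<chi>m: "\<phi> (basis (g \<otimes>\<^bsub>G\<^esub> h)) i = \<phi> (basis g) i \<otimes> \<phi> (basis h) i" if "g \<in> carrier G" "h \<in> carrier G" "i < n" for g h i
    using that f2[of "basis g" "basis h" i] by (simp add: basis_basis)
  have \<chi>D: "\<chi> i \<in> carrier D" if i: "i < n" for i
  proof -
    have "\<phi> (basis g) i \<noteq> \<zero>" if g: "g \<in> carrier G" for g
    proof
      assume z: "\<phi> (basis g) i = \<zero>"
      have "\<phi> (basis \<one>\<^bsub>G\<^esub>) i = \<zero> \<otimes> \<phi> (basis (inv\<^bsub>G\<^esub> g)) i"
        using \<chi>m[OF g _ i, of "inv\<^bsub>G\<^esub> g"] g z by simp
      then show False using f4[OF i] fc[of "basis (inv\<^bsub>G\<^esub> g)" i] i by simp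
    qed
    then show ?thesis unfolding \<chi>_def using i fc \<chi>m by (intro charI) auto
  qed
  define pre where "pre = the_inv_into (carrier kG) \<phi>"
  have pre: "pre v \<in> carrier kG" "\<phi> (pre v) = v" if "v \<in> {..<n} \<rightarrow>\<^sub>E carrier K" for v
    using f5 that unfolding pre_def bij_betw_def
    by (simp_all add: the_inv_into_into[OF _ _ subset_refl] f_the_inv_into_f)
  \<comment> \<open>the primitive idempotents \<open>e i\<close>, and the sums \<open>s i\<close> of the first \<open>i\<close> of them; \<open>s n\<close> is the unit of the group algebra\<close>
  define e where "e i = pre (\<lambda>j\<in>{..<n}. if j = i then \<one> else \<zero>)" for i :: nat
  define s where "s i = pre (\<lambda>j\<in>{..<n}. if j < i then \<one> else \<zero>)" for i :: nat
  have e [simp]: "e i \<in> carrier kG" "\<phi> (e i) = (\<lambda>j\<in>{..<n}. if j = i then \<one> else \<zero>)" for i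
    unfolding e_def by (intro pre; auto)+
  have s [simp]: "s i \<in> carrier kG" "\<phi> (s i) = (\<lambda>j\<in>{..<n}. if j < i then \<one> else \<zero>)" for i
    unfolding s_def by (intro pre; auto)+
  have sn: "s n = basis \<one>\<^bsub>G\<^esub>" using f4 by (intro inj) auto
  have ss: "s (Suc i) = s i \<oplus>\<^bsub>kG\<^esub> e i" for i
    by (intro inj kG_add) (auto simp: f3)
  have s0: "s 0 \<oplus>\<^bsub>kG\<^esub> s 0 = s 0" by (intro inj kG_add) (auto simp: f3)
  have ge: "basis g \<otimes>\<^bsub>kG\<^esub> e i = \<phi> (basis g) i \<odot>\<^bsub>kG\<^esub> e i" if "g \<in> carrier G" "i < n" for g i
    using that fc by (intro inj kG_mult kG_smult) (auto simp: f2 f6)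
  have ex: "\<exists>i<n. lin_ext \<psi> (e i) \<noteq> \<zero>" if \<psi>: "\<psi> \<in> carrier D" for \<psi>
  proof (rule ccontr)
    assume "\<not> ?thesis"
    then have z: "lin_ext \<psi> (e i) = \<zero>" if "i < n" for i using that by blast
    have "lin_ext \<psi> (s i) = \<zero>" if "i \<le> n" for i
      using that
    proof (induction i)
      case 0
      have "lin_ext \<psi> (s 0) \<oplus> lin_ext \<psi> (s 0) = lin_ext \<psi> (s 0)"
        using lin_ext_add[OF \<psi> s(1) s(1), of 0 0] s0 by simp
      then show ?case using lin_ext_closed[OF \<psi> s(1), of 0] by (metis add.l_cancel_one)
    next
      case (Suc i)
      then show ?case using z[of i] \<psi> by (simp add: ss lin_ext_add)
    qed
    then have "lin_ext \<psi> (s n) = \<zero>" by simp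
    then show False using \<psi> by (simp add: sn lin_ext_basis)
  qed
  have char: "\<chi> i = \<psi>" if "\<psi> \<in> carrier D" "i < n" "lin_ext \<psi> (e i) \<noteq> \<zero>" for \<psi> i
  proof (rule char_eqI[OF \<chi>D[OF that(2)] that(1)])
    fix g assume g: "g \<in> carrier G"
    have "\<psi> g \<otimes> lin_ext \<psi> (e i) = \<phi> (basis g) i \<otimes> lin_ext \<psi> (e i)"
      using lin_ext_basis_mult[OF that(1) g, of "e i"] that fc g by (simp add: ge lin_ext_smult)
    then show "\<chi> i g = \<psi> g"
      using that g fc by (simp add: \<chi>_def m_rcancel)
  qed
  have "carrier D \<subseteq> \<chi> ` {..<n}"
  proof
    fix \<psi> assume \<psi>: "\<psi> \<in> carrier D"
    then obtain i where "i < n" "lin_ext \<psi> (e i) \<noteq> \<zero>" using ex by blast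
    then show "\<psi> \<in> \<chi> ` {..<n}" using char[OF \<psi>] by blast
  qed
  then show "finite (carrier D)" by (rule finite_subset) simp
  show "\<exists>\<chi>\<in>carrier D. \<chi> g \<noteq> \<one>" if g: "g \<in> carrier G" "g \<noteq> \<one>\<^bsub>G\<^esub>" for g
  proof (rule ccontr)
    assume *: "\<not> ?thesis"
    have "\<phi> (basis g) i = \<phi> (basis \<one>\<^bsub>G\<^esub>) i" if "i < n" for i
      using * \<chi>D[OF that] f4[OF that] g unfolding \<chi>_def by force
    then have "basis g = basis \<one>\<^bsub>G\<^esub>" by (intro inj) auto
    then have "basis g g = basis \<one>\<^bsub>G\<^esub> g" by simp
    then show False using g by (simp add: basis_def)
  qed
  show "(\<Oplus>g\<in>carrier G. \<one>) \<noteq> \<zero>"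
  proof
    assume z: "(\<Oplus>g\<in>carrier G. \<one>) = \<zero>"
    obtain i where i: "i < n" "lin_ext \<one>\<^bsub>D\<^esub> (e i) \<noteq> \<zero>" using ex D_one_closed by blast
    have c: "\<chi> i = \<one>\<^bsub>D\<^esub>" using char[OF D_one_closed i] .
    have ec: "e i g = e i \<one>\<^bsub>G\<^esub>" if g: "g \<in> carrier G" for g
    proof -
      have "\<phi> (basis g) i = \<one>" using fun_cong[OF c, of g] g by (simp add: \<chi>_def D_one)
      then have "basis g \<otimes>\<^bsub>kG\<^esub> e i = \<one> \<odot>\<^bsub>kG\<^esub> e i" using ge[OF g i(1)] by simp
      then have "(basis g \<otimes>\<^bsub>kG\<^esub> e i) g = (\<one> \<odot>\<^bsub>kG\<^esub> e i) g" by simp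
      moreover have "(basis g \<otimes>\<^bsub>kG\<^esub> e i) g = e i \<one>\<^bsub>G\<^esub>" using g by (simp add: basis_mult)
      moreover have "(\<one> \<odot>\<^bsub>kG\<^esub> e i) g = e i g" using g kG_val[OF e(1) g] by (simp add: group_algebra_def)
      ultimately show ?thesis by simp
    qed
    have "lin_ext \<one>\<^bsub>D\<^esub> (e i) = (\<Oplus>g\<in>carrier G. e i \<one>\<^bsub>G\<^esub> \<otimes> \<one>)"
      unfolding lin_ext_def
    proof (intro finsum_cong_all refl)
      fix a assume a: "a \<in> carrier G"
      show "e i a \<otimes> \<one>\<^bsub>D\<^esub> a = e i \<one>\<^bsub>G\<^esub> \<otimes> \<one>" unfolding ec[OF a] D_one using a by simp
    qed
    also have "\<dots> = e i \<one>\<^bsub>G\<^esub> \<otimes> (\<Oplus>g\<in>carrier G. \<one>)" by (intro finsum_rdistr[symmetric]) auto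
    finally show False using i z by simp
  qed
qed

text \<open>Shifting the summation index by \<open>a\<close> multiplies the sum by \<open>\<mu> a\<close>.\<close>

lemma hom_sum_zero:
  assumes "group H" "finite (carrier H)" "\<And>x. x \<in> carrier H \<Longrightarrow> \<mu> x \<in> carrier K"
    "\<And>x y. \<lbrakk>x \<in> carrier H; y \<in> carrier H\<rbrakk> \<Longrightarrow> \<mu> (x \<otimes>\<^bsub>H\<^esub> y) = \<mu> x \<otimes> \<mu> y" "a \<in> carrier H" "\<mu> a \<noteq> \<one>"
  shows "finsum K \<mu> (carrier H) = \<zero>"
proof -
  interpret H: group H by fact
  have i: "inj_on (\<lambda>h. a \<otimes>\<^bsub>H\<^esub> h) (carrier H)" "(\<lambda>h. a \<otimes>\<^bsub>H\<^esub> h) ` carrier H = carrier H"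
    using assms(5) by (simp_all add: H.inj_on_cmult H.surj_const_mult)
  define c where "c = finsum K \<mu> (carrier H)"
  have c: "c \<in> carrier K" unfolding c_def using assms(3) by (intro finsum_closed) auto
  have "c = finsum K \<mu> ((\<lambda>h. a \<otimes>\<^bsub>H\<^esub> h) ` carrier H)" unfolding i c_def ..
  also have "\<dots> = (\<Oplus>h\<in>carrier H. \<mu> (a \<otimes>\<^bsub>H\<^esub> h))" using i assms(3) by (intro finsum_reindex) auto
  also have "\<dots> = (\<Oplus>h\<in>carrier H. \<mu> a \<otimes> \<mu> h)" using assms(4,5) by (intro finsum_cong_all refl) simp
  also have "\<dots> = \<mu> a \<otimes> c" unfolding c_def using assms by (intro finsum_rdistr[symmetric]) auto
  finally have "\<one> \<otimes> c = \<mu> a \<otimes> c" using c by simp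
  then show ?thesis using c assms(3,5,6) m_rcancel[of c \<one> "\<mu> a"] unfolding c_def[symmetric] by auto
qed

lemma finite_D [simp]: "finite (carrier D)" by (rule split_facts)

text \<open>The order of the group as an element of \<open>K\<close>.\<close>

definition nG where "nG = (\<Oplus>g\<in>carrier G. \<one>)"

lemma nG [simp]: "nG \<in> carrier K" "nG \<noteq> \<zero>"
  unfolding nG_def using split_facts(2) by (auto intro!: finsum_closed)

lemma sum_chars: "\<lbrakk>g \<in> carrier G; g \<noteq> \<one>\<^bsub>G\<^esub>\<rbrakk> \<Longrightarrow> (\<Oplus>\<chi>\<in>carrier D. \<chi> g) = \<zero>"
proof -
  assume g: "g \<in> carrier G" "g \<noteq> \<one>\<^bsub>G\<^esub>"
  then obtain \<chi> where "\<chi> \<in> carrier D" "\<chi> g \<noteq> \<one>" using split_facts(3) by blast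
  then show ?thesis using g comm_group.axioms(2)[OF D_group]
    by (intro hom_sum_zero[where a = \<chi>]) (auto simp: D_mult)
qed

lemma sum_char: "\<lbrakk>\<chi> \<in> carrier D; \<chi> \<noteq> \<one>\<^bsub>D\<^esub>\<rbrakk> \<Longrightarrow> (\<Oplus>g\<in>carrier G. \<chi> g) = \<zero>"
proof -
  assume c: "\<chi> \<in> carrier D" "\<chi> \<noteq> \<one>\<^bsub>D\<^esub>"
  then obtain g where "g \<in> carrier G" "\<chi> g \<noteq> \<one>"
    using char_eqI[OF c(1) D_one_closed] by (auto simp: D_one)
  then show ?thesis using c G.is_group by (intro hom_sum_zero[where a = g]) (auto simp: char_mult)
qed

text \<open>The table of all values \<open>\<chi> g\<close> is summed by rows and by columns.\<close>

lemma sum_D: "(\<Oplus>\<chi>\<in>carrier D. \<one>) = nG"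
proof -
  have "(\<Oplus>\<chi>\<in>carrier D. \<Oplus>g\<in>carrier G. \<chi> g) = (\<Oplus>\<chi>\<in>carrier D. if \<one>\<^bsub>D\<^esub> = \<chi> then nG else \<zero>)"
    by (intro finsum_cong_all refl) (auto simp: sum_char nG_def, simp add: D_one)
  also have "\<dots> = nG" by (rule finsum_singleton) auto
  finally have 1: "(\<Oplus>\<chi>\<in>carrier D. \<Oplus>g\<in>carrier G. \<chi> g) = nG" .
  have "(\<Oplus>g\<in>carrier G. \<Oplus>\<chi>\<in>carrier D. \<chi> g) = (\<Oplus>g\<in>carrier G. if \<one>\<^bsub>G\<^esub> = g then (\<Oplus>\<chi>\<in>carrier D. \<one>) else \<zero>)"
    by (intro finsum_cong_all refl) (auto simp: sum_chars)
  also have "\<dots> = (\<Oplus>\<chi>\<in>carrier D. \<one>)" by (rule finsum_singleton) auto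
  finally show ?thesis using 1 finsum_swap[of "carrier D" "carrier G" "\<lambda>\<chi> g. \<chi> g"] by simp
qed

text \<open>Every character of the dual group is evaluation at a group element. By orthogonality the sums
  \<open>\<Sum>\<^sub>\<chi> \<mu> \<chi> * \<chi> (inverse of a)\<close> add up to the group order when \<open>a\<close> varies, so one of them is nonzero;
  for this \<open>a\<close> the character \<open>\<chi> \<mapsto> \<mu> \<chi> * \<chi> (inverse of a)\<close> of the dual group must be trivial.\<close>

lemma evaluation_duality:
  assumes "\<And>\<chi>. \<chi> \<in> carrier D \<Longrightarrow> \<mu> \<chi> \<in> carrier K" "\<And>\<chi>. \<chi> \<in> carrier D \<Longrightarrow> \<mu> \<chi> \<noteq> \<zero>"
    "\<And>\<chi> \<psi>. \<lbrakk>\<chi> \<in> carrier D; \<psi> \<in> carrier D\<rbrakk> \<Longrightarrow> \<mu> (\<chi> \<otimes>\<^bsub>D\<^esub> \<psi>) = \<mu> \<chi> \<otimes> \<mu> \<psi>"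
  obtains a where "a \<in> carrier G" "\<And>\<chi>. \<chi> \<in> carrier D \<Longrightarrow> \<mu> \<chi> = \<chi> a"
proof -
  have m1: "\<mu> \<one>\<^bsub>D\<^esub> = \<one>"
  proof -
    interpret D: comm_group D by (rule D_group)
    have "\<mu> \<one>\<^bsub>D\<^esub> \<otimes> \<mu> \<one>\<^bsub>D\<^esub> = \<mu> \<one>\<^bsub>D\<^esub> \<otimes> \<one>" using assms(3)[of "\<one>\<^bsub>D\<^esub>" "\<one>\<^bsub>D\<^esub>"] assms(1) by simp
    then show ?thesis using assms(1,2)[of "\<one>\<^bsub>D\<^esub>"] by (subst (asm) m_lcancel) auto
  qed
  have "\<exists>a\<in>carrier G. (\<Oplus>\<chi>\<in>carrier D. \<mu> \<chi> \<otimes> \<chi> (inv\<^bsub>G\<^esub> a)) \<noteq> \<zero>"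
  proof (rule ccontr)
    assume *: "\<not> ?thesis"
    have "(\<Oplus>a\<in>carrier G. \<Oplus>\<chi>\<in>carrier D. \<mu> \<chi> \<otimes> \<chi> (inv\<^bsub>G\<^esub> a)) = (\<Oplus>a\<in>carrier G. \<zero>)"
      using * by (intro finsum_cong_all refl) auto
    then have "\<zero> = (\<Oplus>\<chi>\<in>carrier D. \<Oplus>a\<in>carrier G. \<mu> \<chi> \<otimes> \<chi> (inv\<^bsub>G\<^esub> a))"
      using assms(1) by (subst finsum_swap) auto
    also have "\<dots> = (\<Oplus>\<chi>\<in>carrier D. if \<one>\<^bsub>D\<^esub> = \<chi> then nG else \<zero>)"
    proof (intro finsum_cong_all refl)
      fix \<chi> assume c: "\<chi> \<in> carrier D"
      have "(\<Oplus>a\<in>carrier G. \<mu> \<chi> \<otimes> \<chi> (inv\<^bsub>G\<^esub> a)) = \<mu> \<chi> \<otimes> (\<Oplus>a\<in>carrier G. \<chi> (inv\<^bsub>G\<^esub> a))"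
        using assms(1) c by (intro finsum_rdistr[symmetric]) auto
      also have "(\<Oplus>a\<in>carrier G. \<chi> (inv\<^bsub>G\<^esub> a)) = (\<Oplus>a\<in>carrier G. cinv \<chi> a)"
        by (intro finsum_cong_all refl) (simp add: cinv_def)
      also have "\<dots> = (if \<one>\<^bsub>D\<^esub> = \<chi> then nG else \<zero>)"
      proof (cases "\<one>\<^bsub>D\<^esub> = \<chi>")
        case True
        then have "cinv \<chi> g = \<one>" if "g \<in> carrier G" for g using that by (auto simp: cinv_def D_one)
        then have "(\<Oplus>a\<in>carrier G. cinv \<chi> a) = (\<Oplus>a\<in>carrier G. \<one>)" by (intro finsum_cong_all refl)
        then show ?thesis using True by (simp add: nG_def)
      next
        case False
        have "cinv \<chi> \<noteq> \<one>\<^bsub>D\<^esub>"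
        proof
          assume h: "cinv \<chi> = \<one>\<^bsub>D\<^esub>"
          have "\<chi> g = \<one>" if g: "g \<in> carrier G" for g
            using fun_cong[OF h, of "inv\<^bsub>G\<^esub> g"] g by (simp add: cinv_def D_one)
          then have "\<chi> = \<one>\<^bsub>D\<^esub>" by (intro char_eqI[OF c D_one_closed]) (simp add: D_one)
          then show False using False by simp
        qed
        then show ?thesis using c False by (simp add: sum_char)
      qed
      finally show "(\<Oplus>a\<in>carrier G. \<mu> \<chi> \<otimes> \<chi> (inv\<^bsub>G\<^esub> a)) = (if \<one>\<^bsub>D\<^esub> = \<chi> then nG else \<zero>)"
        using assms(1) c m1 by auto
    qed
    also have "\<dots> = nG" by (rule finsum_singleton) auto
    finally show False using nG(2) by simp
  qed
  then obtain a where a: "a \<in> carrier G" "(\<Oplus>\<chi>\<in>carrier D. \<mu> \<chi> \<otimes> \<chi> (inv\<^bsub>G\<^esub> a)) \<noteq> \<zero>" by blast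
  have "\<mu> \<chi> = \<chi> a" if c: "\<chi> \<in> carrier D" for \<chi>
  proof -
    have 1: "\<mu> \<chi> \<otimes> \<chi> (inv\<^bsub>G\<^esub> a) = \<one>"
    proof (rule ccontr)
      assume "\<mu> \<chi> \<otimes> \<chi> (inv\<^bsub>G\<^esub> a) \<noteq> \<one>"
      then have "(\<Oplus>\<chi>\<in>carrier D. \<mu> \<chi> \<otimes> \<chi> (inv\<^bsub>G\<^esub> a)) = \<zero>"
        using assms(1) a c comm_group.axioms(2)[OF D_group]
        by (intro hom_sum_zero[where a = \<chi>]) (auto simp: assms(3) m_ac, simp add: D_mult m_ac)
      then show False using a by simp
    qed
    have "\<mu> \<chi> = \<mu> \<chi> \<otimes> (\<chi> (inv\<^bsub>G\<^esub> a) \<otimes> \<chi> a)" using assms(1) c a by simp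
    also have "\<dots> = (\<mu> \<chi> \<otimes> \<chi> (inv\<^bsub>G\<^esub> a)) \<otimes> \<chi> a" using assms(1) c a by (simp add: m_assoc del: char_inv)
    finally show ?thesis using 1 c a by simp
  qed
  then show ?thesis using that a by blast
qed

end

section \<open>The category of equivariant objects\<close>

context linear_category begin

lemma pl_neg: "arr C f \<Longrightarrow> pl C (sc C (\<ominus> \<one>) f) f = \<zero>\<^bsub>Hom C (dm C f) (cd C f)\<^esub>"
proof -
  assume f: "arr C f"
  interpret H: module K "Hom C (dm C f) (cd C f)" using f by (auto intro: hom_module)
  have "\<ominus>\<^bsub>Hom C (dm C f) (cd C f)\<^esub> f \<oplus>\<^bsub>Hom C (dm C f) (cd C f)\<^esub> f = \<zero>\<^bsub>Hom C (dm C f) (cd C f)\<^esub>"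
    using arr_carrier[OF f] by (rule H.l_neg)
  then show ?thesis using f by (simp add: neg_sc pl_eq)
qed

end

context susp_category begin

lemma conn_iv_nat:
  assumes "triangle_functor K T T F" "arr T f" "cd T f = Y"
  shows "iv T (conn F Y) \<bullet> Sm (Fmor F f) = Fmor F (Sm f) \<bullet> iv T (conn F (dm T f))"
    "arr T k \<Longrightarrow> cd T k = Sg (Fob F (dm T f)) \<Longrightarrow>
     iv T (conn F Y) \<bullet> Sm (Fmor F f) \<bullet> k = Fmor F (Sm f) \<bullet> iv T (conn F (dm T f)) \<bullet> k"
proof -
  note [simp] = assms(1,2) and Y = assms(3)[symmetric]
  have "conn F Y \<bullet> (iv T (conn F Y) \<bullet> Sm (Fmor F f)) = conn F Y \<bullet> (Fmor F (Sm f) \<bullet> iv T (conn F (dm T f)))"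
    using tfun_nat(2)[of F f _ "iv T (conn F (dm T f))"] by (simp add: Y)
  then show *: "iv T (conn F Y) \<bullet> Sm (Fmor F f) = Fmor F (Sm f) \<bullet> iv T (conn F (dm T f))"
    by (subst (asm) iso_cancel_left) (simp_all add: Y)
  show "arr T k \<Longrightarrow> cd T k = Sg (Fob F (dm T f)) \<Longrightarrow>
     iv T (conn F Y) \<bullet> Sm (Fmor F f) \<bullet> k = Fmor F (Sm f) \<bullet> iv T (conn F (dm T f)) \<bullet> k"
    by (rule comp_reassoc[OF *]) (simp_all add: Y)
qed

end

locale equivariant = acted_pretriangulated K T G A + split_group K G
  for K :: "('k, 'e) ring_scheme" (structure) and T :: "('k, 'o, 'm, 'z) pretricat_scheme"
    and G :: "('g, 'h) monoid_scheme" and A :: "('g, 'o, 'm) taction" +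
  assumes idem: "idempotent_complete T"
begin

abbreviation T' where "T' \<equiv> eqv_cat G T A"
abbreviation A' where "A' \<equiv> dual_action K G T A"
abbreviation tw where "tw \<equiv> twist_ob G T A"
abbreviation sg where "sg \<equiv> eqv_susp_ob G T A"
abbreviation ac where "ac g \<equiv> act A g"

lemma T'_simps [simp]:
  "Hom T' = eqv_hom G T A"
  "g \<cdot>\<^bsub>T'\<^esub> f = (fst f, underlying g \<bullet> underlying f, snd (snd g))"
  "Idt T' P = (P, Idt T (fst P), P)"
  "Fob (Susp T') = sg" "Fmor (Susp T') x = (sg (fst x), Sm (underlying x), sg (snd (snd x)))"
  by (simp_all add: eqv_cat_def case_prod_beta)

lemma eob_iff: "P \<in> Ob T' \<longleftrightarrow> fst P \<in> Ob T \<and> snd P \<in> extensional (carrier G) \<and>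
    (\<forall>g\<in>carrier G. isom T (snd P g) \<and> dm T (snd P g) = fst P \<and> cd T (snd P g) = Fob (ac g) (fst P)) \<and>
    (\<forall>g\<in>carrier G. \<forall>h\<in>carrier G. snd P (g \<otimes>\<^bsub>G\<^esub> h) = coh A g h (fst P) \<bullet> Fmor (ac g) (snd P h) \<bullet> snd P g)"
proof -
  have "P \<in> Ob T' \<longleftrightarrow> fst P \<in> Ob T \<and> snd P \<in> extensional (carrier G) \<and>
    (\<forall>g\<in>carrier G. iso_in T (fst P) (Fob (ac g) (fst P)) (snd P g)) \<and>
    (\<forall>g\<in>carrier G. \<forall>h\<in>carrier G. snd P (g \<otimes>\<^bsub>G\<^esub> h) = coh A g h (fst P) \<bullet> Fmor (ac g) (snd P h) \<bullet> snd P g)"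
    by (simp add: eqv_cat_def eqv_objects_def case_prod_beta)
  moreover have "iso_in T (fst P) (Fob (ac g) (fst P)) (snd P g) \<longleftrightarrow>
      isom T (snd P g) \<and> dm T (snd P g) = fst P \<and> cd T (snd P g) = Fob (ac g) (fst P)"
    if "fst P \<in> Ob T" "g \<in> carrier G" for g
    using that by (simp add: iso_in_iff)
  ultimately show ?thesis by blast
qed

lemma eob [simp]:
  assumes "P \<in> Ob T'"
  shows "fst P \<in> Ob T" "g \<in> carrier G \<Longrightarrow> isom T (snd P g)" "g \<in> carrier G \<Longrightarrow> dm T (snd P g) = fst P"
    "g \<in> carrier G \<Longrightarrow> cd T (snd P g) = Fob (ac g) (fst P)"
  using assms unfolding eob_iff by blast+

lemma eob_cocycle: "\<lbrakk>P \<in> Ob T'; g \<in> carrier G; h \<in> carrier G\<rbrakk> \<Longrightarrow>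
    snd P (g \<otimes>\<^bsub>G\<^esub> h) = coh A g h (fst P) \<bullet> Fmor (ac g) (snd P h) \<bullet> snd P g"
  unfolding eob_iff by blast

lemma eob_eqI: "\<lbrakk>P \<in> Ob T'; Q \<in> Ob T'; fst P = fst Q; \<And>g. g \<in> carrier G \<Longrightarrow> snd P g = snd Q g\<rbrakk> \<Longrightarrow> P = Q"
  unfolding eob_iff by (auto intro!: prod_eqI extensionalityI)

lemma eobI:
  assumes "X \<in> Ob T" "\<And>g. g \<in> carrier G \<Longrightarrow> isom T (\<alpha> g)" "\<And>g. g \<in> carrier G \<Longrightarrow> dm T (\<alpha> g) = X"
    "\<And>g. g \<in> carrier G \<Longrightarrow> cd T (\<alpha> g) = Fob (ac g) X"
    "\<And>g h. \<lbrakk>g \<in> carrier G; h \<in> carrier G\<rbrakk> \<Longrightarrow> \<alpha> (g \<otimes>\<^bsub>G\<^esub> h) = coh A g h X \<bullet> Fmor (ac g) (\<alpha> h) \<bullet> \<alpha> g"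
  shows "(X, \<lambda>g\<in>carrier G. \<alpha> g) \<in> Ob T'"
  unfolding eob_iff using assms by simp

text \<open>The morphisms of \<open>T\<close> that underlie a morphism \<open>P \<rightarrow> Q\<close> of equivariant objects. Statements about
  equivariant objects are reduced to statements about these.\<close>

definition eqm where
  "eqm P Q f \<longleftrightarrow> arr T f \<and> dm T f = fst P \<and> cd T f = fst Q \<and>
    (\<forall>g\<in>carrier G. snd Q g \<bullet> f = Fmor (ac g) f \<bullet> snd P g)"

lemma eqm_D:
  assumes "eqm P Q f"
  shows "arr T f" "dm T f = fst P" "cd T f = fst Q"
    "g \<in> carrier G \<Longrightarrow> snd Q g \<bullet> f = Fmor (ac g) f \<bullet> snd P g"
  using assms unfolding eqm_def by blast+

lemma eqm_nat2:
  assumes "eqm P Q f" "g \<in> carrier G" "arr T k" "cd T k = fst P" "P \<in> Ob T'" "Q \<in> Ob T'"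
  shows "snd Q g \<bullet> f \<bullet> k = Fmor (ac g) f \<bullet> snd P g \<bullet> k"
  using comp_reassoc[OF eqm_D(4)[OF assms(1,2)], of k] eqm_D(1-3)[OF assms(1)] assms(2-) by simp

lemma eqmI: "\<lbrakk>arr T f; dm T f = fst P; cd T f = fst Q; \<And>g. g \<in> carrier G \<Longrightarrow> snd Q g \<bullet> f = Fmor (ac g) f \<bullet> snd P g\<rbrakk> \<Longrightarrow> eqm P Q f"
  unfolding eqm_def by blast

lemma eqv_hom_carrier:
  assumes "P \<in> Ob T'" "Q \<in> Ob T'"
  shows "x \<in> carrier (eqv_hom G T A P Q) \<longleftrightarrow> fst x = P \<and> snd (snd x) = Q \<and> eqm P Q (underlying x)"
proof -
  have "f \<in> carrier (Hom T (fst P) (fst Q)) \<longleftrightarrow> arr T f \<and> dm T f = fst P \<and> cd T f = fst Q" for f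
    using mor_carrier[of "fst P" "fst Q" f] assms by simp
  then show ?thesis by (cases x) (auto simp: eqv_hom_def eqm_def)
qed

lemma eqv_hom_simps:
  "zero (eqv_hom G T A P Q) = (P, \<zero>\<^bsub>Hom T (fst P) (fst Q)\<^esub>, Q)"
  "x \<oplus>\<^bsub>eqv_hom G T A P Q\<^esub> y = (P, underlying x \<oplus>\<^bsub>Hom T (fst P) (fst Q)\<^esub> underlying y, Q)"
  "c \<odot>\<^bsub>eqv_hom G T A P Q\<^esub> x = (P, c \<odot>\<^bsub>Hom T (fst P) (fst Q)\<^esub> underlying x, Q)"
  by (simp_all add: eqv_hom_def)

lemma eqm_idt [simp]: "\<lbrakk>P \<in> Ob T'; fst P = X\<rbrakk> \<Longrightarrow> eqm P P (Idt T X)"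
  by (rule eqmI) auto

lemma eqm_comp:
  assumes "eqm P Q f" "eqm Q R g" "P \<in> Ob T'" "Q \<in> Ob T'" "R \<in> Ob T'"
  shows "eqm P R (g \<bullet> f)"
  by (rule eqmI) (use eqm_D(1-3)[OF assms(1)] eqm_D(1-3)[OF assms(2)] assms(3-) eqm_nat2[OF assms(2)] eqm_D(4)[OF assms(1)] in simp_all)

lemma eqm_sc:
  assumes "eqm P Q f" "c \<in> carrier K" "P \<in> Ob T'" "Q \<in> Ob T'"
  shows "eqm P Q (sc T c f)"
  by (rule eqmI) (use eqm_D(1-3)[OF assms(1)] assms(2-) eqm_D(4)[OF assms(1)] in simp_all)

lemma eqm_pl:
  assumes "eqm P Q f" "eqm P Q f'" "P \<in> Ob T'" "Q \<in> Ob T'"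
  shows "eqm P Q (pl T f f')"
  by (rule eqmI) (use eqm_D(1-3)[OF assms(1)] eqm_D(1-3)[OF assms(2)] assms(3-) eqm_D(4)[OF assms(1)] eqm_D(4)[OF assms(2)] in \<open>simp_all add: comp_pl fun_pl\<close>)

lemma eqm_zero [simp]:
  assumes "P \<in> Ob T'" "Q \<in> Ob T'"
  shows "eqm P Q \<zero>\<^bsub>Hom T (fst P) (fst Q)\<^esub>"
  by (rule eqmI) (use assms in simp_all)

lemma eqm_iv:
  assumes "eqm P Q f" "isom T f" "P \<in> Ob T'" "Q \<in> Ob T'"
  shows "eqm Q P (iv T f)"
proof (rule eqmI)
  note [simp] = eqm_D(1-3)[OF assms(1)] assms(2-)
  fix g assume g [simp]: "g \<in> carrier G"
  have "Fmor (ac g) f \<bullet> (snd P g \<bullet> iv T f) = Fmor (ac g) f \<bullet> (Fmor (ac g) (iv T f) \<bullet> snd Q g)"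
    using eqm_nat2[OF assms(1) g, of "iv T f"] by simp
  then show "snd P g \<bullet> iv T f = Fmor (ac g) (iv T f) \<bullet> snd Q g"
    by (subst (asm) iso_cancel_left) simp_all
qed (use eqm_D(1-3)[OF assms(1)] assms(2-) in simp_all)

lemma eqv_hom_pl_sc:
  assumes "x \<in> carrier (eqv_hom G T A P Q)" "P \<in> Ob T'" "Q \<in> Ob T'"
  shows "x \<oplus>\<^bsub>eqv_hom G T A P Q\<^esub> y = (P, pl T (underlying x) (underlying y), Q)"
    "c \<odot>\<^bsub>eqv_hom G T A P Q\<^esub> x = (P, sc T c (underlying x), Q)"
  using assms eqm_D(1-3)[of P Q "underlying x"] by (simp_all add: eqv_hom_simps eqv_hom_carrier pl_eq sc_eq)

lemma eqv_hom_module: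
  assumes P: "P \<in> Ob T'" and Q: "Q \<in> Ob T'"
  shows "module K (eqv_hom G T A P Q)"
proof (rule moduleI)
  note [simp] = P Q
  let ?H = "eqv_hom G T A P Q"
  have c: "x \<in> carrier ?H \<longleftrightarrow> fst x = P \<and> snd (snd x) = Q \<and> eqm P Q (underlying x)" for x
    by (rule eqv_hom_carrier) simp_all
  have e: "eqm P Q f \<Longrightarrow> arr T f" "eqm P Q f \<Longrightarrow> dm T f = fst P" "eqm P Q f \<Longrightarrow> cd T f = fst Q" for f
    by (simp_all add: eqm_D)
  note s = eqv_hom_pl_sc[OF _ P Q]
  have eq: "x = (P, underlying x, Q)" if "x \<in> carrier ?H" for x using that by (cases x) (simp add: c)
  interpret H: module K "Hom T (fst P) (fst Q)" by (simp add: hom_module)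
  have hc: "underlying x \<in> carrier (Hom T (fst P) (fst Q))" if "x \<in> carrier ?H" for x
    using that e[of "underlying x"] by (intro in_hom) (simp_all add: c)
  have add: "x \<oplus>\<^bsub>?H\<^esub> y \<in> carrier ?H" if "x \<in> carrier ?H" "y \<in> carrier ?H" for x y
    using that by (simp add: s(1)) (simp add: c eqm_pl)
  have smult: "a \<odot>\<^bsub>?H\<^esub> x \<in> carrier ?H" if "a \<in> carrier K" "x \<in> carrier ?H" for a x
    using that by (simp add: s(2)) (simp add: c eqm_sc)
  show "cring K" by (rule is_cring)
  show "abelian_group ?H"
  proof (rule abelian_groupI)
    show "\<zero>\<^bsub>?H\<^esub> \<in> carrier ?H" by (simp add: c eqv_hom_simps)
    show "x \<oplus>\<^bsub>?H\<^esub> y \<in> carrier ?H" if "x \<in> carrier ?H" "y \<in> carrier ?H" for x y using add that .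
    show "x \<oplus>\<^bsub>?H\<^esub> y \<oplus>\<^bsub>?H\<^esub> z = x \<oplus>\<^bsub>?H\<^esub> (y \<oplus>\<^bsub>?H\<^esub> z)" if "x \<in> carrier ?H" "y \<in> carrier ?H" "z \<in> carrier ?H" for x y z
      using hc[OF that(1)] hc[OF that(2)] hc[OF that(3)] by (simp add: eqv_hom_simps H.a_assoc)
    show "x \<oplus>\<^bsub>?H\<^esub> y = y \<oplus>\<^bsub>?H\<^esub> x" if "x \<in> carrier ?H" "y \<in> carrier ?H" for x y
      using hc[OF that(1)] hc[OF that(2)] by (simp add: eqv_hom_simps H.a_comm)
    show "\<zero>\<^bsub>?H\<^esub> \<oplus>\<^bsub>?H\<^esub> x = x" if "x \<in> carrier ?H" for x
      using hc[OF that] eq[OF that] by (simp add: eqv_hom_simps)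
    show "\<exists>y\<in>carrier ?H. y \<oplus>\<^bsub>?H\<^esub> x = \<zero>\<^bsub>?H\<^esub>" if x: "x \<in> carrier ?H" for x
      using x smult[OF a_inv_closed[OF one_closed] x] pl_neg[of "underlying x"] e[of "underlying x"]
      by (intro bexI[of _ "\<ominus> \<one> \<odot>\<^bsub>?H\<^esub> x"]) (simp_all add: s(1) s(2) c eqv_hom_simps(1))
  qed
  show "a \<odot>\<^bsub>?H\<^esub> x \<in> carrier ?H" if "a \<in> carrier K" "x \<in> carrier ?H" for a x using smult that .
  show "(a \<oplus> b) \<odot>\<^bsub>?H\<^esub> x = a \<odot>\<^bsub>?H\<^esub> x \<oplus>\<^bsub>?H\<^esub> b \<odot>\<^bsub>?H\<^esub> x" if "a \<in> carrier K" "b \<in> carrier K" "x \<in> carrier ?H" for a b x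
    using hc[OF that(3)] that(1,2) by (simp add: eqv_hom_simps H.smult_l_distr)
  show "a \<odot>\<^bsub>?H\<^esub> (x \<oplus>\<^bsub>?H\<^esub> y) = a \<odot>\<^bsub>?H\<^esub> x \<oplus>\<^bsub>?H\<^esub> a \<odot>\<^bsub>?H\<^esub> y" if "a \<in> carrier K" "x \<in> carrier ?H" "y \<in> carrier ?H" for a x y
    using hc[OF that(2)] hc[OF that(3)] that(1) by (simp add: eqv_hom_simps H.smult_r_distr)
  show "(a \<otimes> b) \<odot>\<^bsub>?H\<^esub> x = a \<odot>\<^bsub>?H\<^esub> (b \<odot>\<^bsub>?H\<^esub> x)" if "a \<in> carrier K" "b \<in> carrier K" "x \<in> carrier ?H" for a b x
    using hc[OF that(3)] that(1,2) by (simp add: eqv_hom_simps H.smult_assoc1)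
  show "\<one> \<odot>\<^bsub>?H\<^esub> x = x" if "x \<in> carrier ?H" for x
    using hc[OF that] eq[OF that] by (simp add: eqv_hom_simps)
qed

lemma T'_linear: "linear_category K T'"
proof (intro linear_category.intro linear_category_axioms.intro)
  show "field K" by (rule field_axioms)
  fix P assume P [simp]: "P \<in> Ob T'"
  show "Idt T' P \<in> carrier (Hom T' P P)" by (simp add: eqv_hom_carrier)
  fix Q assume Q [simp]: "Q \<in> Ob T'"
  show "module K (Hom T' P Q)" by (simp add: eqv_hom_module)
  fix x assume x: "x \<in> carrier (Hom T' P Q)"
  then have x1: "x = (P, underlying x, Q)" "eqm P Q (underlying x)" by (auto simp: eqv_hom_carrier prod_eq_iff)
  note x2 [simp] = eqm_D(1-3)[OF x1(2)]
  show "P = P' \<and> Q = Q'" if "P' \<in> Ob T'" "Q' \<in> Ob T'" "x \<in> carrier (Hom T' P' Q')" for P' Q'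
    using x that by (simp add: eqv_hom_carrier)
  show "Idt T' Q \<cdot>\<^bsub>T'\<^esub> x = x" "x \<cdot>\<^bsub>T'\<^esub> Idt T' P = x" using x1(1) by (simp_all add: prod_eq_iff)
  fix R assume R [simp]: "R \<in> Ob T'"
  fix y assume y: "y \<in> carrier (Hom T' Q R)"
  then have y1: "y = (Q, underlying y, R)" "eqm Q R (underlying y)" by (auto simp: eqv_hom_carrier prod_eq_iff)
  note y2 [simp] = eqm_D(1-3)[OF y1(2)]
  have f: "fst x = P" "snd (snd x) = Q" "fst y = Q" "snd (snd y) = R" using x y by (simp_all add: eqv_hom_carrier)
  show yx: "y \<cdot>\<^bsub>T'\<^esub> x \<in> carrier (Hom T' P R)"
    using f eqm_comp[OF x1(2) y1(2)] by (simp add: eqv_hom_carrier)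
  show "(z \<cdot>\<^bsub>T'\<^esub> y) \<cdot>\<^bsub>T'\<^esub> x = z \<cdot>\<^bsub>T'\<^esub> (y \<cdot>\<^bsub>T'\<^esub> x)" if "S \<in> Ob T'" "z \<in> carrier (Hom T' R S)" for S z
    using that eqm_D(1-3)[of R S "underlying z"] by (simp add: eqv_hom_carrier)
  have s: "u \<in> carrier (Hom T' P' Q') \<Longrightarrow> u \<oplus>\<^bsub>Hom T' P' Q'\<^esub> v = (P', pl T (underlying u) (underlying v), Q')"
     "u \<in> carrier (Hom T' P' Q') \<Longrightarrow> c \<odot>\<^bsub>Hom T' P' Q'\<^esub> u = (P', sc T c (underlying u), Q')"
    if "P' \<in> Ob T'" "Q' \<in> Ob T'" for P' Q' u v c
    using eqv_hom_pl_sc[of u P' Q'] that by simp_all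
  show "(y \<oplus>\<^bsub>Hom T' Q R\<^esub> y') \<cdot>\<^bsub>T'\<^esub> x = y \<cdot>\<^bsub>T'\<^esub> x \<oplus>\<^bsub>Hom T' P R\<^esub> y' \<cdot>\<^bsub>T'\<^esub> x" if "y' \<in> carrier (Hom T' Q R)" for y'
    unfolding s(1)[OF Q R y] s(1)[OF P R yx] using that f eqm_D(1-3)[of Q R "underlying y'"]
    by (simp add: eqv_hom_carrier comp_pl)
  show "y \<cdot>\<^bsub>T'\<^esub> (x \<oplus>\<^bsub>Hom T' P Q\<^esub> x') = y \<cdot>\<^bsub>T'\<^esub> x \<oplus>\<^bsub>Hom T' P R\<^esub> y \<cdot>\<^bsub>T'\<^esub> x'" if "x' \<in> carrier (Hom T' P Q)" for x'
    unfolding s(1)[OF P Q x] s(1)[OF P R yx] using that f eqm_D(1-3)[of P Q "underlying x'"]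
    by (simp add: eqv_hom_carrier comp_pl)
  show "(c \<odot>\<^bsub>Hom T' Q R\<^esub> y) \<cdot>\<^bsub>T'\<^esub> x = c \<odot>\<^bsub>Hom T' P R\<^esub> (y \<cdot>\<^bsub>T'\<^esub> x)" if "c \<in> carrier K" for c
    unfolding s(2)[OF Q R y] s(2)[OF P R yx] using that f by simp
  show "y \<cdot>\<^bsub>T'\<^esub> (c \<odot>\<^bsub>Hom T' P Q\<^esub> x) = c \<odot>\<^bsub>Hom T' P R\<^esub> (y \<cdot>\<^bsub>T'\<^esub> x)" if "c \<in> carrier K" for c
    unfolding s(2)[OF P Q x] s(2)[OF P R yx] using that f by simp
qed

end

sublocale equivariant \<subseteq> T': linear_category K "eqv_cat G T A"
  by (rule T'_linear)

context equivariant
begin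

lemma T'_mor_iff: "mor T' P Q x \<longleftrightarrow> P \<in> Ob T' \<and> Q \<in> Ob T' \<and> fst x = P \<and> snd (snd x) = Q \<and> eqm P Q (underlying x)"
  using eqv_hom_carrier[of P Q x] unfolding mor_def T'_simps by blast

lemma T'_arr_iff: "arr T' x \<longleftrightarrow> fst x \<in> Ob T' \<and> snd (snd x) \<in> Ob T' \<and> eqm (fst x) (snd (snd x)) (underlying x)"
  unfolding arr_def T'_mor_iff by blast

lemma T'_dm [simp]: "arr T' x \<Longrightarrow> dm T' x = fst x" "arr T' x \<Longrightarrow> cd T' x = snd (snd x)"
  using T'.mor_iff[of "fst x" "snd (snd x)" x] T'_mor_iff[of "fst x" "snd (snd x)" x] T'_arr_iff[of x] by auto

lemma T'_arrI [simp]: "\<lbrakk>P \<in> Ob T'; Q \<in> Ob T'; eqm P Q f\<rbrakk> \<Longrightarrow> arr T' (P, f, Q)"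
  by (simp add: T'_arr_iff)

lemma T'_arrE:
  assumes "arr T' x"
  obtains P f Q where "x = (P, f, Q)" "P \<in> Ob T'" "Q \<in> Ob T'" "eqm P Q f" "arr T f" "dm T f = fst P" "cd T f = fst Q"
  using assms eqm_D(1-3)[of "fst x" "snd (snd x)" "underlying x"] unfolding T'_arr_iff
  by (cases x) auto

lemma T'_arrE2:
  assumes "arr T' x" "fst x = P" "snd (snd x) = Q"
  obtains f where "x = (P, f, Q)" "eqm P Q f" "arr T f" "dm T f = fst P" "cd T f = fst Q"
  using assms by (elim T'_arrE) simp

lemma T'_pl: "arr T' x \<Longrightarrow> pl T' x y = (fst x, pl T (underlying x) (underlying y), snd (snd x))"
  using eqv_hom_pl_sc(1)[of x "fst x" "snd (snd x)" y] eqv_hom_carrier[of "fst x" "snd (snd x)" x] T'_arr_iff[of x]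
  unfolding pl_def[of T'] by simp

lemma T'_sc: "arr T' x \<Longrightarrow> sc T' c x = (fst x, sc T c (underlying x), snd (snd x))"
  using eqv_hom_pl_sc(2)[of x "fst x" "snd (snd x)" c] eqv_hom_carrier[of "fst x" "snd (snd x)" x] T'_arr_iff[of x]
  unfolding sc_def[of T'] by simp

lemma T'_isom:
  assumes "arr T' x"
  shows "isom T' x \<longleftrightarrow> isom T (underlying x)"
    "isom T' x \<Longrightarrow> iv T' x = (snd (snd x), iv T (underlying x), fst x)"
proof -
  obtain P f Q where x [simp]: "x = (P, f, Q)" "P \<in> Ob T'" "Q \<in> Ob T'" "arr T f" "dm T f = fst P" "cd T f = fst Q" and e: "eqm P Q f"
    using T'_arrE[OF assms] by metis
  have 1: "isom T' x" "iv T' x = (Q, iv T f, P)" if i: "isom T f"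
    using T'.isomI[of x "(Q, iv T f, P)"] i e eqm_iv[OF e i] by simp_all
  have 2: "isom T f" if i: "isom T' x"
  proof -
    have h: "arr T' (iv T' x)" "fst (iv T' x) = Q" "snd (snd (iv T' x)) = P"
      using T'.iv_mor(1-3)[OF i] e by simp_all
    obtain h0 where h0: "iv T' x = (Q, h0, P)" using h by (cases "iv T' x") simp
    then have a: "arr T h0" "dm T h0 = fst Q" "cd T h0 = fst P" using h(1) eqm_D(1-3)[of Q P h0] by (simp_all add: T'_arr_iff)
    show ?thesis
      using T'.iv_mor(4,5)[OF i, unfolded h0] e by (intro isomI(1)[of f h0]) (simp_all add: a)
  qed
  show "isom T' x \<longleftrightarrow> isom T (underlying x)" using 1 2 by auto
  show "isom T' x \<Longrightarrow> iv T' x = (snd (snd x), iv T (underlying x), fst x)" using 1 2 by auto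
qed

lemma T'_isom3 [simp]:
  assumes "P \<in> Ob T'" "Q \<in> Ob T'" "eqm P Q f"
  shows "isom T' (P, f, Q) \<longleftrightarrow> isom T f" "isom T f \<Longrightarrow> iv T' (P, f, Q) = (Q, iv T f, P)"
  using T'_isom[of "(P, f, Q)"] assms by simp_all

lemma sg_simps [simp]: "fst (sg P) = Sg (fst P)"
  "\<lbrakk>P \<in> Ob T'; g \<in> carrier G\<rbrakk> \<Longrightarrow> snd (sg P) g = iv T (conn (ac g) (fst P)) \<bullet> Sm (snd P g)"
proof -
  show "fst (sg P) = Sg (fst P)" by (cases P) (simp add: eqv_susp_ob_def)
  assume *: "P \<in> Ob T'" "g \<in> carrier G"
  have "snd (sg P) g = inv_in T (Fob (ac g) (Sg (fst P))) (Sg (Fob (ac g) (fst P))) (conn (ac g) (fst P)) \<bullet> Sm (snd P g)"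
    using *(2) by (cases P) (simp add: eqv_susp_ob_def)
  then show "snd (sg P) g = iv T (conn (ac g) (fst P)) \<bullet> Sm (snd P g)"
    using * by (simp add: inv_in_iv)
qed

lemma sg_ext: "snd (sg P) \<in> extensional (carrier G)"
  by (cases P) (simp add: eqv_susp_ob_def)

lemma ob_restrict: "snd P \<in> extensional (carrier G) \<Longrightarrow> P = (fst P, \<lambda>g\<in>carrier G. snd P g)"
  by (cases P) (simp add: extensional_restrict)

lemma sg_ob [simp]: assumes P: "P \<in> Ob T'" shows "sg P \<in> Ob T'"
proof -
  note [simp] = P
  have "(Sg (fst P), \<lambda>g\<in>carrier G. snd (sg P) g) \<in> Ob T'"
  proof (rule eobI)
    fix g h assume g [simp]: "g \<in> carrier G" and h [simp]: "h \<in> carrier G"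
    let ?X = "fst P" and ?k = "iv T (conn (ac g) (Fob (ac h) (fst P))) \<bullet> Sm (snd P g)"
    have "conn (ac (g \<otimes>\<^bsub>G\<^esub> h)) ?X \<bullet> (coh A g h (Sg ?X) \<bullet> Fmor (ac g) (snd (sg P) h) \<bullet> snd (sg P) g)
       = (conn (ac (g \<otimes>\<^bsub>G\<^esub> h)) ?X \<bullet> coh A g h (Sg ?X)) \<bullet> Fmor (ac g) (snd (sg P) h) \<bullet> snd (sg P) g"
      by simp
    also have "\<dots> = Sm (coh A g h ?X) \<bullet> conn (ac g) (Fob (ac h) ?X) \<bullet> Fmor (ac g) (Sm (snd P h)) \<bullet> iv T (conn (ac g) ?X) \<bullet> Sm (snd P g)"
      by (simp flip: coh_conn)
    also have "\<dots> = Sm (coh A g h ?X) \<bullet> Sm (Fmor (ac g) (snd P h)) \<bullet> conn (ac g) ?X \<bullet> iv T (conn (ac g) ?X) \<bullet> Sm (snd P g)"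
      using tfun_nat(2)[of "ac g" "snd P h" ?X "iv T (conn (ac g) ?X) \<bullet> Sm (snd P g)"] by simp
    also have "\<dots> = conn (ac (g \<otimes>\<^bsub>G\<^esub> h)) ?X \<bullet> snd (sg P) (g \<otimes>\<^bsub>G\<^esub> h)"
      by (simp add: eob_cocycle[of P g h])
    finally show "snd (sg P) (g \<otimes>\<^bsub>G\<^esub> h) = coh A g h (Sg ?X) \<bullet> Fmor (ac g) (snd (sg P) h) \<bullet> snd (sg P) g"
      by (subst (asm) iso_cancel_left) simp_all
  qed simp_all
  then show ?thesis using ob_restrict[OF sg_ext[of P]] by simp
qed

lemma sm_eqm [simp]:
  assumes "eqm P Q f" "P \<in> Ob T'" "Q \<in> Ob T'" shows "eqm (sg P) (sg Q) (Sm f)"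
proof (rule eqmI)
  note [simp] = assms(2,3) eqm_D(1-3)[OF assms(1)]
  fix g assume g [simp]: "g \<in> carrier G"
  have "Sm (snd Q g) \<bullet> Sm f = Sm (Fmor (ac g) f) \<bullet> Sm (snd P g)"
    using eqm_D(4)[OF assms(1) g] by (simp flip: fun_comp)
  then show "snd (sg Q) g \<bullet> Sm f = Fmor (ac g) (Sm f) \<bullet> snd (sg P) g"
    by (simp add: conn_iv_nat)
qed (use assms eqm_D(1-3)[OF assms(1)] in simp_all)

lemma T'_susp_category: "susp_category K T'"
proof (intro susp_category.intro susp_category_axioms.intro)
  show "linear_category K T'" by (rule T'_linear)
  show "linear_functor K T' T' (Susp T')"
  proof (rule T'.endoI)
    fix x assume "arr T' x"
    then show "mor T' (Fob (Susp T') (dm T' x)) (Fob (Susp T') (cd T' x)) (Fmor (Susp T') x)"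
      by (auto simp del: T'.mor_iff simp: T'_mor_iff elim: T'_arrE)
  next
    fix x y assume "arr T' x" "arr T' y" "dm T' y = cd T' x"
    then show "Fmor (Susp T') (y \<cdot>\<^bsub>T'\<^esub> x) = Fmor (Susp T') y \<cdot>\<^bsub>T'\<^esub> Fmor (Susp T') x"
      by (elim T'_arrE) simp
  next
    fix x y assume a: "arr T' x" "arr T' y" "dm T' y = dm T' x" "cd T' y = cd T' x"
    obtain P f Q where x: "x = (P, f, Q)" "P \<in> Ob T'" "Q \<in> Ob T'" "eqm P Q f" "arr T f" "dm T f = fst P" "cd T f = fst Q"
      using T'_arrE[OF a(1)] .
    obtain f' where y: "y = (P, f', Q)" "eqm P Q f'" "arr T f'" "dm T f' = fst P" "cd T f' = fst Q"
      using T'_arrE2[OF a(2), of P Q] a x by auto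
    show "Fmor (Susp T') (pl T' x y) = pl T' (Fmor (Susp T') x) (Fmor (Susp T') y)"
      using x y by (simp add: T'_pl fun_pl)
  next
    fix x c assume a: "arr T' x" "c \<in> carrier K"
    obtain P f Q where x: "x = (P, f, Q)" "P \<in> Ob T'" "Q \<in> Ob T'" "eqm P Q f" "arr T f" "dm T f = fst P" "cd T f = fst Q"
      using T'_arrE[OF a(1)] .
    show "Fmor (Susp T') (sc T' c x) = sc T' c (Fmor (Susp T') x)"
      using x a(2) by (simp add: T'_sc)
  qed simp_all
qed

end

sublocale equivariant \<subseteq> T': susp_category K "eqv_cat G T A"
  by (rule T'_susp_category)

context equivariant
begin

section \<open>The dual action\<close>

lemma tw_simps [simp]: "fst (tw \<chi> P) = fst P"
  "\<lbrakk>P \<in> Ob T'; g \<in> carrier G\<rbrakk> \<Longrightarrow> snd (tw \<chi> P) g = sc T (\<chi> (inv\<^bsub>G\<^esub> g)) (snd P g)"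
  by (cases P; simp add: twist_ob_def sc_eq)
    (cases P; use eob(3,4)[of P g] in \<open>simp add: twist_ob_def sc_def\<close>)

lemma tw_ext: "snd (tw \<chi> P) \<in> extensional (carrier G)"
  by (cases P) (simp add: twist_ob_def)

lemma tw_ob [simp]: assumes P: "P \<in> Ob T'" and \<chi>: "\<chi> \<in> carrier D" shows "tw \<chi> P \<in> Ob T'"
proof -
  note [simp] = P \<chi>
  have "(fst P, \<lambda>g\<in>carrier G. snd (tw \<chi> P) g) \<in> Ob T'"
    by (rule eobI) (simp_all add: eob_cocycle[of P] G.inv_mult char_mult m_ac)
  then show ?thesis using ob_restrict[OF tw_ext[of \<chi> P]] by simp
qed

lemma tw_tw:
  assumes "P \<in> Ob T'" "\<chi> \<in> carrier D" "\<psi> \<in> carrier D"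
  shows "tw \<chi> (tw \<psi> P) = tw (\<chi> \<otimes>\<^bsub>D\<^esub> \<psi>) P"
  by (rule eob_eqI) (use assms in \<open>simp_all, simp add: D_mult\<close>)

lemma tw_one: "P \<in> Ob T' \<Longrightarrow> tw \<one>\<^bsub>D\<^esub> P = P"
  by (rule eob_eqI) (simp_all, simp add: D_one)

lemma tw_sg: "\<lbrakk>P \<in> Ob T'; \<chi> \<in> carrier D\<rbrakk> \<Longrightarrow> sg (tw \<chi> P) = tw \<chi> (sg P)"
  by (rule eob_eqI) simp_all

lemma cinv_mult: "\<chi> \<in> carrier D \<Longrightarrow> \<chi> \<otimes>\<^bsub>D\<^esub> cinv \<chi> = \<one>\<^bsub>D\<^esub>"
  by (auto simp: D_mult D_one cinv_def fun_eq_iff)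

text \<open>A morphism from \<open>P\<close> to the twist of \<open>Q\<close> is a morphism of underlying objects which commutes with the
  structure maps up to the scalars of a character.\<close>

lemma eqm_tw_iff:
  assumes "P \<in> Ob T'" "Q \<in> Ob T'" "\<chi> \<in> carrier D"
  shows "eqm P (tw \<chi> Q) f \<longleftrightarrow> arr T f \<and> dm T f = fst P \<and> cd T f = fst Q \<and>
     (\<forall>g\<in>carrier G. sc T (\<chi> (inv\<^bsub>G\<^esub> g)) (snd Q g \<bullet> f) = Fmor (ac g) f \<bullet> snd P g)"
  unfolding eqm_def using assms by auto

lemma eqm_tw_tw:
  assumes "P \<in> Ob T'" "Q \<in> Ob T'" "\<chi> \<in> carrier D"
  shows "eqm (tw \<chi> P) (tw \<chi> Q) f \<longleftrightarrow> eqm P Q f"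
proof -
  have "snd Q g \<bullet> f = Fmor (ac g) f \<bullet> snd P g"
    if f: "arr T f" "dm T f = fst P" "cd T f = fst Q" and g: "g \<in> carrier G" and
      *: "sc T (\<chi> (inv\<^bsub>G\<^esub> g)) (snd Q g \<bullet> f) = sc T (\<chi> (inv\<^bsub>G\<^esub> g)) (Fmor (ac g) f \<bullet> snd P g)" for g
  proof -
    have "sc T (\<chi> g) (sc T (\<chi> (inv\<^bsub>G\<^esub> g)) (snd Q g \<bullet> f)) = sc T (\<chi> g) (sc T (\<chi> (inv\<^bsub>G\<^esub> g)) (Fmor (ac g) f \<bullet> snd P g))"
      using * by simp
    then show ?thesis using assms f g by simp
  qed
  then show ?thesis unfolding eqm_def using assms by auto
qed

lemma A'_simps [simp]:
  "Fob (act A' \<chi>) = tw \<chi>" "Fmor (act A' \<chi>) x = (tw \<chi> (fst x), underlying x, tw \<chi> (snd (snd x)))"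
  "conn (act A' \<chi>) P = (tw \<chi> (sg P), Idt T (Sg (fst P)), tw \<chi> (sg P))"
  "coh A' \<chi> \<psi> P = (tw (\<chi> \<otimes>\<^bsub>D\<^esub> \<psi>) P, Idt T (fst P), tw (\<chi> \<otimes>\<^bsub>D\<^esub> \<psi>) P)"
  by (simp_all add: dual_action_def case_prod_beta)

lemma T'_exact_unfold: "(x, y, z) \<in> Exact T' \<longleftrightarrow> (\<exists>P\<in>Ob T'. \<exists>Q\<in>Ob T'. \<exists>R\<in>Ob T'.
      x \<in> carrier (eqv_hom G T A P Q) \<and> y \<in> carrier (eqv_hom G T A Q R) \<and>
      z \<in> carrier (eqv_hom G T A R (sg P)) \<and> (underlying x, underlying y, underlying z) \<in> Exact T)"
  by (simp add: eqv_cat_def)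

lemma T'_exact_iff: "(x, y, z) \<in> Exact T' \<longleftrightarrow> arr T' x \<and> arr T' y \<and> arr T' z \<and> fst y = snd (snd x) \<and> fst z = snd (snd y) \<and>
    snd (snd z) = sg (fst x) \<and> (underlying x, underlying y, underlying z) \<in> Exact T"
proof
  assume "(x, y, z) \<in> Exact T'"
  then obtain P Q R where 1: "P \<in> Ob T'" "Q \<in> Ob T'" "R \<in> Ob T'" and
    2: "x \<in> carrier (eqv_hom G T A P Q)" "y \<in> carrier (eqv_hom G T A Q R)" "z \<in> carrier (eqv_hom G T A R (sg P))" and
    3: "(underlying x, underlying y, underlying z) \<in> Exact T"
    unfolding T'_exact_unfold by blast
  from 2 1 have "fst x = P" "snd (snd x) = Q" "eqm P Q (underlying x)" "fst y = Q" "snd (snd y) = R" "eqm Q R (underlying y)"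
    "fst z = R" "snd (snd z) = sg P" "eqm R (sg P) (underlying z)" by (simp_all add: eqv_hom_carrier)
  then show "arr T' x \<and> arr T' y \<and> arr T' z \<and> fst y = snd (snd x) \<and> fst z = snd (snd y) \<and>
    snd (snd z) = sg (fst x) \<and> (underlying x, underlying y, underlying z) \<in> Exact T"
    using 1 3 by (simp add: T'_arr_iff)
next
  assume *: "arr T' x \<and> arr T' y \<and> arr T' z \<and> fst y = snd (snd x) \<and> fst z = snd (snd y) \<and>
    snd (snd z) = sg (fst x) \<and> (underlying x, underlying y, underlying z) \<in> Exact T"
  then have o: "fst x \<in> Ob T'" "snd (snd x) \<in> Ob T'" "snd (snd y) \<in> Ob T'"
    by (simp_all add: T'_arr_iff)
  have "x \<in> carrier (eqv_hom G T A (fst x) (snd (snd x)))" "y \<in> carrier (eqv_hom G T A (snd (snd x)) (snd (snd y)))"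
    "z \<in> carrier (eqv_hom G T A (snd (snd y)) (sg (fst x)))"
    using * unfolding T'_arr_iff by (auto simp: eqv_hom_carrier)
  then show "(x, y, z) \<in> Exact T'" unfolding T'_exact_unfold using * o by blast
qed

lemma tw_endo [simp]: assumes \<chi> [simp]: "\<chi> \<in> carrier D" shows "T'.endo (act A' \<chi>)"
proof (rule T'.endoI)
  fix x assume "arr T' x"
  then show "mor T' (Fob (act A' \<chi>) (dm T' x)) (Fob (act A' \<chi>) (cd T' x)) (Fmor (act A' \<chi>) x)"
    by (auto simp del: T'.mor_iff simp: T'_mor_iff eqm_tw_tw elim: T'_arrE)
next
  fix x y assume a: "arr T' x" "arr T' y" "dm T' y = dm T' x" "cd T' y = cd T' x"
  obtain P f Q where x: "x = (P, f, Q)" "P \<in> Ob T'" "Q \<in> Ob T'" "eqm P Q f"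
    using T'_arrE[OF a(1)] .
  obtain f' where y: "y = (P, f', Q)" "eqm P Q f'"
    using T'_arrE2[OF a(2), of P Q] a x by auto
  show "Fmor (act A' \<chi>) (pl T' x y) = pl T' (Fmor (act A' \<chi>) x) (Fmor (act A' \<chi>) y)"
    using x y by (simp add: T'_pl eqm_tw_tw)
next
  fix x c assume a: "arr T' x" "c \<in> carrier K"
  obtain P f Q where x: "x = (P, f, Q)" "P \<in> Ob T'" "Q \<in> Ob T'" "eqm P Q f"
    using T'_arrE[OF a(1)] .
  show "Fmor (act A' \<chi>) (sc T' c x) = sc T' c (Fmor (act A' \<chi>) x)"
    using x a(2) by (simp add: T'_sc eqm_tw_tw)
qed simp_all

lemma T'_idt:
  assumes "P \<in> Ob T'" "fst P = X"
  shows "arr T' (P, Idt T X, P)" "isom T' (P, Idt T X, P)" "dm T' (P, Idt T X, P) = P" "cd T' (P, Idt T X, P) = P"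
  using assms by auto

lemma tw_tfun [simp]: assumes \<chi> [simp]: "\<chi> \<in> carrier D" shows "triangle_functor K T' T' (act A' \<chi>)"
proof (rule T'.triangle_functorI)
  fix x assume x: "arr T' x"
  then obtain P f Q where "x = (P, f, Q)" "P \<in> Ob T'" "Q \<in> Ob T'" "eqm P Q f" "arr T f" "dm T f = fst P" "cd T f = fst Q"
    by (rule T'_arrE)
  then show "Fmor (Susp T') (Fmor (act A' \<chi>) x) \<cdot>\<^bsub>T'\<^esub> conn (act A' \<chi>) (dm T' x) =
     conn (act A' \<chi>) (cd T' x) \<cdot>\<^bsub>T'\<^esub> Fmor (act A' \<chi>) (Fmor (Susp T') x)"
    by (simp add: tw_sg)
next
  fix x y z assume e: "(x, y, z) \<in> Exact T'"
  note f = e[unfolded T'_exact_iff]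
  obtain P f Q where x: "x = (P, f, Q)" "P \<in> Ob T'" "Q \<in> Ob T'" "eqm P Q f" "arr T f" "dm T f = fst P" "cd T f = fst Q"
    using f T'_arrE[of x] by metis
  obtain f' R where y: "y = (Q, f', R)" "R \<in> Ob T'" "eqm Q R f'" "arr T f'" "dm T f' = fst Q" "cd T f' = fst R"
    using f x T'_arrE[of y] by (metis fst_conv snd_conv)
  obtain f'' where z: "z = (R, f'', sg P)" "eqm R (sg P) f''" "arr T f''" "dm T f'' = fst R" "cd T f'' = Sg (fst P)"
    using f x y T'_arrE2[of z R "sg P"] by auto
  have "(f, f', f'') \<in> Exact T" using f x y z by simp
  then show "(Fmor (act A' \<chi>) x, Fmor (act A' \<chi>) y, conn (act A' \<chi>) (dm T' x) \<cdot>\<^bsub>T'\<^esub> Fmor (act A' \<chi>) z) \<in> Exact T'"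
    unfolding T'_exact_iff using x y z by (simp add: eqm_tw_tw tw_sg)
next
  fix P assume P: "P \<in> Ob T'"
  then have "tw \<chi> (sg P) \<in> Ob T'" "fst (tw \<chi> (sg P)) = Sg (fst P)" by simp_all
  note i = T'_idt[OF this]
  show "isom T' (conn (act A' \<chi>) P)" "dm T' (conn (act A' \<chi>) P) = Fob (act A' \<chi>) (Fob (Susp T') P)"
    "cd T' (conn (act A' \<chi>) P) = Fob (Susp T') (Fob (act A' \<chi>) P)"
    using i P \<chi> by (simp_all only: A'_simps T'_simps tw_sg)
qed (rule tw_endo[OF \<chi>])

lemma tw_equi [simp]: assumes \<chi> [simp]: "\<chi> \<in> carrier D" shows "T'.equi (act A' \<chi>)"
  unfolding T'.equi_def
proof (intro conjI allI impI ballI)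
  fix x y assume "arr T' x" "arr T' y" "dm T' x = dm T' y" "cd T' x = cd T' y" "Fmor (act A' \<chi>) x = Fmor (act A' \<chi>) y"
  then show "x = y" by (simp add: prod_eq_iff)
next
  fix P assume P: "P \<in> Ob T'"
  then show "\<exists>Q\<in>Ob T'. \<exists>\<theta>. isom T' \<theta> \<and> dm T' \<theta> = Fob (act A' \<chi>) Q \<and> cd T' \<theta> = P"
    using T'.isom_idt(1)[OF P] by (intro bexI[of _ "tw (cinv \<chi>) P"] exI[of _ "Idt T' P"]) (simp_all add: tw_tw cinv_mult tw_one)
next
  fix P Q x assume P: "P \<in> Ob T'" and Q: "Q \<in> Ob T'" and "mor T' (Fob (act A' \<chi>) P) (Fob (act A' \<chi>) Q) x"
  then have "fst x = tw \<chi> P" "snd (snd x) = tw \<chi> Q" "eqm (tw \<chi> P) (tw \<chi> Q) (underlying x)"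
    by (simp_all add: T'_mor_iff del: T'.mor_iff)
  then show "\<exists>f. mor T' P Q f \<and> Fmor (act A' \<chi>) f = x"
    using P Q by (intro exI[of _ "(P, underlying x, Q)"]) (simp add: eqm_tw_tw prod_eq_iff)
qed

lemma T'_triangle_action: "triangle_action K D T' A'"
proof
  show "triangle_autoequivalence K T' (act A' \<chi>)" if "\<chi> \<in> carrier D" for \<chi>
    using that by (simp add: T'.autoeq_iff)
  show "tri_nat_iso T' T' (tcomp T' (act A' \<chi>) (act A' \<psi>)) (act A' (\<chi> \<otimes>\<^bsub>D\<^esub> \<psi>)) (coh A' \<chi> \<psi>)"
    if "\<chi> \<in> carrier D" "\<psi> \<in> carrier D" for \<chi> \<psi>
  proof -
    have "tri_nat_iso T' T' (tcomp T' (act A' \<chi>) (act A' \<psi>)) (act A' (\<chi> \<otimes>\<^bsub>D\<^esub> \<psi>)) (\<lambda>P. Idt T' (Fob (tcomp T' (act A' \<chi>) (act A' \<psi>)) P))"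
      using that by (intro T'.tni_eq) (simp_all add: tw_tw tw_sg T'_arr_iff)
    then show ?thesis
      by (rule T'.tni_cong) (use that in \<open>simp_all add: tw_tw tw_sg\<close>)
  qed
  show "coh A' (\<chi> \<otimes>\<^bsub>D\<^esub> \<psi>) \<xi> P \<cdot>\<^bsub>T'\<^esub> coh A' \<chi> \<psi> (Fob (act A' \<xi>) P) =
      coh A' \<chi> (\<psi> \<otimes>\<^bsub>D\<^esub> \<xi>) P \<cdot>\<^bsub>T'\<^esub> Fmor (act A' \<chi>) (coh A' \<psi> \<xi> P)"
    if "\<chi> \<in> carrier D" "\<psi> \<in> carrier D" "\<xi> \<in> carrier D" "P \<in> Ob T'" for \<chi> \<psi> \<xi> P
  proof -
    interpret D: comm_group D by (rule D_group)
    show ?thesis using that by (simp add: tw_tw D.m_assoc)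
  qed
qed

end

sublocale equivariant \<subseteq> T': acted_category K "eqv_cat G T A" "dual_group K G" "dual_action K G T A"
  by (intro acted_category.intro T'_susp_category T'_triangle_action comm_group.axioms(2) D_group)

section \<open>Finite direct sums\<close>

context pretriangulated_category
begin

text \<open>Direct sums over a finite index set, built from binary ones by induction; the empty sum is a zero
  object.\<close>

lemma finite_biproduct:
  assumes "finite S" "\<And>h. h \<in> S \<Longrightarrow> Y h \<in> Ob T"
  shows "\<exists>B i p. B \<in> Ob T \<and> (\<forall>h\<in>S. mor T (Y h) B (i h) \<and> mor T B (Y h) (p h)) \<and>
    (\<forall>h\<in>S. \<forall>l\<in>S. p l \<bullet> i h = (if l = h then Idt T (Y h) else \<zero>\<^bsub>Hom T (Y h) (Y l)\<^esub>)) \<and>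
    finsum (Hom T B B) (\<lambda>h. i h \<bullet> p h) S = Idt T B"
  using assms
proof (induction S)
  case empty
  obtain Z where "zero_object T Z" using zero_object_exists by blast
  then show ?case by (intro exI[of _ Z]) (auto simp: zero_object_def)
next
  case (insert a S)
  then obtain B i p where B: "B \<in> Ob T" and m: "\<forall>h\<in>S. mor T (Y h) B (i h) \<and> mor T B (Y h) (p h)"
    and o: "\<forall>h\<in>S. \<forall>l\<in>S. p l \<bullet> i h = (if l = h then Idt T (Y h) else \<zero>\<^bsub>Hom T (Y h) (Y l)\<^esub>)"
    and s: "finsum (Hom T B B) (\<lambda>h. i h \<bullet> p h) S = Idt T B" by auto
  have Ya: "Y a \<in> Ob T" using insert by simp
  obtain P i0 j0 p0 q0 where "biproduct_of T (Y a) B P i0 j0 p0 q0" using biproduct_exists[OF Ya B] by blast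
  then have P: "P \<in> Ob T" and "i0 \<in> carrier (Hom T (Y a) P)" "j0 \<in> carrier (Hom T B P)"
     "p0 \<in> carrier (Hom T P (Y a))" "q0 \<in> carrier (Hom T P B)" and
    r: "p0 \<bullet> i0 = Idt T (Y a)" "q0 \<bullet> j0 = Idt T B" "p0 \<bullet> j0 = \<zero>\<^bsub>Hom T B (Y a)\<^esub>" "q0 \<bullet> i0 = \<zero>\<^bsub>Hom T (Y a) B\<^esub>"
     "(i0 \<bullet> p0) \<oplus>\<^bsub>Hom T P P\<^esub> (j0 \<bullet> q0) = Idt T P" by (auto simp: biproduct_of_def)
  then have m0: "mor T (Y a) P i0" "mor T B P j0" "mor T P (Y a) p0" "mor T P B q0"
    using Ya B by (auto simp: mor_def simp del: mor_iff)
  note m1 = m0[unfolded mor_iff]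
  have pl: "pl T (i0 \<bullet> p0) (j0 \<bullet> q0) = Idt T P" using r(5) m1 by (simp add: pl_eq)
  define i' where "i' h = (if h = a then i0 else j0 \<bullet> i h)" for h
  define p' where "p' h = (if h = a then p0 else p h \<bullet> q0)" for h
  have ne: "h \<in> S \<Longrightarrow> h \<noteq> a" for h using insert by auto
  have m': "\<forall>h\<in>insert a S. mor T (Y h) P (i' h) \<and> mor T P (Y h) (p' h)"
    using m m1 ne by (auto simp: i'_def p'_def)
  have qj: "q0 \<bullet> j0 \<bullet> k = k" if "arr T k" "cd T k = B" for k
    using comp_reassoc1[OF r(2), of k] that m1 by simp
  have pj: "p0 \<bullet> j0 \<bullet> k = \<zero>\<^bsub>Hom T (dm T k) (Y a)\<^esub>" if "arr T k" "cd T k = B" for k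
    using comp_reassoc1[OF r(3), of k] that m1 Ya by simp
  have o': "\<forall>h\<in>insert a S. \<forall>l\<in>insert a S. p' l \<bullet> i' h = (if l = h then Idt T (Y h) else \<zero>\<^bsub>Hom T (Y h) (Y l)\<^esub>)"
    using m m1 ne o r Ya insert.prems by (auto simp: i'_def p'_def qj pj)
  have "finsum (Hom T P P) (\<lambda>h. i' h \<bullet> p' h) (insert a S) = pl T (i' a \<bullet> p' a) (finsum (Hom T P P) (\<lambda>h. i' h \<bullet> p' h) S)"
    using insert P m' by (intro sum_insert) auto
  also have "finsum (Hom T P P) (\<lambda>h. i' h \<bullet> p' h) S = finsum (Hom T P P) (\<lambda>h. j0 \<bullet> (i h \<bullet> p h) \<bullet> q0) S"
    using m m1 ne by (intro finsum_cong_all refl) (auto simp: i'_def p'_def)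
  also have "\<dots> = j0 \<bullet> finsum (Hom T B B) (\<lambda>h. i h \<bullet> p h) S \<bullet> q0"
    using insert m m1 B P by simp
  also have "\<dots> = j0 \<bullet> q0" using s m1 by simp
  also have "pl T (i' a \<bullet> p' a) (j0 \<bullet> q0) = Idt T P" using pl by (simp add: i'_def p'_def)
  finally show ?case using P m' o' by blast
qed

end

context equivariant
begin

section \<open>The unit of the action\<close>

abbreviation ee where "ee \<equiv> \<one>\<^bsub>G\<^esub>"

text \<open>The action is associative up to \<open>coh\<close> but has no unit isomorphism among its data. It is determined:
  the functor of the neutral element is idempotent up to \<open>coh\<close> and faithful.\<close>

definition unit_at :: "'o \<Rightarrow> 'm" where "unit_at X = rfl (ac ee) X (Fob (ac ee) X) (iv T (coh A ee ee X))"

lemma unit_at_mor [simp]: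
  assumes "X \<in> Ob T"
  shows "isom T (unit_at X)" "dm T (unit_at X) = X" "cd T (unit_at X) = Fob (ac ee) X"
    "Fmor (ac ee) (unit_at X) = iv T (coh A ee ee X)"
proof -
  have 1: "arr T (unit_at X)" "dm T (unit_at X) = X" "cd T (unit_at X) = Fob (ac ee) X" "Fmor (ac ee) (unit_at X) = iv T (coh A ee ee X)"
    unfolding unit_at_def using assms by simp_all
  then show "dm T (unit_at X) = X" "cd T (unit_at X) = Fob (ac ee) X" "Fmor (ac ee) (unit_at X) = iv T (coh A ee ee X)" by simp_all
  show "isom T (unit_at X)" by (rule equi_isom[of "ac ee"]) (use 1 assms in simp_all)
qed

lemma coh11_iv_nat:
  assumes "arr T f"
  shows "Fmor (ac ee) (Fmor (ac ee) f) \<bullet> iv T (coh A ee ee (dm T f)) = iv T (coh A ee ee (cd T f)) \<bullet> Fmor (ac ee) f"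
proof -
  have "coh A ee ee (cd T f) \<bullet> (Fmor (ac ee) (Fmor (ac ee) f) \<bullet> iv T (coh A ee ee (dm T f))) =
    coh A ee ee (cd T f) \<bullet> (iv T (coh A ee ee (cd T f)) \<bullet> Fmor (ac ee) f)"
    using coh_nat(2)[of ee ee f "dm T f" "iv T (coh A ee ee (dm T f))"] assms by simp
  then show ?thesis using assms by (subst (asm) iso_cancel_left) simp_all
qed

lemma unit_at_nat:
  assumes "arr T f" "dm T f = X" shows "Fmor (ac ee) f \<bullet> unit_at X = unit_at (cd T f) \<bullet> f"
proof -
  have "Fmor (ac ee) f \<bullet> unit_at (dm T f) = unit_at (cd T f) \<bullet> f"
    by (rule equi_faithful[of "ac ee"]) (use assms(1) coh11_iv_nat[OF assms(1)] in simp_all)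
  then show ?thesis using assms by simp
qed

lemma unit_at_conn:
  assumes X [simp]: "X \<in> Ob T" shows "Sm (unit_at X) = conn (ac ee) X \<bullet> unit_at (Sg X)"
proof (rule equi_faithful[of "ac ee"])
  have "Sm (coh A ee ee X) \<bullet> conn (ac ee) (Fob (ac ee) X) \<bullet> Fmor (ac ee) (Sm (unit_at X))
      = Sm (coh A ee ee X) \<bullet> Sm (Fmor (ac ee) (unit_at X)) \<bullet> conn (ac ee) X"
    using tfun_nat(1)[of "ac ee" "unit_at X" X] by (simp del: unit_at_mor(4))
  also have "\<dots> = conn (ac ee) X \<bullet> coh A ee ee (Sg X) \<bullet> Fmor (ac ee) (unit_at (Sg X))" by simp
  also have "\<dots> = (Sm (coh A ee ee X) \<bullet> conn (ac ee) (Fob (ac ee) X) \<bullet> Fmor (ac ee) (conn (ac ee) X)) \<bullet> Fmor (ac ee) (unit_at (Sg X))"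
    unfolding coh_conn[OF G.one_closed G.one_closed X] by (simp del: unit_at_mor(4))
  finally have "(Sm (coh A ee ee X) \<bullet> conn (ac ee) (Fob (ac ee) X)) \<bullet> Fmor (ac ee) (Sm (unit_at X)) =
     (Sm (coh A ee ee X) \<bullet> conn (ac ee) (Fob (ac ee) X)) \<bullet> Fmor (ac ee) (conn (ac ee) X \<bullet> unit_at (Sg X))"
    by (simp del: unit_at_mor(4))
  then show "Fmor (ac ee) (Sm (unit_at X)) = Fmor (ac ee) (conn (ac ee) X \<bullet> unit_at (Sg X))"
    by (subst (asm) iso_cancel_left) simp_all
qed simp_all

lemma unit_at_tni: "tri_nat_iso T T (tid T) (ac ee) unit_at"
  by (simp add: tni_iff unit_at_nat unit_at_conn)

text \<open>The cocycle condition at the neutral element forces the structure map there.\<close>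

lemma eob_one: assumes P [simp]: "P \<in> Ob T'" shows "snd P ee = unit_at (fst P)"
proof (rule equi_faithful[of "ac ee"])
  have "snd P ee = (coh A ee ee (fst P) \<bullet> Fmor (ac ee) (snd P ee)) \<bullet> snd P ee"
    using eob_cocycle[of P ee ee] by simp
  then have "Idt T (Fob (ac ee) (fst P)) \<bullet> snd P ee = (coh A ee ee (fst P) \<bullet> Fmor (ac ee) (snd P ee)) \<bullet> snd P ee" by simp
  then have "Idt T (Fob (ac ee) (fst P)) = coh A ee ee (fst P) \<bullet> Fmor (ac ee) (snd P ee)"
    by (subst (asm) iso_cancel_right) simp_all
  then have "coh A ee ee (fst P) \<bullet> Fmor (ac ee) (snd P ee) = coh A ee ee (fst P) \<bullet> Fmor (ac ee) (unit_at (fst P))" by simp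
  then show "Fmor (ac ee) (snd P ee) = Fmor (ac ee) (unit_at (fst P))" by (subst (asm) iso_cancel_left) simp_all
qed simp_all

section \<open>Induced equivariant objects\<close>

text \<open>The direct sum of all the translates of \<open>X\<close>, with its injections and projections.\<close>

definition direct_sum_data :: "'o \<Rightarrow> 'o \<times> ('g \<Rightarrow> 'm) \<times> ('g \<Rightarrow> 'm) \<Rightarrow> bool" where
  "direct_sum_data X t = (case t of (B, i, p) \<Rightarrow> B \<in> Ob T \<and> (\<forall>h\<in>carrier G. mor T (Fob (ac h) X) B (i h) \<and> mor T B (Fob (ac h) X) (p h)) \<and>
    (\<forall>h\<in>carrier G. \<forall>l\<in>carrier G. p l \<bullet> i h = (if l = h then Idt T (Fob (ac h) X) else \<zero>\<^bsub>Hom T (Fob (ac h) X) (Fob (ac l) X)\<^esub>)) \<and>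
    finsum (Hom T B B) (\<lambda>h. i h \<bullet> p h) (carrier G) = Idt T B)"

definition sum_ob where "sum_ob X = fst (SOME t. direct_sum_data X t)"
definition sum_in where "sum_in X = fst (snd (SOME t. direct_sum_data X t))"
definition sum_pr where "sum_pr X = snd (snd (SOME t. direct_sum_data X t))"

lemma direct_sum_data: assumes "X \<in> Ob T" shows "direct_sum_data X (sum_ob X, sum_in X, sum_pr X)"
proof -
  have "\<exists>t. direct_sum_data X t"
    using finite_biproduct[of "carrier G" "\<lambda>h. Fob (ac h) X"] assms unfolding direct_sum_data_def by simp
  then have "direct_sum_data X (SOME t. direct_sum_data X t)" by (rule someI_ex)
  then show ?thesis unfolding sum_ob_def sum_in_def sum_pr_def by simp
qed

lemma sum_ob_simps [simp]:
  assumes "X \<in> Ob T"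
  shows "sum_ob X \<in> Ob T" "h \<in> carrier G \<Longrightarrow> arr T (sum_in X h)" "h \<in> carrier G \<Longrightarrow> dm T (sum_in X h) = Fob (ac h) X"
    "h \<in> carrier G \<Longrightarrow> cd T (sum_in X h) = sum_ob X" "h \<in> carrier G \<Longrightarrow> arr T (sum_pr X h)" "h \<in> carrier G \<Longrightarrow> dm T (sum_pr X h) = sum_ob X"
    "h \<in> carrier G \<Longrightarrow> cd T (sum_pr X h) = Fob (ac h) X"
    "\<lbrakk>h \<in> carrier G; l \<in> carrier G\<rbrakk> \<Longrightarrow> sum_pr X l \<bullet> sum_in X h = (if l = h then Idt T (Fob (ac h) X) else \<zero>\<^bsub>Hom T (Fob (ac h) X) (Fob (ac l) X)\<^esub>)"
    "finsum (Hom T (sum_ob X) (sum_ob X)) (\<lambda>h. sum_in X h \<bullet> sum_pr X h) (carrier G) = Idt T (sum_ob X)"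
  using direct_sum_data[OF assms] unfolding direct_sum_data_def by auto

lemma sum_ob_assoc:
  assumes "X \<in> Ob T" "h \<in> carrier G" "l \<in> carrier G" "arr T k" "cd T k = Fob (ac h) X"
  shows "sum_pr X l \<bullet> sum_in X h \<bullet> k = (if l = h then k else \<zero>\<^bsub>Hom T (dm T k) (Fob (ac l) X)\<^esub>)"
  using comp_reassoc1[OF sum_ob_simps(8)[OF assms(1-3)], of k] assms by auto

lemma sum_ob_ext:
  assumes X: "X \<in> Ob T" and f: "arr T f" "dm T f = sum_ob X" "arr T f'" "dm T f' = sum_ob X" "cd T f = cd T f'"
    and e: "\<And>h. h \<in> carrier G \<Longrightarrow> f \<bullet> sum_in X h = f' \<bullet> sum_in X h"
  shows "f = f'"
proof -
  have "f \<bullet> sum_in X h \<bullet> sum_pr X h = f' \<bullet> sum_in X h \<bullet> sum_pr X h" if "h \<in> carrier G" for h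
    using comp_reassoc[OF e[OF that], of "sum_pr X h"] that X f by simp
  then have "f \<bullet> finsum (Hom T (sum_ob X) (sum_ob X)) (\<lambda>h. sum_in X h \<bullet> sum_pr X h) (carrier G)
     = f' \<bullet> finsum (Hom T (sum_ob X) (sum_ob X)) (\<lambda>h. sum_in X h \<bullet> sum_pr X h) (carrier G)"
    using X f by (simp del: sum_ob_simps(9) cong: finsum_cong_all)
  then show ?thesis using X f by simp
qed

lemma G_cancel [simp]: "\<lbrakk>g \<in> carrier G; l \<in> carrier G\<rbrakk> \<Longrightarrow> g \<otimes>\<^bsub>G\<^esub> (inv\<^bsub>G\<^esub> g \<otimes>\<^bsub>G\<^esub> l) = l"
  "\<lbrakk>g \<in> carrier G; l \<in> carrier G\<rbrakk> \<Longrightarrow> inv\<^bsub>G\<^esub> g \<otimes>\<^bsub>G\<^esub> (g \<otimes>\<^bsub>G\<^esub> l) = l"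
  by (simp_all flip: G.m_assoc)

text \<open>A structure map at \<open>g\<close> is described on the summand of \<open>g h\<close> for each \<open>h\<close>, so equality is
  tested in this numbering of the summands.\<close>

lemma sum_ob_ext_shift:
  assumes X: "X \<in> Ob T" and f: "arr T f" "dm T f = sum_ob X" "arr T f'" "dm T f' = sum_ob X" "cd T f = cd T f'"
    and g: "g \<in> carrier G" and e: "\<And>h. h \<in> carrier G \<Longrightarrow> f \<bullet> sum_in X (g \<otimes>\<^bsub>G\<^esub> h) = f' \<bullet> sum_in X (g \<otimes>\<^bsub>G\<^esub> h)"
  shows "f = f'"
proof (rule sum_ob_ext[OF X f])
  fix h assume "h \<in> carrier G"
  then show "f \<bullet> sum_in X h = f' \<bullet> sum_in X h" using e[of "inv\<^bsub>G\<^esub> g \<otimes>\<^bsub>G\<^esub> h"] g by simp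
qed

definition copair where "copair X Y c = finsum (Hom T (sum_ob X) Y) (\<lambda>h. c h \<bullet> sum_pr X h) (carrier G)"

lemma copair [simp]:
  assumes "X \<in> Ob T" "Y \<in> Ob T" "\<And>h. h \<in> carrier G \<Longrightarrow> mor T (Fob (ac h) X) Y (c h)"
  shows "arr T (copair X Y c)" "dm T (copair X Y c) = sum_ob X" "cd T (copair X Y c) = Y"
    "l \<in> carrier G \<Longrightarrow> copair X Y c \<bullet> sum_in X l = c l"
proof -
  note m = assms(3)[unfolded mor_iff]
  show "arr T (copair X Y c)" "dm T (copair X Y c) = sum_ob X" "cd T (copair X Y c) = Y"
    unfolding copair_def using assms m by simp_all
  assume l: "l \<in> carrier G"
  have "copair X Y c \<bullet> sum_in X l = finsum (Hom T (Fob (ac l) X) Y) (\<lambda>h. c h \<bullet> sum_pr X h \<bullet> sum_in X l) (carrier G)"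
    unfolding copair_def using assms m l by simp
  also have "\<dots> = c l \<bullet> sum_pr X l \<bullet> sum_in X l"
    by (rule sum_single) (use assms(1,2) m l in auto)
  finally show "copair X Y c \<bullet> sum_in X l = c l" using assms m l by simp
qed

text \<open>The structure map of the induced object at \<open>g\<close>: it permutes the summands, taking the translate of
  \<open>X\<close> by \<open>g h\<close> to the image under \<open>g\<close> of the translate by \<open>h\<close>.\<close>

definition rho where "rho X g = copair X (Fob (ac g) (sum_ob X))
   (\<lambda>l. Fmor (ac g) (sum_in X (inv\<^bsub>G\<^esub> g \<otimes>\<^bsub>G\<^esub> l)) \<bullet> iv T (coh A g (inv\<^bsub>G\<^esub> g \<otimes>\<^bsub>G\<^esub> l) X))"

lemma rho [simp]:
  assumes "X \<in> Ob T" "g \<in> carrier G"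
  shows "arr T (rho X g)" "dm T (rho X g) = sum_ob X" "cd T (rho X g) = Fob (ac g) (sum_ob X)"
    "h \<in> carrier G \<Longrightarrow> rho X g \<bullet> sum_in X (g \<otimes>\<^bsub>G\<^esub> h) = Fmor (ac g) (sum_in X h) \<bullet> iv T (coh A g h X)"
  unfolding rho_def using assms by simp_all

lemma rho_assoc:
  assumes "X \<in> Ob T" "g \<in> carrier G" "h \<in> carrier G" "arr T k" "cd T k = Fob (ac (g \<otimes>\<^bsub>G\<^esub> h)) X"
  shows "rho X g \<bullet> sum_in X (g \<otimes>\<^bsub>G\<^esub> h) \<bullet> k = Fmor (ac g) (sum_in X h) \<bullet> iv T (coh A g h X) \<bullet> k"
  using comp_reassoc[OF rho(4)[OF assms(1-3)], of k] assms by simp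

lemma rho_isom [simp]:
  assumes X [simp]: "X \<in> Ob T" and g [simp]: "g \<in> carrier G" shows "isom T (rho X g)"
proof -
  \<comment> \<open>the inverse, assembled from its restrictions to the images of the summands\<close>
  define s where "s = finsum (Hom T (Fob (ac g) (sum_ob X)) (sum_ob X)) (\<lambda>h. sum_in X (g \<otimes>\<^bsub>G\<^esub> h) \<bullet> coh A g h X \<bullet> Fmor (ac g) (sum_pr X h)) (carrier G)"
  have s [simp]: "arr T s" "dm T s = Fob (ac g) (sum_ob X)" "cd T s = sum_ob X" unfolding s_def by simp_all
  have 1: "rho X g \<bullet> s = Idt T (Fob (ac g) (sum_ob X))"
  proof -
    have "rho X g \<bullet> s = finsum (Hom T (Fob (ac g) (sum_ob X)) (Fob (ac g) (sum_ob X))) (\<lambda>h. Fmor (ac g) (sum_in X h \<bullet> sum_pr X h)) (carrier G)"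
      unfolding s_def by (simp add: rho_assoc cong: finsum_cong_all)
    also have "\<dots> = Fmor (ac g) (finsum (Hom T (sum_ob X) (sum_ob X)) (\<lambda>h. sum_in X h \<bullet> sum_pr X h) (carrier G))"
      by (simp del: sum_ob_simps(9))
    finally show ?thesis by simp
  qed
  have sb: "s \<bullet> Fmor (ac g) (sum_in X h) = sum_in X (g \<otimes>\<^bsub>G\<^esub> h) \<bullet> coh A g h X" if h [simp]: "h \<in> carrier G" for h
  proof -
    have "s \<bullet> Fmor (ac g) (sum_in X h) = finsum (Hom T (Fob (ac g) (Fob (ac h) X)) (sum_ob X))
        (\<lambda>l. sum_in X (g \<otimes>\<^bsub>G\<^esub> l) \<bullet> coh A g l X \<bullet> Fmor (ac g) (sum_pr X l \<bullet> sum_in X h)) (carrier G)"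
      unfolding s_def by (simp del: sum_ob_simps(8))
    also have "\<dots> = sum_in X (g \<otimes>\<^bsub>G\<^esub> h) \<bullet> coh A g h X \<bullet> Fmor (ac g) (sum_pr X h \<bullet> sum_in X h)"
      by (rule sum_single) auto
    finally show ?thesis by simp
  qed
  have "s \<bullet> rho X g = Idt T (sum_ob X)"
  proof (rule sum_ob_ext_shift[OF X _ _ _ _ _ g])
    fix h assume h [simp]: "h \<in> carrier G"
    have "s \<bullet> Fmor (ac g) (sum_in X h) \<bullet> iv T (coh A g h X) = sum_in X (g \<otimes>\<^bsub>G\<^esub> h)"
      using comp_reassoc[OF sb[OF h], of "iv T (coh A g h X)"] by simp
    then show "(s \<bullet> rho X g) \<bullet> sum_in X (g \<otimes>\<^bsub>G\<^esub> h) = Idt T (sum_ob X) \<bullet> sum_in X (g \<otimes>\<^bsub>G\<^esub> h)" by simp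
  qed simp_all
  then show ?thesis using isomI(1)[of "rho X g" s] 1 by simp
qed

definition ind :: "'o \<Rightarrow> ('g, 'o, 'm) eqv_ob" where "ind X = (sum_ob X, \<lambda>g\<in>carrier G. rho X g)"

lemma ind_simps [simp]: "fst (ind X) = sum_ob X" "g \<in> carrier G \<Longrightarrow> snd (ind X) g = rho X g"
  by (simp_all add: ind_def)

lemma ind_ob [simp]: assumes X [simp]: "X \<in> Ob T" shows "ind X \<in> Ob T'"
  unfolding ind_def
proof (rule eobI)
  fix g h assume g [simp]: "g \<in> carrier G" and h [simp]: "h \<in> carrier G"
  show "rho X (g \<otimes>\<^bsub>G\<^esub> h) = coh A g h (sum_ob X) \<bullet> Fmor (ac g) (rho X h) \<bullet> rho X g"
  proof (rule sum_ob_ext_shift[OF X, where g = "g \<otimes>\<^bsub>G\<^esub> h"])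
    fix l assume l [simp]: "l \<in> carrier G"
    let ?c = "coh A g (h \<otimes>\<^bsub>G\<^esub> l) X" and ?d = "coh A (g \<otimes>\<^bsub>G\<^esub> h) l X"
    have a: "g \<otimes>\<^bsub>G\<^esub> h \<otimes>\<^bsub>G\<^esub> l = g \<otimes>\<^bsub>G\<^esub> (h \<otimes>\<^bsub>G\<^esub> l)" by (simp add: G.m_assoc)
    have c: "?d \<bullet> coh A g h (Fob (ac l) X) = ?c \<bullet> Fmor (ac g) (coh A h l X)" by (rule coh_cocycle) simp_all
    have "coh A g h (sum_ob X) \<bullet> Fmor (ac g) (rho X h) \<bullet> rho X g \<bullet> sum_in X (g \<otimes>\<^bsub>G\<^esub> (h \<otimes>\<^bsub>G\<^esub> l))
      = coh A g h (sum_ob X) \<bullet> Fmor (ac g) (rho X h \<bullet> sum_in X (h \<otimes>\<^bsub>G\<^esub> l)) \<bullet> iv T ?c"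
      by (simp del: rho(4)) simp
    also have "\<dots> = coh A g h (sum_ob X) \<bullet> Fmor (ac g) (Fmor (ac h) (sum_in X l)) \<bullet> Fmor (ac g) (iv T (coh A h l X)) \<bullet> iv T ?c"
      by simp
    also have "\<dots> = Fmor (ac (g \<otimes>\<^bsub>G\<^esub> h)) (sum_in X l) \<bullet> coh A g h (Fob (ac l) X) \<bullet> Fmor (ac g) (iv T (coh A h l X)) \<bullet> iv T ?c"
      using coh_nat(2)[of g h "sum_in X l" "Fob (ac l) X" "Fmor (ac g) (iv T (coh A h l X)) \<bullet> iv T ?c"] by (simp add: G.m_assoc)
    also have "coh A g h (Fob (ac l) X) \<bullet> Fmor (ac g) (iv T (coh A h l X)) \<bullet> iv T ?c = iv T ?d"
    proof -
      have "?d \<bullet> (coh A g h (Fob (ac l) X) \<bullet> Fmor (ac g) (iv T (coh A h l X)) \<bullet> iv T ?c) = ?d \<bullet> iv T ?d"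
        using comp_reassoc[OF c, of "Fmor (ac g) (iv T (coh A h l X)) \<bullet> iv T ?c"] by (simp add: G.m_assoc)
      then show ?thesis by (subst (asm) iso_cancel_left) (simp_all add: G.m_assoc)
    qed
    also have "Fmor (ac (g \<otimes>\<^bsub>G\<^esub> h)) (sum_in X l) \<bullet> iv T ?d = rho X (g \<otimes>\<^bsub>G\<^esub> h) \<bullet> sum_in X (g \<otimes>\<^bsub>G\<^esub> h \<otimes>\<^bsub>G\<^esub> l)"
      by simp
    finally show "rho X (g \<otimes>\<^bsub>G\<^esub> h) \<bullet> sum_in X (g \<otimes>\<^bsub>G\<^esub> h \<otimes>\<^bsub>G\<^esub> l) =
       (coh A g h (sum_ob X) \<bullet> Fmor (ac g) (rho X h) \<bullet> rho X g) \<bullet> sum_in X (g \<otimes>\<^bsub>G\<^esub> h \<otimes>\<^bsub>G\<^esub> l)"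
      unfolding a by (simp del: rho(4))
  qed simp_all
qed simp_all

definition indm where "indm u = copair (dm T u) (sum_ob (cd T u)) (\<lambda>h. sum_in (cd T u) h \<bullet> Fmor (ac h) u)"

lemma indm [simp]:
  assumes "arr T u"
  shows "arr T (indm u)" "dm T (indm u) = sum_ob (dm T u)" "cd T (indm u) = sum_ob (cd T u)"
  unfolding indm_def using assms by simp_all

lemma indm_sum_in:
  assumes "arr T u" "dm T u = X" "h \<in> carrier G"
  shows "indm u \<bullet> sum_in X h = sum_in (cd T u) h \<bullet> Fmor (ac h) u"
    "\<lbrakk>arr T k; cd T k = Fob (ac h) X\<rbrakk> \<Longrightarrow> indm u \<bullet> sum_in X h \<bullet> k = sum_in (cd T u) h \<bullet> Fmor (ac h) u \<bullet> k"
proof -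
  show *: "indm u \<bullet> sum_in X h = sum_in (cd T u) h \<bullet> Fmor (ac h) u"
    unfolding indm_def assms(2)[symmetric] using assms(1,3) by simp
  show "\<lbrakk>arr T k; cd T k = Fob (ac h) X\<rbrakk> \<Longrightarrow> indm u \<bullet> sum_in X h \<bullet> k = sum_in (cd T u) h \<bullet> Fmor (ac h) u \<bullet> k"
    by (rule comp_reassoc[OF *]) (use assms(1,3) in \<open>simp_all flip: assms(2)\<close>)
qed

lemma sum_pr_indm:
  assumes u: "arr T u" and g [simp]: "g \<in> carrier G"
  shows "sum_pr (cd T u) g \<bullet> indm u = Fmor (ac g) u \<bullet> sum_pr (dm T u) g"
  by (rule sum_ob_ext[of "dm T u"]) (use u in \<open>auto simp: indm_sum_in sum_ob_assoc\<close>)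

lemma coh_iv_nat:
  assumes "g \<in> carrier G" "h \<in> carrier G" "arr T f" "cd T f = Y"
  shows "iv T (coh A g h Y) \<bullet> Fmor (ac (g \<otimes>\<^bsub>G\<^esub> h)) f = Fmor (ac g) (Fmor (ac h) f) \<bullet> iv T (coh A g h (dm T f))"
proof -
  have "coh A g h (cd T f) \<bullet> (iv T (coh A g h (cd T f)) \<bullet> Fmor (ac (g \<otimes>\<^bsub>G\<^esub> h)) f) =
     coh A g h (cd T f) \<bullet> (Fmor (ac g) (Fmor (ac h) f) \<bullet> iv T (coh A g h (dm T f)))"
    using coh_nat(2)[of g h f "dm T f" "iv T (coh A g h (dm T f))"] assms(1-3) by simp
  then show ?thesis using assms(1-3) unfolding assms(4)[symmetric] by (subst (asm) iso_cancel_left) simp_all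
qed

lemma indm_eqm [simp]:
  assumes u [simp]: "arr T u" shows "eqm (ind (dm T u)) (ind (cd T u)) (indm u)"
proof (rule eqmI)
  fix g assume g [simp]: "g \<in> carrier G"
  show "snd (ind (cd T u)) g \<bullet> indm u = Fmor (ac g) (indm u) \<bullet> snd (ind (dm T u)) g"
  proof (rule sum_ob_ext_shift[of "dm T u", where g = g])
    fix h assume h [simp]: "h \<in> carrier G"
    have "(rho (cd T u) g \<bullet> indm u) \<bullet> sum_in (dm T u) (g \<otimes>\<^bsub>G\<^esub> h) = Fmor (ac g) (sum_in (cd T u) h) \<bullet> iv T (coh A g h (cd T u)) \<bullet> Fmor (ac (g \<otimes>\<^bsub>G\<^esub> h)) u"
      by (simp add: indm_sum_in rho_assoc)
    also have "\<dots> = Fmor (ac g) (sum_in (cd T u) h \<bullet> Fmor (ac h) u) \<bullet> iv T (coh A g h (dm T u))"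
      by (simp add: coh_iv_nat)
    also have "\<dots> = Fmor (ac g) (indm u \<bullet> sum_in (dm T u) h) \<bullet> iv T (coh A g h (dm T u))" by (simp only: indm_sum_in(1)[OF u refl h])
    also have "\<dots> = (Fmor (ac g) (indm u) \<bullet> rho (dm T u) g) \<bullet> sum_in (dm T u) (g \<otimes>\<^bsub>G\<^esub> h)" by simp
    finally show "(snd (ind (cd T u)) g \<bullet> indm u) \<bullet> sum_in (dm T u) (g \<otimes>\<^bsub>G\<^esub> h) =
       (Fmor (ac g) (indm u) \<bullet> snd (ind (dm T u)) g) \<bullet> sum_in (dm T u) (g \<otimes>\<^bsub>G\<^esub> h)" by simp
  qed simp_all
qed simp_all

text \<open>For \<open>w : Z \<rightarrow> \<Sigma>X\<close> the induced morphism, followed by the identification of the induced object of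
  \<open>\<Sigma>X\<close> with the suspension of the induced object of \<open>X\<close>.\<close>

definition inds where "inds X w = copair (dm T w) (Sg (sum_ob X)) (\<lambda>h. Sm (sum_in X h) \<bullet> conn (ac h) X \<bullet> Fmor (ac h) w)"

context
  fixes X w assumes X [simp]: "X \<in> Ob T" and w [simp]: "arr T w" "cd T w = Sg X"
begin

lemma inds [simp]: "arr T (inds X w)" "dm T (inds X w) = sum_ob (dm T w)" "cd T (inds X w) = Sg (sum_ob X)"
  unfolding inds_def by simp_all

lemma inds_sum_in:
  assumes h [simp]: "h \<in> carrier G"
  shows "inds X w \<bullet> sum_in (dm T w) h = Sm (sum_in X h) \<bullet> conn (ac h) X \<bullet> Fmor (ac h) w"
  unfolding inds_def by simp

lemma sum_pr_inds:
  assumes g [simp]: "g \<in> carrier G"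
  shows "Sm (sum_pr X g) \<bullet> inds X w = (conn (ac g) X \<bullet> Fmor (ac g) w) \<bullet> sum_pr (dm T w) g"
proof (rule sum_ob_ext[of "dm T w"])
  fix h assume h [simp]: "h \<in> carrier G"
  have "Sm (sum_pr X g) \<bullet> Sm (sum_in X h) \<bullet> k = Sm (sum_pr X g \<bullet> sum_in X h) \<bullet> k" if "arr T k" "cd T k = Sg (Fob (ac h) X)" for k
    using that by (simp del: sum_ob_simps(8))
  then show "(Sm (sum_pr X g) \<bullet> inds X w) \<bullet> sum_in (dm T w) h = ((conn (ac g) X \<bullet> Fmor (ac g) w) \<bullet> sum_pr (dm T w) g) \<bullet> sum_in (dm T w) h"
    by (simp add: inds_sum_in)
qed simp_all

lemma inds_eqm: "eqm (ind (dm T w)) (sg (ind X)) (inds X w)"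
proof (rule eqmI)
  fix g assume g [simp]: "g \<in> carrier G"
  show "snd (sg (ind X)) g \<bullet> inds X w = Fmor (ac g) (inds X w) \<bullet> snd (ind (dm T w)) g"
  proof (rule sum_ob_ext_shift[of "dm T w", where g = g])
    fix h assume h [simp]: "h \<in> carrier G"
    let ?gh = "g \<otimes>\<^bsub>G\<^esub> h" and ?hX = "Fob (ac h) X"
    have e: "Sm (iv T (coh A g h X)) \<bullet> conn (ac ?gh) X = conn (ac g) ?hX \<bullet> Fmor (ac g) (conn (ac h) X) \<bullet> iv T (coh A g h (Sg X))"
    proof -
      have "Sm (coh A g h X) \<bullet> (Sm (iv T (coh A g h X)) \<bullet> conn (ac ?gh) X) =
          (conn (ac ?gh) X \<bullet> coh A g h (Sg X)) \<bullet> iv T (coh A g h (Sg X))" by simp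
      also have "\<dots> = Sm (coh A g h X) \<bullet> (conn (ac g) ?hX \<bullet> Fmor (ac g) (conn (ac h) X) \<bullet> iv T (coh A g h (Sg X)))"
        by (simp flip: coh_conn)
      finally show ?thesis by (subst (asm) iso_cancel_left) simp_all
    qed
    have "(snd (sg (ind X)) g \<bullet> inds X w) \<bullet> sum_in (dm T w) ?gh =
       iv T (conn (ac g) (sum_ob X)) \<bullet> Sm (rho X g) \<bullet> Sm (sum_in X ?gh) \<bullet> conn (ac ?gh) X \<bullet> Fmor (ac ?gh) w"
      by (simp add: inds_sum_in)
    also have "\<dots> = iv T (conn (ac g) (sum_ob X)) \<bullet> Sm (rho X g \<bullet> sum_in X ?gh) \<bullet> conn (ac ?gh) X \<bullet> Fmor (ac ?gh) w"
      by (simp del: rho(4))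
    also have "\<dots> = iv T (conn (ac g) (sum_ob X)) \<bullet> Sm (Fmor (ac g) (sum_in X h)) \<bullet> (Sm (iv T (coh A g h X)) \<bullet> conn (ac ?gh) X) \<bullet> Fmor (ac ?gh) w"
      by simp
    also have "\<dots> = Fmor (ac g) (Sm (sum_in X h)) \<bullet> Fmor (ac g) (conn (ac h) X) \<bullet> iv T (coh A g h (Sg X)) \<bullet> Fmor (ac ?gh) w"
      unfolding e by (simp add: conn_iv_nat)
    also have "\<dots> = Fmor (ac g) (Sm (sum_in X h) \<bullet> conn (ac h) X \<bullet> Fmor (ac h) w) \<bullet> iv T (coh A g h (dm T w))"
      by (simp add: coh_iv_nat)
    also have "\<dots> = Fmor (ac g) (inds X w \<bullet> sum_in (dm T w) h) \<bullet> iv T (coh A g h (dm T w))"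
      by (simp only: inds_sum_in[OF h])
    also have "\<dots> = (Fmor (ac g) (inds X w) \<bullet> snd (ind (dm T w)) g) \<bullet> sum_in (dm T w) ?gh" by simp
    finally show "(snd (sg (ind X)) g \<bullet> inds X w) \<bullet> sum_in (dm T w) ?gh =
       (Fmor (ac g) (inds X w) \<bullet> snd (ind (dm T w)) g) \<bullet> sum_in (dm T w) ?gh" .
  qed simp_all
qed simp_all

end

text \<open>The induced triangle is the direct sum of the translates of the given one.\<close>

lemma ind_exact:
  assumes e: "(u, v, w) \<in> Exact T"
  shows "(indm u, indm v, inds (dm T u) w) \<in> Exact T"
proof -
  note c = exact_cand[OF e, unfolded cand_def]
  show ?thesis
  proof (rule exact_of_family[of "carrier G" _ _ _ "\<lambda>h. Fmor (ac h) u" "\<lambda>h. Fmor (ac h) v" "\<lambda>h. conn (ac h) (dm T u) \<bullet> Fmor (ac h) w"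
        "sum_in (dm T u)" "sum_in (cd T u)" "sum_in (cd T v)" "sum_pr (dm T u)" "sum_pr (cd T u)" "sum_pr (cd T v)"])
    show "(Fmor (ac h) u, Fmor (ac h) v, conn (ac h) (dm T u) \<bullet> Fmor (ac h) w) \<in> Exact T" if "h \<in> carrier G" for h
      using tfun_exact[OF _ e exact_cand[OF e], of "ac h"] that by simp
    show "inds (dm T u) w \<bullet> sum_in (cd T v) h = Sm (sum_in (dm T u) h) \<bullet> conn (ac h) (dm T u) \<bullet> Fmor (ac h) w" if "h \<in> carrier G" for h
      using inds_sum_in[of "dm T u" w h] c that by simp
    show "(conn (ac h) (dm T u) \<bullet> Fmor (ac h) w) \<bullet> sum_pr (cd T v) h = Sm (sum_pr (dm T u) h) \<bullet> inds (dm T u) w" if "h \<in> carrier G" for h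
      using sum_pr_inds[of "dm T u" w h] c that by simp
  qed (use c sum_pr_indm[of u] sum_pr_indm[of v] in \<open>simp_all add: cand_def indm_sum_in\<close>)
qed

text \<open>The object \<open>X\<close> is the summand of the neutral element in its induced object. Hence every object of
  \<open>T\<close> is a retract of one that underlies an equivariant object, naturally in \<open>X\<close>.\<close>

definition incl where "incl X = sum_in X ee \<bullet> unit_at X"
definition retr where "retr X = iv T (unit_at X) \<bullet> sum_pr X ee"

lemma r_simps [simp]:
  assumes "X \<in> Ob T"
  shows "arr T (incl X)" "dm T (incl X) = X" "cd T (incl X) = sum_ob X" "arr T (retr X)" "dm T (retr X) = sum_ob X" "cd T (retr X) = X"
    "retr X \<bullet> incl X = Idt T X"
  unfolding incl_def retr_def using assms by (simp_all add: sum_ob_assoc)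

lemma unit_at_iv_nat: "arr T f \<Longrightarrow> iv T (unit_at (cd T f)) \<bullet> Fmor (ac ee) f = f \<bullet> iv T (unit_at (dm T f))"
proof -
  assume f: "arr T f"
  have "unit_at (cd T f) \<bullet> (iv T (unit_at (cd T f)) \<bullet> Fmor (ac ee) f) = (Fmor (ac ee) f \<bullet> unit_at (dm T f)) \<bullet> iv T (unit_at (dm T f))"
    using f by simp
  also have "\<dots> = unit_at (cd T f) \<bullet> (f \<bullet> iv T (unit_at (dm T f)))" using f by (subst unit_at_nat) simp_all
  finally show ?thesis using f by (subst (asm) iso_cancel_left) simp_all
qed

lemma incl_nat:
  assumes u: "arr T u" shows "indm u \<bullet> incl (dm T u) = incl (cd T u) \<bullet> u" "u \<bullet> retr (dm T u) = retr (cd T u) \<bullet> indm u"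
proof -
  show "indm u \<bullet> incl (dm T u) = incl (cd T u) \<bullet> u" unfolding incl_def using u by (simp add: indm_sum_in unit_at_nat)
  have "retr (cd T u) \<bullet> indm u = (iv T (unit_at (cd T u)) \<bullet> Fmor (ac ee) u) \<bullet> sum_pr (dm T u) ee"
    unfolding retr_def using u by (simp add: sum_pr_indm)
  also have "\<dots> = (u \<bullet> iv T (unit_at (dm T u))) \<bullet> sum_pr (dm T u) ee" unfolding unit_at_iv_nat[OF u] ..
  finally show "u \<bullet> retr (dm T u) = retr (cd T u) \<bullet> indm u" unfolding retr_def using u by simp
qed

lemma incl_susp_nat:
  assumes X [simp]: "X \<in> Ob T" and w [simp]: "arr T w" "cd T w = Sg X"
  shows "inds X w \<bullet> incl (dm T w) = Sm (incl X) \<bullet> w" "w \<bullet> retr (dm T w) = Sm (retr X) \<bullet> inds X w"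
proof -
  have "inds X w \<bullet> incl (dm T w) = Sm (sum_in X ee) \<bullet> conn (ac ee) X \<bullet> Fmor (ac ee) w \<bullet> unit_at (dm T w)"
    unfolding incl_def using comp_reassoc[OF inds_sum_in[OF X w G.one_closed], of "unit_at (dm T w)"] by simp
  then show "inds X w \<bullet> incl (dm T w) = Sm (incl X) \<bullet> w" unfolding incl_def by (simp add: unit_at_nat unit_at_conn)
  have "Sm (retr X) \<bullet> inds X w = iv T (Sm (unit_at X)) \<bullet> conn (ac ee) X \<bullet> Fmor (ac ee) w \<bullet> sum_pr (dm T w) ee"
    unfolding retr_def by (simp add: sum_pr_inds)
  also have "\<dots> = (iv T (unit_at (Sg X)) \<bullet> Fmor (ac ee) w) \<bullet> sum_pr (dm T w) ee"
    unfolding unit_at_conn[OF X] by simp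
  also have "\<dots> = w \<bullet> retr (dm T w)" using unit_at_iv_nat[OF w(1)] unfolding retr_def by simp
  finally show "w \<bullet> retr (dm T w) = Sm (retr X) \<bullet> inds X w" ..
qed

text \<open>Every exact triangle is a retract of the equivariant triangle that it induces, so only equivariant
  triangles have to be considered.\<close>

lemma exact_pres_dense:
  assumes F [simp]: "endo F" and m: "\<And>X. X \<in> Ob T \<Longrightarrow> mor T (Fob F (Sg X)) (Sg (Fob F X)) (\<omega> X)"
    and n: "\<And>f. arr T f \<Longrightarrow> Sm (Fmor F f) \<bullet> \<omega> (dm T f) = \<omega> (cd T f) \<bullet> Fmor F (Sm f)"
    and d: "\<And>x y z. (x, y, z) \<in> Exact T' \<Longrightarrow> (Fmor F (underlying x), Fmor F (underlying y), \<omega> (fst (fst x)) \<bullet> Fmor F (underlying z)) \<in> Exact T"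
    and e: "(u, v, w) \<in> Exact T"
  shows "(Fmor F u, Fmor F v, \<omega> (dm T u) \<bullet> Fmor F w) \<in> Exact T"
proof -
  note m1 [simp] = m[unfolded mor_iff]
  note c = exact_cand[OF e, unfolded cand_def]
  have o: "dm T u \<in> Ob T" "cd T u \<in> Ob T" "cd T v \<in> Ob T" using c by simp_all
  let ?x = "(ind (dm T u), indm u, ind (cd T u))" and ?y = "(ind (cd T u), indm v, ind (cd T v))"
    and ?z = "(ind (cd T v), inds (dm T u) w, sg (ind (dm T u)))"
  have "eqm (ind (cd T u)) (ind (cd T v)) (indm v)" "eqm (ind (dm T u)) (ind (cd T u)) (indm u)"
    "eqm (ind (cd T v)) (sg (ind (dm T u))) (inds (dm T u) w)"
    using indm_eqm[of v] indm_eqm[of u] inds_eqm[of "dm T u" w] c by simp_all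
  then have "(?x, ?y, ?z) \<in> Exact T'"
    unfolding T'_exact_iff using ind_exact[OF e] o by simp
  from d[OF this] have ee: "(Fmor F (indm u), Fmor F (indm v), \<omega> (sum_ob (dm T u)) \<bullet> Fmor F (inds (dm T u) w)) \<in> Exact T" by simp
  note r = incl_nat[of u] incl_nat[of v] incl_susp_nat[of "dm T u" w]
  have FF: "Fmor F (f \<bullet> f') = Fmor F (h \<bullet> h') \<Longrightarrow> arr T f \<Longrightarrow> arr T f' \<Longrightarrow> arr T h \<Longrightarrow> arr T h' \<Longrightarrow> dm T f = cd T f' \<Longrightarrow> dm T h = cd T h' \<Longrightarrow>
     Fmor F f \<bullet> Fmor F f' = Fmor F h \<bullet> Fmor F h'" for f f' h h' by simp
  have I: "Fmor F (retr X) \<bullet> Fmor F (incl X) = Idt T (Fob F X)" if "X \<in> Ob T" for X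
    using that by (simp flip: fun_comp)
  \<comment> \<open>the triangle is a retract of the induced one: a family with a single member\<close>
  have si: "finsum (Hom T X X) f {()} = f ()" if "mor T X X (f ())" "X \<in> Ob T" for X and f :: "unit \<Rightarrow> 'm"
    using that by (intro sum_single) auto
  show ?thesis
  proof (rule exact_of_family[of "{()}" _ _ _ "\<lambda>h. Fmor F (indm u)" "\<lambda>h. Fmor F (indm v)" "\<lambda>h. \<omega> (sum_ob (dm T u)) \<bullet> Fmor F (inds (dm T u) w)"
        "\<lambda>h. Fmor F (retr (dm T u))" "\<lambda>h. Fmor F (retr (cd T u))" "\<lambda>h. Fmor F (retr (cd T v))"
        "\<lambda>h. Fmor F (incl (dm T u))" "\<lambda>h. Fmor F (incl (cd T u))" "\<lambda>h. Fmor F (incl (cd T v))"])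
    show "Fmor F u \<bullet> Fmor F (retr (dm T u)) = Fmor F (retr (cd T u)) \<bullet> Fmor F (indm u)"
      "Fmor F (indm u) \<bullet> Fmor F (incl (dm T u)) = Fmor F (incl (cd T u)) \<bullet> Fmor F u"
      by (rule FF; use r c o in \<open>simp del: fun_comp\<close>)+
    show "Fmor F v \<bullet> Fmor F (retr (cd T u)) = Fmor F (retr (cd T v)) \<bullet> Fmor F (indm v)"
      "Fmor F (indm v) \<bullet> Fmor F (incl (cd T u)) = Fmor F (incl (cd T v)) \<bullet> Fmor F v"
      by (rule FF; use r c o in \<open>simp del: fun_comp\<close>)+
    have 1: "Fmor F w \<bullet> Fmor F (retr (cd T v)) = Fmor F (Sm (retr (dm T u))) \<bullet> Fmor F (inds (dm T u) w)"
      by (rule FF; use r c o in \<open>simp del: fun_comp\<close>)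
    have 2: "Fmor F (inds (dm T u) w) \<bullet> Fmor F (incl (cd T v)) = Fmor F (Sm (incl (dm T u))) \<bullet> Fmor F w"
      by (rule FF; use r c o in \<open>simp del: fun_comp\<close>)
    have 3: "Sm (Fmor F (retr (dm T u))) \<bullet> \<omega> (sum_ob (dm T u)) = \<omega> (dm T u) \<bullet> Fmor F (Sm (retr (dm T u)))"
      "Sm (Fmor F (incl (dm T u))) \<bullet> \<omega> (dm T u) = \<omega> (sum_ob (dm T u)) \<bullet> Fmor F (Sm (incl (dm T u)))"
      using n[of "retr (dm T u)"] n[of "incl (dm T u)"] o by simp_all
    show "(\<omega> (dm T u) \<bullet> Fmor F w) \<bullet> Fmor F (retr (cd T v)) = Sm (Fmor F (retr (dm T u))) \<bullet> \<omega> (sum_ob (dm T u)) \<bullet> Fmor F (inds (dm T u) w)"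
      using comp_reassoc[OF 3(1), of "Fmor F (inds (dm T u) w)"] 1 c o by simp
    show "(\<omega> (sum_ob (dm T u)) \<bullet> Fmor F (inds (dm T u) w)) \<bullet> Fmor F (incl (cd T v)) = Sm (Fmor F (incl (dm T u))) \<bullet> \<omega> (dm T u) \<bullet> Fmor F w"
      using comp_reassoc[OF 3(2), of "Fmor F w"] 2 c o by simp
  qed (use ee c o in \<open>simp_all add: cand_def si I\<close>)
qed

end

section \<open>Homogeneous components\<close>

context linear_category begin

lemma sum_shift:
  assumes "group H" "X \<in> Ob C" "Y \<in> Ob C" "a \<in> carrier H" "\<And>h. h \<in> carrier H \<Longrightarrow> mor C X Y (f h)"
  shows "finsum (Hom C X Y) (\<lambda>h. f (a \<otimes>\<^bsub>H\<^esub> h)) (carrier H) = finsum (Hom C X Y) f (carrier H)"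
proof -
  interpret H: group H by fact
  have "finsum (Hom C X Y) f ((\<lambda>h. a \<otimes>\<^bsub>H\<^esub> h) ` carrier H) = finsum (Hom C X Y) (\<lambda>h. f (a \<otimes>\<^bsub>H\<^esub> h)) (carrier H)"
    using assms
    by (intro abelian_monoid.finsum_reindex[OF abelian_group.axioms(1)[OF hom_abelian]])
      (auto intro!: in_hom H.inj_on_cmult)
  then show ?thesis using assms(4) by (simp add: H.surj_const_mult)
qed

lemma sum_pl:
  assumes "finite S" "X \<in> Ob C" "Y \<in> Ob C" "\<And>h. h \<in> S \<Longrightarrow> mor C X Y (f h)" "\<And>h. h \<in> S \<Longrightarrow> mor C X Y (g h)"
  shows "finsum (Hom C X Y) (\<lambda>h. pl C (f h) (g h)) S = pl C (finsum (Hom C X Y) f S) (finsum (Hom C X Y) g S)"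
proof -
  interpret H: abelian_group "Hom C X Y" using assms by (intro hom_abelian)
  note m = assms(4,5)[unfolded mor_iff]
  have "finsum (Hom C X Y) (\<lambda>h. pl C (f h) (g h)) S = finsum (Hom C X Y) (\<lambda>h. f h \<oplus>\<^bsub>Hom C X Y\<^esub> g h) S"
    using m by (intro finsum_cong_all refl) (simp add: pl_eq)
  also have "\<dots> = finsum (Hom C X Y) f S \<oplus>\<^bsub>Hom C X Y\<^esub> finsum (Hom C X Y) g S"
    using m by (intro H.finsum_addf) (auto intro!: in_hom)
  finally show ?thesis using assms(2,3) m by (simp add: pl_eq)
qed

end

context equivariant
begin

text \<open>The group acts linearly on the morphisms between two underlying objects by conjugation with the
  structure maps, and the morphisms of equivariant objects are the invariants.\<close>

definition conjugate where "conjugate P Q g f = iv T (snd Q g) \<bullet> Fmor (ac g) f \<bullet> snd P g"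

text \<open>The projection onto an isotypic component of this representation.\<close>

definition component where "component P Q \<chi> f =
   sc T (inv nG) (finsum (Hom T (fst P) (fst Q)) (\<lambda>g. sc T (\<chi> g) (conjugate P Q g f)) (carrier G))"

lemma inv_nG [simp]: "inv nG \<in> carrier K" "inv nG \<otimes> nG = \<one>"
  using nG by (simp_all add: field_Units)

context
  fixes P Q assumes P [simp]: "P \<in> Ob T'" and Q [simp]: "Q \<in> Ob T'"
begin

abbreviation hm where "hm f \<equiv> arr T f \<and> dm T f = fst P \<and> cd T f = fst Q"

lemma conjugate_mor [simp]:
  assumes "hm f" "g \<in> carrier G"
  shows "arr T (conjugate P Q g f)" "dm T (conjugate P Q g f) = fst P" "cd T (conjugate P Q g f) = fst Q"
  unfolding conjugate_def using assms by simp_all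

lemma conjugate_cj:
  assumes f: "hm f" and g: "g \<in> carrier G" "h \<in> carrier G"
  shows "conjugate P Q g (conjugate P Q h f) = conjugate P Q (g \<otimes>\<^bsub>G\<^esub> h) f"
  unfolding conjugate_def using f g by (simp add: eob_cocycle coh_nat)

lemma conjugate_one:
  assumes f: "hm f" shows "conjugate P Q ee f = f"
  unfolding conjugate_def using f by (simp add: eob_one unit_at_nat)

lemma conjugate_sc: "\<lbrakk>hm f; g \<in> carrier G; c \<in> carrier K\<rbrakk> \<Longrightarrow> conjugate P Q g (sc T c f) = sc T c (conjugate P Q g f)"
  unfolding conjugate_def by simp

lemma conjugate_pl: "\<lbrakk>hm f; hm f'; g \<in> carrier G\<rbrakk> \<Longrightarrow> conjugate P Q g (pl T f f') = pl T (conjugate P Q g f) (conjugate P Q g f')"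
  unfolding conjugate_def by (simp add: comp_pl fun_pl)

lemma conjugate_sum:
  assumes "finite S" "\<And>h. h \<in> S \<Longrightarrow> mor T (fst P) (fst Q) (a h)" "g \<in> carrier G"
  shows "conjugate P Q g (finsum (Hom T (fst P) (fst Q)) a S) = finsum (Hom T (fst P) (fst Q)) (\<lambda>h. conjugate P Q g (a h)) S"
  unfolding conjugate_def using assms(1,3) assms(2)[unfolded mor_iff] by simp

lemma eqm_tw_conjugate:
  assumes \<chi> [simp]: "\<chi> \<in> carrier D" and f: "hm f"
  shows "eqm P (tw \<chi> Q) f \<longleftrightarrow> (\<forall>g\<in>carrier G. conjugate P Q g f = sc T (\<chi> (inv\<^bsub>G\<^esub> g)) f)"
proof -
  have "sc T (\<chi> (inv\<^bsub>G\<^esub> g)) (snd Q g \<bullet> f) = Fmor (ac g) f \<bullet> snd P g \<longleftrightarrow> conjugate P Q g f = sc T (\<chi> (inv\<^bsub>G\<^esub> g)) f"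
    if g [simp]: "g \<in> carrier G" for g
  proof -
    have "snd Q g \<bullet> sc T (\<chi> (inv\<^bsub>G\<^esub> g)) f = Fmor (ac g) f \<bullet> snd P g \<longleftrightarrow>
        sc T (\<chi> (inv\<^bsub>G\<^esub> g)) f = iv T (snd Q g) \<bullet> Fmor (ac g) f \<bullet> snd P g"
      using f by (intro iso_move_left) simp_all
    then show ?thesis unfolding conjugate_def using f by auto
  qed
  then show ?thesis using f unfolding eqm_tw_iff[OF P Q \<chi>] by auto
qed

lemma eqm_hm: "eqm P (tw \<chi> Q) f \<Longrightarrow> hm f"
  using eqm_D(1-3)[of P "tw \<chi> Q" f] by simp

lemma component_mor [simp]:
  assumes "hm f" "\<chi> \<in> carrier D"
  shows "arr T (component P Q \<chi> f)" "dm T (component P Q \<chi> f) = fst P" "cd T (component P Q \<chi> f) = fst Q"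
  unfolding component_def using assms by simp_all

text \<open>A homogeneous morphism \<open>P \<rightarrow> Q\<close> of degree \<open>\<chi>\<close> is the same as a morphism of equivariant objects from
  \<open>P\<close> to the twist of \<open>Q\<close> by \<open>\<chi>\<close>. In this way \<open>T\<close>, restricted to underlying objects, is the orbit
  category of the equivariant objects under the dual action.\<close>

lemma component_eqm [simp]:
  assumes f: "hm f" and \<chi> [simp]: "\<chi> \<in> carrier D"
  shows "eqm P (tw \<chi> Q) (component P Q \<chi> f)"
proof (subst eqm_tw_conjugate[OF \<chi>])
  note [simp] = f
  let ?S = "finsum (Hom T (fst P) (fst Q))"
  show "\<forall>g\<in>carrier G. conjugate P Q g (component P Q \<chi> f) = sc T (\<chi> (inv\<^bsub>G\<^esub> g)) (component P Q \<chi> f)"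
  proof
    fix g assume g [simp]: "g \<in> carrier G"
    have "conjugate P Q g (component P Q \<chi> f) = sc T (inv nG) (?S (\<lambda>h. conjugate P Q g (sc T (\<chi> h) (conjugate P Q h f))) (carrier G))"
      unfolding component_def by (simp add: conjugate_sc conjugate_sum del: sc_sum)
    also have "?S (\<lambda>h. conjugate P Q g (sc T (\<chi> h) (conjugate P Q h f))) (carrier G) =
       ?S (\<lambda>h. sc T (\<chi> (inv\<^bsub>G\<^esub> g \<otimes>\<^bsub>G\<^esub> (g \<otimes>\<^bsub>G\<^esub> h))) (conjugate P Q (g \<otimes>\<^bsub>G\<^esub> h) f)) (carrier G)"
      by (intro finsum_cong_all refl) (simp add: conjugate_sc conjugate_cj)
    also have "\<dots> = ?S (\<lambda>h. sc T (\<chi> (inv\<^bsub>G\<^esub> g \<otimes>\<^bsub>G\<^esub> h)) (conjugate P Q h f)) (carrier G)"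
      by (rule sum_shift[OF G.is_group, where f = "\<lambda>h. sc T (\<chi> (inv\<^bsub>G\<^esub> g \<otimes>\<^bsub>G\<^esub> h)) (conjugate P Q h f)"]) simp_all
    also have "\<dots> = ?S (\<lambda>h. sc T (\<chi> (inv\<^bsub>G\<^esub> g)) (sc T (\<chi> h) (conjugate P Q h f))) (carrier G)"
      by (intro finsum_cong_all refl) (simp add: char_mult)
    also have "\<dots> = sc T (\<chi> (inv\<^bsub>G\<^esub> g)) (?S (\<lambda>h. sc T (\<chi> h) (conjugate P Q h f)) (carrier G))"
      by (subst sc_sum) simp_all
    also have "sc T (inv nG) \<dots> = sc T (\<chi> (inv\<^bsub>G\<^esub> g)) (component P Q \<chi> f)"
      unfolding component_def by (simp add: m_comm del: sc_sum)
    finally show "conjugate P Q g (component P Q \<chi> f) = sc T (\<chi> (inv\<^bsub>G\<^esub> g)) (component P Q \<chi> f)" .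
  qed
qed (use f in simp)

text \<open>Summation over all characters isolates the contribution of the neutral element.\<close>

lemma sum_component:
  assumes f: "hm f"
  shows "finsum (Hom T (fst P) (fst Q)) (\<lambda>\<chi>. component P Q \<chi> f) (carrier D) = f"
proof -
  note [simp] = f
  let ?S = "finsum (Hom T (fst P) (fst Q))"
  have "?S (\<lambda>\<chi>. component P Q \<chi> f) (carrier D) = sc T (inv nG) (?S (\<lambda>\<chi>. ?S (\<lambda>g. sc T (\<chi> g) (conjugate P Q g f)) (carrier G)) (carrier D))"
    unfolding component_def by (subst (2) sc_sum) simp_all
  also have "?S (\<lambda>\<chi>. ?S (\<lambda>g. sc T (\<chi> g) (conjugate P Q g f)) (carrier G)) (carrier D) =
     ?S (\<lambda>g. ?S (\<lambda>\<chi>. sc T (\<chi> g) (conjugate P Q g f)) (carrier D)) (carrier G)"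
    by (rule sum_swap) simp_all
  also have "\<dots> = ?S (\<lambda>g. if g = ee then sc T nG f else \<zero>\<^bsub>Hom T (fst P) (fst Q)\<^esub>) (carrier G)"
  proof (intro finsum_cong_all refl)
    fix g assume g [simp]: "g \<in> carrier G"
    have "?S (\<lambda>\<chi>. sc T (\<chi> g) (conjugate P Q g f)) (carrier D) = sc T (finsum K (\<lambda>\<chi>. \<chi> g) (carrier D)) (conjugate P Q g f)"
      by (rule sum_sc_left) simp_all
    also have "\<dots> = (if g = ee then sc T nG f else \<zero>\<^bsub>Hom T (fst P) (fst Q)\<^esub>)"
    proof (cases "g = ee")
      case True
      have "finsum K (\<lambda>\<chi>. \<chi> ee) (carrier D) = finsum K (\<lambda>\<chi>. \<one>) (carrier D)" by (intro finsum_cong_all refl) simp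
      then show ?thesis using True by (simp add: sum_D conjugate_one)
    qed (simp add: sum_chars sc_zero)
    finally show "?S (\<lambda>\<chi>. sc T (\<chi> g) (conjugate P Q g f)) (carrier D) = (if g = ee then sc T nG f else \<zero>\<^bsub>Hom T (fst P) (fst Q)\<^esub>)" .
  qed
  also have "\<dots> = sc T nG f" by (subst sum_single[where a = ee]) simp_all
  finally show ?thesis by simp
qed

text \<open>Orthogonality of the characters \<open>\<chi>\<close> and \<open>\<psi>\<close>.\<close>

lemma component_homog:
  assumes e: "eqm P (tw \<psi> Q) f" and [simp]: "\<psi> \<in> carrier D" "\<chi> \<in> carrier D"
  shows "component P Q \<chi> f = (if \<chi> = \<psi> then f else \<zero>\<^bsub>Hom T (fst P) (fst Q)\<^esub>)"
proof -
  have f [simp]: "hm f" using eqm_hm[OF e] .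
  let ?S = "finsum (Hom T (fst P) (fst Q))"
  have "?S (\<lambda>g. sc T (\<chi> g) (conjugate P Q g f)) (carrier G) = ?S (\<lambda>g. sc T ((\<chi> \<otimes>\<^bsub>D\<^esub> cinv \<psi>) g) f) (carrier G)"
    using e unfolding eqm_tw_conjugate[OF assms(2) f] by (intro finsum_cong_all refl) (simp add: D_mult cinv_def)
  also have "\<dots> = sc T (finsum K (\<chi> \<otimes>\<^bsub>D\<^esub> cinv \<psi>) (carrier G)) f"
    by (rule sum_sc_left) simp_all
  finally have 1: "component P Q \<chi> f = sc T (inv nG) (sc T (finsum K (\<chi> \<otimes>\<^bsub>D\<^esub> cinv \<psi>) (carrier G)) f)"
    unfolding component_def by simp
  show ?thesis
  proof (cases "\<chi> = \<psi>")
    case True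
    have "finsum K (\<chi> \<otimes>\<^bsub>D\<^esub> cinv \<psi>) (carrier G) = finsum K (\<lambda>g. \<one>) (carrier G)"
      unfolding True cinv_mult[OF assms(2)] by (intro finsum_cong_all refl) (simp add: D_one)
    then show ?thesis using 1 True by (simp flip: nG_def)
  next
    case False
    have "\<chi> \<otimes>\<^bsub>D\<^esub> cinv \<psi> \<noteq> \<one>\<^bsub>D\<^esub>"
    proof
      assume h: "\<chi> \<otimes>\<^bsub>D\<^esub> cinv \<psi> = \<one>\<^bsub>D\<^esub>"
      interpret D: comm_group D by (rule D_group)
      have "\<chi> \<otimes>\<^bsub>D\<^esub> cinv \<psi> = \<psi> \<otimes>\<^bsub>D\<^esub> cinv \<psi>" using h cinv_mult[of \<psi>] by simp
      then have "\<chi> = \<psi>" by simp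
      then show False using False by simp
    qed
    then show ?thesis using 1 False by (simp add: sum_char sc_zero)
  qed
qed

lemma component_pl:
  assumes "hm f" "hm f'" "\<chi> \<in> carrier D"
  shows "component P Q \<chi> (pl T f f') = pl T (component P Q \<chi> f) (component P Q \<chi> f')"
  unfolding component_def using assms by (simp add: conjugate_pl sc_pl sum_pl del: sc_sum cong: finsum_cong_all)

end

section \<open>Density of the underlying objects\<close>

text \<open>A morphism of underlying objects is the sum of its homogeneous components, and naturality is an
  additive condition on the morphism.\<close>

lemma homog_nat:
  assumes [simp]: "endo F" "endo H" and m: "\<And>P. P \<in> Ob T' \<Longrightarrow> mor T (Fob F (fst P)) (Fob H (fst P)) (\<eta> P)"
    and n: "\<And>P Q \<chi> f. \<lbrakk>P \<in> Ob T'; Q \<in> Ob T'; \<chi> \<in> carrier D; eqm P (tw \<chi> Q) f\<rbrakk> \<Longrightarrow> Fmor H f \<bullet> \<eta> P = \<eta> Q \<bullet> Fmor F f"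
    and [simp]: "P \<in> Ob T'" "Q \<in> Ob T'" and f: "arr T f" "dm T f = fst P" "cd T f = fst Q"
  shows "Fmor H f \<bullet> \<eta> P = \<eta> Q \<bullet> Fmor F f"
proof -
  note [simp] = m[unfolded mor_iff] f
  let ?f = "finsum (Hom T (fst P) (fst Q)) (\<lambda>\<chi>. component P Q \<chi> f) (carrier D)"
  have "Fmor H ?f \<bullet> \<eta> P = \<eta> Q \<bullet> Fmor F ?f"
    using n[of P Q _ "component P Q _ f"] by (simp cong: finsum_cong_all)
  then show ?thesis by (simp add: sum_component)
qed

text \<open>A family on equivariant objects is extended to \<open>X\<close> by restricting its value at the induced object
  along the retraction.\<close>

definition dense_ext where "dense_ext F H \<eta> X = Fmor H (retr X) \<bullet> \<eta> (ind X) \<bullet> Fmor F (incl X)"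

context
  fixes F :: "('o, 'm, 'o, 'm, 'u) lfunctor_scheme" and H :: "('o, 'm, 'o, 'm, 'v) lfunctor_scheme" and \<eta>
  assumes F [simp]: "endo F" and H [simp]: "endo H"
    and m: "\<And>P. P \<in> Ob T' \<Longrightarrow> isom T (\<eta> P) \<and> dm T (\<eta> P) = Fob F (fst P) \<and> cd T (\<eta> P) = Fob H (fst P)"
    and n: "\<And>P Q \<chi> f. \<lbrakk>P \<in> Ob T'; Q \<in> Ob T'; \<chi> \<in> carrier D; eqm P (tw \<chi> Q) f\<rbrakk> \<Longrightarrow> Fmor H f \<bullet> \<eta> P = \<eta> Q \<bullet> Fmor F f"
begin

lemma dense_ext_base_nat:
  assumes "P \<in> Ob T'" "Q \<in> Ob T'" "arr T f" "dm T f = fst P" "cd T f = fst Q"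
  shows "Fmor H f \<bullet> \<eta> P = \<eta> Q \<bullet> Fmor F f" "\<lbrakk>arr T k; cd T k = Fob F (fst P)\<rbrakk> \<Longrightarrow> Fmor H f \<bullet> \<eta> P \<bullet> k = \<eta> Q \<bullet> Fmor F f \<bullet> k"
proof -
  show *: "Fmor H f \<bullet> \<eta> P = \<eta> Q \<bullet> Fmor F f"
    by (rule homog_nat[OF F H _ n assms]) (use m in simp_all)
  show "\<lbrakk>arr T k; cd T k = Fob F (fst P)\<rbrakk> \<Longrightarrow> Fmor H f \<bullet> \<eta> P \<bullet> k = \<eta> Q \<bullet> Fmor F f \<bullet> k"
    by (rule comp_reassoc[OF *]) (use m assms in simp_all)
qed

lemma dense_ext_mor [simp]:
  assumes "X \<in> Ob T"
  shows "isom T (dense_ext F H \<eta> X)" "dm T (dense_ext F H \<eta> X) = Fob F X" "cd T (dense_ext F H \<eta> X) = Fob H X"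
proof -
  note [simp] = assms m
  have 1: "arr T (dense_ext F H \<eta> X)" "dm T (dense_ext F H \<eta> X) = Fob F X" "cd T (dense_ext F H \<eta> X) = Fob H X"
    unfolding dense_ext_def by simp_all
  then show "dm T (dense_ext F H \<eta> X) = Fob F X" "cd T (dense_ext F H \<eta> X) = Fob H X" by simp_all
  let ?e = "\<eta> (ind X)" and ?p = "incl X \<bullet> retr X"
  \<comment> \<open>the inverse is the inverse of \<open>\<eta>\<close> at the induced object, restricted in the same way\<close>
  define j where "j = Fmor F (retr X) \<bullet> iv T ?e \<bullet> Fmor H (incl X)"
  have j: "arr T j" "dm T j = Fob H X" "cd T j = Fob F X" unfolding j_def by simp_all
  have rr: "Fmor L (retr X) \<bullet> Fmor L (incl X) = Idt T (Fob L X)" if "endo L" for L :: "('o, 'm, 'o, 'm, 'w) lfunctor_scheme"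
    using that by (simp flip: fun_comp)
  have r2: "Fmor L (retr X) \<bullet> Fmor L ?p = Fmor L (retr X)" "Fmor L ?p \<bullet> Fmor L (incl X) = Fmor L (incl X)" if "endo L" for L :: "('o, 'm, 'o, 'm, 'w) lfunctor_scheme"
  proof -
    have "Fmor L (retr X) \<bullet> Fmor L ?p = (Fmor L (retr X) \<bullet> Fmor L (incl X)) \<bullet> Fmor L (retr X)" using that by simp
    then show "Fmor L (retr X) \<bullet> Fmor L ?p = Fmor L (retr X)" using that by (simp add: rr del: assoc)
    have "Fmor L ?p \<bullet> Fmor L (incl X) = Fmor L (incl X) \<bullet> (Fmor L (retr X) \<bullet> Fmor L (incl X))" using that by simp
    then show "Fmor L ?p \<bullet> Fmor L (incl X) = Fmor L (incl X)" using that by (simp add: rr)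
  qed
  have ne: "Fmor H ?p \<bullet> ?e = ?e \<bullet> Fmor F ?p" by (rule dense_ext_base_nat) simp_all
  have "dense_ext F H \<eta> X \<bullet> j = Fmor H (retr X) \<bullet> (?e \<bullet> Fmor F ?p) \<bullet> iv T ?e \<bullet> Fmor H (incl X)"
    unfolding dense_ext_def j_def by simp
  also have "\<dots> = (Fmor H (retr X) \<bullet> Fmor H ?p) \<bullet> Fmor H (incl X)"
    unfolding ne[symmetric] by simp
  also have "\<dots> = Idt T (Fob H X)" by (simp add: r2 rr del: fun_comp)
  finally have a: "dense_ext F H \<eta> X \<bullet> j = Idt T (Fob H X)" .
  have "j \<bullet> dense_ext F H \<eta> X = Fmor F (retr X) \<bullet> iv T ?e \<bullet> (Fmor H ?p \<bullet> ?e) \<bullet> Fmor F (incl X)"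
    unfolding dense_ext_def j_def by simp
  also have "\<dots> = Fmor F (retr X) \<bullet> (Fmor F ?p \<bullet> Fmor F (incl X))"
    unfolding ne by simp
  also have "\<dots> = Idt T (Fob F X)" by (simp add: r2 rr del: fun_comp)
  finally show "isom T (dense_ext F H \<eta> X)" using isomI(1)[of "dense_ext F H \<eta> X" j] 1 j a by simp
qed

lemma dense_ext_nat:
  assumes f: "arr T f"
  shows "Fmor H f \<bullet> dense_ext F H \<eta> (dm T f) = dense_ext F H \<eta> (cd T f) \<bullet> Fmor F f"
proof -
  note [simp] = f m
  let ?X = "dm T f" and ?Y = "cd T f"
  have "Fmor H f \<bullet> dense_ext F H \<eta> ?X = Fmor H (retr ?Y \<bullet> (incl ?Y \<bullet> f \<bullet> retr ?X)) \<bullet> \<eta> (ind ?X) \<bullet> Fmor F (incl ?X)"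
  proof -
    have "retr ?Y \<bullet> (incl ?Y \<bullet> f \<bullet> retr ?X) = (retr ?Y \<bullet> incl ?Y) \<bullet> f \<bullet> retr ?X" by (simp del: r_simps(7))
    then have "retr ?Y \<bullet> (incl ?Y \<bullet> f \<bullet> retr ?X) = f \<bullet> retr ?X" by simp
    then show ?thesis unfolding dense_ext_def by simp
  qed
  also have "\<dots> = Fmor H (retr ?Y) \<bullet> (Fmor H (incl ?Y \<bullet> f \<bullet> retr ?X) \<bullet> \<eta> (ind ?X)) \<bullet> Fmor F (incl ?X)" by simp
  also have "Fmor H (incl ?Y \<bullet> f \<bullet> retr ?X) \<bullet> \<eta> (ind ?X) = \<eta> (ind ?Y) \<bullet> Fmor F (incl ?Y \<bullet> f \<bullet> retr ?X)"
    by (rule dense_ext_base_nat) simp_all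
  also have "Fmor H (retr ?Y) \<bullet> (\<eta> (ind ?Y) \<bullet> Fmor F (incl ?Y \<bullet> f \<bullet> retr ?X)) \<bullet> Fmor F (incl ?X) =
     Fmor H (retr ?Y) \<bullet> \<eta> (ind ?Y) \<bullet> Fmor F (incl ?Y) \<bullet> Fmor F f \<bullet> Fmor F (retr ?X \<bullet> incl ?X)"
    by (simp del: r_simps(7))
  also have "\<dots> = dense_ext F H \<eta> ?Y \<bullet> Fmor F f" unfolding dense_ext_def by simp
  finally show ?thesis .
qed

text \<open>For \<open>X\<close> underlying \<open>P\<close> the retraction from the induced object of \<open>X\<close> to \<open>P\<close> is a morphism of
  underlying objects but not of equivariant objects. This is where naturality is needed for
  morphisms of all degrees.\<close>

lemma dense_ext_eq: assumes P: "P \<in> Ob T'" shows "dense_ext F H \<eta> (fst P) = \<eta> P"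
proof -
  note [simp] = P m
  have "dense_ext F H \<eta> (fst P) = (Fmor H (retr (fst P)) \<bullet> \<eta> (ind (fst P))) \<bullet> Fmor F (incl (fst P))"
    unfolding dense_ext_def by simp
  also have "Fmor H (retr (fst P)) \<bullet> \<eta> (ind (fst P)) = \<eta> P \<bullet> Fmor F (retr (fst P))"
    by (rule dense_ext_base_nat) simp_all
  also have "(\<eta> P \<bullet> Fmor F (retr (fst P))) \<bullet> Fmor F (incl (fst P)) = \<eta> P \<bullet> Fmor F (retr (fst P) \<bullet> incl (fst P))"
    by (simp del: r_simps(7))
  finally show ?thesis by simp
qed

end

text \<open>Each of the two families is recovered from its value at the induced object by naturality along
  \<open>incl X\<close> and \<open>retr X\<close>.\<close>

lemma dense_eq:
  assumes [simp]: "endo F" "endo H"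
    and a: "\<And>X. X \<in> Ob T \<Longrightarrow> mor T (Fob F X) (Fob H X) (a X)" and an: "\<And>f. arr T f \<Longrightarrow> Fmor H f \<bullet> a (dm T f) = a (cd T f) \<bullet> Fmor F f"
    and b: "\<And>X. X \<in> Ob T \<Longrightarrow> mor T (Fob F X) (Fob H X) (b X)" and bn: "\<And>f. arr T f \<Longrightarrow> Fmor H f \<bullet> b (dm T f) = b (cd T f) \<bullet> Fmor F f"
    and e: "\<And>P. P \<in> Ob T' \<Longrightarrow> a (fst P) = b (fst P)" and X [simp]: "X \<in> Ob T"
  shows "a X = b X"
proof -
  note [simp] = a[unfolded mor_iff] b[unfolded mor_iff]
  have *: "c X = Fmor H (retr X) \<bullet> c (sum_ob X) \<bullet> Fmor F (incl X)"
    if c: "\<And>X. X \<in> Ob T \<Longrightarrow> mor T (Fob F X) (Fob H X) (c X)" and n: "\<And>f. arr T f \<Longrightarrow> Fmor H f \<bullet> c (dm T f) = c (cd T f) \<bullet> Fmor F f" for c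
  proof -
    note [simp] = c[unfolded mor_iff]
    have "Fmor H (retr X) \<bullet> c (sum_ob X) \<bullet> Fmor F (incl X) = (Fmor H (retr X) \<bullet> c (sum_ob X)) \<bullet> Fmor F (incl X)" by simp
    also have "\<dots> = c X \<bullet> Fmor F (retr X \<bullet> incl X)" using n[of "retr X"] by (simp del: r_simps(7))
    finally show ?thesis by simp
  qed
  show ?thesis using *[OF a an] *[OF b bn] e[of "ind X"] by simp
qed

end

context equivariant
begin

section \<open>Equivariantization\<close>

abbreviation zo where "zo \<equiv> eqvz_ob G T"
abbreviation fz where "fz \<equiv> eqvz_functor G T A"

lemma zo_fst [simp]: "fst (zo (F, \<delta>) P) = Fob F (fst P)"
  by (cases P) (simp add: eqvz_ob_def)

lemma zo_snd [simp]: "g \<in> carrier G \<Longrightarrow> snd (zo (F, \<delta>) P) g = \<delta> g (fst P) \<bullet> Fmor F (snd P g)"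
  by (cases P) (simp add: eqvz_ob_def)

lemma zo_ext: "snd (zo x P) \<in> extensional (carrier G)"
  by (cases P; cases x) (simp add: eqvz_ob_def)

lemma fz_eq: "fz x = (fst (fz x), snd (fz x))" by simp

lemma fz_simps [simp]: "Fob (fst (fz x)) = zo x"
  "Fmor (fst (fz x)) t = (zo x (fst t), Fmor (fst x) (underlying t), zo x (snd (snd t)))"
  "conn (fst (fz x)) P = (zo x (sg P), conn (fst x) (fst P), sg (zo x P))"
  "snd (fz x) \<chi> P = (zo x (tw \<chi> P), Idt T (fst (zo x (tw \<chi> P))), zo x (tw \<chi> P))"
  by (simp_all add: eqvz_functor_def case_prod_beta)

context
  fixes F :: "('o, 'm, 'o, 'm) tfunctor" and \<delta> assumes xe: "ea (F, \<delta>)"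
begin

lemmas xs = ea_simps[OF xe]
declare xs [simp]

lemma zo_ob [simp]: assumes P [simp]: "P \<in> Ob T'" shows "zo (F, \<delta>) P \<in> Ob T'"
proof -
  have "(Fob F (fst P), \<lambda>g\<in>carrier G. snd (zo (F, \<delta>) P) g) \<in> Ob T'"
    by (rule eobI) (simp_all add: eob_cocycle[of P] ea_coh[OF xe] ea_nat[OF xe])
  then show ?thesis using ob_restrict[OF zo_ext[of "(F, \<delta>)" P]] by simp
qed

lemma zo_eqm [simp]:
  assumes e: "eqm P Q f" and [simp]: "P \<in> Ob T'" "Q \<in> Ob T'"
  shows "eqm (zo (F, \<delta>) P) (zo (F, \<delta>) Q) (Fmor F f)"
proof (rule eqmI)
  note [simp] = eqm_D(1-3)[OF e]
  fix g assume g [simp]: "g \<in> carrier G"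
  have "Fmor F (snd Q g) \<bullet> Fmor F f = Fmor F (Fmor (ac g) f) \<bullet> Fmor F (snd P g)"
    using eqm_D(4)[OF e g] by (simp flip: fun_comp)
  then show "snd (zo (F, \<delta>) Q) g \<bullet> Fmor F f = Fmor (ac g) (Fmor F f) \<bullet> snd (zo (F, \<delta>) P) g"
    by (simp add: ea_nat[OF xe])
qed (use eqm_D(1-3)[OF e] in simp_all)

lemma zo_tw [simp]: "\<lbrakk>P \<in> Ob T'; \<chi> \<in> carrier D\<rbrakk> \<Longrightarrow> zo (F, \<delta>) (tw \<chi> P) = tw \<chi> (zo (F, \<delta>) P)"
  by (rule eob_eqI) simp_all

lemma zo_conn [simp]:
  assumes P [simp]: "P \<in> Ob T'"
  shows "eqm (zo (F, \<delta>) (sg P)) (sg (zo (F, \<delta>) P)) (conn F (fst P))"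
proof (rule eqmI)
  fix g assume g [simp]: "g \<in> carrier G"
  let ?X = "fst P" let ?c = "conn (ac g) (Fob F ?X)"
  have "?c \<bullet> (snd (sg (zo (F, \<delta>) P)) g \<bullet> conn F ?X) = Sm (\<delta> g ?X) \<bullet> Sm (Fmor F (snd P g)) \<bullet> conn F ?X"
    by simp
  also have "\<dots> = Sm (\<delta> g ?X) \<bullet> conn F (Fob (ac g) ?X) \<bullet> Fmor F (Sm (snd P g))"
    by (simp add: tfun_nat)
  also have "\<dots> = (Sm (\<delta> g ?X) \<bullet> conn F (Fob (ac g) ?X) \<bullet> Fmor F (conn (ac g) ?X)) \<bullet> Fmor F (iv T (conn (ac g) ?X)) \<bullet> Fmor F (Sm (snd P g))"
    by simp
  also have "\<dots> = ?c \<bullet> (Fmor (ac g) (conn F ?X) \<bullet> snd (zo (F, \<delta>) (sg P)) g)"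
    unfolding ea_conn[OF xe g eob(1)[OF P]] by simp
  finally show "snd (sg (zo (F, \<delta>) P)) g \<bullet> conn F ?X = Fmor (ac g) (conn F ?X) \<bullet> snd (zo (F, \<delta>) (sg P)) g"
    by (subst (asm) iso_cancel_left) simp_all
qed simp_all

lemma fz_endo [simp]: "T'.endo (fst (fz (F, \<delta>)))"
proof (rule T'.endoI)
  fix x assume "arr T' x"
  then show "mor T' (Fob (fst (fz (F, \<delta>))) (dm T' x)) (Fob (fst (fz (F, \<delta>))) (cd T' x)) (Fmor (fst (fz (F, \<delta>))) x)"
    by (auto simp del: T'.mor_iff simp: T'_mor_iff elim: T'_arrE)
next
  fix x y assume "arr T' x" "arr T' y" "dm T' y = cd T' x"
  then show "Fmor (fst (fz (F, \<delta>))) (y \<cdot>\<^bsub>T'\<^esub> x) = Fmor (fst (fz (F, \<delta>))) y \<cdot>\<^bsub>T'\<^esub> Fmor (fst (fz (F, \<delta>))) x"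
    by (elim T'_arrE) simp
next
  fix x y assume a: "arr T' x" "arr T' y" "dm T' y = dm T' x" "cd T' y = cd T' x"
  obtain P f Q where x: "x = (P, f, Q)" "P \<in> Ob T'" "Q \<in> Ob T'" "eqm P Q f" "arr T f" "dm T f = fst P" "cd T f = fst Q"
    using T'_arrE[OF a(1)] .
  obtain f' where y: "y = (P, f', Q)" "eqm P Q f'" "arr T f'" "dm T f' = fst P" "cd T f' = fst Q"
    using T'_arrE2[OF a(2), of P Q] a x by auto
  show "Fmor (fst (fz (F, \<delta>))) (pl T' x y) = pl T' (Fmor (fst (fz (F, \<delta>))) x) (Fmor (fst (fz (F, \<delta>))) y)"
    using x y by (simp add: T'_pl fun_pl)
next
  fix x c assume a: "arr T' x" "c \<in> carrier K"
  obtain P f Q where x: "x = (P, f, Q)" "P \<in> Ob T'" "Q \<in> Ob T'" "eqm P Q f" "arr T f" "dm T f = fst P" "cd T f = fst Q"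
    using T'_arrE[OF a(1)] .
  show "Fmor (fst (fz (F, \<delta>))) (sc T' c x) = sc T' c (Fmor (fst (fz (F, \<delta>))) x)"
    using x a(2) by (simp add: T'_sc)
qed simp_all

lemma fz_tfun [simp]: "triangle_functor K T' T' (fst (fz (F, \<delta>)))"
proof (rule T'.triangle_functorI)
  fix x assume x: "arr T' x"
  then obtain P f Q where "x = (P, f, Q)" "P \<in> Ob T'" "Q \<in> Ob T'" "eqm P Q f" "arr T f" "dm T f = fst P" "cd T f = fst Q"
    by (rule T'_arrE)
  then show "Fmor (Susp T') (Fmor (fst (fz (F, \<delta>))) x) \<cdot>\<^bsub>T'\<^esub> conn (fst (fz (F, \<delta>))) (dm T' x) =
     conn (fst (fz (F, \<delta>))) (cd T' x) \<cdot>\<^bsub>T'\<^esub> Fmor (fst (fz (F, \<delta>))) (Fmor (Susp T') x)"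
    by (simp add: tfun_nat)
next
  fix x y z assume e: "(x, y, z) \<in> Exact T'"
  note f = e[unfolded T'_exact_iff]
  obtain P f0 Q where x: "x = (P, f0, Q)" "P \<in> Ob T'" "Q \<in> Ob T'" "eqm P Q f0" "arr T f0" "dm T f0 = fst P" "cd T f0 = fst Q"
    using f T'_arrE[of x] by metis
  obtain f' R where y: "y = (Q, f', R)" "R \<in> Ob T'" "eqm Q R f'" "arr T f'" "dm T f' = fst Q" "cd T f' = fst R"
    using f x T'_arrE[of y] by (metis fst_conv snd_conv)
  obtain f'' where z: "z = (R, f'', sg P)" "eqm R (sg P) f''" "arr T f''" "dm T f'' = fst R" "cd T f'' = Sg (fst P)"
    using f x y T'_arrE2[of z R "sg P"] by auto
  have "(f0, f', f'') \<in> Exact T" using f x y z by simp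
  then have "(Fmor F f0, Fmor F f', conn F (fst P) \<bullet> Fmor F f'') \<in> Exact T"
    using tfun_exact[OF xs(1)] exact_cand x by metis
  moreover have "eqm (zo (F, \<delta>) R) (sg (zo (F, \<delta>) P)) (conn F (fst P) \<bullet> Fmor F f'')"
    by (rule eqm_comp[OF zo_eqm[OF z(2)] zo_conn]) (use x y in simp_all)
  ultimately show "(Fmor (fst (fz (F, \<delta>))) x, Fmor (fst (fz (F, \<delta>))) y, conn (fst (fz (F, \<delta>))) (dm T' x) \<cdot>\<^bsub>T'\<^esub> Fmor (fst (fz (F, \<delta>))) z) \<in> Exact T'"
    unfolding T'_exact_iff using x y z by simp
qed simp_all

text \<open>Full faithfulness is inherited from \<open>F\<close>. For essential surjectivity, the structure maps of an
  equivariant object \<open>Q\<close> are carried over to a preimage of its underlying object; the cocycle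
  condition is verified after applying \<open>F\<close>.\<close>

lemma fz_equi [simp]: "T'.equi (fst (fz (F, \<delta>)))"
  unfolding T'.equi_def
proof (intro conjI allI impI ballI)
  fix x y assume a: "arr T' x" "arr T' y" "dm T' x = dm T' y" "cd T' x = cd T' y" "Fmor (fst (fz (F, \<delta>))) x = Fmor (fst (fz (F, \<delta>))) y"
  obtain P f Q where x: "x = (P, f, Q)" "P \<in> Ob T'" "Q \<in> Ob T'" "eqm P Q f" "arr T f" "dm T f = fst P" "cd T f = fst Q"
    using T'_arrE[OF a(1)] .
  obtain f' where y: "y = (P, f', Q)" "eqm P Q f'" "arr T f'" "dm T f' = fst P" "cd T f' = fst Q"
    using T'_arrE2[OF a(2), of P Q] a x by auto
  have "f = f'" by (rule equi_faithful[OF xs(2)]) (use x y a in simp_all)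
  then show "x = y" using x y by simp
next
  fix P Q t assume P [simp]: "P \<in> Ob T'" and Q [simp]: "Q \<in> Ob T'" and "mor T' (Fob (fst (fz (F, \<delta>))) P) (Fob (fst (fz (F, \<delta>))) Q) t"
  then have t: "fst t = zo (F, \<delta>) P" "snd (snd t) = zo (F, \<delta>) Q" and e: "eqm (zo (F, \<delta>) P) (zo (F, \<delta>) Q) (underlying t)"
    by (simp_all add: T'_mor_iff del: T'.mor_iff)
  define h where "h = underlying t"
  have h [simp]: "arr T h" "dm T h = Fob F (fst P)" "cd T h = Fob F (fst Q)"
    using eqm_D(1-3)[OF e] by (simp_all add: h_def)
  define f where "f = rfl F (fst P) (fst Q) h"
  have f [simp]: "arr T f" "dm T f = fst P" "cd T f = fst Q" "Fmor F f = h" unfolding f_def by simp_all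
  have "eqm P Q f"
  proof (rule eqmI)
    fix g assume g [simp]: "g \<in> carrier G"
    show "snd Q g \<bullet> f = Fmor (ac g) f \<bullet> snd P g"
    proof (rule equi_faithful[OF xs(2)])
      have "\<delta> g (fst Q) \<bullet> Fmor F (snd Q g \<bullet> f) = snd (zo (F, \<delta>) Q) g \<bullet> h" by simp
      also have "\<dots> = Fmor (ac g) (Fmor F f) \<bullet> snd (zo (F, \<delta>) P) g" using eqm_D(4)[OF e g] by (simp add: h_def)
      also have "\<dots> = \<delta> g (fst Q) \<bullet> Fmor F (Fmor (ac g) f \<bullet> snd P g)"
        using ea_nat(2)[OF xe g, of f "fst P" "Fmor F (snd P g)"] by simp
      finally show "Fmor F (snd Q g \<bullet> f) = Fmor F (Fmor (ac g) f \<bullet> snd P g)"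
        by (subst (asm) iso_cancel_left) simp_all
    qed simp_all
  qed simp_all
  then show "\<exists>s. mor T' P Q s \<and> Fmor (fst (fz (F, \<delta>))) s = t"
    using t by (intro exI[of _ "(P, f, Q)"]) (simp add: prod_eq_iff h_def)
next
  fix Q assume Q [simp]: "Q \<in> Ob T'"
  let ?X = "qob F (fst Q)" and ?t = "qth F (fst Q)"
  define \<alpha> where "\<alpha> g = rfl F ?X (Fob (ac g) ?X) (iv T (\<delta> g ?X) \<bullet> Fmor (ac g) (iv T ?t) \<bullet> snd Q g \<bullet> ?t)" for g
  have a [simp]: "arr T (\<alpha> g)" "dm T (\<alpha> g) = ?X" "cd T (\<alpha> g) = Fob (ac g) ?X"
    "Fmor F (\<alpha> g) = iv T (\<delta> g ?X) \<bullet> Fmor (ac g) (iv T ?t) \<bullet> snd Q g \<bullet> ?t" if "g \<in> carrier G" for g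
    unfolding \<alpha>_def using that by simp_all
  have ai [simp]: "isom T (\<alpha> g)" if "g \<in> carrier G" for g
    by (rule equi_isom[OF _ xs(2)]) (use that in simp_all)
  define P where "P = (?X, \<lambda>g\<in>carrier G. \<alpha> g)"
  have P [simp]: "P \<in> Ob T'" unfolding P_def
  proof (rule eobI)
    fix g h assume g [simp]: "g \<in> carrier G" and h [simp]: "h \<in> carrier G"
    show "\<alpha> (g \<otimes>\<^bsub>G\<^esub> h) = coh A g h ?X \<bullet> Fmor (ac g) (\<alpha> h) \<bullet> \<alpha> g"
    proof (rule equi_faithful[OF xs(2)])
      have "\<delta> (g \<otimes>\<^bsub>G\<^esub> h) ?X \<bullet> Fmor F (coh A g h ?X \<bullet> Fmor (ac g) (\<alpha> h) \<bullet> \<alpha> g) =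
         coh A g h (Fob F ?X) \<bullet> Fmor (ac g) (\<delta> h ?X) \<bullet> Fmor (ac g) (Fmor F (\<alpha> h)) \<bullet> \<delta> g ?X \<bullet> Fmor F (\<alpha> g)"
        by (simp add: ea_coh[OF xe] ea_nat[OF xe] del: a(4))
      also have "\<dots> = coh A g h (Fob F ?X) \<bullet> Fmor (ac g) (Fmor (ac h) (iv T ?t)) \<bullet> Fmor (ac g) (snd Q h) \<bullet> snd Q g \<bullet> ?t"
        by simp
      also have "\<dots> = Fmor (ac (g \<otimes>\<^bsub>G\<^esub> h)) (iv T ?t) \<bullet> coh A g h (fst Q) \<bullet> Fmor (ac g) (snd Q h) \<bullet> snd Q g \<bullet> ?t"
        using coh_nat(2)[of g h "iv T ?t" "fst Q" "Fmor (ac g) (snd Q h) \<bullet> snd Q g \<bullet> ?t"] by simp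
      also have "\<dots> = \<delta> (g \<otimes>\<^bsub>G\<^esub> h) ?X \<bullet> Fmor F (\<alpha> (g \<otimes>\<^bsub>G\<^esub> h))" by (simp add: eob_cocycle)
      finally show "Fmor F (\<alpha> (g \<otimes>\<^bsub>G\<^esub> h)) = Fmor F (coh A g h ?X \<bullet> Fmor (ac g) (\<alpha> h) \<bullet> \<alpha> g)"
        by (subst (asm) iso_cancel_left) simp_all
    qed simp_all
  qed simp_all
  have "eqm (zo (F, \<delta>) P) Q ?t"
    by (rule eqmI) (simp_all add: P_def)
  then show "\<exists>Y\<in>Ob T'. \<exists>\<theta>. isom T' \<theta> \<and> dm T' \<theta> = Fob (fst (fz (F, \<delta>))) Y \<and> cd T' \<theta> = Q"
    by (intro bexI[of _ P] exI[of _ "(zo (F, \<delta>) P, ?t, Q)"]) simp_all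
qed

lemma fz_ea [simp]: "T'.ea (fz (F, \<delta>))"
proof (subst fz_eq, rule T'.eaI)
  fix \<chi> assume \<chi> [simp]: "\<chi> \<in> carrier D"
  have "tri_nat_iso T' T' (tcomp T' (fst (fz (F, \<delta>))) (act A' \<chi>)) (tcomp T' (act A' \<chi>) (fst (fz (F, \<delta>))))
      (\<lambda>P. Idt T' (Fob (tcomp T' (fst (fz (F, \<delta>))) (act A' \<chi>)) P))"
  proof (rule T'.tni_eq)
    fix t assume "arr T' t"
    then show "Fmor (tcomp T' (act A' \<chi>) (fst (fz (F, \<delta>)))) t = Fmor (tcomp T' (fst (fz (F, \<delta>))) (act A' \<chi>)) t"
      by (elim T'_arrE) simp
  qed (simp_all add: tw_sg)
  then show "tri_nat_iso T' T' (tcomp T' (fst (fz (F, \<delta>))) (act A' \<chi>)) (tcomp T' (act A' \<chi>) (fst (fz (F, \<delta>)))) (snd (fz (F, \<delta>)) \<chi>)"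
    by (rule T'.tni_cong) simp_all
next
  interpret D: comm_group D by (rule D_group)
  show "snd (fz (F, \<delta>)) (\<chi> \<otimes>\<^bsub>D\<^esub> \<psi>) P \<cdot>\<^bsub>T'\<^esub> Fmor (fst (fz (F, \<delta>))) (coh A' \<chi> \<psi> P) =
       coh A' \<chi> \<psi> (Fob (fst (fz (F, \<delta>))) P) \<cdot>\<^bsub>T'\<^esub> Fmor (act A' \<chi>) (snd (fz (F, \<delta>)) \<psi> P) \<cdot>\<^bsub>T'\<^esub> snd (fz (F, \<delta>)) \<chi> (Fob (act A' \<psi>) P)"
    if "\<chi> \<in> carrier D" "\<psi> \<in> carrier D" "P \<in> Ob T'" for \<chi> \<psi> P
    using that by (simp add: tw_tw)
qed simp_all

end

lemma fz_ea': "ea x \<Longrightarrow> T'.ea (fz x)"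
  by (cases x) (simp add: fz_ea)

lemma fz_ei:
  assumes "ei x y" "ea x" "ea y" shows "T'.ei (fz x) (fz y)"
proof -
  obtain F \<delta> F' \<delta>' where xy [simp]: "x = (F, \<delta>)" "y = (F', \<delta>')" by (metis surj_pair)
  note xe = assms(2,3)[unfolded xy]
  note [simp] = ea_simps[OF xe(1)] ea_simps[OF xe(2)]
  note [simp] = zo_ob[OF xe(1)] zo_ob[OF xe(2)] fz_endo[OF xe(1)] fz_endo[OF xe(2)] zo_tw[OF xe(1)] zo_tw[OF xe(2)]
  obtain \<phi> where \<phi>: "tri_nat_iso T T F F' \<phi>"
    "\<And>g X. \<lbrakk>g \<in> carrier G; X \<in> Ob T\<rbrakk> \<Longrightarrow> Fmor (ac g) (\<phi> X) \<bullet> \<delta> g X = \<delta>' g X \<bullet> \<phi> (Fob (ac g) X)"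
    using assms(1) by (auto elim: eiE)
  have m [simp]: "isom T (\<phi> X)" "dm T (\<phi> X) = Fob F X" "cd T (\<phi> X) = Fob F' X" if "X \<in> Ob T" for X
    using tni_mor[OF \<phi>(1) _ _ that] by simp_all
  have e [simp]: "eqm (zo (F, \<delta>) P) (zo (F', \<delta>') P) (\<phi> (fst P))" if [simp]: "P \<in> Ob T'" for P
  proof (rule eqmI)
    fix g assume g [simp]: "g \<in> carrier G"
    show "snd (zo (F', \<delta>') P) g \<bullet> \<phi> (fst P) = Fmor (ac g) (\<phi> (fst P)) \<bullet> snd (zo (F, \<delta>) P) g"
      using comp_reassoc[OF \<phi>(2)[OF g, of "fst P"], of "Fmor F (snd P g)"] tni_nat(1)[OF \<phi>(1), of "snd P g"] by simp
  qed simp_all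
  have "T'.ei (fst (fz x), snd (fz x)) (fst (fz y), snd (fz y))"
  proof (rule T'.eiI)
    show "tri_nat_iso T' T' (fst (fz x)) (fst (fz y)) (\<lambda>P. (zo x P, \<phi> (fst P), zo y P))"
      unfolding xy
    proof (subst T'.tni_iff; (intro conjI ballI allI impI)?)
      fix t assume "arr T' t"
      then obtain P f Q where "t = (P, f, Q)" "P \<in> Ob T'" "Q \<in> Ob T'" "eqm P Q f" "arr T f" "dm T f = fst P" "cd T f = fst Q"
        by (rule T'_arrE)
      then show "Fmor (fst (fz (F', \<delta>'))) t \<cdot>\<^bsub>T'\<^esub> (zo (F, \<delta>) (dm T' t), \<phi> (fst (dm T' t)), zo (F', \<delta>') (dm T' t)) =
         (zo (F, \<delta>) (cd T' t), \<phi> (fst (cd T' t)), zo (F', \<delta>') (cd T' t)) \<cdot>\<^bsub>T'\<^esub> Fmor (fst (fz (F, \<delta>))) t"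
        using tni_nat(1)[OF \<phi>(1)] by simp
    next
      fix P assume "P \<in> Ob T'"
      then show "Fmor (Susp T') (zo (F, \<delta>) P, \<phi> (fst P), zo (F', \<delta>') P) \<cdot>\<^bsub>T'\<^esub> conn (fst (fz (F, \<delta>))) P =
         conn (fst (fz (F', \<delta>'))) P \<cdot>\<^bsub>T'\<^esub> (zo (F, \<delta>) (Fob (Susp T') P), \<phi> (fst (Fob (Susp T') P)), zo (F', \<delta>') (Fob (Susp T') P))"
        using tni_conn(1)[OF \<phi>(1), of "fst P"] by simp
    qed simp_all
  qed simp_all
  then show ?thesis by simp
qed

lemma fz_mult:
  assumes "ea x" "ea y"
  shows "T'.ei (fz (eqv_mult T x y)) (eqv_mult T' (fz x) (fz y))"
proof -
  obtain F \<delta> F' \<delta>' where xy [simp]: "x = (F, \<delta>)" "y = (F', \<delta>')" by (metis surj_pair)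
  note xe = assms[unfolded xy]
  note [simp] = ea_simps[OF xe(1)] ea_simps[OF xe(2)]
  note [simp] = zo_ob[OF xe(1)] zo_ob[OF xe(2)] zo_tw[OF xe(1)] zo_tw[OF xe(2)]
  have m: "eqv_mult T (F, \<delta>) (F', \<delta>') = (tcomp T F F', \<lambda>g X. \<delta> g (Fob F' X) \<bullet> Fmor F (\<delta>' g X))" by (simp add: eqv_mult_def)
  have me: "ea (tcomp T F F', \<lambda>g X. \<delta> g (Fob F' X) \<bullet> Fmor F (\<delta>' g X))" using ea_mult[OF assms] m by simp
  have m': "eqv_mult T' (fz x) (fz y) = (tcomp T' (fst (fz x)) (fst (fz y)),
     \<lambda>\<chi> P. snd (fz x) \<chi> (Fob (fst (fz y)) P) \<cdot>\<^bsub>T'\<^esub> Fmor (fst (fz x)) (snd (fz y) \<chi> P))" by (simp add: eqv_mult_def case_prod_beta)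
  have z: "zo (F, \<delta>) (zo (F', \<delta>') P) = zo (tcomp T F F', \<lambda>g X. \<delta> g (Fob F' X) \<bullet> Fmor F (\<delta>' g X)) P" if [simp]: "P \<in> Ob T'" for P
    by (rule eob_eqI) (use zo_ob[OF me] in simp_all)
  show ?thesis
  proof (subst fz_eq, unfold m', rule T'.ei_eq)
    show "T'.ea (fst (fz (eqv_mult T x y)), snd (fz (eqv_mult T x y)))"
      using fz_ea'[OF ea_mult[OF assms]] by simp
    show "T'.ea (tcomp T' (fst (fz x)) (fst (fz y)),
     \<lambda>\<chi> P. snd (fz x) \<chi> (Fob (fst (fz y)) P) \<cdot>\<^bsub>T'\<^esub> Fmor (fst (fz x)) (snd (fz y) \<chi> P))"
      using T'.ea_mult[OF fz_ea'[OF assms(1)] fz_ea'[OF assms(2)]] m' by simp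
    fix P assume P [simp]: "P \<in> Ob T'"
    show "Fob (tcomp T' (fst (fz x)) (fst (fz y))) P = Fob (fst (fz (eqv_mult T x y))) P"
      using z by (simp add: m)
    show "conn (tcomp T' (fst (fz x)) (fst (fz y))) P = conn (fst (fz (eqv_mult T x y))) P"
      using z by (simp add: m)
    show "snd (fz x) \<chi> (Fob (fst (fz y)) P) \<cdot>\<^bsub>T'\<^esub> Fmor (fst (fz x)) (snd (fz y) \<chi> P) = snd (fz (eqv_mult T x y)) \<chi> P"
      if "\<chi> \<in> carrier D" for \<chi>
      using z[of P] zo_tw[OF me, of P \<chi>] that by (simp add: m)
  next
    fix t assume "arr T' t"
    then obtain P f Q where "t = (P, f, Q)" "P \<in> Ob T'" "Q \<in> Ob T'" "eqm P Q f" "arr T f" "dm T f = fst P" "cd T f = fst Q"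
      by (rule T'_arrE)
    then show "Fmor (tcomp T' (fst (fz x)) (fst (fz y))) t = Fmor (fst (fz (eqv_mult T x y))) t"
      using z by (simp add: m)
  qed
qed

text \<open>An isomorphism between the equivariantizations that commutes with all twists is natural for
  homogeneous morphisms of every degree, so it extends to \<open>T\<close>. That the extension respects the
  connecting and the equivariance isomorphisms is an equality of natural families, which can be
  checked on underlying objects.\<close>

lemma fz_injective:
  assumes "T'.ei (fz x) (fz y)" "ea x" "ea y" shows "ei x y"
proof -
  obtain F \<delta> F' \<delta>' where xy [simp]: "x = (F, \<delta>)" "y = (F', \<delta>')" by (metis surj_pair)
  note xe = assms(2,3)[unfolded xy]
  note [simp] = ea_simps[OF xe(1)] ea_simps[OF xe(2)]
  note [simp] = zo_ob[OF xe(1)] zo_ob[OF xe(2)] fz_endo[OF xe(1)] fz_endo[OF xe(2)] fz_tfun[OF xe(1)] fz_tfun[OF xe(2)] zo_tw[OF xe(1)] zo_tw[OF xe(2)]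
  have "T'.ei (fst (fz x), snd (fz x)) (fst (fz y), snd (fz y))" using assms(1) by simp
  then obtain \<phi>' where \<phi>: "tri_nat_iso T' T' (fst (fz x)) (fst (fz y)) \<phi>'"
    "\<And>\<chi> P. \<lbrakk>\<chi> \<in> carrier D; P \<in> Ob T'\<rbrakk> \<Longrightarrow> Fmor (act A' \<chi>) (\<phi>' P) \<cdot>\<^bsub>T'\<^esub> snd (fz x) \<chi> P = snd (fz y) \<chi> P \<cdot>\<^bsub>T'\<^esub> \<phi>' (Fob (act A' \<chi>) P)"
    by (rule T'.eiE) blast
  define \<phi> where "\<phi> P = underlying (\<phi>' P)" for P
  have i': "isom T' (\<phi>' P)" "dm T' (\<phi>' P) = zo (F, \<delta>) P" "cd T' (\<phi>' P) = zo (F', \<delta>') P" if "P \<in> Ob T'" for P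
    using T'.tni_mor[OF \<phi>(1) _ _ that] by simp_all
  have eq: "\<phi>' P = (zo (F, \<delta>) P, \<phi> P, zo (F', \<delta>') P)" and e: "eqm (zo (F, \<delta>) P) (zo (F', \<delta>') P) (\<phi> P)" and i: "isom T (\<phi> P)" if P: "P \<in> Ob T'" for P
  proof -
    note a = i'[OF P]
    have f: "fst (\<phi>' P) = zo (F, \<delta>) P" "snd (snd (\<phi>' P)) = zo (F', \<delta>') P" using a T'_dm[OF T'.isom_arr[OF a(1)]] by simp_all
    then show "\<phi>' P = (zo (F, \<delta>) P, \<phi> P, zo (F', \<delta>') P)" by (simp add: \<phi>_def prod_eq_iff)
    show "eqm (zo (F, \<delta>) P) (zo (F', \<delta>') P) (\<phi> P)" using T'.isom_arr[OF a(1), unfolded T'_arr_iff] f by (simp add: \<phi>_def)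
    show "isom T (\<phi> P)" using T'_isom(1)[OF T'.isom_arr[OF a(1)]] a(1) by (simp add: \<phi>_def)
  qed
  have m: "isom T (\<phi> P) \<and> dm T (\<phi> P) = Fob F (fst P) \<and> cd T (\<phi> P) = Fob F' (fst P)" if "P \<in> Ob T'" for P
    using i[OF that] eqm_D(2,3)[OF e[OF that]] by simp
  note [simp] = m
  have tw: "\<phi> (tw \<chi> P) = \<phi> P" if "\<chi> \<in> carrier D" "P \<in> Ob T'" for \<chi> P
    using \<phi>(2)[OF that] that eq[of P] eq[of "tw \<chi> P"] by simp
  have n: "Fmor F' f \<bullet> \<phi> P = \<phi> Q \<bullet> Fmor F f" if [simp]: "P \<in> Ob T'" "Q \<in> Ob T'" "\<chi> \<in> carrier D" and f: "eqm P (tw \<chi> Q) f" for P Q \<chi> f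
  proof -
    have "arr T' (P, f, tw \<chi> Q)" using f by simp
    from T'.tni_nat(1)[OF \<phi>(1) _ _ this, of P] f
    show ?thesis by (simp add: eq tw)
  qed
  define \<psi> where "\<psi> = dense_ext F F' \<phi>"
  have p [simp]: "isom T (\<psi> X)" "dm T (\<psi> X) = Fob F X" "cd T (\<psi> X) = Fob F' X" if "X \<in> Ob T" for X
    unfolding \<psi>_def by (rule dense_ext_mor[OF _ _ m n]; simp add: that)+
  have pn: "Fmor F' f \<bullet> \<psi> X = \<psi> (cd T f) \<bullet> Fmor F f" if "arr T f" "dm T f = X" for f X
    using dense_ext_nat[OF _ _ m n that(1)] that(2) unfolding \<psi>_def by simp
  have pn2: "Fmor F' f \<bullet> \<psi> X \<bullet> k = \<psi> (cd T f) \<bullet> Fmor F f \<bullet> k" if "arr T f" "dm T f = X" "arr T k" "cd T k = Fob F X" for f X k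
  proof -
    have "X \<in> Ob T" using that(1,2) dm_Ob by blast
    then show ?thesis by (intro comp_reassoc[OF pn]) (use that in simp_all)
  qed
  have pe: "\<psi> (fst P) = \<phi> P" if "P \<in> Ob T'" for P
    unfolding \<psi>_def by (rule dense_ext_eq[OF _ _ m n that]) simp_all
  have "ei (F, \<delta>) (F', \<delta>')"
  proof (rule eiI)
    have c: "Sm (\<psi> X) \<bullet> conn F X = conn F' X \<bullet> \<psi> (Sg X)" if X: "X \<in> Ob T" for X
    proof (rule dense_eq[where F = "fcomp F (Susp T)" and H = "fcomp (Susp T) F'" and X = X
          and a = "\<lambda>X. Sm (\<psi> X) \<bullet> conn F X" and b = "\<lambda>X. conn F' X \<bullet> \<psi> (Sg X)"])
      fix P assume P [simp]: "P \<in> Ob T'"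
      show "Sm (\<psi> (fst P)) \<bullet> conn F (fst P) = conn F' (fst P) \<bullet> \<psi> (Sg (fst P))"
        using T'.tni_conn(1)[OF \<phi>(1), of P] pe[of "sg P"] by (simp add: eq pe)
    next
      fix f assume f [simp]: "arr T f"
      have "Sm (Fmor F' f) \<bullet> Sm (\<psi> (dm T f)) = Sm (\<psi> (cd T f)) \<bullet> Sm (Fmor F f)"
        using pn[OF f refl] by (simp flip: fun_comp)
      from comp_reassoc[OF this, of "conn F (dm T f)"]
      show "Fmor (fcomp (Susp T) F') f \<bullet> Sm (\<psi> (dm T f)) \<bullet> conn F (dm T f) = (Sm (\<psi> (cd T f)) \<bullet> conn F (cd T f)) \<bullet> Fmor (fcomp F (Susp T)) f"
        by (simp add: tfun_nat)
      show "Fmor (fcomp (Susp T) F') f \<bullet> conn F' (dm T f) \<bullet> \<psi> (Sg (dm T f)) = (conn F' (cd T f) \<bullet> \<psi> (Sg (cd T f))) \<bullet> Fmor (fcomp F (Susp T)) f"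
        by (simp add: tfun_nat pn)
    qed (use X in simp_all)
    show "tri_nat_iso T T F F' \<psi>"
      by (simp add: tni_iff pn c)
    fix g X assume g [simp]: "g \<in> carrier G" and X: "X \<in> Ob T"
    show "Fmor (ac g) (\<psi> X) \<bullet> \<delta> g X = \<delta>' g X \<bullet> \<psi> (Fob (ac g) X)"
    proof (rule dense_eq[where F = "fcomp F (ac g)" and H = "fcomp (ac g) F'" and X = X
          and a = "\<lambda>X. Fmor (ac g) (\<psi> X) \<bullet> \<delta> g X" and b = "\<lambda>X. \<delta>' g X \<bullet> \<psi> (Fob (ac g) X)"])
      fix P assume P [simp]: "P \<in> Ob T'"
      have "(\<delta>' g (fst P) \<bullet> \<psi> (Fob (ac g) (fst P))) \<bullet> Fmor F (snd P g) = snd (zo (F', \<delta>') P) g \<bullet> \<phi> P"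
        using pn[of "snd P g" "fst P"] by (simp add: pe)
      also have "\<dots> = Fmor (ac g) (\<phi> P) \<bullet> snd (zo (F, \<delta>) P) g" using eqm_D(4)[OF e[OF P] g] .
      also have "\<dots> = (Fmor (ac g) (\<psi> (fst P)) \<bullet> \<delta> g (fst P)) \<bullet> Fmor F (snd P g)" by (simp add: pe)
      finally show "Fmor (ac g) (\<psi> (fst P)) \<bullet> \<delta> g (fst P) = \<delta>' g (fst P) \<bullet> \<psi> (Fob (ac g) (fst P))"
        by (subst (asm) iso_cancel_right) simp_all
    next
      fix f assume f [simp]: "arr T f"
      have "Fmor (ac g) (Fmor F' f) \<bullet> Fmor (ac g) (\<psi> (dm T f)) = Fmor (ac g) (\<psi> (cd T f)) \<bullet> Fmor (ac g) (Fmor F f)"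
        using pn[OF f refl] by (simp flip: fun_comp)
      from comp_reassoc[OF this, of "\<delta> g (dm T f)"]
      show "Fmor (fcomp (ac g) F') f \<bullet> Fmor (ac g) (\<psi> (dm T f)) \<bullet> \<delta> g (dm T f) = (Fmor (ac g) (\<psi> (cd T f)) \<bullet> \<delta> g (cd T f)) \<bullet> Fmor (fcomp F (ac g)) f"
        by (simp add: ea_nat[OF xe(1)])
      show "Fmor (fcomp (ac g) F') f \<bullet> \<delta>' g (dm T f) \<bullet> \<psi> (Fob (ac g) (dm T f)) = (\<delta>' g (cd T f) \<bullet> \<psi> (Fob (ac g) (cd T f))) \<bullet> Fmor (fcomp F (ac g)) f"
        by (simp add: ea_nat[OF xe(2)] pn)
    qed (use X in simp_all)
  qed
  then show ?thesis by simp
qed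

end

section \<open>Essential surjectivity of equivariantization\<close>

context equivariant
begin

lemma component_sum:
  assumes [simp]: "P \<in> Ob T'" "Q \<in> Ob T'" "\<chi> \<in> carrier D" and S: "finite S" and a: "\<And>h. h \<in> S \<Longrightarrow> mor T (fst P) (fst Q) (a h)"
  shows "component P Q \<chi> (finsum (Hom T (fst P) (fst Q)) a S) = finsum (Hom T (fst P) (fst Q)) (\<lambda>h. component P Q \<chi> (a h)) S"
  using S a
proof (induction S)
  case empty
  have "eqm P (tw \<chi> Q) \<zero>\<^bsub>Hom T (fst P) (fst Q)\<^esub>" using eqm_zero[of P "tw \<chi> Q"] by simp
  then show ?case using component_homog[of P Q \<chi> _ \<chi>] by simp
next
  case (insert x S)
  have m: "arr T (a h)" "dm T (a h) = fst P" "cd T (a h) = fst Q" if "h \<in> insert x S" for h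
    using insert.prems[OF that] by simp_all
  have "finsum (Hom T (fst P) (fst Q)) a (insert x S) = pl T (a x) (finsum (Hom T (fst P) (fst Q)) a S)"
    using insert m by (intro sum_insert) simp_all
  moreover have "finsum (Hom T (fst P) (fst Q)) (\<lambda>h. component P Q \<chi> (a h)) (insert x S) =
     pl T (component P Q \<chi> (a x)) (finsum (Hom T (fst P) (fst Q)) (\<lambda>h. component P Q \<chi> (a h)) S)"
    using insert m by (intro sum_insert) simp_all
  ultimately show ?case using insert m by (simp add: component_pl)
qed

lemma component_sc:
  assumes "P \<in> Ob T'" "Q \<in> Ob T'" "\<chi> \<in> carrier D" "c \<in> carrier K" "arr T f" "dm T f = fst P" "cd T f = fst Q"
  shows "component P Q \<chi> (sc T c f) = sc T c (component P Q \<chi> f)"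
proof -
  have "finsum (Hom T (fst P) (fst Q)) (\<lambda>g. sc T (\<chi> g) (conjugate P Q g (sc T c f))) (carrier G) =
     finsum (Hom T (fst P) (fst Q)) (\<lambda>g. sc T c (sc T (\<chi> g) (conjugate P Q g f))) (carrier G)"
    using assms by (intro finsum_cong_all refl) (simp add: conjugate_sc m_comm)
  also have "\<dots> = sc T c (finsum (Hom T (fst P) (fst Q)) (\<lambda>g. (sc T (\<chi> g) (conjugate P Q g f))) (carrier G))"
    using assms by (subst sc_sum) simp_all
  finally show ?thesis unfolding component_def using assms by (simp add: m_comm del: sc_sum)
qed

context
  fixes \<Phi> :: "(('g, 'o, 'm) eqv_ob, ('g, 'o, 'm) eqv_mor, ('g, 'o, 'm) eqv_ob, ('g, 'o, 'm) eqv_mor) tfunctor" and \<epsilon>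
  assumes ye: "T'.ea (\<Phi>, \<epsilon>)"
begin

lemmas ys = T'.ea_simps[OF ye]
declare ys [simp]

text \<open>The morphisms of \<open>T\<close> underlying the values of \<open>\<Phi>\<close>, its equivariance isomorphisms and its connecting
  isomorphisms. All computations with \<open>\<Phi>\<close> are carried out with these.\<close>

definition pm where "pm P f Q = underlying (Fmor \<Phi> (P, f, Q))"
definition ep where "ep \<chi> P = underlying (\<epsilon> \<chi> P)"
definition cn where "cn P = underlying (conn \<Phi> P)"

lemma triple_of:
  assumes "arr T' t" "dm T' t = P" "cd T' t = Q"
  shows "t = (P, underlying t, Q)" "eqm P Q (underlying t)"
proof -
  have "P = fst t" "Q = snd (snd t)" using assms by auto
  then show "t = (P, underlying t, Q)" "eqm P Q (underlying t)"
    using assms(1) T'_arr_iff[of t] by simp_all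
qed

lemma pm_eq:
  assumes "P \<in> Ob T'" "Q \<in> Ob T'" "eqm P Q f"
  shows "Fmor \<Phi> (P, f, Q) = (Fob \<Phi> P, pm P f Q, Fob \<Phi> Q)" "eqm (Fob \<Phi> P) (Fob \<Phi> Q) (pm P f Q)"
proof -
  have a: "arr T' (P, f, Q)" using assms by simp
  have "arr T' (Fmor \<Phi> (P, f, Q))" "dm T' (Fmor \<Phi> (P, f, Q)) = Fob \<Phi> P" "cd T' (Fmor \<Phi> (P, f, Q)) = Fob \<Phi> Q"
    using T'.fun_arr[OF T'.tfun_endo[OF ys(1)] a] a by simp_all
  from triple_of[OF this] show "Fmor \<Phi> (P, f, Q) = (Fob \<Phi> P, pm P f Q, Fob \<Phi> Q)" "eqm (Fob \<Phi> P) (Fob \<Phi> Q) (pm P f Q)"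
    unfolding pm_def .
qed

lemma pm_mor [simp]:
  assumes "P \<in> Ob T'" "Q \<in> Ob T'" "eqm P Q f"
  shows "arr T (pm P f Q)" "dm T (pm P f Q) = fst (Fob \<Phi> P)" "cd T (pm P f Q) = fst (Fob \<Phi> Q)"
  using eqm_D(1-3)[OF pm_eq(2)[OF assms]] .

lemma pm_comp:
  assumes "P \<in> Ob T'" "Q \<in> Ob T'" "R \<in> Ob T'" "eqm P Q f" "eqm Q R g"
  shows "pm P (g \<bullet> f) R = pm Q g R \<bullet> pm P f Q"
  using T'.fun_comp[of \<Phi> "(Q, g, R)" "(P, f, Q)"] assms eqm_comp[OF assms(4,5)] by (simp add: pm_eq)

lemma pm_idt: "\<lbrakk>P \<in> Ob T'; fst P = X\<rbrakk> \<Longrightarrow> pm P (Idt T X) P = Idt T (fst (Fob \<Phi> P))"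
  using T'.fun_idt[of \<Phi> P] by (auto simp: pm_def)

lemma pm_pl:
  assumes "P \<in> Ob T'" "Q \<in> Ob T'" "eqm P Q f" "eqm P Q g"
  shows "pm P (pl T f g) Q = pl T (pm P f Q) (pm P g Q)"
  using T'.fun_pl[of \<Phi> "(P, f, Q)" "(P, g, Q)"] assms eqm_pl[OF assms(3,4)] pm_eq(2)[OF assms(1-3)] by (simp add: T'_pl pm_eq)

lemma pm_sc:
  assumes "P \<in> Ob T'" "Q \<in> Ob T'" "eqm P Q f" "c \<in> carrier K"
  shows "pm P (sc T c f) Q = sc T c (pm P f Q)"
  using T'.fun_sc[of \<Phi> "(P, f, Q)" c] assms eqm_sc[OF assms(3,4)] pm_eq(2)[OF assms(1-3)] by (simp add: T'_sc pm_eq)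

lemma pm_zero:
  assumes "P \<in> Ob T'" "Q \<in> Ob T'" "fst P = X" "fst Q = Y"
  shows "pm P \<zero>\<^bsub>Hom T X Y\<^esub> Q = \<zero>\<^bsub>Hom T (fst (Fob \<Phi> P)) (fst (Fob \<Phi> Q))\<^esub>"
proof -
  have e: "eqm P Q \<zero>\<^bsub>Hom T X Y\<^esub>" using eqm_zero[OF assms(1,2)] assms by simp
  have X: "X \<in> Ob T" "Y \<in> Ob T" using assms by auto
  have "pm P \<zero>\<^bsub>Hom T X Y\<^esub> Q = pm P (sc T \<zero> \<zero>\<^bsub>Hom T X Y\<^esub>) Q" using X by simp
  also have "\<dots> = sc T \<zero> (pm P \<zero>\<^bsub>Hom T X Y\<^esub> Q)" using pm_sc[OF assms(1,2) e zero_closed] .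
  also have "\<dots> = \<zero>\<^bsub>Hom T (fst (Fob \<Phi> P)) (fst (Fob \<Phi> Q))\<^esub>" using pm_mor[OF assms(1,2) e] by (simp add: sc_zero)
  finally show ?thesis .
qed

lemma pm_faithful:
  assumes "P \<in> Ob T'" "Q \<in> Ob T'" "eqm P Q f" "eqm P Q g" "pm P f Q = pm P g Q" shows "f = g"
  using T'.equi_faithful[OF ys(2), of "(P, f, Q)" "(P, g, Q)"] assms by (simp add: pm_eq)

lemma pm_full:
  assumes "P \<in> Ob T'" "Q \<in> Ob T'" "eqm (Fob \<Phi> P) (Fob \<Phi> Q) h"
  shows "\<exists>f. eqm P Q f \<and> pm P f Q = h"
proof -
  define t where "t = T'.rfl \<Phi> P Q (Fob \<Phi> P, h, Fob \<Phi> Q)"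
  have "arr T' (Fob \<Phi> P, h, Fob \<Phi> Q)" using assms by simp
  then have t: "arr T' t" "dm T' t = P" "cd T' t = Q" "Fmor \<Phi> t = (Fob \<Phi> P, h, Fob \<Phi> Q)"
    unfolding t_def using T'.rfl_mor[OF ys(2) assms(1,2), of "(Fob \<Phi> P, h, Fob \<Phi> Q)"] by simp_all
  then show ?thesis using triple_of[OF t(1-3)] unfolding pm_def by (metis fst_conv snd_conv)
qed

lemma ep_eq:
  assumes "\<chi> \<in> carrier D" "P \<in> Ob T'"
  shows "\<epsilon> \<chi> P = (Fob \<Phi> (tw \<chi> P), ep \<chi> P, tw \<chi> (Fob \<Phi> P))" "eqm (Fob \<Phi> (tw \<chi> P)) (tw \<chi> (Fob \<Phi> P)) (ep \<chi> P)"
    "isom T (ep \<chi> P)" "dm T (ep \<chi> P) = fst (Fob \<Phi> (tw \<chi> P))" "cd T (ep \<chi> P) = fst (Fob \<Phi> P)"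
proof -
  have i: "isom T' (\<epsilon> \<chi> P)" "dm T' (\<epsilon> \<chi> P) = Fob \<Phi> (tw \<chi> P)" "cd T' (\<epsilon> \<chi> P) = tw \<chi> (Fob \<Phi> P)"
    using assms ys(3-5)[of \<chi> P] by simp_all
  note t = triple_of[OF T'.isom_arr[OF i(1)] i(2,3)]
  show "\<epsilon> \<chi> P = (Fob \<Phi> (tw \<chi> P), ep \<chi> P, tw \<chi> (Fob \<Phi> P))" "eqm (Fob \<Phi> (tw \<chi> P)) (tw \<chi> (Fob \<Phi> P)) (ep \<chi> P)"
    using t unfolding ep_def by simp_all
  then show "isom T (ep \<chi> P)" "dm T (ep \<chi> P) = fst (Fob \<Phi> (tw \<chi> P))" "cd T (ep \<chi> P) = fst (Fob \<Phi> P)"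
    using i(1) assms eqm_D(2,3)[of "Fob \<Phi> (tw \<chi> P)" "tw \<chi> (Fob \<Phi> P)" "ep \<chi> P"] by simp_all
qed

lemmas ep_mor [simp] = ep_eq(3-5)

lemma ep_nat:
  assumes [simp]: "\<chi> \<in> carrier D" "P \<in> Ob T'" "Q \<in> Ob T'" and e: "eqm P Q f"
  shows "pm P f Q \<bullet> ep \<chi> P = ep \<chi> Q \<bullet> pm (tw \<chi> P) f (tw \<chi> Q)"
  using T'.ea_nat(1)[OF ye assms(1), of "(P, f, Q)" P] e by (simp add: ep_eq(1) pm_eq eqm_tw_tw)

lemma ep_coh:
  assumes [simp]: "\<chi> \<in> carrier D" "\<psi> \<in> carrier D" "P \<in> Ob T'"
  shows "ep (\<chi> \<otimes>\<^bsub>D\<^esub> \<psi>) P = ep \<psi> P \<bullet> ep \<chi> (tw \<psi> P)"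
proof -
  have "eqm (tw (\<chi> \<otimes>\<^bsub>D\<^esub> \<psi>) P) (tw (\<chi> \<otimes>\<^bsub>D\<^esub> \<psi>) P) (Idt T (fst P))" by simp
  then show ?thesis
    using T'.ea_coh(1)[OF ye assms] by (simp add: ep_eq(1) pm_eq pm_idt tw_tw)
qed

lemma ep_one: assumes P [simp]: "P \<in> Ob T'" shows "ep \<one>\<^bsub>D\<^esub> P = Idt T (fst (Fob \<Phi> P))"
proof -
  interpret D: comm_group D by (rule D_group)
  have d: "dm T (ep \<one>\<^bsub>D\<^esub> P) = fst (Fob \<Phi> P)" using ep_eq(4)[of "\<one>\<^bsub>D\<^esub>" P] by (simp add: tw_one)
  have "ep \<one>\<^bsub>D\<^esub> P \<bullet> ep \<one>\<^bsub>D\<^esub> P = ep \<one>\<^bsub>D\<^esub> P \<bullet> Idt T (fst (Fob \<Phi> P))"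
    using ep_coh[of "\<one>\<^bsub>D\<^esub>" "\<one>\<^bsub>D\<^esub>" P] d by (simp add: tw_one)
  then show ?thesis using d by (subst (asm) iso_cancel_left) simp_all
qed

lemma cn_eq:
  assumes "P \<in> Ob T'"
  shows "conn \<Phi> P = (Fob \<Phi> (sg P), cn P, sg (Fob \<Phi> P))" "eqm (Fob \<Phi> (sg P)) (sg (Fob \<Phi> P)) (cn P)"
    "isom T (cn P)" "dm T (cn P) = fst (Fob \<Phi> (sg P))" "cd T (cn P) = Sg (fst (Fob \<Phi> P))"
proof -
  have i: "isom T' (conn \<Phi> P)" "dm T' (conn \<Phi> P) = Fob \<Phi> (sg P)" "cd T' (conn \<Phi> P) = sg (Fob \<Phi> P)"
    using assms T'.tfun_conn[OF ys(1), of P] by simp_all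
  note t = triple_of[OF T'.isom_arr[OF i(1)] i(2,3)]
  show "conn \<Phi> P = (Fob \<Phi> (sg P), cn P, sg (Fob \<Phi> P))" "eqm (Fob \<Phi> (sg P)) (sg (Fob \<Phi> P)) (cn P)"
    using t unfolding cn_def by simp_all
  then show "isom T (cn P)" "dm T (cn P) = fst (Fob \<Phi> (sg P))" "cd T (cn P) = Sg (fst (Fob \<Phi> P))"
    using i(1) assms eqm_D(2,3)[of "Fob \<Phi> (sg P)" "sg (Fob \<Phi> P)" "cn P"] by simp_all
qed

lemmas cn_mor [simp] = cn_eq(3-5)

lemma cn_nat:
  assumes [simp]: "P \<in> Ob T'" "Q \<in> Ob T'" and e [simp]: "eqm P Q f"
  shows "Sm (pm P f Q) \<bullet> cn P = cn Q \<bullet> pm (sg P) (Sm f) (sg Q)"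
  using T'.tfun_nat(1)[OF ys(1), of "(P, f, Q)" P] by (simp add: cn_eq(1) pm_eq)

lemma cn_ep:
  assumes [simp]: "\<chi> \<in> carrier D" "P \<in> Ob T'"
  shows "Sm (ep \<chi> P) \<bullet> cn (tw \<chi> P) = cn P \<bullet> ep \<chi> (sg P)"
proof -
  have "cn (tw \<chi> P) \<bullet> pm (tw \<chi> (sg P)) (Idt T (Sg (fst P))) (tw \<chi> (sg P)) = cn (tw \<chi> P)"
    using cn_eq(3-5)[of "tw \<chi> P"] by (simp add: pm_idt tw_sg)
  moreover have "Idt T (Sg (fst (Fob \<Phi> P))) \<bullet> cn P \<bullet> ep \<chi> (sg P) = cn P \<bullet> ep \<chi> (sg P)" by simp
  moreover have "eqm (tw \<chi> (sg P)) (tw \<chi> (sg P)) (Idt T (Sg (fst P)))" by simp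
  ultimately show ?thesis
    using T'.ea_conn[OF ye assms] by (simp add: ep_eq(1) cn_eq(1) pm_eq(1) tw_sg del: idt_comp)
qed

lemma pm_exact:
  assumes "P \<in> Ob T'" "Q \<in> Ob T'" "R \<in> Ob T'" "eqm P Q f" "eqm Q R g" "eqm R (sg P) h" "(f, g, h) \<in> Exact T"
  shows "(pm P f Q, pm Q g R, cn P \<bullet> pm R h (sg P)) \<in> Exact T"
proof -
  have 1: "((P, f, Q), (Q, g, R), (R, h, sg P)) \<in> Exact T'" unfolding T'_exact_iff using assms by simp
  have "cand T' (P, f, Q) (Q, g, R) (R, h, sg P)" unfolding cand_def using assms by simp
  from T'.tfun_exact[OF ys(1) 1 this] show ?thesis unfolding T'_exact_iff using assms by (simp add: pm_eq cn_eq(1))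
qed

text \<open>The extension of \<open>\<Phi>\<close> to all morphisms between underlying objects. The component of degree \<open>\<chi>\<close> is a
  morphism from \<open>P\<close> to the twist of \<open>Q\<close>, to which \<open>\<Phi>\<close> applies; the isomorphism \<open>ep \<chi> Q\<close> identifies the
  image of the twist with the twist of the image, which has the same underlying object as the image
  of \<open>Q\<close>.\<close>

definition extend where "extend P Q f = finsum (Hom T (fst (Fob \<Phi> P)) (fst (Fob \<Phi> Q)))
   (\<lambda>\<chi>. ep \<chi> Q \<bullet> pm P (component P Q \<chi> f) (tw \<chi> Q)) (carrier D)"

context
  fixes P Q assumes P [simp]: "P \<in> Ob T'" and Q [simp]: "Q \<in> Ob T'"
begin

lemma extend_mor [simp]:
  assumes "arr T f" "dm T f = fst P" "cd T f = fst Q"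
  shows "arr T (extend P Q f)" "dm T (extend P Q f) = fst (Fob \<Phi> P)" "cd T (extend P Q f) = fst (Fob \<Phi> Q)"
  unfolding extend_def using assms by simp_all

lemma extend_homog:
  assumes \<chi> [simp]: "\<chi> \<in> carrier D" and e: "eqm P (tw \<chi> Q) f"
  shows "extend P Q f = ep \<chi> Q \<bullet> pm P f (tw \<chi> Q)"
proof -
  note [simp] = eqm_hm[OF P Q e]
  have "extend P Q f = ep \<chi> Q \<bullet> pm P (component P Q \<chi> f) (tw \<chi> Q)" unfolding extend_def
  proof (rule sum_single)
    fix \<psi> assume [simp]: "\<psi> \<in> carrier D" and "\<psi> \<noteq> \<chi>"
    then have "component P Q \<psi> f = \<zero>\<^bsub>Hom T (fst P) (fst Q)\<^esub>" using component_homog[OF P Q e] by simp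
    then show "ep \<psi> Q \<bullet> pm P (component P Q \<psi> f) (tw \<psi> Q) = \<zero>\<^bsub>Hom T (fst (Fob \<Phi> P)) (fst (Fob \<Phi> Q))\<^esub>"
      by (simp add: pm_zero)
  qed (use e in simp_all)
  then show ?thesis using component_homog[OF P Q e \<chi> \<chi>] by simp
qed

lemma extend_homog_eqm:
  assumes \<chi> [simp]: "\<chi> \<in> carrier D" and e: "eqm P (tw \<chi> Q) f"
  shows "eqm (Fob \<Phi> P) (tw \<chi> (Fob \<Phi> Q)) (extend P Q f)"
  unfolding extend_homog[OF assms] by (rule eqm_comp[OF pm_eq(2) ep_eq(2)]) (use e in simp_all)

lemma extend_plain: "eqm P Q f \<Longrightarrow> extend P Q f = pm P f Q"
  using extend_homog[of "\<one>\<^bsub>D\<^esub>" f] by (simp add: tw_one ep_one)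

lemma extend_pl:
  assumes "arr T f" "dm T f = fst P" "cd T f = fst Q" "arr T f'" "dm T f' = fst P" "cd T f' = fst Q"
  shows "extend P Q (pl T f f') = pl T (extend P Q f) (extend P Q f')"
  unfolding extend_def using assms by (simp add: component_pl pm_pl comp_pl sum_pl cong: finsum_cong_all)

lemma extend_sc:
  assumes "arr T f" "dm T f = fst P" "cd T f = fst Q" "c \<in> carrier K"
  shows "extend P Q (sc T c f) = sc T c (extend P Q f)"
  unfolding extend_def using assms by (simp add: component_sc pm_sc cong: finsum_cong_all)

lemma extend_sum:
  assumes "finite S" "\<And>h. h \<in> S \<Longrightarrow> mor T (fst P) (fst Q) (a h)"
  shows "extend P Q (finsum (Hom T (fst P) (fst Q)) a S) = finsum (Hom T (fst (Fob \<Phi> P)) (fst (Fob \<Phi> Q))) (\<lambda>h. extend P Q (a h)) S"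
  using assms
proof (induction S)
  case empty
  have "eqm P Q \<zero>\<^bsub>Hom T (fst P) (fst Q)\<^esub>" by simp
  then show ?case using extend_plain by (simp add: pm_zero)
next
  case (insert x S)
  have m: "arr T (a h)" "dm T (a h) = fst P" "cd T (a h) = fst Q" if "h \<in> insert x S" for h
    using insert.prems[OF that] by simp_all
  have "finsum (Hom T (fst P) (fst Q)) a (insert x S) = pl T (a x) (finsum (Hom T (fst P) (fst Q)) a S)"
    using insert m by (intro sum_insert) simp_all
  moreover have "finsum (Hom T (fst (Fob \<Phi> P)) (fst (Fob \<Phi> Q))) (\<lambda>h. extend P Q (a h)) (insert x S) =
     pl T (extend P Q (a x)) (finsum (Hom T (fst (Fob \<Phi> P)) (fst (Fob \<Phi> Q))) (\<lambda>h. extend P Q (a h)) S)"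
    using insert m by (intro sum_insert) simp_all
  ultimately show ?case using insert m by (simp add: extend_pl)
qed

lemma extend_decomp:
  assumes "arr T f" "dm T f = fst P" "cd T f = fst Q"
  shows "extend P Q f = finsum (Hom T (fst (Fob \<Phi> P)) (fst (Fob \<Phi> Q))) (\<lambda>\<chi>. extend P Q (component P Q \<chi> f)) (carrier D)"
  using extend_sum[of "carrier D" "\<lambda>\<chi>. component P Q \<chi> f"] assms sum_component[OF P Q, of f] by simp

text \<open>The extension preserves degrees. Hence it is full and faithful, degree by degree, as \<open>\<Phi>\<close> is.\<close>

lemma extend_component:
  assumes f: "arr T f" "dm T f = fst P" "cd T f = fst Q" and \<psi> [simp]: "\<psi> \<in> carrier D"
  shows "component (Fob \<Phi> P) (Fob \<Phi> Q) \<psi> (extend P Q f) = extend P Q (component P Q \<psi> f)"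
proof -
  note [simp] = f
  have e: "eqm (Fob \<Phi> P) (tw \<chi> (Fob \<Phi> Q)) (extend P Q (component P Q \<chi> f))" if "\<chi> \<in> carrier D" for \<chi>
    using that by (intro extend_homog_eqm) simp_all
  have "component (Fob \<Phi> P) (Fob \<Phi> Q) \<psi> (extend P Q f) = finsum (Hom T (fst (Fob \<Phi> P)) (fst (Fob \<Phi> Q)))
     (\<lambda>\<chi>. component (Fob \<Phi> P) (Fob \<Phi> Q) \<psi> (extend P Q (component P Q \<chi> f))) (carrier D)"
    unfolding extend_decomp[OF f] by (rule component_sum) simp_all
  also have "\<dots> = component (Fob \<Phi> P) (Fob \<Phi> Q) \<psi> (extend P Q (component P Q \<psi> f))"
    by (rule sum_single) (use component_homog[OF _ _ e] in simp_all)
  also have "\<dots> = extend P Q (component P Q \<psi> f)" using component_homog[OF _ _ e, of \<psi> \<psi>] by simp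
  finally show ?thesis .
qed

lemma extend_faithful:
  assumes "arr T f" "dm T f = fst P" "cd T f = fst Q" "arr T f'" "dm T f' = fst P" "cd T f' = fst Q" "extend P Q f = extend P Q f'"
  shows "f = f'"
proof -
  have "component P Q \<chi> f = component P Q \<chi> f'" if [simp]: "\<chi> \<in> carrier D" for \<chi>
  proof -
    have "extend P Q (component P Q \<chi> f) = extend P Q (component P Q \<chi> f')" using extend_component[of f \<chi>] extend_component[of f' \<chi>] assms by simp
    then have "ep \<chi> Q \<bullet> pm P (component P Q \<chi> f) (tw \<chi> Q) = ep \<chi> Q \<bullet> pm P (component P Q \<chi> f') (tw \<chi> Q)"
      using extend_homog[of \<chi> "component P Q \<chi> f"] extend_homog[of \<chi> "component P Q \<chi> f'"] assms by simp
    then have "pm P (component P Q \<chi> f) (tw \<chi> Q) = pm P (component P Q \<chi> f') (tw \<chi> Q)"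
      using assms by (subst (asm) iso_cancel_left) simp_all
    then show ?thesis by (rule pm_faithful[rotated -1]) (use assms in simp_all)
  qed
  then have "finsum (Hom T (fst P) (fst Q)) (\<lambda>\<chi>. component P Q \<chi> f) (carrier D) = finsum (Hom T (fst P) (fst Q)) (\<lambda>\<chi>. component P Q \<chi> f') (carrier D)"
    by (intro finsum_cong_all refl)
  then show ?thesis using assms by (simp add: sum_component)
qed

lemma extend_full:
  assumes h: "arr T h" "dm T h = fst (Fob \<Phi> P)" "cd T h = fst (Fob \<Phi> Q)"
  shows "\<exists>f. mor T (fst P) (fst Q) f \<and> extend P Q f = h"
proof -
  note [simp] = h
  let ?h = "\<lambda>\<chi>. component (Fob \<Phi> P) (Fob \<Phi> Q) \<chi> h"
  have "\<exists>k. eqm P (tw \<chi> Q) k \<and> pm P k (tw \<chi> Q) = iv T (ep \<chi> Q) \<bullet> ?h \<chi>" if [simp]: "\<chi> \<in> carrier D" for \<chi>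
  proof (rule pm_full)
    show "eqm (Fob \<Phi> P) (Fob \<Phi> (tw \<chi> Q)) (iv T (ep \<chi> Q) \<bullet> ?h \<chi>)"
      by (rule eqm_comp[OF component_eqm eqm_iv[OF ep_eq(2)]]) simp_all
  qed simp_all
  then obtain k where k: "\<And>\<chi>. \<chi> \<in> carrier D \<Longrightarrow> eqm P (tw \<chi> Q) (k \<chi>)"
    and pk: "\<And>\<chi>. \<chi> \<in> carrier D \<Longrightarrow> pm P (k \<chi>) (tw \<chi> Q) = iv T (ep \<chi> Q) \<bullet> ?h \<chi>" by metis
  have km: "mor T (fst P) (fst Q) (k \<chi>)" if "\<chi> \<in> carrier D" for \<chi> using eqm_hm[OF P Q k[OF that]] by simp
  have "extend P Q (k \<chi>) = ?h \<chi>" if [simp]: "\<chi> \<in> carrier D" for \<chi>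
    using extend_homog[OF that k[OF that]] by (simp add: pk)
  then have "extend P Q (finsum (Hom T (fst P) (fst Q)) k (carrier D)) = finsum (Hom T (fst (Fob \<Phi> P)) (fst (Fob \<Phi> Q))) ?h (carrier D)"
    using extend_sum[OF finite_D km] by (simp cong: finsum_cong_all)
  also have "\<dots> = h" by (simp add: sum_component)
  finally show ?thesis using km by (intro exI[of _ "finsum (Hom T (fst P) (fst Q)) k (carrier D)"]) simp
qed

end

text \<open>Degrees multiply under composition, and the coherence of the equivariance isomorphisms of \<open>\<Phi>\<close> says
  that their composites are those of the product.\<close>

lemma extend_comp_homog:
  assumes [simp]: "P \<in> Ob T'" "Q \<in> Ob T'" "R \<in> Ob T'" "\<chi> \<in> carrier D" "\<psi> \<in> carrier D"
    and f: "eqm P (tw \<chi> Q) f" and g: "eqm Q (tw \<psi> R) g"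
  shows "extend P R (g \<bullet> f) = extend Q R g \<bullet> extend P Q f"
proof -
  note [simp] = eqm_hm[OF _ _ f] eqm_hm[OF _ _ g]
  have g': "eqm (tw \<chi> Q) (tw (\<chi> \<otimes>\<^bsub>D\<^esub> \<psi>) R) g" using g by (simp add: eqm_tw_tw flip: tw_tw)
  have gf: "eqm P (tw (\<chi> \<otimes>\<^bsub>D\<^esub> \<psi>) R) (g \<bullet> f)" by (rule eqm_comp[OF f g']) simp_all
  have "extend P R (g \<bullet> f) = (ep \<psi> R \<bullet> ep \<chi> (tw \<psi> R)) \<bullet> pm (tw \<chi> Q) g (tw (\<chi> \<otimes>\<^bsub>D\<^esub> \<psi>) R) \<bullet> pm P f (tw \<chi> Q)"
    using extend_homog[OF _ _ _ gf] pm_comp[OF _ _ _ f g'] by (simp add: ep_coh)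
  also have "\<dots> = ep \<psi> R \<bullet> (ep \<chi> (tw \<psi> R) \<bullet> pm (tw \<chi> Q) g (tw \<chi> (tw \<psi> R))) \<bullet> pm P f (tw \<chi> Q)"
    using f g' by (simp add: tw_tw)
  also have "ep \<chi> (tw \<psi> R) \<bullet> pm (tw \<chi> Q) g (tw \<chi> (tw \<psi> R)) = pm Q g (tw \<psi> R) \<bullet> ep \<chi> Q"
    using ep_nat[OF _ _ _ g] by simp
  finally show ?thesis using extend_homog[OF _ _ _ f] extend_homog[OF _ _ _ g] f g by simp
qed

lemma extend_comp:
  assumes P [simp]: "P \<in> Ob T'" and Q [simp]: "Q \<in> Ob T'" and R [simp]: "R \<in> Ob T'"
    and f: "arr T f" "dm T f = fst P" "cd T f = fst Q" and g: "arr T g" "dm T g = fst Q" "cd T g = fst R"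
  shows "extend P R (g \<bullet> f) = extend Q R g \<bullet> extend P Q f"
proof -
  note [simp] = f g
  let ?D = "carrier D" and ?S = "finsum (Hom T (fst P) (fst R))" and ?S' = "finsum (Hom T (fst (Fob \<Phi> P)) (fst (Fob \<Phi> R)))"
  have "g \<bullet> f = finsum (Hom T (fst Q) (fst R)) (\<lambda>\<psi>. component Q R \<psi> g) ?D \<bullet> finsum (Hom T (fst P) (fst Q)) (\<lambda>\<chi>. component P Q \<chi> f) ?D"
    by (simp add: sum_component del: comp_sum sum_comp)
  also have "\<dots> = ?S (\<lambda>\<psi>. ?S (\<lambda>\<chi>. component Q R \<psi> g \<bullet> component P Q \<chi> f) ?D) ?D"
    by (subst sum_comp) (simp_all cong: finsum_cong_all)
  finally have "extend P R (g \<bullet> f) = ?S' (\<lambda>\<psi>. ?S' (\<lambda>\<chi>. extend P R (component Q R \<psi> g \<bullet> component P Q \<chi> f)) ?D) ?D"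
    by (simp add: extend_sum cong: finsum_cong_all)
  also have "\<dots> = ?S' (\<lambda>\<psi>. ?S' (\<lambda>\<chi>. extend Q R (component Q R \<psi> g) \<bullet> extend P Q (component P Q \<chi> f)) ?D) ?D"
  proof (intro finsum_cong_all refl)
    fix \<psi> \<chi> assume "\<psi> \<in> carrier D" "\<chi> \<in> carrier D"
    then show "extend P R (component Q R \<psi> g \<bullet> component P Q \<chi> f) = extend Q R (component Q R \<psi> g) \<bullet> extend P Q (component P Q \<chi> f)"
      by (intro extend_comp_homog[of P Q R \<chi> \<psi>]) simp_all
  qed
  also have "\<dots> = finsum (Hom T (fst (Fob \<Phi> Q)) (fst (Fob \<Phi> R))) (\<lambda>\<psi>. extend Q R (component Q R \<psi> g)) ?D \<bullet>
      finsum (Hom T (fst (Fob \<Phi> P)) (fst (Fob \<Phi> Q))) (\<lambda>\<chi>. extend P Q (component P Q \<chi> f)) ?D"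
    by (subst sum_comp) (simp_all cong: finsum_cong_all)
  finally show ?thesis by (simp only: extend_decomp[OF P Q f] extend_decomp[OF Q R g])
qed

lemma extend_idt: "\<lbrakk>P \<in> Ob T'; fst P = X\<rbrakk> \<Longrightarrow> extend P P (Idt T X) = Idt T (fst (Fob \<Phi> P))"
  by (simp add: extend_plain pm_idt)

lemma extend_tw: assumes "P \<in> Ob T'" "\<chi> \<in> carrier D" "fst P = X" shows "extend (tw \<chi> P) P (Idt T X) = ep \<chi> P"
  using extend_homog[of "tw \<chi> P" P \<chi> "Idt T X"] assms by (simp add: pm_idt)

lemma extend_cn:
  assumes [simp]: "P \<in> Ob T'" "Q \<in> Ob T'" "\<chi> \<in> carrier D" and f: "eqm P (tw \<chi> Q) f"
  shows "Sm (extend P Q f) \<bullet> cn P = cn Q \<bullet> extend (sg P) (sg Q) (Sm f)"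
proof -
  note [simp] = eqm_hm[OF _ _ f]
  have f': "eqm (sg P) (tw \<chi> (sg Q)) (Sm f)" using sm_eqm[OF f] by (simp add: tw_sg)
  have "Sm (extend P Q f) \<bullet> cn P = Sm (ep \<chi> Q) \<bullet> Sm (pm P f (tw \<chi> Q)) \<bullet> cn P"
    using extend_homog[OF _ _ _ f] f by simp
  also have "\<dots> = Sm (ep \<chi> Q) \<bullet> cn (tw \<chi> Q) \<bullet> pm (sg P) (Sm f) (sg (tw \<chi> Q))"
    using cn_nat[OF _ _ f] by simp
  also have "\<dots> = (cn Q \<bullet> ep \<chi> (sg Q)) \<bullet> pm (sg P) (Sm f) (tw \<chi> (sg Q))"
    using comp_reassoc[OF cn_ep[of \<chi> Q], of "pm (sg P) (Sm f) (tw \<chi> (sg Q))"] f' cn_eq(4)[of "tw \<chi> Q"] by (simp add: tw_sg)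
  finally show ?thesis using extend_homog[OF _ _ _ f'] f' by simp
qed


section \<open>The functor on the base category\<close>

text \<open>In the induced object of \<open>X\<close>, the object \<open>X\<close> is the image of the idempotent \<open>incl X \<bullet> retr X\<close>. The
  functor on \<open>T\<close> that is to be constructed must therefore send \<open>X\<close> to an image of \<open>em X\<close>, and such an
  image exists because \<open>T\<close> is idempotent complete.\<close>

abbreviation em where "em X \<equiv> extend (ind X) (ind X) (incl X \<bullet> retr X)"
abbreviation fI where "fI X \<equiv> fst (Fob \<Phi> (ind X))"

definition split_data where
  "split_data X t = (case t of (Y, r, s) \<Rightarrow> Y \<in> Ob T \<and> mor T (fI X) Y r \<and> mor T Y (fI X) s \<and> s \<bullet> r = em X \<and> r \<bullet> s = Idt T Y)"

definition fo where "fo X = fst (SOME t. split_data X t)"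
definition fr where "fr X = fst (snd (SOME t. split_data X t))"
definition fs where "fs X = snd (snd (SOME t. split_data X t))"

lemma rr: "X \<in> Ob T \<Longrightarrow> retr X \<bullet> incl X \<bullet> k = k" if "arr T k" "cd T k = X" for k
  using comp_reassoc1[OF r_simps(7), of X k] that by simp

lemma em_idem: "X \<in> Ob T \<Longrightarrow> em X \<bullet> em X = em X"
  using rr[of "retr X" X] by (simp flip: extend_comp)

lemma split_data:
  assumes X [simp]: "X \<in> Ob T" shows "split_data X (fo X, fr X, fs X)"
proof -
  have "em X \<in> carrier (Hom T (fI X) (fI X))" by (intro in_hom) simp_all
  moreover have "fI X \<in> Ob T" by simp
  ultimately obtain Y r s where "Y \<in> Ob T" "r \<in> carrier (Hom T (fI X) Y)" "s \<in> carrier (Hom T Y (fI X))" "s \<bullet> r = em X" "r \<bullet> s = Idt T Y"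
    using idem em_idem[OF X] unfolding idempotent_complete_def by blast
  then have "split_data X (Y, r, s)" unfolding split_data_def using morI[of "fI X" Y r] morI[of Y "fI X" s] \<open>fI X \<in> Ob T\<close> by simp
  then have "split_data X (SOME t. split_data X t)" by (rule someI)
  then show ?thesis unfolding fo_def fr_def fs_def by simp
qed

lemma f_simps [simp]:
  assumes "X \<in> Ob T"
  shows "fo X \<in> Ob T" "arr T (fr X)" "dm T (fr X) = fI X" "cd T (fr X) = fo X"
    "arr T (fs X)" "dm T (fs X) = fo X" "cd T (fs X) = fI X" "fs X \<bullet> fr X = em X" "fr X \<bullet> fs X = Idt T (fo X)"
  using split_data[OF assms] unfolding split_data_def by simp_all

lemma f_assoc:
  assumes "X \<in> Ob T" "arr T k"
  shows "cd T k = fI X \<Longrightarrow> fs X \<bullet> fr X \<bullet> k = em X \<bullet> k" "cd T k = fo X \<Longrightarrow> fr X \<bullet> fs X \<bullet> k = k"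
  using comp_reassoc1[OF f_simps(8)[OF assms(1)], of k] comp_reassoc1[OF f_simps(9)[OF assms(1)], of k] assms by simp_all

text \<open>Here \<open>fm f\<close> extends \<open>f\<close> by zero to the induced objects before the extension of \<open>\<Phi>\<close> is applied, and
  \<open>fmor f\<close> is the restriction of the result to the images of the idempotents.\<close>

definition fm where "fm f = extend (ind (dm T f)) (ind (cd T f)) (incl (cd T f) \<bullet> f \<bullet> retr (dm T f))"
definition fmor where "fmor f = fr (cd T f) \<bullet> fm f \<bullet> fs (dm T f)"

lemma fm_mor [simp]:
  assumes "arr T f" shows "arr T (fm f)" "dm T (fm f) = fI (dm T f)" "cd T (fm f) = fI (cd T f)"
  unfolding fm_def using assms by simp_all

lemma fm_em:
  assumes f: "arr T f" shows "em (cd T f) \<bullet> fm f = fm f" "fm f \<bullet> em (dm T f) = fm f"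
proof -
  note [simp] = f
  have "em (cd T f) \<bullet> fm f = extend (ind (dm T f)) (ind (cd T f)) ((incl (cd T f) \<bullet> retr (cd T f)) \<bullet> (incl (cd T f) \<bullet> f \<bullet> retr (dm T f)))"
    unfolding fm_def by (subst extend_comp[symmetric]) simp_all
  then show "em (cd T f) \<bullet> fm f = fm f" unfolding fm_def using rr[of "f \<bullet> retr (dm T f)" "cd T f"] by simp
  have "fm f \<bullet> em (dm T f) = extend (ind (dm T f)) (ind (cd T f)) ((incl (cd T f) \<bullet> f \<bullet> retr (dm T f)) \<bullet> (incl (dm T f) \<bullet> retr (dm T f)))"
    unfolding fm_def by (subst extend_comp[symmetric]) simp_all
  then show "fm f \<bullet> em (dm T f) = fm f" unfolding fm_def using rr[of "retr (dm T f)" "dm T f"] by simp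
qed

lemma fm_comp:
  assumes f: "arr T f" and g: "arr T g" "dm T g = cd T f" shows "fm (g \<bullet> f) = fm g \<bullet> fm f"
proof -
  note [simp] = f g
  have "fm g \<bullet> fm f = extend (ind (dm T f)) (ind (cd T g)) ((incl (cd T g) \<bullet> g \<bullet> retr (cd T f)) \<bullet> (incl (cd T f) \<bullet> f \<bullet> retr (dm T f)))"
    unfolding fm_def g(2) by (subst extend_comp[symmetric]) simp_all
  then show ?thesis unfolding fm_def using rr[of "f \<bullet> retr (dm T f)" "cd T f"] by simp
qed

lemma fmor_mor [simp]:
  assumes "arr T f" shows "arr T (fmor f)" "dm T (fmor f) = fo (dm T f)" "cd T (fmor f) = fo (cd T f)"
  unfolding fmor_def using assms by simp_all

lemma fmor_fr:
  assumes f: "arr T f" "dm T f = X" shows "fmor f \<bullet> fr X = fr (cd T f) \<bullet> fm f"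
    "\<lbrakk>arr T k; cd T k = fI X\<rbrakk> \<Longrightarrow> fmor f \<bullet> fr X \<bullet> k = fr (cd T f) \<bullet> fm f \<bullet> k"
proof -
  have *: "fmor f \<bullet> fr (dm T f) = fr (cd T f) \<bullet> fm f"
    unfolding fmor_def using f(1) fm_em(2)[OF f(1)] by simp
  then show "fmor f \<bullet> fr X = fr (cd T f) \<bullet> fm f" using f by simp
  then show "\<lbrakk>arr T k; cd T k = fI X\<rbrakk> \<Longrightarrow> fmor f \<bullet> fr X \<bullet> k = fr (cd T f) \<bullet> fm f \<bullet> k"
    by (rule comp_reassoc) (use f(1) in \<open>simp_all flip: f(2)\<close>)
qed

text \<open>If \<open>X\<close> underlies \<open>P\<close>, then the object underlying \<open>\<Phi> P\<close> is another image of the idempotent \<open>em X\<close>, so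
  it is isomorphic to the chosen one.\<close>

definition sb where "sb P = fr (fst P) \<bullet> extend P (ind (fst P)) (incl (fst P))"

lemma sb_isom [simp]:
  assumes P [simp]: "P \<in> Ob T'" shows "isom T (sb P)" "dm T (sb P) = fst (Fob \<Phi> P)" "cd T (sb P) = fo (fst P)"
proof -
  let ?X = "fst P" let ?I = "ind (fst P)"
  have m: "arr T (sb P)" "dm T (sb P) = fst (Fob \<Phi> P)" "cd T (sb P) = fo ?X" unfolding sb_def by simp_all
  then show "dm T (sb P) = fst (Fob \<Phi> P)" "cd T (sb P) = fo ?X" by simp_all
  \<comment> \<open>the comparison in the other direction\<close>
  define j where "j = extend ?I P (retr ?X) \<bullet> fs ?X"
  have j: "arr T j" "dm T j = fo ?X" "cd T j = fst (Fob \<Phi> P)" unfolding j_def by simp_all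
  have "j \<bullet> sb P = extend ?I P (retr ?X) \<bullet> em ?X \<bullet> extend P ?I (incl ?X)"
    unfolding j_def sb_def by (simp add: f_assoc)
  also have "\<dots> = Idt T (fst (Fob \<Phi> P))" by (simp add: extend_idt flip: extend_comp)
  finally have 1: "j \<bullet> sb P = Idt T (fst (Fob \<Phi> P))" .
  have "sb P \<bullet> j = fr ?X \<bullet> (extend P ?I (incl ?X) \<bullet> extend ?I P (retr ?X)) \<bullet> fs ?X"
    unfolding j_def sb_def by simp
  also have "\<dots> = fr ?X \<bullet> em ?X \<bullet> fs ?X" by (simp flip: extend_comp)
  also have "\<dots> = fr ?X \<bullet> (fs ?X \<bullet> fr ?X) \<bullet> fs ?X" by (simp only: f_simps(8)[OF eob(1)[OF P]])
  also have "\<dots> = Idt T (fo ?X)" by (simp add: f_assoc del: f_simps(8))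
  finally show "isom T (sb P)" using isomI(1)[of "sb P" j] 1 m j by simp
qed

lemma sb_nat:
  assumes [simp]: "P \<in> Ob T'" "Q \<in> Ob T'" and f: "arr T f" "dm T f = fst P" "cd T f = fst Q"
  shows "fmor f \<bullet> sb P = sb Q \<bullet> extend P Q f"
    "\<lbrakk>arr T k; cd T k = fst (Fob \<Phi> P)\<rbrakk> \<Longrightarrow> fmor f \<bullet> sb P \<bullet> k = sb Q \<bullet> extend P Q f \<bullet> k"
proof -
  note [simp] = f
  have "fmor f \<bullet> sb P = fr (fst Q) \<bullet> fm f \<bullet> extend P (ind (fst P)) (incl (fst P))"
    unfolding sb_def by (simp add: fmor_fr)
  also have "fm f \<bullet> extend P (ind (fst P)) (incl (fst P)) = extend P (ind (fst Q)) ((incl (fst Q) \<bullet> f \<bullet> retr (fst P)) \<bullet> incl (fst P))"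
    unfolding fm_def by (subst extend_comp) simp_all
  also have "(incl (fst Q) \<bullet> f \<bullet> retr (fst P)) \<bullet> incl (fst P) = incl (fst Q) \<bullet> f" by simp
  also have "extend P (ind (fst Q)) (incl (fst Q) \<bullet> f) = extend Q (ind (fst Q)) (incl (fst Q)) \<bullet> extend P Q f" by (subst extend_comp) simp_all
  finally show *: "fmor f \<bullet> sb P = sb Q \<bullet> extend P Q f" unfolding sb_def by simp
  show "\<lbrakk>arr T k; cd T k = fst (Fob \<Phi> P)\<rbrakk> \<Longrightarrow> fmor f \<bullet> sb P \<bullet> k = sb Q \<bullet> extend P Q f \<bullet> k"
    by (rule comp_reassoc[OF *]) simp_all
qed

definition F0 :: "('o, 'm, 'o, 'm) lfunctor" where "F0 = \<lparr>Fob = fo, Fmor = fmor\<rparr>"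

lemma F0_simps: "Fob F0 = fo" "Fmor F0 = fmor" by (simp_all add: F0_def)

lemma F0_endo [simp]: "endo F0"
proof (rule endoI; unfold F0_simps)
  show "fmor (Idt T X) = Idt T (fo X)" if [simp]: "X \<in> Ob T" for X
  proof -
    have "fmor (Idt T X) = fr X \<bullet> (fs X \<bullet> fr X) \<bullet> fs X" unfolding fmor_def fm_def by simp
    then show ?thesis by (simp add: f_assoc del: f_simps(8))
  qed
  show "fmor (g \<bullet> f) = fmor g \<bullet> fmor f" if [simp]: "arr T f" "arr T g" "dm T g = cd T f" for f g
  proof -
    have "fmor g \<bullet> fmor f = (fmor g \<bullet> fr (cd T f)) \<bullet> fm f \<bullet> fs (dm T f)" unfolding fmor_def[of f] by simp
    also have "\<dots> = fr (cd T g) \<bullet> (fm g \<bullet> fm f) \<bullet> fs (dm T f)" by (simp add: fmor_fr)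
    finally show ?thesis unfolding fmor_def[of "g \<bullet> f"] by (simp add: fm_comp)
  qed
  show "fmor (pl T f g) = pl T (fmor f) (fmor g)" if [simp]: "arr T f" "arr T g" "dm T g = dm T f" "cd T g = cd T f" for f g
    unfolding fmor_def fm_def by (simp add: comp_pl extend_pl)
  show "fmor (sc T c f) = sc T c (fmor f)" if [simp]: "arr T f" "c \<in> carrier K" for f c
    unfolding fmor_def fm_def by (simp add: extend_sc)
qed simp_all

lemma fm_faithful:
  assumes f: "arr T f" "arr T g" "dm T f = dm T g" "cd T f = cd T g" and e: "fm f = fm g" shows "f = g"
proof -
  note [simp] = f
  have a: "incl (cd T g) \<bullet> f \<bullet> retr (dm T g) = incl (cd T g) \<bullet> g \<bullet> retr (dm T g)"
    by (rule extend_faithful[of "ind (dm T g)" "ind (cd T g)"]) (use e in \<open>simp_all add: fm_def\<close>)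
  have *: "h = retr (cd T g) \<bullet> (incl (cd T g) \<bullet> h \<bullet> retr (dm T g)) \<bullet> incl (dm T g)" if "arr T h" "dm T h = dm T g" "cd T h = cd T g" for h
    using that rr[of h "cd T g"] by simp
  show ?thesis using *[of f] *[of g] a by simp
qed

lemma fm_fmor: assumes f: "arr T f" shows "fs (cd T f) \<bullet> fmor f \<bullet> fr (dm T f) = fm f"
  using f fm_em[OF f] by (simp add: fmor_fr f_assoc)

text \<open>Full faithfulness comes from that of \<open>extend\<close>. For essential surjectivity, the induced object of \<open>X\<close> is isomorphic to some
  \<open>\<Phi> Q\<close>, so \<open>X\<close> is the image of an idempotent on the object underlying \<open>\<Phi> Q\<close>. This idempotent lifts to
  one on the object underlying \<open>Q\<close>, and the image of the lift is sent to \<open>X\<close>.\<close>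

lemma F0_equi [simp]: "equi F0"
  unfolding equi_def F0_simps
proof (intro conjI allI impI ballI)
  fix f g assume a: "arr T f" "arr T g" "dm T f = dm T g" "cd T f = cd T g" "fmor f = fmor g"
  then have "fm f = fm g" using fm_fmor[of f] fm_fmor[of g] by simp
  then show "f = g" using fm_faithful a by blast
next
  fix X Y h assume X [simp]: "X \<in> Ob T" and Y [simp]: "Y \<in> Ob T" and "mor T (fo X) (fo Y) h"
  then have h [simp]: "arr T h" "dm T h = fo X" "cd T h = fo Y" by simp_all
  obtain k where k: "arr T k" "dm T k = sum_ob X" "cd T k = sum_ob Y" "extend (ind X) (ind Y) k = fs Y \<bullet> h \<bullet> fr X"
    using extend_full[of "ind X" "ind Y" "fs Y \<bullet> h \<bullet> fr X"] by auto
  note [simp] = k(1-3)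
  define f where "f = retr Y \<bullet> k \<bullet> incl X"
  have f [simp]: "arr T f" "dm T f = X" "cd T f = Y" unfolding f_def by simp_all
  have "fm f = extend (ind X) (ind Y) ((incl Y \<bullet> retr Y) \<bullet> k \<bullet> (incl X \<bullet> retr X))" unfolding fm_def f unfolding f_def by simp
  also have "\<dots> = em Y \<bullet> extend (ind X) (ind Y) k \<bullet> em X" by (simp flip: extend_comp)
  also have "\<dots> = (em Y \<bullet> fs Y) \<bullet> h \<bullet> (fr X \<bullet> em X)" unfolding k(4) by simp
  also have "em Y \<bullet> fs Y = fs Y \<bullet> (fr Y \<bullet> fs Y)" by (simp flip: f_simps(8))
  also have "fr X \<bullet> em X = (fr X \<bullet> fs X) \<bullet> fr X" by (simp add: f_assoc(2) flip: f_simps(8))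
  finally have fmf: "fm f = fs Y \<bullet> h \<bullet> fr X" by simp
  have "fmor f = (fr Y \<bullet> fs Y) \<bullet> h \<bullet> (fr X \<bullet> fs X)" unfolding fmor_def f fmf by (simp add: f_assoc)
  then have "fmor f = h" by simp
  then show "\<exists>f. mor T X Y f \<and> fmor f = h" by (intro exI[of _ f]) simp
next
  fix X assume X [simp]: "X \<in> Ob T"
  obtain Q where Q [simp]: "Q \<in> Ob T'" and "\<exists>\<theta>. isom T' \<theta> \<and> dm T' \<theta> = Fob \<Phi> Q \<and> cd T' \<theta> = ind X"
    using ys(2) unfolding T'.equi_def by (metis ind_ob X)
  then obtain \<theta>' where t: "isom T' \<theta>'" "dm T' \<theta>' = Fob \<Phi> Q" "cd T' \<theta>' = ind X" by blast
  define \<theta> where "\<theta> = underlying \<theta>'"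
  have "isom T \<theta>" using T'_isom(1)[OF T'.isom_arr[OF t(1)]] t(1) by (simp add: \<theta>_def)
  moreover have "eqm (Fob \<Phi> Q) (ind X) \<theta>" using triple_of(2)[OF T'.isom_arr[OF t(1)] t(2,3)] by (simp add: \<theta>_def)
  ultimately have th [simp]: "isom T \<theta>" "dm T \<theta> = fst (Fob \<Phi> Q)" "cd T \<theta> = sum_ob X" using eqm_D(2,3)[of "Fob \<Phi> Q" "ind X" \<theta>] by simp_all
  \<comment> \<open>\<open>X\<close> as a retract of the object underlying \<open>\<Phi> Q\<close>\<close>
  define i where "i = iv T \<theta> \<bullet> incl X" define p where "p = retr X \<bullet> \<theta>"
  have i [simp]: "arr T i" "dm T i = X" "cd T i = fst (Fob \<Phi> Q)" and p [simp]: "arr T p" "dm T p = fst (Fob \<Phi> Q)" "cd T p = X"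
    unfolding i_def p_def by simp_all
  have pi: "p \<bullet> i = Idt T X" unfolding i_def p_def by simp
  have pik: "p \<bullet> i \<bullet> k = k" if "arr T k" "cd T k = X" for k using comp_reassoc1[OF pi, of k] that by simp
  obtain e where e [simp]: "arr T e" "dm T e = fst Q" "cd T e = fst Q" and fe: "extend Q Q e = i \<bullet> p"
    using extend_full[of Q Q "i \<bullet> p"] by auto
  have ee: "e \<bullet> e = e"
  proof (rule extend_faithful[of Q Q])
    have "extend Q Q (e \<bullet> e) = extend Q Q e \<bullet> extend Q Q e" by (rule extend_comp) simp_all
    then show "extend Q Q (e \<bullet> e) = extend Q Q e" by (simp add: fe pik)
  qed simp_all
  have "e \<in> carrier (Hom T (fst Q) (fst Q))" by (simp add: in_hom)
  then obtain Y r s where Y: "Y \<in> Ob T" and "r \<in> carrier (Hom T (fst Q) Y)" "s \<in> carrier (Hom T Y (fst Q))" and sr: "s \<bullet> r = e" and rs: "r \<bullet> s = Idt T Y"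
    using idem ee eob(1)[OF Q] unfolding idempotent_complete_def by blast
  then have r [simp]: "arr T r" "dm T r = fst Q" "cd T r = Y" and s [simp]: "arr T s" "dm T s = Y" "cd T s = fst Q"
    using morI[of "fst Q" Y r] morI[of Y "fst Q" s] by simp_all
  have FF: "fmor (g \<bullet> f) = fmor g \<bullet> fmor f" if "arr T f" "arr T g" "dm T g = cd T f" for f g
    using fun_comp[OF F0_endo, of g f] that by (simp add: F0_simps)
  have F1: "fmor (Idt T Y) = Idt T (fo Y)" using fun_idt[OF F0_endo Y] by (simp add: F0_simps)
  have [simp]: "fo Y \<in> Ob T" using Y by simp
  define a where "a = p \<bullet> iv T (sb Q) \<bullet> fmor s"
  define b where "b = fmor r \<bullet> sb Q \<bullet> i"
  have a [simp]: "arr T a" "dm T a = fo Y" "cd T a = X" and b [simp]: "arr T b" "dm T b = X" "cd T b = fo Y"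
    unfolding a_def b_def by simp_all
  have s1: "fmor e \<bullet> sb Q = sb Q \<bullet> extend Q Q e" by (rule sb_nat(1)) simp_all
  have "a \<bullet> b = p \<bullet> iv T (sb Q) \<bullet> (fmor s \<bullet> fmor r) \<bullet> sb Q \<bullet> i" unfolding a_def b_def by simp
  also have "\<dots> = p \<bullet> iv T (sb Q) \<bullet> (fmor e \<bullet> sb Q) \<bullet> i" by (simp flip: FF add: sr)
  also have "\<dots> = p \<bullet> (i \<bullet> p) \<bullet> i" unfolding s1 fe by simp
  finally have ab: "a \<bullet> b = Idt T X" by (simp add: pi pik)
  have "b \<bullet> a = fmor r \<bullet> sb Q \<bullet> (i \<bullet> p) \<bullet> iv T (sb Q) \<bullet> fmor s" unfolding a_def b_def by simp
  also have "\<dots> = fmor r \<bullet> (sb Q \<bullet> extend Q Q e) \<bullet> iv T (sb Q) \<bullet> fmor s" by (simp add: fe)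
  also have "\<dots> = fmor r \<bullet> (fmor e \<bullet> sb Q) \<bullet> iv T (sb Q) \<bullet> fmor s" by (simp only: s1)
  also have "\<dots> = fmor (r \<bullet> e \<bullet> s)" by (simp add: FF)
  also have "r \<bullet> e \<bullet> s = Idt T Y" unfolding sr[symmetric] using comp_reassoc1[OF rs, of "r \<bullet> s"] Y by (simp add: rs)
  finally have ba: "b \<bullet> a = Idt T (fo Y)" using F1 by simp
  show "\<exists>Y\<in>Ob T. \<exists>\<theta>. isom T \<theta> \<and> dm T \<theta> = fo Y \<and> cd T \<theta> = X"
    using isomI(1)[of a b] ab ba Y by (intro bexI[of _ Y] exI[of _ a]) simp_all
qed

section \<open>Connecting and equivariance isomorphisms by density\<close>

text \<open>On underlying objects, the connecting isomorphism is the one of \<open>\<Phi>\<close>, and the equivariance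
  isomorphism is given by the structure maps of \<open>\<Phi> P\<close>, both transported along \<open>sb\<close>. By density these
  extend to isomorphisms \<open>om\<close> and \<open>dl g\<close> on \<open>T\<close>.\<close>

definition wb where "wb P = Sm (sb P) \<bullet> cn P \<bullet> iv T (sb (sg P))"
definition om where "om = dense_ext (fcomp F0 (Susp T)) (fcomp (Susp T) F0) wb"
definition db where "db g P = Fmor (ac g) (sb P) \<bullet> snd (Fob \<Phi> P) g \<bullet> iv T (sb P) \<bullet> fmor (iv T (snd P g))"
definition dl where "dl g = dense_ext (fcomp F0 (ac g)) (fcomp (ac g) F0) (db g)"

lemma fmor_isom [simp]: "isom T f \<Longrightarrow> isom T (fmor f)" "isom T f \<Longrightarrow> fmor (iv T f) = iv T (fmor f)"
  using fun_isom[OF F0_endo, of f] by (simp_all add: F0_simps)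

lemma fmor_comp [simp]: "\<lbrakk>arr T g; arr T f; dm T g = cd T f\<rbrakk> \<Longrightarrow> fmor (g \<bullet> f) = fmor g \<bullet> fmor f"
  using fun_comp[OF F0_endo, of g f] by (simp add: F0_simps)

lemma sb_iv_nat:
  assumes [simp]: "P \<in> Ob T'" "Q \<in> Ob T'" and f [simp]: "arr T f" "dm T f = fst P" "cd T f = fst Q"
  shows "extend P Q f \<bullet> iv T (sb P) = iv T (sb Q) \<bullet> fmor f"
proof -
  have "sb Q \<bullet> (extend P Q f \<bullet> iv T (sb P)) = (sb Q \<bullet> extend P Q f) \<bullet> iv T (sb P)" by simp
  also have "\<dots> = sb Q \<bullet> (iv T (sb Q) \<bullet> fmor f)" unfolding sb_nat(1)[OF assms, symmetric] by simp
  finally show ?thesis by (subst (asm) iso_cancel_left) simp_all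
qed

lemma wb_props:
  shows "\<And>P. P \<in> Ob T' \<Longrightarrow> isom T (wb P) \<and> dm T (wb P) = Fob (fcomp F0 (Susp T)) (fst P) \<and> cd T (wb P) = Fob (fcomp (Susp T) F0) (fst P)"
    and "\<And>P Q \<chi> f. \<lbrakk>P \<in> Ob T'; Q \<in> Ob T'; \<chi> \<in> carrier D; eqm P (tw \<chi> Q) f\<rbrakk> \<Longrightarrow>
       Fmor (fcomp (Susp T) F0) f \<bullet> wb P = wb Q \<bullet> Fmor (fcomp F0 (Susp T)) f"
proof -
  show "isom T (wb P) \<and> dm T (wb P) = Fob (fcomp F0 (Susp T)) (fst P) \<and> cd T (wb P) = Fob (fcomp (Susp T) F0) (fst P)"
    if "P \<in> Ob T'" for P unfolding wb_def using that by (simp add: F0_simps)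
  fix P Q \<chi> f assume [simp]: "P \<in> Ob T'" "Q \<in> Ob T'" "\<chi> \<in> carrier D" and e: "eqm P (tw \<chi> Q) f"
  note [simp] = eqm_hm[OF _ _ e]
  have s: "fmor f \<bullet> sb P = sb Q \<bullet> extend P Q f" by (rule sb_nat(1)) simp_all
  have "Sm (fmor f) \<bullet> wb P = Sm (fmor f \<bullet> sb P) \<bullet> cn P \<bullet> iv T (sb (sg P))" unfolding wb_def by simp
  also have "\<dots> = Sm (sb Q) \<bullet> (Sm (extend P Q f) \<bullet> cn P) \<bullet> iv T (sb (sg P))" unfolding s by simp
  also have "\<dots> = Sm (sb Q) \<bullet> cn Q \<bullet> (extend (sg P) (sg Q) (Sm f) \<bullet> iv T (sb (sg P)))" by (simp add: extend_cn[OF _ _ _ e])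
  also have "\<dots> = wb Q \<bullet> fmor (Sm f)" unfolding wb_def by (simp add: sb_iv_nat)
  finally show "Fmor (fcomp (Susp T) F0) f \<bullet> wb P = wb Q \<bullet> Fmor (fcomp F0 (Susp T)) f" by (simp add: F0_simps)
qed

lemma om [simp]:
  assumes "X \<in> Ob T" shows "isom T (om X)" "dm T (om X) = fo (Sg X)" "cd T (om X) = Sg (fo X)"
  using dense_ext_mor[OF _ _ wb_props assms] unfolding om_def by (simp_all add: F0_simps)

lemma om_nat: "arr T f \<Longrightarrow> Sm (fmor f) \<bullet> om (dm T f) = om (cd T f) \<bullet> fmor (Sm f)"
  using dense_ext_nat[OF _ _ wb_props, where f = f] unfolding om_def by (simp add: F0_simps)

lemma om_sb: assumes P [simp]: "P \<in> Ob T'" shows "om (fst P) \<bullet> sb (sg P) = Sm (sb P) \<bullet> cn P"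
proof -
  have "om (fst P) = wb P" using dense_ext_eq[OF _ _ wb_props P] unfolding om_def by simp
  then show ?thesis unfolding wb_def by simp
qed

lemma db_props:
  assumes g [simp]: "g \<in> carrier G"
  shows "\<And>P. P \<in> Ob T' \<Longrightarrow> isom T (db g P) \<and> dm T (db g P) = Fob (fcomp F0 (ac g)) (fst P) \<and> cd T (db g P) = Fob (fcomp (ac g) F0) (fst P)"
    and "\<And>P Q \<chi> f. \<lbrakk>P \<in> Ob T'; Q \<in> Ob T'; \<chi> \<in> carrier D; eqm P (tw \<chi> Q) f\<rbrakk> \<Longrightarrow>
       Fmor (fcomp (ac g) F0) f \<bullet> db g P = db g Q \<bullet> Fmor (fcomp F0 (ac g)) f"
proof -
  show "isom T (db g P) \<and> dm T (db g P) = Fob (fcomp F0 (ac g)) (fst P) \<and> cd T (db g P) = Fob (fcomp (ac g) F0) (fst P)"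
    if "P \<in> Ob T'" for P unfolding db_def using that by (simp add: F0_simps)
  fix P Q \<chi> f assume [simp]: "P \<in> Ob T'" "Q \<in> Ob T'" "\<chi> \<in> carrier D" and e: "eqm P (tw \<chi> Q) f"
  note [simp] = eqm_hm[OF _ _ e]
  let ?c = "\<chi> (inv\<^bsub>G\<^esub> g)"
  have e1: "Fmor (ac g) (extend P Q f) \<bullet> snd (Fob \<Phi> P) g = sc T ?c (snd (Fob \<Phi> Q) g \<bullet> extend P Q f)"
    using eqm_D(4)[OF extend_homog_eqm[OF _ _ _ e] g] by simp
  have e2: "Fmor (ac g) f \<bullet> snd P g = sc T ?c (snd Q g \<bullet> f)"
    using eqm_D(4)[OF e g] by simp
  have e3: "Fmor (ac g) f = sc T ?c (snd Q g \<bullet> f \<bullet> iv T (snd P g))"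
  proof -
    have "Fmor (ac g) f = (Fmor (ac g) f \<bullet> snd P g) \<bullet> iv T (snd P g)" by simp
    also have "\<dots> = sc T ?c (snd Q g \<bullet> f \<bullet> iv T (snd P g))" unfolding e2 by simp
    finally show ?thesis .
  qed
  have fsc: "fmor (sc T c h) = sc T c (fmor h)" if "arr T h" "c \<in> carrier K" for c h
    using fun_sc[OF F0_endo that] by (simp add: F0_simps)
  have s: "fmor f \<bullet> sb P = sb Q \<bullet> extend P Q f" by (rule sb_nat(1)) simp_all
  have "Fmor (ac g) (fmor f) \<bullet> db g P = Fmor (ac g) (fmor f \<bullet> sb P) \<bullet> snd (Fob \<Phi> P) g \<bullet> iv T (sb P) \<bullet> fmor (iv T (snd P g))"
    unfolding db_def by simp
  also have "\<dots> = Fmor (ac g) (sb Q) \<bullet> (Fmor (ac g) (extend P Q f) \<bullet> snd (Fob \<Phi> P) g) \<bullet> iv T (sb P) \<bullet> fmor (iv T (snd P g))"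
    unfolding s by simp
  also have "\<dots> = sc T ?c (Fmor (ac g) (sb Q) \<bullet> snd (Fob \<Phi> Q) g \<bullet> (extend P Q f \<bullet> iv T (sb P)) \<bullet> fmor (iv T (snd P g)))"
    unfolding e1 by simp
  also have "\<dots> = sc T ?c (Fmor (ac g) (sb Q) \<bullet> snd (Fob \<Phi> Q) g \<bullet> iv T (sb Q) \<bullet> fmor f \<bullet> fmor (iv T (snd P g)))"
    by (simp add: sb_iv_nat)
  also have "\<dots> = db g Q \<bullet> fmor (Fmor (ac g) f)"
    unfolding e3 db_def by (simp add: fsc)
  finally show "Fmor (fcomp (ac g) F0) f \<bullet> db g P = db g Q \<bullet> Fmor (fcomp F0 (ac g)) f" by (simp add: F0_simps)
qed

lemma dl [simp]:
  assumes "g \<in> carrier G" "X \<in> Ob T" shows "isom T (dl g X)" "dm T (dl g X) = fo (Fob (ac g) X)" "cd T (dl g X) = Fob (ac g) (fo X)"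
  using dense_ext_mor[OF _ _ db_props[OF assms(1)] assms(2)] assms(1) unfolding dl_def by (simp_all add: F0_simps)

lemma dl_nat: "\<lbrakk>g \<in> carrier G; arr T f; dm T f = X\<rbrakk> \<Longrightarrow> Fmor (ac g) (fmor f) \<bullet> dl g X = dl g (cd T f) \<bullet> fmor (Fmor (ac g) f)"
  using dense_ext_nat[OF _ _ db_props[of g], where f = f] unfolding dl_def by (auto simp add: F0_simps)

lemma dl_nat2:
  assumes "g \<in> carrier G" "arr T f" "arr T k" "cd T k = fo (Fob (ac g) (dm T f))"
  shows "Fmor (ac g) (fmor f) \<bullet> dl g (dm T f) \<bullet> k = dl g (cd T f) \<bullet> fmor (Fmor (ac g) f) \<bullet> k"
  by (rule comp_reassoc[OF dl_nat]) (use assms in simp_all)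

lemma dl_sb:
  assumes P [simp]: "P \<in> Ob T'" and g [simp]: "g \<in> carrier G"
  shows "dl g (fst P) \<bullet> fmor (snd P g) \<bullet> sb P = Fmor (ac g) (sb P) \<bullet> snd (Fob \<Phi> P) g"
proof -
  have "dl g (fst P) = db g P" using dense_ext_eq[OF _ _ db_props[OF g] P] unfolding dl_def by simp
  then show ?thesis unfolding db_def by simp
qed

definition FF :: "('o, 'm, 'o, 'm) tfunctor" where "FF = \<lparr>Fob = fo, Fmor = fmor, conn = om\<rparr>"

lemma FF_simps [simp]: "Fob FF = fo" "Fmor FF = fmor" "conn FF = om" by (simp_all add: FF_def)

lemma FF_endo [simp]: "endo FF"
  using F0_endo by (simp add: linear_functor_def F0_simps)

lemma FF_equi [simp]: "equi FF"
  using F0_equi by (simp add: equi_def F0_simps)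

text \<open>Exactness is tested on equivariant triangles, whose image is isomorphic through \<open>sb\<close> to the image
  under \<open>\<Phi>\<close>.\<close>

lemma FF_tfun [simp]: "triangle_functor K T T FF"
proof (rule triangle_functorI)
  show "Sm (Fmor FF f) \<bullet> conn FF (dm T f) = conn FF (cd T f) \<bullet> Fmor FF (Sm f)" if "arr T f" for f
    using om_nat[OF that] by simp
  fix u v w assume e: "(u, v, w) \<in> Exact T"
  show "(Fmor FF u, Fmor FF v, conn FF (dm T u) \<bullet> Fmor FF w) \<in> Exact T"
  proof (rule exact_pres_dense[OF FF_endo _ _ _ e])
    show "mor T (Fob FF (Sg X)) (Sg (Fob FF X)) (conn FF X)" if "X \<in> Ob T" for X using that by simp
    show "Sm (Fmor FF f) \<bullet> conn FF (dm T f) = conn FF (cd T f) \<bullet> Fmor FF (Sm f)" if "arr T f" for f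
      using om_nat[OF that] by simp
    fix x y z assume e: "(x, y, z) \<in> Exact T'"
    note f = e[unfolded T'_exact_iff]
    obtain P f0 Q where x: "x = (P, f0, Q)" "P \<in> Ob T'" "Q \<in> Ob T'" "eqm P Q f0" "arr T f0" "dm T f0 = fst P" "cd T f0 = fst Q"
      using f T'_arrE[of x] by metis
    obtain f' R where y: "y = (Q, f', R)" "R \<in> Ob T'" "eqm Q R f'" "arr T f'" "dm T f' = fst Q" "cd T f' = fst R"
      using f x T'_arrE[of y] by (metis fst_conv snd_conv)
    obtain f'' where z: "z = (R, f'', sg P)" "eqm R (sg P) f''" "arr T f''" "dm T f'' = fst R" "cd T f'' = Sg (fst P)"
      using f x y T'_arrE2[of z R "sg P"] by auto
    note [simp] = x(2-) y(2-) z(2-)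
    have "(f0, f', f'') \<in> Exact T" using f x y z by simp
    then have e2: "(pm P f0 Q, pm Q f' R, cn P \<bullet> pm R f'' (sg P)) \<in> Exact T" by (intro pm_exact) simp_all
    have "(fmor f0, fmor f', om (fst P) \<bullet> fmor f'') \<in> Exact T"
    proof (rule exact_transport[OF e2, of _ _ _ "sb P" "sb Q" "sb R"])
      show "sb Q \<bullet> pm P f0 Q = fmor f0 \<bullet> sb P" "sb R \<bullet> pm Q f' R = fmor f' \<bullet> sb Q"
        using sb_nat(1)[of P Q f0] sb_nat(1)[of Q R f'] by (simp_all add: extend_plain)
      have "(om (fst P) \<bullet> fmor f'') \<bullet> sb R = (om (fst P) \<bullet> sb (sg P)) \<bullet> pm R f'' (sg P)"
        using sb_nat(1)[of R "sg P" f''] by (simp add: extend_plain)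
      also have "\<dots> = Sm (sb P) \<bullet> cn P \<bullet> pm R f'' (sg P)" unfolding om_sb[OF x(2)] by simp
      finally show "Sm (sb P) \<bullet> cn P \<bullet> pm R f'' (sg P) = (om (fst P) \<bullet> fmor f'') \<bullet> sb R" ..
    qed (simp_all add: cand_def)
    then show "(Fmor FF (underlying x), Fmor FF (underlying y), conn FF (fst (fst x)) \<bullet> Fmor FF (underlying z)) \<in> Exact T"
      using x(1) y(1) z(1) by simp
  qed
qed simp_all

text \<open>Compatibility of \<open>dl\<close> with the connecting isomorphisms and with products of group elements are
  equalities of natural families, so they are checked on underlying objects. There both sides are
  precomposed with the isomorphism \<open>?k\<close>, after which \<open>om_sb\<close> and \<open>dl_sb\<close> turn them into statements
  about \<open>\<Phi> P\<close>.\<close>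

lemma FF_ea [simp]: "ea (FF, dl)"
proof (rule eaI)
  fix g assume g [simp]: "g \<in> carrier G"
  have n: "Fmor (ac g) (fmor f) \<bullet> dl g X = dl g (cd T f) \<bullet> fmor (Fmor (ac g) f)" if "arr T f" "dm T f = X" for f X
    using dl_nat[OF g that] .
  have c: "Sm (dl g X) \<bullet> om (Fob (ac g) X) \<bullet> fmor (conn (ac g) X) = conn (ac g) (fo X) \<bullet> Fmor (ac g) (om X) \<bullet> dl g (Sg X)" if X [simp]: "X \<in> Ob T" for X
  proof (rule dense_eq[where F = "fcomp FF (fcomp (ac g) (Susp T))" and H = "fcomp (Susp T) (fcomp (ac g) FF)" and X = X
     and a = "\<lambda>X. Sm (dl g X) \<bullet> om (Fob (ac g) X) \<bullet> fmor (conn (ac g) X)" and b = "\<lambda>X. conn (ac g) (fo X) \<bullet> Fmor (ac g) (om X) \<bullet> dl g (Sg X)"])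
    fix P assume P [simp]: "P \<in> Ob T'"
    let ?X = "fst P" let ?k = "fmor (snd (sg P) g) \<bullet> sb (sg P)"
    have k: "isom T ?k" "cd T ?k = fo (Fob (ac g) (Sg ?X))" by simp_all
    have "(Sm (dl g ?X) \<bullet> om (Fob (ac g) ?X) \<bullet> fmor (conn (ac g) ?X)) \<bullet> ?k = Sm (dl g ?X) \<bullet> (om (Fob (ac g) ?X) \<bullet> fmor (Sm (snd P g))) \<bullet> sb (sg P)"
      by simp
    also have "om (Fob (ac g) ?X) \<bullet> fmor (Sm (snd P g)) = Sm (fmor (snd P g)) \<bullet> om ?X" using om_nat[of "snd P g"] by simp
    also have "Sm (dl g ?X) \<bullet> (Sm (fmor (snd P g)) \<bullet> om ?X) \<bullet> sb (sg P) = Sm (dl g ?X) \<bullet> Sm (fmor (snd P g)) \<bullet> (om ?X \<bullet> sb (sg P))" by simp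
    also have "\<dots> = Sm (dl g ?X \<bullet> fmor (snd P g) \<bullet> sb P) \<bullet> cn P" unfolding om_sb[OF P] by simp
    also have "\<dots> = Sm (Fmor (ac g) (sb P)) \<bullet> Sm (snd (Fob \<Phi> P) g) \<bullet> cn P" unfolding dl_sb[OF P g] by simp
    finally have 1: "(Sm (dl g ?X) \<bullet> om (Fob (ac g) ?X) \<bullet> fmor (conn (ac g) ?X)) \<bullet> ?k = Sm (Fmor (ac g) (sb P)) \<bullet> Sm (snd (Fob \<Phi> P) g) \<bullet> cn P" .
    have d: "dl g (Sg ?X) \<bullet> ?k = Fmor (ac g) (sb (sg P)) \<bullet> snd (Fob \<Phi> (sg P)) g" using dl_sb[OF sg_ob[OF P] g] by simp
    have "(conn (ac g) (fo ?X) \<bullet> Fmor (ac g) (om ?X) \<bullet> dl g (Sg ?X)) \<bullet> ?k = conn (ac g) (fo ?X) \<bullet> Fmor (ac g) (om ?X) \<bullet> dl g (Sg ?X) \<bullet> ?k" by simp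
    also have "\<dots> = conn (ac g) (fo ?X) \<bullet> Fmor (ac g) (om ?X \<bullet> sb (sg P)) \<bullet> snd (Fob \<Phi> (sg P)) g" unfolding d by simp
    also have "\<dots> = conn (ac g) (fo ?X) \<bullet> Fmor (ac g) (Sm (sb P)) \<bullet> (Fmor (ac g) (cn P) \<bullet> snd (Fob \<Phi> (sg P)) g)" unfolding om_sb[OF P] by simp
    also have "Fmor (ac g) (cn P) \<bullet> snd (Fob \<Phi> (sg P)) g = iv T (conn (ac g) (fst (Fob \<Phi> P))) \<bullet> Sm (snd (Fob \<Phi> P) g) \<bullet> cn P"
      using eqm_D(4)[OF cn_eq(2)[OF P] g] by simp
    also have "conn (ac g) (fo ?X) \<bullet> Fmor (ac g) (Sm (sb P)) \<bullet> iv T (conn (ac g) (fst (Fob \<Phi> P))) \<bullet> Sm (snd (Fob \<Phi> P) g) \<bullet> cn P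
      = Sm (Fmor (ac g) (sb P)) \<bullet> Sm (snd (Fob \<Phi> P) g) \<bullet> cn P"
      using tfun_nat(2)[of "ac g" "sb P" "fst (Fob \<Phi> P)" "iv T (conn (ac g) (fst (Fob \<Phi> P))) \<bullet> Sm (snd (Fob \<Phi> P) g) \<bullet> cn P"] by simp
    finally have "(Sm (dl g ?X) \<bullet> om (Fob (ac g) ?X) \<bullet> fmor (conn (ac g) ?X)) \<bullet> ?k = (conn (ac g) (fo ?X) \<bullet> Fmor (ac g) (om ?X) \<bullet> dl g (Sg ?X)) \<bullet> ?k"
      using 1 by simp
    then show "Sm (dl g ?X) \<bullet> om (Fob (ac g) ?X) \<bullet> fmor (conn (ac g) ?X) = conn (ac g) (fo ?X) \<bullet> Fmor (ac g) (om ?X) \<bullet> dl g (Sg ?X)"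
      by (subst (asm) iso_cancel_right[OF k(1)]) simp_all
  next
    fix f assume f [simp]: "arr T f"
    let ?X = "dm T f" and ?Y = "cd T f"
    have 1: "Sm (Fmor (ac g) (fmor f)) \<bullet> Sm (dl g ?X) = Sm (dl g ?Y) \<bullet> Sm (fmor (Fmor (ac g) f))"
      using n[OF f refl] by (simp flip: fun_comp)
    have 2: "Sm (fmor (Fmor (ac g) f)) \<bullet> om (Fob (ac g) ?X) = om (Fob (ac g) ?Y) \<bullet> fmor (Sm (Fmor (ac g) f))"
      using om_nat[of "Fmor (ac g) f"] by simp
    have 3: "fmor (Sm (Fmor (ac g) f)) \<bullet> fmor (conn (ac g) ?X) = fmor (conn (ac g) ?Y) \<bullet> fmor (Fmor (ac g) (Sm f))"
      using tfun_nat(1)[of "ac g" f ?X] by (simp flip: fmor_comp)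
    show "Fmor (fcomp (Susp T) (fcomp (ac g) FF)) f \<bullet> Sm (dl g ?X) \<bullet> om (Fob (ac g) ?X) \<bullet> fmor (conn (ac g) ?X) =
       (Sm (dl g ?Y) \<bullet> om (Fob (ac g) ?Y) \<bullet> fmor (conn (ac g) ?Y)) \<bullet> Fmor (fcomp FF (fcomp (ac g) (Susp T))) f"
      using comp_reassoc[OF 1, of "om (Fob (ac g) ?X) \<bullet> fmor (conn (ac g) ?X)"] comp_reassoc[OF 2, of "fmor (conn (ac g) ?X)"] 3 by simp
    have 4: "Fmor (ac g) (Sm (fmor f)) \<bullet> Fmor (ac g) (om ?X) = Fmor (ac g) (om ?Y) \<bullet> Fmor (ac g) (fmor (Sm f))"
      using om_nat[OF f] by (simp flip: fun_comp)
    show "Fmor (fcomp (Susp T) (fcomp (ac g) FF)) f \<bullet> conn (ac g) (fo ?X) \<bullet> Fmor (ac g) (om ?X) \<bullet> dl g (Sg ?X) =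
       (conn (ac g) (fo ?Y) \<bullet> Fmor (ac g) (om ?Y) \<bullet> dl g (Sg ?Y)) \<bullet> Fmor (fcomp FF (fcomp (ac g) (Susp T))) f"
      using comp_reassoc[OF 4, of "dl g (Sg ?X)"] n[of "Sm f" "Sg ?X"] by (simp add: tfun_nat)
  qed simp_all
  show "tri_nat_iso T T (tcomp T FF (ac g)) (tcomp T (ac g) FF) (dl g)"
    by (simp add: tni_iff n c)
next
  fix g h X assume g [simp]: "g \<in> carrier G" and h [simp]: "h \<in> carrier G" and X [simp]: "X \<in> Ob T"
  let ?gh = "g \<otimes>\<^bsub>G\<^esub> h"
  have "dl ?gh X \<bullet> fmor (coh A g h X) = coh A g h (fo X) \<bullet> Fmor (ac g) (dl h X) \<bullet> dl g (Fob (ac h) X)"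
  proof (rule dense_eq[where F = "fcomp FF (fcomp (ac g) (ac h))" and H = "fcomp (ac ?gh) FF" and X = X
     and a = "\<lambda>X. dl ?gh X \<bullet> fmor (coh A g h X)" and b = "\<lambda>X. coh A g h (fo X) \<bullet> Fmor (ac g) (dl h X) \<bullet> dl g (Fob (ac h) X)"])
    fix P assume P [simp]: "P \<in> Ob T'"
    let ?X = "fst P" let ?k = "fmor (Fmor (ac g) (snd P h)) \<bullet> fmor (snd P g) \<bullet> sb P"
    have k: "isom T ?k" "cd T ?k = fo (Fob (ac g) (Fob (ac h) ?X))" by simp_all
    have "(dl ?gh ?X \<bullet> fmor (coh A g h ?X)) \<bullet> ?k = dl ?gh ?X \<bullet> fmor (snd P ?gh) \<bullet> sb P"
      by (simp add: eob_cocycle)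
    also have "\<dots> = Fmor (ac ?gh) (sb P) \<bullet> snd (Fob \<Phi> P) ?gh" by (rule dl_sb) simp_all
    finally have 1: "(dl ?gh ?X \<bullet> fmor (coh A g h ?X)) \<bullet> ?k = Fmor (ac ?gh) (sb P) \<bullet> snd (Fob \<Phi> P) ?gh" .
    have "(coh A g h (fo ?X) \<bullet> Fmor (ac g) (dl h ?X) \<bullet> dl g (Fob (ac h) ?X)) \<bullet> ?k =
       coh A g h (fo ?X) \<bullet> Fmor (ac g) (dl h ?X) \<bullet> (dl g (Fob (ac h) ?X) \<bullet> fmor (Fmor (ac g) (snd P h)) \<bullet> fmor (snd P g) \<bullet> sb P)" by simp
    also have "dl g (Fob (ac h) ?X) \<bullet> fmor (Fmor (ac g) (snd P h)) \<bullet> fmor (snd P g) \<bullet> sb P =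
       Fmor (ac g) (fmor (snd P h)) \<bullet> (dl g ?X \<bullet> fmor (snd P g) \<bullet> sb P)"
      using dl_nat2[of g "snd P h" "fmor (snd P g) \<bullet> sb P"] by simp
    also have "\<dots> = Fmor (ac g) (fmor (snd P h)) \<bullet> Fmor (ac g) (sb P) \<bullet> snd (Fob \<Phi> P) g" unfolding dl_sb[OF P g] by simp
    also have "coh A g h (fo ?X) \<bullet> Fmor (ac g) (dl h ?X) \<bullet> Fmor (ac g) (fmor (snd P h)) \<bullet> Fmor (ac g) (sb P) \<bullet> snd (Fob \<Phi> P) g
       = coh A g h (fo ?X) \<bullet> Fmor (ac g) (dl h ?X \<bullet> fmor (snd P h) \<bullet> sb P) \<bullet> snd (Fob \<Phi> P) g" by simp
    also have "\<dots> = coh A g h (fo ?X) \<bullet> Fmor (ac g) (Fmor (ac h) (sb P)) \<bullet> Fmor (ac g) (snd (Fob \<Phi> P) h) \<bullet> snd (Fob \<Phi> P) g" unfolding dl_sb[OF P h] by simp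
    also have "\<dots> = Fmor (ac ?gh) (sb P) \<bullet> snd (Fob \<Phi> P) ?gh"
      using coh_nat(2)[of g h "sb P" "fst (Fob \<Phi> P)" "Fmor (ac g) (snd (Fob \<Phi> P) h) \<bullet> snd (Fob \<Phi> P) g"] by (simp add: eob_cocycle)
    finally have "(dl ?gh ?X \<bullet> fmor (coh A g h ?X)) \<bullet> ?k = (coh A g h (fo ?X) \<bullet> Fmor (ac g) (dl h ?X) \<bullet> dl g (Fob (ac h) ?X)) \<bullet> ?k" using 1 by simp
    then show "dl ?gh ?X \<bullet> fmor (coh A g h ?X) = coh A g h (fo ?X) \<bullet> Fmor (ac g) (dl h ?X) \<bullet> dl g (Fob (ac h) ?X)"
      by (subst (asm) iso_cancel_right[OF k(1)]) simp_all
  next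
    fix f assume f [simp]: "arr T f"
    let ?X = "dm T f" and ?Y = "cd T f"
    have 1: "fmor (Fmor (ac ?gh) f) \<bullet> fmor (coh A g h ?X) = fmor (coh A g h ?Y) \<bullet> fmor (Fmor (ac g) (Fmor (ac h) f))"
      using coh_nat(1)[OF g h f refl] by (simp flip: fmor_comp)
    show "Fmor (fcomp (ac ?gh) FF) f \<bullet> dl ?gh ?X \<bullet> fmor (coh A g h ?X) = (dl ?gh ?Y \<bullet> fmor (coh A g h ?Y)) \<bullet> Fmor (fcomp FF (fcomp (ac g) (ac h))) f"
      using dl_nat2[of ?gh f "fmor (coh A g h ?X)"] 1 by simp
    have 2: "Fmor (ac g) (Fmor (ac h) (fmor f)) \<bullet> Fmor (ac g) (dl h ?X) = Fmor (ac g) (dl h ?Y) \<bullet> Fmor (ac g) (fmor (Fmor (ac h) f))"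
      using dl_nat[OF h f refl] by (simp flip: fun_comp)
    show "Fmor (fcomp (ac ?gh) FF) f \<bullet> coh A g h (fo ?X) \<bullet> Fmor (ac g) (dl h ?X) \<bullet> dl g (Fob (ac h) ?X) =
       (coh A g h (fo ?Y) \<bullet> Fmor (ac g) (dl h ?Y) \<bullet> dl g (Fob (ac h) ?Y)) \<bullet> Fmor (fcomp FF (fcomp (ac g) (ac h))) f"
      using comp_reassoc[OF 2, of "dl g (Fob (ac h) ?X)"] dl_nat[of g "Fmor (ac h) f" "Fob (ac h) ?X"] by (simp add: coh_nat)
  qed simp_all
  then show "dl ?gh X \<bullet> Fmor FF (coh A g h X) = coh A g h (Fob FF X) \<bullet> Fmor (ac g) (dl h X) \<bullet> dl g (Fob (ac h) X)" by simp
qed simp_all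

lemma FF_iso: "T'.ei (\<Phi>, \<epsilon>) (fz (FF, dl))"
proof -
  note [simp] = zo_ob[OF FF_ea] fz_endo[OF FF_ea] zo_tw[OF FF_ea] zo_eqm[OF FF_ea] zo_conn[OF FF_ea]
  have e [simp]: "eqm (Fob \<Phi> P) (zo (FF, dl) P) (sb P)" if P [simp]: "P \<in> Ob T'" for P
    by (rule eqmI) (simp_all add: dl_sb)
  have "T'.ei (\<Phi>, \<epsilon>) (fst (fz (FF, dl)), snd (fz (FF, dl)))"
  proof (rule T'.eiI)
    show "tri_nat_iso T' T' \<Phi> (fst (fz (FF, dl))) (\<lambda>P. (Fob \<Phi> P, sb P, zo (FF, dl) P))"
    proof (subst T'.tni_iff; (intro conjI ballI allI impI)?)
      fix t assume "arr T' t"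
      then obtain P f Q where [simp]: "t = (P, f, Q)" "P \<in> Ob T'" "Q \<in> Ob T'" "eqm P Q f" "arr T f" "dm T f = fst P" "cd T f = fst Q"
        by (rule T'_arrE)
      show "Fmor (fst (fz (FF, dl))) t \<cdot>\<^bsub>T'\<^esub> (Fob \<Phi> (dm T' t), sb (dm T' t), zo (FF, dl) (dm T' t)) =
         (Fob \<Phi> (cd T' t), sb (cd T' t), zo (FF, dl) (cd T' t)) \<cdot>\<^bsub>T'\<^esub> Fmor \<Phi> t"
        using sb_nat(1)[of P Q f] by (simp add: extend_plain pm_eq)
    next
      fix P assume P [simp]: "P \<in> Ob T'"
      show "Fmor (Susp T') (Fob \<Phi> P, sb P, zo (FF, dl) P) \<cdot>\<^bsub>T'\<^esub> conn \<Phi> P =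
         conn (fst (fz (FF, dl))) P \<cdot>\<^bsub>T'\<^esub> (Fob \<Phi> (Fob (Susp T') P), sb (Fob (Susp T') P), zo (FF, dl) (Fob (Susp T') P))"
        using om_sb[OF P] by (simp add: cn_eq(1))
    qed simp_all
    fix \<chi> P assume \<chi> [simp]: "\<chi> \<in> carrier D" and P [simp]: "P \<in> Ob T'"
    have "sb P \<bullet> ep \<chi> P = sb (tw \<chi> P)"
      using sb_nat(1)[of "tw \<chi> P" P "Idt T (fst P)"] fun_idt[OF FF_endo, of "fst P"] by (simp add: extend_tw)
    then show "Fmor (act A' \<chi>) (Fob \<Phi> P, sb P, zo (FF, dl) P) \<cdot>\<^bsub>T'\<^esub> \<epsilon> \<chi> P =
       snd (fz (FF, dl)) \<chi> P \<cdot>\<^bsub>T'\<^esub> (Fob \<Phi> (Fob (act A' \<chi>) P), sb (Fob (act A' \<chi>) P), zo (FF, dl) (Fob (act A' \<chi>) P))"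
      by (simp add: ep_eq(1))
  qed
  then show ?thesis by simp
qed

end

lemma fz_surjective:
  assumes "T'.ea y" shows "\<exists>x. ea x \<and> T'.ei y (fz x)"
proof -
  obtain \<Phi> \<epsilon> where y: "y = (\<Phi>, \<epsilon>)" by (metis surj_pair)
  then show ?thesis using FF_ea FF_iso assms by blast
qed

end

section \<open>Scalars from the triangle center\<close>

context susp_category
begin

lemma center_map:
  assumes "c \<in> carrier K" "X \<in> Ob T"
  shows "(c \<odot>\<^bsub>tri_center T\<^esub> \<one>\<^bsub>tri_center T\<^esub>) X = sc T c (Idt T X)"
  using assms by (simp add: tri_center_def sc_eq)

lemma center_scalar:
  assumes t: "tri_center_trivial K T" and m: "\<And>X. X \<in> Ob T \<Longrightarrow> mor T X X (\<zeta> X)"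
    and n: "\<And>f. arr T f \<Longrightarrow> f \<bullet> \<zeta> (dm T f) = \<zeta> (cd T f) \<bullet> f" and s: "\<And>X. X \<in> Ob T \<Longrightarrow> Sm (\<zeta> X) = \<zeta> (Sg X)"
  obtains c where "c \<in> carrier K" "\<And>X. X \<in> Ob T \<Longrightarrow> \<zeta> X = sc T c (Idt T X)"
proof -
  let ?z = "restrict \<zeta> (Ob T)"
  note [simp] = m[unfolded mor_iff]
  have "nat_trans T T fid fid ?z"
    using n by (subst nat_trans_iff) simp_all
  then have "?z \<in> carrier (tri_center T)"
    using s by (simp add: tri_center_def)
  moreover have "(\<lambda>c. c \<odot>\<^bsub>tri_center T\<^esub> \<one>\<^bsub>tri_center T\<^esub>) ` carrier K = carrier (tri_center T)"
    using t unfolding tri_center_trivial_def ring_iso_def bij_betw_def by blast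
  ultimately obtain c where c: "c \<in> carrier K" "?z = c \<odot>\<^bsub>tri_center T\<^esub> \<one>\<^bsub>tri_center T\<^esub>" by blast
  have "\<zeta> X = sc T c (Idt T X)" if X: "X \<in> Ob T" for X
  proof -
    have "?z X = sc T c (Idt T X)" unfolding c(2) using center_map[OF c(1) X] .
    then show ?thesis using X by simp
  qed
  then show ?thesis using that c(1) by blast
qed

lemma center_scalar_unique:
  assumes t: "tri_center_trivial K T" and c: "c \<in> carrier K" "d \<in> carrier K"
    and e: "\<And>X. X \<in> Ob T \<Longrightarrow> sc T c (Idt T X) = sc T d (Idt T X)"
  shows "c = d"
proof -
  have "c \<odot>\<^bsub>tri_center T\<^esub> \<one>\<^bsub>tri_center T\<^esub> = d \<odot>\<^bsub>tri_center T\<^esub> \<one>\<^bsub>tri_center T\<^esub>"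
  proof (rule extensionalityI[of _ "Ob T"])
    show "c \<odot>\<^bsub>tri_center T\<^esub> \<one>\<^bsub>tri_center T\<^esub> \<in> extensional (Ob T)" "d \<odot>\<^bsub>tri_center T\<^esub> \<one>\<^bsub>tri_center T\<^esub> \<in> extensional (Ob T)"
      by (simp_all add: tri_center_def)
    fix X assume X: "X \<in> Ob T"
    show "(c \<odot>\<^bsub>tri_center T\<^esub> \<one>\<^bsub>tri_center T\<^esub>) X = (d \<odot>\<^bsub>tri_center T\<^esub> \<one>\<^bsub>tri_center T\<^esub>) X"
      unfolding center_map[OF c(1) X] center_map[OF c(2) X] using e[OF X] .
  qed
  then show ?thesis
    using t c unfolding tri_center_trivial_def ring_iso_def bij_betw_def inj_on_def by blast
qed

text \<open>By full faithfulness of \<open>F\<close>, the composite of one isomorphism with the inverse of the other is the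
  image of a unit of the triangle center.\<close>

lemma tni_scalar:
  assumes t: "tri_center_trivial K T" and F [simp]: "triangle_functor K T T F" "equi F" and H [simp]: "triangle_functor K T T H"
    and e: "tri_nat_iso T T F H \<eta>" and u: "tri_nat_iso T T F H \<mu>"
  obtains c where "c \<in> carrier K" "c \<noteq> \<zero>" "\<And>X. X \<in> Ob T \<Longrightarrow> \<mu> X = sc T c (\<eta> X)"
proof -
  have m [simp]: "isom T (\<eta> X)" "dm T (\<eta> X) = Fob F X" "cd T (\<eta> X) = Fob H X"
    "isom T (\<mu> X)" "dm T (\<mu> X) = Fob F X" "cd T (\<mu> X) = Fob H X" if "X \<in> Ob T" for X
    using tni_mor[OF e _ _ that] tni_mor[OF u _ _ that] by simp_all
  define \<zeta> where "\<zeta> X = rfl F X X (iv T (\<eta> X) \<bullet> \<mu> X)" for X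
  have z [simp]: "arr T (\<zeta> X)" "dm T (\<zeta> X) = X" "cd T (\<zeta> X) = X" "Fmor F (\<zeta> X) = iv T (\<eta> X) \<bullet> \<mu> X" if "X \<in> Ob T" for X
    unfolding \<zeta>_def using that by simp_all
  have zi [simp]: "isom T (\<zeta> X)" if "X \<in> Ob T" for X
    by (rule equi_isom[OF _ F(2)]) (use that in simp_all)
  have a: "tri_nat_iso T T F F (\<lambda>X. iv T (\<eta> X) \<bullet> \<mu> X)"
    by (rule tni_trans[OF u tni_sym[OF e]]) simp_all
  have n: "f \<bullet> \<zeta> (dm T f) = \<zeta> (cd T f) \<bullet> f" if f [simp]: "arr T f" for f
    by (rule equi_faithful[OF F(2)]) (use tni_nat(1)[OF a, of f "dm T f"] in simp_all)
  have s: "Sm (\<zeta> X) = \<zeta> (Sg X)" if X [simp]: "X \<in> Ob T" for X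
  proof (rule equi_faithful[OF F(2)])
    have "conn F X \<bullet> Fmor F (Sm (\<zeta> X)) = Sm (Fmor F (\<zeta> X)) \<bullet> conn F X" using tfun_nat(1)[OF F(1), of "\<zeta> X" X] by simp
    also have "\<dots> = conn F X \<bullet> Fmor F (\<zeta> (Sg X))" using tni_conn(1)[OF a F(1) F(1) X] by simp
    finally show "Fmor F (Sm (\<zeta> X)) = Fmor F (\<zeta> (Sg X))" by (subst (asm) iso_cancel_left) simp_all
  qed simp_all
  obtain c where c: "c \<in> carrier K" "\<And>X. X \<in> Ob T \<Longrightarrow> \<zeta> X = sc T c (Idt T X)"
    using center_scalar[OF t _ n s] by (metis mor_iff z(1-3))
  have "c \<noteq> \<zero>"
  proof
    assume c0: "c = \<zero>"
    have "sc T \<zero> (Idt T X) = sc T \<one> (Idt T X)" if X [simp]: "X \<in> Ob T" for X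
    proof -
      have "Idt T X = iv T (\<zeta> X) \<bullet> \<zeta> X" by simp
      also have "\<dots> = iv T (\<zeta> X) \<bullet> sc T \<zero> (Idt T X)" by (rule arg_cong[where f="\<lambda>z. iv T (\<zeta> X) \<bullet> z"]) (use c(2)[OF X] c0 in blast)
      also have "\<dots> = sc T \<zero> (iv T (\<zeta> X))" by simp
      also have "\<dots> = sc T \<zero> (Idt T X)" by (simp add: sc_zero)
      finally show ?thesis by simp
    qed
    then have "\<zero> = \<one>" using center_scalar_unique[OF t zero_closed one_closed] by blast
    then show False by simp
  qed
  moreover have "\<mu> X = sc T c (\<eta> X)" if X [simp]: "X \<in> Ob T" for X
  proof -
    have "\<mu> X = \<eta> X \<bullet> Fmor F (\<zeta> X)" by simp
    also have "\<dots> = \<eta> X \<bullet> Fmor F (sc T c (Idt T X))" unfolding c(2)[OF X] ..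
    also have "\<dots> = sc T c (\<eta> X)" using c(1) by simp
    finally show ?thesis .
  qed
  ultimately show ?thesis using that c(1) by blast
qed

definition tri_isomorphic where "tri_isomorphic F H \<longleftrightarrow> triangle_functor K T T F \<and> triangle_functor K T T H \<and> (\<exists>\<eta>. tri_nat_iso T T F H \<eta>)"

lemma tri_isomorphic_sym: "tri_isomorphic F H \<Longrightarrow> tri_isomorphic H F"
  unfolding tri_isomorphic_def using tni_sym by blast

lemma tri_isomorphic_trans: "tri_isomorphic F H \<Longrightarrow> tri_isomorphic H L \<Longrightarrow> tri_isomorphic F L"
  unfolding tri_isomorphic_def using tni_trans by blast

lemma tri_isomorphic_left: "tri_isomorphic F H \<Longrightarrow> triangle_functor K T T L \<Longrightarrow> tri_isomorphic (tcomp T L F) (tcomp T L H)"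
  unfolding tri_isomorphic_def using tni_whisker_left triangle_tcomp by blast

lemma tri_isomorphic_right: "tri_isomorphic F H \<Longrightarrow> triangle_functor K T T L \<Longrightarrow> tri_isomorphic (tcomp T F L) (tcomp T H L)"
  unfolding tri_isomorphic_def using tni_whisker_right triangle_tcomp by blast

lemma tri_isomorphic_assoc:
  assumes [simp]: "triangle_functor K T T F" "triangle_functor K T T H" "triangle_functor K T T L"
  shows "tri_isomorphic (tcomp T (tcomp T F H) L) (tcomp T F (tcomp T H L))"
proof -
  have "tri_nat_iso T T (tcomp T (tcomp T F H) L) (tcomp T F (tcomp T H L)) (\<lambda>X. Idt T (Fob (tcomp T (tcomp T F H) L) X))"
    by (rule tni_eq) simp_all
  then show ?thesis unfolding tri_isomorphic_def by (intro conjI exI triangle_tcomp assms)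
qed

lemma tri_isomorphic_unit:
  assumes [simp]: "triangle_functor K T T F"
  shows "tri_isomorphic (tcomp T (tid T) F) F" "tri_isomorphic (tcomp T F (tid T)) F"
proof -
  have "tri_nat_iso T T (tcomp T (tid T) F) F (\<lambda>X. Idt T (Fob (tcomp T (tid T) F) X))"
    "tri_nat_iso T T (tcomp T F (tid T)) F (\<lambda>X. Idt T (Fob (tcomp T F (tid T)) X))"
    by (rule tni_eq; simp)+
  then show "tri_isomorphic (tcomp T (tid T) F) F" "tri_isomorphic (tcomp T F (tid T)) F"
    unfolding tri_isomorphic_def using triangle_tcomp[OF triangle_tid(1) assms] triangle_tcomp[OF assms triangle_tid(1)] assms by blast+
qed

end

context equivariant
begin

definition iso_to_action where "iso_to_action F \<longleftrightarrow> (\<exists>a\<in>carrier G. tri_isomorphic F (ac a))"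

lemma iso_to_action_iff: "triangle_functor K T T F \<Longrightarrow> iso_to_action F \<longleftrightarrow> (\<exists>a\<in>carrier G. \<exists>\<phi>. tri_nat_iso T T F (ac a) \<phi>)"
  unfolding iso_to_action_def tri_isomorphic_def using act_tfun by blast

lemma coh_tri_isomorphic: "\<lbrakk>a \<in> carrier G; b \<in> carrier G\<rbrakk> \<Longrightarrow> tri_isomorphic (tcomp T (ac a) (ac b)) (ac (a \<otimes>\<^bsub>G\<^esub> b))"
  unfolding tri_isomorphic_def using coh_iso act_tfun triangle_tcomp by (metis G.m_closed)

lemma unit_at_tri_isomorphic: "tri_isomorphic (tid T) (ac ee)"
  unfolding tri_isomorphic_def using unit_at_tni triangle_tid by (metis G.one_closed act_tfun(1))

lemma iso_to_action_mult: "\<lbrakk>iso_to_action F; iso_to_action H\<rbrakk> \<Longrightarrow> iso_to_action (tcomp T F H)"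
proof -
  assume "iso_to_action F" "iso_to_action H"
  then obtain a b where a: "a \<in> carrier G" "tri_isomorphic F (ac a)" and b: "b \<in> carrier G" "tri_isomorphic H (ac b)" unfolding iso_to_action_def by blast
  have "tri_isomorphic (tcomp T F H) (tcomp T (ac a) H)" using tri_isomorphic_right[OF a(2)] b(2) by (simp add: tri_isomorphic_def)
  moreover have "tri_isomorphic (tcomp T (ac a) H) (tcomp T (ac a) (ac b))" using tri_isomorphic_left[OF b(2)] a(1) by simp
  ultimately have "tri_isomorphic (tcomp T F H) (ac (a \<otimes>\<^bsub>G\<^esub> b))" using coh_tri_isomorphic[OF a(1) b(1)] tri_isomorphic_trans by blast
  then show ?thesis unfolding iso_to_action_def using a b by blast
qed

lemma iso_to_action_inverse:
  assumes F: "iso_to_action F" and H [simp]: "triangle_functor K T T H" and i: "tri_isomorphic (tcomp T F H) (tid T)"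
  shows "iso_to_action H"
proof -
  obtain a where a [simp]: "a \<in> carrier G" and t: "tri_isomorphic F (ac a)" using F unfolding iso_to_action_def by blast
  let ?i = "ac (inv\<^bsub>G\<^esub> a)"
  have Ft [simp]: "triangle_functor K T T F" using t by (simp add: tri_isomorphic_def)
  have "tri_isomorphic (tcomp T ?i F) (tcomp T ?i (ac a))" using tri_isomorphic_left[OF t] by simp
  moreover have "tri_isomorphic (tcomp T ?i (ac a)) (ac ee)" using coh_tri_isomorphic[of "inv\<^bsub>G\<^esub> a" a] by simp
  ultimately have "tri_isomorphic (tcomp T ?i F) (tid T)" using unit_at_tri_isomorphic tri_isomorphic_sym tri_isomorphic_trans by blast
  then have "tri_isomorphic (tcomp T (tcomp T ?i F) H) (tcomp T (tid T) H)" using tri_isomorphic_right by simp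
  then have 1: "tri_isomorphic (tcomp T (tcomp T ?i F) H) H" using tri_isomorphic_unit(1)[OF H] tri_isomorphic_trans by blast
  have "tri_isomorphic (tcomp T ?i (tcomp T F H)) (tcomp T ?i (tid T))" using tri_isomorphic_left[OF i] by simp
  then have "tri_isomorphic (tcomp T ?i (tcomp T F H)) ?i" by (rule tri_isomorphic_trans) (rule tri_isomorphic_unit(2)[OF act_tfun(1)[OF G.inv_closed[OF a]]])
  with tri_isomorphic_assoc[OF act_tfun(1)[OF G.inv_closed[OF a]] Ft H] have "tri_isomorphic (tcomp T (tcomp T ?i F) H) ?i" by (rule tri_isomorphic_trans)
  then have "tri_isomorphic H ?i" using 1 tri_isomorphic_sym tri_isomorphic_trans by blast
  then show ?thesis unfolding iso_to_action_def using a by blast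
qed

text \<open>Every object is a retract of an underlying one.\<close>

lemma scalar_on_base:
  assumes t: "tri_center_trivial K T" and c [simp]: "c \<in> carrier K" "d \<in> carrier K"
    and e: "\<And>P. P \<in> Ob T' \<Longrightarrow> sc T c (Idt T (fst P)) = sc T d (Idt T (fst P))"
  shows "c = d"
proof (rule center_scalar_unique[OF t c])
  fix X assume X [simp]: "X \<in> Ob T"
  have "retr X \<bullet> sc T c (Idt T (sum_ob X)) \<bullet> incl X = retr X \<bullet> sc T d (Idt T (sum_ob X)) \<bullet> incl X"
    using e[of "ind X"] by simp
  then show "sc T c (Idt T X) = sc T d (Idt T X)" by simp
qed

section \<open>Functors isomorphic to group elements and to characters\<close>

text \<open>The functors \<open>F F\<^sub>g\<close> and \<open>F\<^sub>g F\<^sub>a\<close> are identified in two ways, through \<open>\<delta> g\<close> and through the coherence of the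
  action, which uses that the group is commutative. The two identifications differ by a scalar \<open>l g\<close>.
  Composed with the inverse of the structure map at \<open>a\<close>, the isomorphism \<open>\<phi>\<close> gives \<open>\<psi>\<close> from the
  equivariantization of \<open>F\<close> to the identity, equivariant up to \<open>l\<close>; so \<open>l\<close> is multiplicative and
  \<open>\<psi>\<close> is an isomorphism to the twist by the corresponding character.\<close>

lemma iso_to_action_char:
  assumes t: "tri_center_trivial K T" and xe: "ea (F, \<delta>)" and a: "iso_to_action F"
  shows "\<exists>\<chi>\<in>carrier D. T'.tri_isomorphic (fst (fz (F, \<delta>))) (act A' \<chi>)"
proof -
  note [simp] = ea_simps[OF xe] zo_ob[OF xe] fz_endo[OF xe] fz_tfun[OF xe] zo_tw[OF xe]
  obtain a \<phi> where a [simp]: "a \<in> carrier G" and ph: "tri_nat_iso T T F (ac a) \<phi>"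
    using a unfolding iso_to_action_def tri_isomorphic_def by blast
  have m [simp]: "isom T (\<phi> X)" "dm T (\<phi> X) = Fob F X" "cd T (\<phi> X) = Fob (ac a) X" if "X \<in> Ob T" for X
    using tni_mor[OF ph _ _ that] by simp_all
  have "\<exists>c. c \<in> carrier K \<and> c \<noteq> \<zero> \<and> (\<forall>X\<in>Ob T. Fmor (ac g) (\<phi> X) \<bullet> \<delta> g X = sc T c (iv T (coh A g a X) \<bullet> coh A a g X \<bullet> \<phi> (Fob (ac g) X)))"
    if g [simp]: "g \<in> carrier G" for g
  proof -
    have 1: "tri_nat_iso T T (tcomp T F (ac g)) (tcomp T (ac g) (ac a)) (\<lambda>X. Fmor (ac g) (\<phi> X) \<bullet> \<delta> g X)"
      by (rule tni_trans[OF ea_tni[OF xe g] tni_whisker_left[OF ph]]) simp_all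
    have ag: "a \<otimes>\<^bsub>G\<^esub> g = g \<otimes>\<^bsub>G\<^esub> a" by (simp add: G.m_comm)
    have c1: "tri_nat_iso T T (tcomp T (ac a) (ac g)) (ac (g \<otimes>\<^bsub>G\<^esub> a)) (coh A a g)"
      using coh_iso[of a g] ag by simp
    have c2: "tri_nat_iso T T (ac (g \<otimes>\<^bsub>G\<^esub> a)) (tcomp T (ac g) (ac a)) (\<lambda>X. iv T (coh A g a X))"
      by (rule tni_sym[OF coh_iso]) simp_all
    have 2: "tri_nat_iso T T (tcomp T F (ac g)) (tcomp T (ac g) (ac a)) (\<lambda>X. iv T (coh A g a X) \<bullet> coh A a g X \<bullet> \<phi> (Fob (ac g) X))"
      by (rule tni_trans[OF tni_trans[OF tni_whisker_right[OF ph] c1] c2]) simp_all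
    obtain c where "c \<in> carrier K" "c \<noteq> \<zero>" "\<And>X. X \<in> Ob T \<Longrightarrow> Fmor (ac g) (\<phi> X) \<bullet> \<delta> g X = sc T c (iv T (coh A g a X) \<bullet> coh A a g X \<bullet> \<phi> (Fob (ac g) X))"
      using tni_scalar[OF t _ _ _ 2 1] by auto
    then show ?thesis by blast
  qed
  then obtain l where l [simp]: "\<And>g. g \<in> carrier G \<Longrightarrow> l g \<in> carrier K" "\<And>g. g \<in> carrier G \<Longrightarrow> l g \<noteq> \<zero>"
    and le: "\<And>g X. \<lbrakk>g \<in> carrier G; X \<in> Ob T\<rbrakk> \<Longrightarrow> Fmor (ac g) (\<phi> X) \<bullet> \<delta> g X = sc T (l g) (iv T (coh A g a X) \<bullet> coh A a g X \<bullet> \<phi> (Fob (ac g) X))"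
    by metis
  define \<psi> where "\<psi> P = iv T (snd P a) \<bullet> \<phi> (fst P)" for P
  have ps [simp]: "isom T (\<psi> P)" "dm T (\<psi> P) = Fob F (fst P)" "cd T (\<psi> P) = fst P" if "P \<in> Ob T'" for P
    unfolding \<psi>_def using that by simp_all
  have E: "Fmor (ac g) (\<psi> P) \<bullet> snd (zo (F, \<delta>) P) g = sc T (l g) (snd P g \<bullet> \<psi> P)" if g [simp]: "g \<in> carrier G" and P [simp]: "P \<in> Ob T'" for g P
  proof -
    let ?X = "fst P"
    have ag: "a \<otimes>\<^bsub>G\<^esub> g = g \<otimes>\<^bsub>G\<^esub> a" by (simp add: G.m_comm)
    have ct [simp]: "cd T (coh A a g ?X) = Fob (ac (g \<otimes>\<^bsub>G\<^esub> a)) ?X" using coh_mor(3)[of a g ?X] ag by simp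
    have "snd P (g \<otimes>\<^bsub>G\<^esub> a) = coh A a g ?X \<bullet> Fmor (ac a) (snd P g) \<bullet> snd P a" using eob_cocycle[of P a g] ag by simp
    then have h: "coh A a g ?X \<bullet> Fmor (ac a) (snd P g) \<bullet> snd P a = coh A g a ?X \<bullet> Fmor (ac g) (snd P a) \<bullet> snd P g"
      using eob_cocycle[of P g a] by simp
    have h2: "coh A a g ?X \<bullet> Fmor (ac a) (snd P g) = coh A g a ?X \<bullet> Fmor (ac g) (snd P a) \<bullet> snd P g \<bullet> iv T (snd P a)"
    proof -
      have "coh A a g ?X \<bullet> Fmor (ac a) (snd P g) = (coh A a g ?X \<bullet> Fmor (ac a) (snd P g) \<bullet> snd P a) \<bullet> iv T (snd P a)" by simp
      also have "\<dots> = coh A g a ?X \<bullet> Fmor (ac g) (snd P a) \<bullet> snd P g \<bullet> iv T (snd P a)" unfolding h by simp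
      finally show ?thesis .
    qed
    have "Fmor (ac g) (\<psi> P) \<bullet> snd (zo (F, \<delta>) P) g = Fmor (ac g) (iv T (snd P a)) \<bullet> (Fmor (ac g) (\<phi> ?X) \<bullet> \<delta> g ?X) \<bullet> Fmor F (snd P g)"
      unfolding \<psi>_def by simp
    also have "\<dots> = sc T (l g) (Fmor (ac g) (iv T (snd P a)) \<bullet> iv T (coh A g a ?X) \<bullet> coh A a g ?X \<bullet> (\<phi> (Fob (ac g) ?X) \<bullet> Fmor F (snd P g)))"
      unfolding le[OF g eob(1)[OF P]] by simp
    also have "\<phi> (Fob (ac g) ?X) \<bullet> Fmor F (snd P g) = Fmor (ac a) (snd P g) \<bullet> \<phi> ?X"
      using tni_nat(1)[OF ph, of "snd P g" ?X] by simp
    also have "Fmor (ac g) (iv T (snd P a)) \<bullet> iv T (coh A g a ?X) \<bullet> coh A a g ?X \<bullet> Fmor (ac a) (snd P g) \<bullet> \<phi> ?X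
      = Fmor (ac g) (iv T (snd P a)) \<bullet> iv T (coh A g a ?X) \<bullet> (coh A a g ?X \<bullet> Fmor (ac a) (snd P g)) \<bullet> \<phi> ?X" by simp
    also have "\<dots> = snd P g \<bullet> \<psi> P" unfolding h2 \<psi>_def by simp
    finally show ?thesis .
  qed
  have lm: "l (g \<otimes>\<^bsub>G\<^esub> h) = l g \<otimes> l h" if g [simp]: "g \<in> carrier G" and h [simp]: "h \<in> carrier G" for g h
  proof (rule scalar_on_base[OF t])
    fix P assume P [simp]: "P \<in> Ob T'"
    let ?X = "fst P" let ?Z = "zo (F, \<delta>) P"
    have "Fmor (ac (g \<otimes>\<^bsub>G\<^esub> h)) (\<psi> P) \<bullet> snd ?Z (g \<otimes>\<^bsub>G\<^esub> h) = Fmor (ac (g \<otimes>\<^bsub>G\<^esub> h)) (\<psi> P) \<bullet> coh A g h (Fob F ?X) \<bullet> Fmor (ac g) (snd ?Z h) \<bullet> snd ?Z g"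
      using eob_cocycle[of ?Z g h] by (simp del: zo_snd)
    also have "\<dots> = coh A g h ?X \<bullet> Fmor (ac g) (Fmor (ac h) (\<psi> P)) \<bullet> Fmor (ac g) (snd ?Z h) \<bullet> snd ?Z g"
      using coh_nat(2)[of g h "\<psi> P" "Fob F ?X" "Fmor (ac g) (snd ?Z h) \<bullet> snd ?Z g"] by simp
    also have "\<dots> = coh A g h ?X \<bullet> Fmor (ac g) (Fmor (ac h) (\<psi> P) \<bullet> snd ?Z h) \<bullet> snd ?Z g" by simp
    also have "\<dots> = coh A g h ?X \<bullet> Fmor (ac g) (sc T (l h) (snd P h \<bullet> \<psi> P)) \<bullet> snd ?Z g" unfolding E[OF h P] ..
    also have "\<dots> = sc T (l h) (coh A g h ?X \<bullet> Fmor (ac g) (snd P h) \<bullet> (Fmor (ac g) (\<psi> P) \<bullet> snd ?Z g))" by simp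
    also have "\<dots> = sc T (l g \<otimes> l h) (snd P (g \<otimes>\<^bsub>G\<^esub> h) \<bullet> \<psi> P)" unfolding E[OF g P] by (simp add: eob_cocycle m_comm)
    finally have "sc T (l (g \<otimes>\<^bsub>G\<^esub> h)) (snd P (g \<otimes>\<^bsub>G\<^esub> h) \<bullet> \<psi> P) = sc T (l g \<otimes> l h) (snd P (g \<otimes>\<^bsub>G\<^esub> h) \<bullet> \<psi> P)" using E[of "g \<otimes>\<^bsub>G\<^esub> h" P] by simp
    then have "(snd P (g \<otimes>\<^bsub>G\<^esub> h)) \<bullet> (sc T (l (g \<otimes>\<^bsub>G\<^esub> h)) (Idt T ?X) \<bullet> \<psi> P) = (snd P (g \<otimes>\<^bsub>G\<^esub> h)) \<bullet> (sc T (l g \<otimes> l h) (Idt T ?X) \<bullet> \<psi> P)" by simp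
    then have "sc T (l (g \<otimes>\<^bsub>G\<^esub> h)) (Idt T ?X) \<bullet> \<psi> P = sc T (l g \<otimes> l h) (Idt T ?X) \<bullet> \<psi> P"
      by (subst (asm) iso_cancel_left) simp_all
    then show "sc T (l (g \<otimes>\<^bsub>G\<^esub> h)) (Idt T ?X) = sc T (l g \<otimes> l h) (Idt T ?X)"
      by (subst (asm) iso_cancel_right) simp_all
  qed simp_all
  \<comment> \<open>the twist by \<open>\<chi>\<close> multiplies the structure map at \<open>g\<close> by the value of \<open>\<chi>\<close> at the inverse of \<open>g\<close>\<close>
  define \<chi> where "\<chi> = (\<lambda>g\<in>carrier G. l (inv\<^bsub>G\<^esub> g))"
  have \<chi> [simp]: "\<chi> \<in> carrier D" unfolding \<chi>_def by (rule charI) (simp_all add: lm G.inv_mult)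
  have \<chi>i: "\<chi> (inv\<^bsub>G\<^esub> g) = l g" if "g \<in> carrier G" for g unfolding \<chi>_def using that by simp
  have e [simp]: "eqm (zo (F, \<delta>) P) (tw \<chi> P) (\<psi> P)" if P [simp]: "P \<in> Ob T'" for P
    by (rule eqmI) (simp_all add: E \<chi>i del: zo_snd)
  have "tri_nat_iso T' T' (fst (fz (F, \<delta>))) (act A' \<chi>) (\<lambda>P. (zo (F, \<delta>) P, \<psi> P, tw \<chi> P))"
  proof (subst T'.tni_iff; (intro conjI ballI allI impI)?)
    fix s assume "arr T' s"
    then obtain P f Q where s [simp]: "s = (P, f, Q)" "P \<in> Ob T'" "Q \<in> Ob T'" "arr T f" "dm T f = fst P" "cd T f = fst Q" and f: "eqm P Q f"
      by (rule T'_arrE)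
    have "snd Q a \<bullet> (f \<bullet> \<psi> P) = (snd Q a \<bullet> f) \<bullet> \<psi> P" by simp
    also have "\<dots> = Fmor (ac a) f \<bullet> \<phi> (fst P)" unfolding eqm_D(4)[OF f a] unfolding \<psi>_def by simp
    also have "\<dots> = snd Q a \<bullet> (\<psi> Q \<bullet> Fmor F f)" unfolding \<psi>_def using tni_nat(1)[OF ph, of f "fst P"] by simp
    finally have "f \<bullet> \<psi> P = \<psi> Q \<bullet> Fmor F f" by (subst (asm) iso_cancel_left) simp_all
    then show "Fmor (act A' \<chi>) s \<cdot>\<^bsub>T'\<^esub> (zo (F, \<delta>) (dm T' s), \<psi> (dm T' s), tw \<chi> (dm T' s)) =
        (zo (F, \<delta>) (cd T' s), \<psi> (cd T' s), tw \<chi> (cd T' s)) \<cdot>\<^bsub>T'\<^esub> Fmor (fst (fz (F, \<delta>))) s"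
      using f by simp
  next
    fix P assume P [simp]: "P \<in> Ob T'"
    have "\<psi> (sg P) = iv T (Sm (snd P a)) \<bullet> conn (ac a) (fst P) \<bullet> \<phi> (Sg (fst P))" unfolding \<psi>_def by simp
    also have "\<dots> = Sm (\<psi> P) \<bullet> conn F (fst P)" unfolding \<psi>_def using tni_conn(1)[OF ph, of "fst P"] by simp
    finally show "Fmor (Susp T') (zo (F, \<delta>) P, \<psi> P, tw \<chi> P) \<cdot>\<^bsub>T'\<^esub> conn (fst (fz (F, \<delta>))) P =
        conn (act A' \<chi>) P \<cdot>\<^bsub>T'\<^esub> (zo (F, \<delta>) (Fob (Susp T') P), \<psi> (Fob (Susp T') P), tw \<chi> (Fob (Susp T') P))"
      by (simp add: tw_sg)
  qed simp_all
  then show ?thesis unfolding T'.tri_isomorphic_def using \<chi> by (intro bexI[of _ \<chi>]) auto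
qed

text \<open>The given isomorphism \<open>\<psi>\<close> commutes with the twist by \<open>\<kappa>\<close> up to a scalar \<open>u \<kappa>\<close>, because the triangle center
  of the category of equivariant objects is trivial. As a function of \<open>\<kappa>\<close> this scalar is a character
  of the dual group, so it is evaluation at some \<open>a\<close>. Composition with the structure maps at \<open>a\<close>
  cancels the scalars: the result is natural for homogeneous morphisms of every degree and extends
  to an isomorphism from \<open>F\<close> to the functor of \<open>a\<close>.\<close>

lemma char_iso_to_action:
  assumes t: "tri_center_trivial K T'" and xe: "ea (F, \<delta>)" and c: "\<chi> \<in> carrier D" "T'.tri_isomorphic (fst (fz (F, \<delta>))) (act A' \<chi>)"
  shows "iso_to_action F"
proof -
  interpret D: comm_group D by (rule D_group)
  note [simp] = ea_simps[OF xe] zo_ob[OF xe] fz_endo[OF xe] fz_tfun[OF xe] fz_equi[OF xe] zo_tw[OF xe] c(1)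
  obtain \<psi>' where ps: "tri_nat_iso T' T' (fst (fz (F, \<delta>))) (act A' \<chi>) \<psi>'"
    using c(2) unfolding T'.tri_isomorphic_def by blast
  define \<psi> where "\<psi> P = underlying (\<psi>' P)" for P
  have i': "isom T' (\<psi>' P)" "dm T' (\<psi>' P) = zo (F, \<delta>) P" "cd T' (\<psi>' P) = tw \<chi> P" if "P \<in> Ob T'" for P
    using T'.tni_mor[OF ps _ _ that] by simp_all
  have eq: "\<psi>' P = (zo (F, \<delta>) P, \<psi> P, tw \<chi> P)" and e [simp]: "eqm (zo (F, \<delta>) P) (tw \<chi> P) (\<psi> P)" and i [simp]: "isom T (\<psi> P)" if P: "P \<in> Ob T'" for P
  proof -
    note a = i'[OF P]
    have f: "fst (\<psi>' P) = zo (F, \<delta>) P" "snd (snd (\<psi>' P)) = tw \<chi> P" using a T'_dm[OF T'.isom_arr[OF a(1)]] by simp_all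
    then show "\<psi>' P = (zo (F, \<delta>) P, \<psi> P, tw \<chi> P)" by (simp add: \<psi>_def prod_eq_iff)
    show "eqm (zo (F, \<delta>) P) (tw \<chi> P) (\<psi> P)" using T'.isom_arr[OF a(1), unfolded T'_arr_iff] f by (simp add: \<psi>_def)
    show "isom T (\<psi> P)" using T'_isom(1)[OF T'.isom_arr[OF a(1)]] a(1) by (simp add: \<psi>_def)
  qed
  have pm [simp]: "dm T (\<psi> P) = Fob F (fst P)" "cd T (\<psi> P) = fst P" if "P \<in> Ob T'" for P
    using eqm_D(2,3)[OF e[OF that]] by simp_all
  have "\<exists>c. c \<in> carrier K \<and> c \<noteq> \<zero> \<and> (\<forall>P\<in>Ob T'. \<psi> (tw \<kappa> P) = sc T c (\<psi> P))" if k [simp]: "\<kappa> \<in> carrier D" for \<kappa>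
  proof -
    have 1: "tri_nat_iso T' T' (tcomp T' (fst (fz (F, \<delta>))) (act A' \<kappa>)) (tcomp T' (act A' \<chi>) (act A' \<kappa>)) (\<lambda>P. \<psi>' (tw \<kappa> P))"
      using T'.tni_whisker_right[OF ps, of "act A' \<kappa>"] by simp
    have 2: "tri_nat_iso T' T' (tcomp T' (fst (fz (F, \<delta>))) (act A' \<kappa>)) (tcomp T' (act A' \<chi>) (act A' \<kappa>)) (\<lambda>P. Fmor (act A' \<kappa>) (\<psi>' P))"
    proof (rule T'.tni_cong[OF T'.tni_whisker_left[OF ps, of "act A' \<kappa>"]])
      fix s assume "arr T' s"
      then obtain P f Q where "s = (P, f, Q)" "P \<in> Ob T'" "Q \<in> Ob T'" "eqm P Q f" by (rule T'_arrE)
      then show "Fmor (tcomp T' (fst (fz (F, \<delta>))) (act A' \<kappa>)) s = Fmor (tcomp T' (act A' \<kappa>) (fst (fz (F, \<delta>)))) s"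
        "Fmor (tcomp T' (act A' \<chi>) (act A' \<kappa>)) s = Fmor (tcomp T' (act A' \<kappa>) (act A' \<chi>)) s"
        by (simp_all add: tw_tw D.m_comm)
    qed (simp_all add: tw_tw tw_sg D.m_comm)
    obtain c where c: "c \<in> carrier K" "c \<noteq> \<zero>" "\<And>P. P \<in> Ob T' \<Longrightarrow> \<psi>' (tw \<kappa> P) = sc T' c (Fmor (act A' \<kappa>) (\<psi>' P))"
      using T'.tni_scalar[OF t _ _ _ 2 1] by auto
    have "\<psi> (tw \<kappa> P) = sc T c (\<psi> P)" if P [simp]: "P \<in> Ob T'" for P
    proof -
      have "eqm (tw \<kappa> (zo (F, \<delta>) P)) (tw \<kappa> (tw \<chi> P)) (\<psi> P)" by (simp add: eqm_tw_tw)
      then have "sc T' c (tw \<kappa> (zo (F, \<delta>) P), \<psi> P, tw \<kappa> (tw \<chi> P)) = (tw \<kappa> (zo (F, \<delta>) P), sc T c (\<psi> P), tw \<kappa> (tw \<chi> P))"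
        by (simp add: T'_sc)
      then show ?thesis using c(3)[OF P] by (simp add: eq)
    qed
    then show ?thesis using c by blast
  qed
  then have "\<forall>\<kappa>\<in>carrier D. \<exists>c. c \<in> carrier K \<and> c \<noteq> \<zero> \<and> (\<forall>P\<in>Ob T'. \<psi> (tw \<kappa> P) = sc T c (\<psi> P))" by (rule ballI)
  from bchoice[OF this] obtain u where "\<forall>\<kappa>\<in>carrier D. u \<kappa> \<in> carrier K \<and> u \<kappa> \<noteq> \<zero> \<and> (\<forall>P\<in>Ob T'. \<psi> (tw \<kappa> P) = sc T (u \<kappa>) (\<psi> P))" by (rule exE)
  then have u [simp]: "\<And>\<kappa>. \<kappa> \<in> carrier D \<Longrightarrow> u \<kappa> \<in> carrier K" "\<And>\<kappa>. \<kappa> \<in> carrier D \<Longrightarrow> u \<kappa> \<noteq> \<zero>"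
    and ut: "\<And>\<kappa> P. \<lbrakk>\<kappa> \<in> carrier D; P \<in> Ob T'\<rbrakk> \<Longrightarrow> \<psi> (tw \<kappa> P) = sc T (u \<kappa>) (\<psi> P)" by blast+
  have um: "u (\<kappa> \<otimes>\<^bsub>D\<^esub> l) = u \<kappa> \<otimes> u l" if k [simp]: "\<kappa> \<in> carrier D" and l [simp]: "l \<in> carrier D" for \<kappa> l
  proof (rule T'.center_scalar_unique[OF t])
    fix P assume P [simp]: "P \<in> Ob T'"
    have "sc T (u (\<kappa> \<otimes>\<^bsub>D\<^esub> l)) (\<psi> P) = \<psi> (tw \<kappa> (tw l P))" by (simp add: tw_tw ut)
    also have "\<dots> = sc T (u \<kappa> \<otimes> u l) (\<psi> P)" by (simp add: ut del: tw_simps)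
    finally have "sc T (u (\<kappa> \<otimes>\<^bsub>D\<^esub> l)) (Idt T (fst P)) \<bullet> \<psi> P = sc T (u \<kappa> \<otimes> u l) (Idt T (fst P)) \<bullet> \<psi> P" by simp
    then have "sc T (u (\<kappa> \<otimes>\<^bsub>D\<^esub> l)) (Idt T (fst P)) = sc T (u \<kappa> \<otimes> u l) (Idt T (fst P))"
      by (subst (asm) iso_cancel_right) simp_all
    then show "sc T' (u (\<kappa> \<otimes>\<^bsub>D\<^esub> l)) (Idt T' P) = sc T' (u \<kappa> \<otimes> u l) (Idt T' P)" by (simp add: T'_sc)
  qed simp_all
  obtain a where a [simp]: "a \<in> carrier G" and ua: "\<And>\<kappa>. \<kappa> \<in> carrier D \<Longrightarrow> u \<kappa> = \<kappa> a"
    using evaluation_duality[of u] um u by blast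
  define \<phi> where "\<phi> P = snd P a \<bullet> \<psi> P" for P
  have m: "isom T (\<phi> P) \<and> dm T (\<phi> P) = Fob F (fst P) \<and> cd T (\<phi> P) = Fob (ac a) (fst P)" if "P \<in> Ob T'" for P
    unfolding \<phi>_def using that by simp
  have n: "Fmor (ac a) f \<bullet> \<phi> P = \<phi> Q \<bullet> Fmor F f" if P [simp]: "P \<in> Ob T'" and Q [simp]: "Q \<in> Ob T'" and k [simp]: "\<kappa> \<in> carrier D" and f: "eqm P (tw \<kappa> Q) f" for P Q \<kappa> f
  proof -
    note [simp] = eqm_hm[OF P Q f]
    have "arr T' (P, f, tw \<kappa> Q)" using f by simp
    from T'.tni_nat(1)[OF ps _ _ this, of P] f
    have 1: "f \<bullet> \<psi> P = sc T (u \<kappa>) (\<psi> Q \<bullet> Fmor F f)" by (simp add: eq ut)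
    have "Fmor (ac a) f \<bullet> \<phi> P = (Fmor (ac a) f \<bullet> snd P a) \<bullet> \<psi> P" unfolding \<phi>_def by simp
    also have "Fmor (ac a) f \<bullet> snd P a = sc T (\<kappa> (inv\<^bsub>G\<^esub> a)) (snd Q a \<bullet> f)" using eqm_D(4)[OF f a] by simp
    also have "sc T (\<kappa> (inv\<^bsub>G\<^esub> a)) (snd Q a \<bullet> f) \<bullet> \<psi> P = sc T (\<kappa> (inv\<^bsub>G\<^esub> a)) (snd Q a \<bullet> (f \<bullet> \<psi> P))" by simp
    also have "\<dots> = \<phi> Q \<bullet> Fmor F f" unfolding 1 \<phi>_def by (simp add: ua)
    finally show ?thesis .
  qed
  define \<theta> where "\<theta> = dense_ext F (ac a) \<phi>"
  have p [simp]: "isom T (\<theta> X)" "dm T (\<theta> X) = Fob F X" "cd T (\<theta> X) = Fob (ac a) X" if "X \<in> Ob T" for X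
    unfolding \<theta>_def by (rule dense_ext_mor[OF _ _ m n]; simp add: that)+
  have pn: "Fmor (ac a) f \<bullet> \<theta> X = \<theta> (cd T f) \<bullet> Fmor F f" if "arr T f" "dm T f = X" for f X
    using dense_ext_nat[OF _ _ m n that(1)] that(2) unfolding \<theta>_def by simp
  have pe: "\<theta> (fst P) = \<phi> P" if "P \<in> Ob T'" for P
    unfolding \<theta>_def by (rule dense_ext_eq[OF _ _ m n that]) simp_all
  have c: "Sm (\<theta> X) \<bullet> conn F X = conn (ac a) X \<bullet> \<theta> (Sg X)" if X: "X \<in> Ob T" for X
  proof (rule dense_eq[where F = "fcomp F (Susp T)" and H = "fcomp (Susp T) (ac a)" and X = X
        and a = "\<lambda>X. Sm (\<theta> X) \<bullet> conn F X" and b = "\<lambda>X. conn (ac a) X \<bullet> \<theta> (Sg X)"])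
    fix P assume P [simp]: "P \<in> Ob T'"
    have "Sm (\<psi> P) \<bullet> conn F (fst P) = \<psi> (sg P)" using T'.tni_conn(1)[OF ps _ _ P] by (simp add: eq tw_sg)
    then show "Sm (\<theta> (fst P)) \<bullet> conn F (fst P) = conn (ac a) (fst P) \<bullet> \<theta> (Sg (fst P))"
      using pe[of "sg P"] by (simp add: pe \<phi>_def)
  next
    fix f assume f [simp]: "arr T f"
    have "Sm (Fmor (ac a) f) \<bullet> Sm (\<theta> (dm T f)) = Sm (\<theta> (cd T f)) \<bullet> Sm (Fmor F f)"
      using pn[OF f refl] by (simp flip: fun_comp)
    from comp_reassoc[OF this, of "conn F (dm T f)"]
    show "Fmor (fcomp (Susp T) (ac a)) f \<bullet> Sm (\<theta> (dm T f)) \<bullet> conn F (dm T f) = (Sm (\<theta> (cd T f)) \<bullet> conn F (cd T f)) \<bullet> Fmor (fcomp F (Susp T)) f"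
      by (simp add: tfun_nat)
    show "Fmor (fcomp (Susp T) (ac a)) f \<bullet> conn (ac a) (dm T f) \<bullet> \<theta> (Sg (dm T f)) = (conn (ac a) (cd T f) \<bullet> \<theta> (Sg (cd T f))) \<bullet> Fmor (fcomp F (Susp T)) f"
      by (simp add: tfun_nat pn)
  qed (use X in simp_all)
  have "tri_nat_iso T T F (ac a) \<theta>" by (simp add: tni_iff pn c)
  then show ?thesis unfolding iso_to_action_def tri_isomorphic_def using a by auto
qed

section \<open>The isomorphisms of groups\<close>

abbreviation AutG where "AutG \<equiv> Aut_tri K G T A"
abbreviation AutG' where "AutG' \<equiv> Aut_tri K D T' A'"
abbreviation ActG where "ActG \<equiv> Act_tri K G T A"
abbreviation ActG' where "ActG' \<equiv> Act_tri K D T' A'"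
abbreviation zm where "zm \<equiv> eqvz_map K G T A"

text \<open>The map on classes is a union over representatives, which is constant because isomorphic functors
  have isomorphic equivariantizations.\<close>

lemma zm_ec: assumes "ea x" shows "zm (ec x) = T'.ec (fz x)"
proof -
  have "T'.ec (fz y) = T'.ec (fz x)" if "y \<in> ec x" for y
    using fz_ei[OF ec_D(2)[OF that] assms ec_D(1)[OF that]] fz_ea'[OF assms] fz_ea'[OF ec_D(1)[OF that]]
    by (simp add: T'.ec_eq_iff T'.ei_sym)
  then have "zm (ec x) = (\<Union>y\<in>ec x. T'.ec (fz x))" unfolding eqvz_map_def by (intro SUP_cong refl)
  moreover have "ec x \<noteq> {}" using ec_self[OF assms] by blast
  ultimately show ?thesis by simp
qed

lemma zm_hom: "zm \<in> hom AutG AutG'"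
proof (rule homI)
  show "zm c \<in> carrier AutG'" if "c \<in> carrier AutG" for c
    using that fz_ea' unfolding Aut_tri_carrier T'.Aut_tri_carrier by (metis zm_ec)
  fix c d assume "c \<in> carrier AutG" "d \<in> carrier AutG"
  then obtain x y where x: "c = ec x" "ea x" "d = ec y" "ea y" unfolding Aut_tri_carrier by blast
  have "zm (c \<otimes>\<^bsub>AutG\<^esub> d) = T'.ec (fz (eqv_mult T x y))" using x by (simp add: ec_mult zm_ec ea_mult)
  also have "\<dots> = T'.ec (eqv_mult T' (fz x) (fz y))"
    using fz_mult[OF x(2,4)] x by (simp add: T'.ec_eq_iff fz_ea' ea_mult T'.ea_mult)
  also have "\<dots> = zm c \<otimes>\<^bsub>AutG'\<^esub> zm d" using x by (simp add: T'.ec_mult fz_ea' zm_ec)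
  finally show "zm (c \<otimes>\<^bsub>AutG\<^esub> d) = zm c \<otimes>\<^bsub>AutG'\<^esub> zm d" .
qed

lemma zm_surj: "c \<in> carrier AutG' \<Longrightarrow> \<exists>x. ea x \<and> c = zm (ec x)"
proof -
  assume "c \<in> carrier AutG'"
  then obtain y where y: "c = T'.ec y" "T'.ea y" unfolding T'.Aut_tri_carrier by blast
  obtain x where x: "ea x" "T'.ei y (fz x)" using fz_surjective[OF y(2)] by blast
  then have "c = zm (ec x)" unfolding y(1) zm_ec[OF x(1)] using T'.ec_eq_iff[OF y(2) fz_ea'[OF x(1)]] by blast
  with x(1) show ?thesis by blast
qed

lemma zm_iso: "zm \<in> iso AutG AutG'"
proof -
  have "inj_on zm (carrier AutG)"
  proof (rule inj_onI)
    fix c d assume "c \<in> carrier AutG" "d \<in> carrier AutG" and e: "zm c = zm d"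
    then obtain x y where x: "c = ec x" "ea x" "d = ec y" "ea y" unfolding Aut_tri_carrier by blast
    then have "T'.ei (fz x) (fz y)" using e by (simp add: zm_ec T'.ec_eq_iff fz_ea')
    then show "c = d" using fz_injective x by (simp add: ec_eq_iff)
  qed
  moreover have "zm ` carrier AutG = carrier AutG'"
  proof
    show "zm ` carrier AutG \<subseteq> carrier AutG'" using zm_hom by (auto simp: hom_def)
    show "carrier AutG' \<subseteq> zm ` carrier AutG" using zm_surj Aut_tri_carrier by blast
  qed
  ultimately show ?thesis using zm_hom by (simp add: iso_def bij_betw_def)
qed

text \<open>Inverses are transported along the bijection with the group of \<open>T\<close>.\<close>

lemma AutG'_group: "group AutG'"
  by (rule group.iso_imp_group[OF Aut_group _ T'.Aut_monoid]) (use zm_iso in \<open>auto simp: is_iso_def\<close>)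

lemma ActG_carrier: "c \<in> carrier ActG \<longleftrightarrow> (\<exists>x. c = ec x \<and> ea x \<and> iso_to_action (fst x))"
proof -
  have "c \<in> carrier ActG \<longleftrightarrow> (\<exists>F \<delta>. c = ec (F, \<delta>) \<and> ea (F, \<delta>) \<and> (\<exists>a\<in>carrier G. \<exists>\<phi>. tri_nat_iso T T F (ac a) \<phi>))"
    by (simp add: Act_tri_def)
  also have "\<dots> \<longleftrightarrow> (\<exists>F \<delta>. c = ec (F, \<delta>) \<and> ea (F, \<delta>) \<and> iso_to_action F)" using iso_to_action_iff ea_tfun(1) by blast
  finally show ?thesis by auto
qed

lemma ActG'_carrier: "c \<in> carrier ActG' \<longleftrightarrow> (\<exists>y. c = T'.ec y \<and> T'.ea y \<and> (\<exists>\<chi>\<in>carrier D. T'.tri_isomorphic (fst y) (act A' \<chi>)))"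
proof -
  have "c \<in> carrier ActG' \<longleftrightarrow> (\<exists>F \<delta>. c = T'.ec (F, \<delta>) \<and> T'.ea (F, \<delta>) \<and> (\<exists>\<chi>\<in>carrier D. \<exists>\<phi>. tri_nat_iso T' T' F (act A' \<chi>) \<phi>))"
    by (simp add: Act_tri_def)
  also have "\<dots> \<longleftrightarrow> (\<exists>F \<delta>. c = T'.ec (F, \<delta>) \<and> T'.ea (F, \<delta>) \<and> (\<exists>\<chi>\<in>carrier D. T'.tri_isomorphic F (act A' \<chi>)))"
    unfolding T'.tri_isomorphic_def using T'.ea_tfun(1) tw_tfun by blast
  finally show ?thesis by auto
qed

lemma ei_tri_isomorphic: "\<lbrakk>ei x y; ea x; ea y\<rbrakk> \<Longrightarrow> tri_isomorphic (fst x) (fst y)"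
  unfolding tri_isomorphic_def by (cases x; cases y) (auto elim!: eiE intro: ea_tfun)

lemma T'_ei_tri_isomorphic: "\<lbrakk>T'.ei x y; T'.ea x; T'.ea y\<rbrakk> \<Longrightarrow> T'.tri_isomorphic (fst x) (fst y)"
  unfolding T'.tri_isomorphic_def by (cases x; cases y) (auto elim!: T'.eiE intro: T'.ea_tfun)

lemma ActG_subgroup: "subgroup (carrier ActG) AutG"
proof -
  interpret Au: group AutG by (rule Aut_group)
  have one: "\<one>\<^bsub>AutG\<^esub> = ec (eqv_one T A)" by (simp add: Aut_tri_def)
  show ?thesis
  proof (rule Au.subgroupI)
    show "carrier ActG \<subseteq> carrier AutG" unfolding subset_iff ActG_carrier Aut_tri_carrier by blast
    have "iso_to_action (fst (eqv_one T A))" unfolding iso_to_action_def eqv_one_def using unit_at_tri_isomorphic G.one_closed by auto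
    then show "carrier ActG \<noteq> {}" using ActG_carrier ea_one by blast
    fix c assume "c \<in> carrier ActG"
    then obtain x where x: "c = ec x" "ea x" "iso_to_action (fst x)" unfolding ActG_carrier by blast
    have cc: "c \<in> carrier AutG" using x unfolding Aut_tri_carrier by blast
    then have "inv\<^bsub>AutG\<^esub> c \<in> carrier AutG" by simp
    then obtain y where y: "inv\<^bsub>AutG\<^esub> c = ec y" "ea y" unfolding Aut_tri_carrier by blast
    have "ec (eqv_mult T x y) = ec (eqv_one T A)" using Au.r_inv[OF cc] x y one by (simp add: ec_mult)
    then have "ei (eqv_mult T x y) (eqv_one T A)" using x y by (simp add: ec_eq_iff ea_mult ea_one)
    then have "tri_isomorphic (fst (eqv_mult T x y)) (fst (eqv_one T A))" using x y by (intro ei_tri_isomorphic ea_mult ea_one)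
    then have "tri_isomorphic (tcomp T (fst x) (fst y)) (tid T)" by (simp add: eqv_mult_def eqv_one_def case_prod_beta)
    moreover have "triangle_functor K T T (fst y)" using y(2) ea_tfun(1) by (cases y) auto
    ultimately have "iso_to_action (fst y)" using iso_to_action_inverse[OF x(3)] by blast
    then show "inv\<^bsub>AutG\<^esub> c \<in> carrier ActG" unfolding ActG_carrier using y by blast
    fix d assume "d \<in> carrier ActG"
    then obtain z where z: "d = ec z" "ea z" "iso_to_action (fst z)" unfolding ActG_carrier by blast
    have "iso_to_action (fst (eqv_mult T x z))" using iso_to_action_mult[OF x(3) z(3)] by (simp add: eqv_mult_def case_prod_beta)
    then show "c \<otimes>\<^bsub>AutG\<^esub> d \<in> carrier ActG" unfolding ActG_carrier using x z ec_mult ea_mult by blast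
  qed
qed

lemma zm_ActG:
  assumes "tri_center_trivial K T" "tri_center_trivial K T'"
  shows "zm ` carrier ActG = carrier ActG'"
proof (intro equalityI subsetI)
  fix c assume "c \<in> zm ` carrier ActG"
  then obtain x where x: "c = zm (ec x)" "ea x" "iso_to_action (fst x)" unfolding image_iff Bex_def ActG_carrier by blast
  have "\<exists>\<chi>\<in>carrier D. T'.tri_isomorphic (fst (fz x)) (act A' \<chi>)"
    using iso_to_action_char[OF assms(1), of "fst x" "snd x"] x by simp
  then show "c \<in> carrier ActG'" unfolding ActG'_carrier using x zm_ec fz_ea' by blast
next
  fix c assume "c \<in> carrier ActG'"
  then obtain y \<chi> where y: "c = T'.ec y" "T'.ea y" and \<chi>: "\<chi> \<in> carrier D" "T'.tri_isomorphic (fst y) (act A' \<chi>)" unfolding ActG'_carrier by blast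
  obtain x where x: "ea x" "T'.ei y (fz x)" using fz_surjective[OF y(2)] by blast
  have "T'.tri_isomorphic (fst (fz x)) (fst y)" using T'_ei_tri_isomorphic[OF x(2) y(2) fz_ea'[OF x(1)]] by (rule T'.tri_isomorphic_sym)
  then have "T'.tri_isomorphic (fst (fz x)) (act A' \<chi>)" using \<chi>(2) T'.tri_isomorphic_trans by blast
  then have "iso_to_action (fst x)" using char_iso_to_action[OF assms(2), of "fst x" "snd x"] x \<chi>(1) by simp
  then have "ec x \<in> carrier ActG" unfolding ActG_carrier using x by blast
  moreover have "c = zm (ec x)" using x y by (simp add: zm_ec T'.ec_eq_iff fz_ea')
  ultimately show "c \<in> zm ` carrier ActG" by blast
qed

lemma Act_iso:
  assumes "tri_center_trivial K T" "tri_center_trivial K T'"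
  shows "group ActG" "group ActG'" "zm \<in> iso ActG ActG'"
proof -
  interpret Au: group AutG by (rule Aut_group)
  interpret Au': group AutG' by (rule AutG'_group)
  interpret z: group_hom AutG AutG' zm by unfold_locales (rule zm_hom)
  have eq: "ActG = AutG\<lparr>carrier := carrier ActG\<rparr>" "ActG' = AutG'\<lparr>carrier := carrier ActG'\<rparr>"
    by (simp_all add: Act_tri_def)
  have "subgroup (zm ` carrier ActG) AutG'" by (rule z.subgroup_img_is_subgroup[OF ActG_subgroup])
  then have s': "subgroup (carrier ActG') AutG'" unfolding zm_ActG[OF assms] .
  show "group ActG" using subgroup.subgroup_is_group[OF ActG_subgroup Aut_group] eq(1) by simp
  show "group ActG'" using subgroup.subgroup_is_group[OF s' AutG'_group] eq(2) by simp
  have sub: "carrier ActG \<subseteq> carrier AutG" using ActG_subgroup by (rule subgroup.subset)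
  have m: "mult ActG = mult AutG" "mult ActG' = mult AutG'" by (simp_all add: Act_tri_def)
  have "zm \<in> hom ActG ActG'"
  proof (rule homI)
    show "zm c \<in> carrier ActG'" if "c \<in> carrier ActG" for c using that zm_ActG[OF assms] by blast
    show "zm (c \<otimes>\<^bsub>ActG\<^esub> d) = zm c \<otimes>\<^bsub>ActG'\<^esub> zm d" if "c \<in> carrier ActG" "d \<in> carrier ActG" for c d
      using that sub z.hom_mult unfolding m by blast
  qed
  moreover have "inj_on zm (carrier ActG)" using zm_iso sub unfolding iso_def bij_betw_def by (auto intro: inj_on_subset)
  ultimately show "zm \<in> iso ActG ActG'" unfolding iso_def bij_betw_def using zm_ActG[OF assms] by blast
qed

end

theorem theorem6p2:
  fixes K :: "('k, 'e) ring_scheme"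
    and G :: "('g, 'h) monoid_scheme"
    and T :: "('k, 'o, 'm, 'z) pretricat_scheme"
    and A :: "('g, 'o, 'm) taction"
  assumes "field K"
    and "comm_group G" and "finite (carrier G)" and "splits_over G K"
    and "pretriangulated_category K T" and "idempotent_complete T"
    and "triangle_action K G T A"
  shows "let G' = dual_group K G; T' = eqv_cat G T A; A' = dual_action K G T A in
    group (Aut_tri K G T A) \<and> group (Aut_tri K G' T' A') \<and>
    (\<forall>x. eqv_autoequivalence K G T A x \<longrightarrow>
       eqvz_map K G T A (eqv_class K G T A x) = eqv_class K G' T' A' (eqvz_functor G T A x)) \<and>
    eqvz_map K G T A \<in> iso (Aut_tri K G T A) (Aut_tri K G' T' A') \<and>
    (tri_center_trivial K T \<and> tri_center_trivial K T' \<longrightarrow>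
       group (Act_tri K G T A) \<and> group (Act_tri K G' T' A') \<and>
       eqvz_map K G T A \<in> iso (Act_tri K G T A) (Act_tri K G' T' A'))"
proof -
  interpret P: pretriangulated_category K T by fact
  interpret equivariant K T G A
    by (intro equivariant.intro equivariant_axioms.intro acted_pretriangulated.intro acted_category.intro
        split_group.intro split_group_axioms.intro assms P.susp_category_pretriangulated comm_group.axioms(2))
  show ?thesis
    using Aut_group AutG'_group zm_ec zm_iso Act_iso by (simp add: Let_def)
qed

end
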